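(* Let $\theta,\sigma>0$ and let $u$ be the solution of the stochastic heat equation $\mathrm{d}u(t,x)=\theta u_{xx}(t,x)\,\mathrm{d}t+\sigma\,\mathrm{d}W(t,x)$ on $G=[0,\pi]$, $t>0$, with $u(0,x)=0$ and $u(t,0)=u(t,\pi)=0$, i.e. $u(t,x)=\sum_{k\ge1}u_k(t)h_k(x)$ with $h_k(x)=\sqrt{2/\pi}\sin(kx)$ and $u_k(t)=\sigma\int_0^t e^{-\theta k^2(t-s)}\,\mathrm{d}w_k(s)$, where $(w_k)_{k\ge1}$ are independent standard Brownian motions. Fix $x\in(0,\pi)$ and $0<c<d<\infty$, let $t_i=c+(d-c)i/n$, $i=0,\dots,n$, and define $$\widehat\theta_{n,x}=\frac{3(d-c)\sigma^4}{\pi\sum_{i=1}^n(u(t_i,x)-u(t_{i-1},x))^4},\qquad \widehat\sigma^2_{n,x}=\sqrt{\frac{\theta\pi}{3(d-c)}\sum_{i=1}^n(u(t_i,x)-u(t_{i-1},x))^4}.$$ Then $\widehat\theta_{n,x}\to\theta$ in probability and $\widehat\sigma^2_{n,x}\to\sigma^2$ in probability as $n\to\infty$. Moreover, as $n\to\infty$, $$\sqrt n\Big(\widehat\theta_{n,x}-\frac{(d-c)\theta}{n\sigma_n^4}\Big)\xrightarrow{\mathcal D}\mathcal N\Big(0,\tfrac19\theta^2(\bar\sigma_2^2+\bar\sigma_4^2)\Big),\qquad \sqrt n\Big(\widehat\sigma^2_{n,x}-\frac{\sqrt n\,\sigma_n^2}{\sqrt{d-c}}\sigma^2\Big)\xrightarrow{\mathcal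 D}\mathcal N\Big(0,\tfrac1{36}\sigma^4(\bar\sigma_2^2+\bar\sigma_4^2)\Big),$$ where $$\sigma_n^2=\frac{2}{\sqrt{\pi\theta}}\sum_{k\ge1}\frac{\sin^2(kx)}{k^2}\big(1-e^{-(d-c)\theta k^2/n}\big),$$ $$F_n(j)=\frac{1}{\sqrt{\pi\theta}}\sum_{k\ge1}\frac{\sin^2(kx)}{k^2}\Big(2e^{-j(d-c)\theta k^2/n}-e^{-(j+1)(d-c)\theta k^2/n}-e^{-(j-1)(d-c)\theta k^2/n}\Big),$$ $$\bar\sigma_2^2=72+144\lim_{n\to\infty}\sum_{j=1}^{n-1}\Big(1-\frac jn\Big)\Big|\frac{F_n(j)}{\sigma_n^2}\Big|^2,\qquad \bar\sigma_4^2=24+48\lim_{n\to\infty}\sum_{j=1}^{n-1}\Big(1-\frac jn\Big)\Big|\frac{F_n(j)}{\sigma_n^2}\Big|^4.$$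
   Context: The consistency of $\widehat\theta_{n,x}$ is the statement when $\sigma$ is regarded as known, that of $\widehat\sigma^2_{n,x}$ when $\theta$ is regarded as known. $\xrightarrow{\mathcal D}$ denotes convergence in distribution. *)

theory Defs
  imports "HOL-Probability.Probability"
begin

definition std_BM :: "'a measure \<Rightarrow> (real \<Rightarrow> 'a \<Rightarrow> real) \<Rightarrow> bool" where
  "std_BM M w \<longleftrightarrow>
     prob_space M \<and>
     (\<forall>t\<ge>0. w t \<in> borel_measurable M) \<and>
     (\<forall>\<omega>\<in>space M. w 0 \<omega> = 0 \<and> continuous_on {0..} (\<lambda>t. w t \<omega>)) \<and>
     (\<forall>s t. 0 \<le> s \<and> s < t \<longrightarrow>
        distributed M lborel (\<lambda>\<omega>. w t \<omega> - w s \<omega>)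
          (\<lambda>y. ennreal (normal_density 0 (sqrt (t - s)) y))) \<and>
     (\<forall>(n::nat) (ts::nat \<Rightarrow> real). 0 \<le> ts 0 \<and> (\<forall>i<n. ts i < ts (Suc i)) \<longrightarrow>
        prob_space.indep_vars M (\<lambda>_. borel) (\<lambda>i \<omega>. w (ts (Suc i)) \<omega> - w (ts i) \<omega>) {..<n})"

text \<open>Wiener integral of a deterministic C^1 integrand f over [0,t], defined pathwise
  through the integration by parts formula
  int_0^t f dw = f t * w t - f 0 * w 0 - int_0^t f'(s) w(s) ds.\<close>
definition wiener_integral ::
  "(real \<Rightarrow> real) \<Rightarrow> (real \<Rightarrow> 'a \<Rightarrow> real) \<Rightarrow> real \<Rightarrow> 'a \<Rightarrow> real" where
  "wiener_integral f w t \<omega> =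
     f t * w t \<omega> - f 0 * w 0 \<omega> - integral {0..t} (\<lambda>s. deriv f s * w s \<omega>)"

definition eig_fun :: "nat \<Rightarrow> real \<Rightarrow> real" where
  "eig_fun k x = sqrt (2 / pi) * sin (real k * x)"

definition she_mode ::
  "real \<Rightarrow> real \<Rightarrow> (nat \<Rightarrow> real \<Rightarrow> 'a \<Rightarrow> real) \<Rightarrow> nat \<Rightarrow> real \<Rightarrow> 'a \<Rightarrow> real" where
  "she_mode \<theta> \<sigma> w k t \<omega> =
     \<sigma> * wiener_integral (\<lambda>s. exp (- \<theta> * (real k)\<^sup>2 * (t - s))) (w k) t \<omega>"

definition she_sol ::
  "real \<Rightarrow> real \<Rightarrow> (nat \<Rightarrow> real \<Rightarrow> 'a \<Rightarrow> real) \<Rightarrow> real \<Rightarrow> real \<Rightarrow> 'a \<Rightarrow> real" where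
  "she_sol \<theta> \<sigma> w t x \<omega> = (\<Sum>k. she_mode \<theta> \<sigma> w (Suc k) t \<omega> * eig_fun (Suc k) x)"

definition grid :: "real \<Rightarrow> real \<Rightarrow> nat \<Rightarrow> nat \<Rightarrow> real" where
  "grid c d n i = c + (d - c) * real i / real n"

definition quartic_var ::
  "real \<Rightarrow> real \<Rightarrow> (nat \<Rightarrow> real \<Rightarrow> 'a \<Rightarrow> real) \<Rightarrow> real \<Rightarrow> real \<Rightarrow> real \<Rightarrow> nat \<Rightarrow> 'a \<Rightarrow> real" where
  "quartic_var \<theta> \<sigma> w x c d n \<omega> =
     (\<Sum>i=1..n. (she_sol \<theta> \<sigma> w (grid c d n i) x \<omega>
                 - she_sol \<theta> \<sigma> w (grid c d n (i - 1)) x \<omega>) ^ 4)"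

definition theta_hat ::
  "real \<Rightarrow> real \<Rightarrow> (nat \<Rightarrow> real \<Rightarrow> 'a \<Rightarrow> real) \<Rightarrow> real \<Rightarrow> real \<Rightarrow> real \<Rightarrow> nat \<Rightarrow> 'a \<Rightarrow> real" where
  "theta_hat \<theta> \<sigma> w x c d n \<omega> =
     3 * (d - c) * \<sigma> ^ 4 / (pi * quartic_var \<theta> \<sigma> w x c d n \<omega>)"

definition sigma2_hat ::
  "real \<Rightarrow> real \<Rightarrow> (nat \<Rightarrow> real \<Rightarrow> 'a \<Rightarrow> real) \<Rightarrow> real \<Rightarrow> real \<Rightarrow> real \<Rightarrow> nat \<Rightarrow> 'a \<Rightarrow> real" where
  "sigma2_hat \<theta> \<sigma> w x c d n \<omega> =
     sqrt (\<theta> * pi / (3 * (d - c)) * quartic_var \<theta> \<sigma> w x c d n \<omega>)"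

definition sig_n2 :: "real \<Rightarrow> real \<Rightarrow> real \<Rightarrow> real \<Rightarrow> nat \<Rightarrow> real" where
  "sig_n2 \<theta> x c d n = 2 / sqrt (pi * \<theta>) *
     (\<Sum>k. sin (real (Suc k) * x) ^ 2 / (real (Suc k))\<^sup>2
            * (1 - exp (- (d - c) * \<theta> * (real (Suc k))\<^sup>2 / real n)))"

definition F_n :: "real \<Rightarrow> real \<Rightarrow> real \<Rightarrow> real \<Rightarrow> nat \<Rightarrow> nat \<Rightarrow> real" where
  "F_n \<theta> x c d n j = 1 / sqrt (pi * \<theta>) *
     (\<Sum>k. sin (real (Suc k) * x) ^ 2 / (real (Suc k))\<^sup>2
        * (2 * exp (- real j * (d - c) * \<theta> * (real (Suc k))\<^sup>2 / real n)
           - exp (- (real j + 1) * (d - c) * \<theta> * (real (Suc k))\<^sup>2 / real n)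
           - exp (- (real j - 1) * (d - c) * \<theta> * (real (Suc k))\<^sup>2 / real n)))"

definition sbar2 :: "real \<Rightarrow> real \<Rightarrow> real \<Rightarrow> real \<Rightarrow> real" where
  "sbar2 \<theta> x c d = 72 + 144 * lim (\<lambda>n.
     \<Sum>j=1..n-1. (1 - real j / real n) * \<bar>F_n \<theta> x c d n j / sig_n2 \<theta> x c d n\<bar> ^ 2)"

definition sbar4 :: "real \<Rightarrow> real \<Rightarrow> real \<Rightarrow> real \<Rightarrow> real" where
  "sbar4 \<theta> x c d = 24 + 48 * lim (\<lambda>n.
     \<Sum>j=1..n-1. (1 - real j / real n) * \<bar>F_n \<theta> x c d n j / sig_n2 \<theta> x c d n\<bar> ^ 4)"

definition conv_in_prob :: "'a measure \<Rightarrow> (nat \<Rightarrow> 'a \<Rightarrow> real) \<Rightarrow> real \<Rightarrow> bool" where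
  "conv_in_prob M X L \<longleftrightarrow>
     (\<forall>\<epsilon>>0. (\<lambda>n. measure M {\<omega> \<in> space M. \<epsilon> < \<bar>X n \<omega> - L\<bar>}) \<longlonglongrightarrow> 0)"

definition conv_in_distr_normal :: "'a measure \<Rightarrow> (nat \<Rightarrow> 'a \<Rightarrow> real) \<Rightarrow> real \<Rightarrow> bool" where
  "conv_in_distr_normal M X v \<longleftrightarrow>
     weak_conv_m (\<lambda>n. distr M borel (X n)) (density lborel (normal_density 0 (sqrt v)))"

end

theory Submission
  imports Defs "HOL-Real_Asymp.Real_Asymp"
begin

text \<open>The increments of the solution form a centred Gaussian array, and centred Gaussian families are
  handled throughout via the integration by parts formula
  $E[X_i F(X)] = \sum_j E[X_i X_j]\, E[\partial_j F(X)]$. Applied to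
  $F = \exp(i\tau S)$ with $S = \sum_j X_j^4$ it yields
  $\varphi'(\tau) = -\tau E[Q \exp(i\tau(S - ES))]$ for the centred characteristic function
  $\varphi$ of $S$, where $Q$ is a polynomial in $X$ with $EQ = \mathrm{Var}\, S$. Hence
  $|\varphi(\tau) - \exp(-\tau^2 EQ/2)| \le \tau^2 \sqrt{\mathrm{Var}\, Q}$, and Wick's formula bounds
  $\mathrm{Var}\, Q$ by a multiple of the number of variables as soon as the absolute row sums of the
  covariance matrix are bounded.

  For the normalised increments those row sums are bounded because the stationary part of the
  correlation at lag $j$ is minus a second difference of a convex function
  $j \mapsto \sum_k a_k e^{-j\lambda_k}$, hence of constant sign and telescoping, while the deviation from
  stationarity is $O(n^{-3/2})$ since $c > 0$. Both estimators are smooth functions of $S$.\<close>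

section \<open>Limits of expectations and test functions\<close>

text \<open>\<open>she_sol\<close> is a pathwise \<open>suminf\<close>, which identifies the
  solution only where the series converges. Mean-square convergence would not do, so almost sure
  convergence is proved at each fixed time; all covariances are then limits of expressions in
  finitely many Brownian values. The factor \<tau> in front of Q has this origin: two integrations
  by parts in E[X_j^4 exp(i \<tau> S)] isolate 3 R_jj^2 E[exp(i \<tau> S)], which the centring
  removes, and every other term comes from differentiating the exponential. With \<tau> = t / sqrt n
  and Var Q = O(n) the error \<tau>^2 sqrt (Var Q) is O(1 / sqrt n). The increments are scaled by
  the stationary variance, a deterministic number that does not depend on their position. With U the
  average of X_j^4 divided by 3, the estimators are exactly A n / U and B n sqrt U, where A n and B
  n are the centring terms of the theorem. The derivatives -1 and 1/2 at U = 1, divided by the 3 in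
  U, produce 1/9 and 1/36.\<close>

lemma (in prob_space) integral_tendsto_of_AE_L2_bounded:
  fixes Y :: "nat \<Rightarrow> 'a \<Rightarrow> 'b::{banach, second_countable_topology}"
  assumes meas [measurable]: "\<And>N. Y N \<in> borel_measurable M" "Z \<in> borel_measurable M"
    and lim: "AE \<omega> in M. (\<lambda>N. Y N \<omega>) \<longlonglongrightarrow> Z \<omega>"
    and int: "\<And>N. integrable M (\<lambda>\<omega>. (norm (Y N \<omega>))\<^sup>2)"
    and bd: "\<And>N. expectation (\<lambda>\<omega>. (norm (Y N \<omega>))\<^sup>2) \<le> K"
  shows "integrable M (\<lambda>\<omega>. (norm (Z \<omega>))\<^sup>2)" "integrable M Z"
    "expectation (\<lambda>\<omega>. (norm (Z \<omega>))\<^sup>2) \<le> K"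
    "(\<lambda>N. expectation (Y N)) \<longlonglongrightarrow> expectation Z"
proof -
  have K: "0 \<le> K" using bd[of 0] by (rule order_trans[rotated]) simp
  have nb: "(\<integral>\<^sup>+\<omega>. ennreal ((norm (Y N \<omega>))\<^sup>2) \<partial>M) \<le> ennreal K" for N
    by (subst nn_integral_eq_integral) (use int bd in \<open>auto intro: ennreal_leI\<close>)
  have "(\<integral>\<^sup>+\<omega>. ennreal ((norm (Z \<omega>))\<^sup>2) \<partial>M)
      = (\<integral>\<^sup>+\<omega>. liminf (\<lambda>N. ennreal ((norm (Y N \<omega>))\<^sup>2)) \<partial>M)"
  proof (rule nn_integral_cong_AE)
    show "AE \<omega> in M. ennreal ((norm (Z \<omega>))\<^sup>2) = liminf (\<lambda>N. ennreal ((norm (Y N \<omega>))\<^sup>2))"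
      using lim
    proof eventually_elim
      case (elim \<omega>)
      have "(\<lambda>N. ennreal ((norm (Y N \<omega>))\<^sup>2)) \<longlonglongrightarrow> ennreal ((norm (Z \<omega>))\<^sup>2)"
        by (intro tendsto_ennrealI tendsto_power tendsto_norm elim)
      then show ?case by (intro lim_imp_Liminf[symmetric]) auto
    qed
  qed
  also have "\<dots> \<le> liminf (\<lambda>N. \<integral>\<^sup>+\<omega>. ennreal ((norm (Y N \<omega>))\<^sup>2) \<partial>M)"
    by (rule nn_integral_liminf) simp
  also have "\<dots> \<le> liminf (\<lambda>N. ennreal K)"
    by (rule Liminf_mono) (use nb in auto)
  finally have nZ: "(\<integral>\<^sup>+\<omega>. ennreal ((norm (Z \<omega>))\<^sup>2) \<partial>M) \<le> ennreal K"
    by (simp add: Liminf_const)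
  show iZ: "integrable M (\<lambda>\<omega>. (norm (Z \<omega>))\<^sup>2)"
    by (rule integrableI_bounded) (use le_less_trans[OF nZ ennreal_less_top] in auto)
  have "ennreal (expectation (\<lambda>\<omega>. (norm (Z \<omega>))\<^sup>2)) \<le> ennreal K"
    using nZ by (subst (asm) nn_integral_eq_integral[OF iZ]) auto
  then show bZ: "expectation (\<lambda>\<omega>. (norm (Z \<omega>))\<^sup>2) \<le> K" using K by simp
  have sq: "a \<le> 1 + a\<^sup>2" for a :: real
  proof -
    have "0 \<le> (a - 1)\<^sup>2 + a\<^sup>2 + 1" by simp
    then show ?thesis by (simp add: power2_eq_square algebra_simps)
  qed
  have L1: "integrable M f" if [measurable]: "f \<in> borel_measurable M" and "integrable M (\<lambda>\<omega>. (norm (f \<omega>))\<^sup>2)"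
    for f :: "'a \<Rightarrow> 'b"
  proof (rule Bochner_Integration.integrable_bound)
    show "integrable M (\<lambda>\<omega>. 1 + (norm (f \<omega>))\<^sup>2)" using that by simp
  qed (auto intro: order_trans[OF sq])
  show i1Z: "integrable M Z" by (rule L1) (auto intro: iZ)
  have i1Y: "integrable M (Y N)" for N by (rule L1) (auto intro: int)
  have id: "integrable M (\<lambda>\<omega>. (norm (Y N \<omega> - Z \<omega>))\<^sup>2)"
    and bd2: "expectation (\<lambda>\<omega>. (norm (Y N \<omega> - Z \<omega>))\<^sup>2) \<le> 4 * K" for N
  proof -
    have p: "(norm (a - b))\<^sup>2 \<le> 2 * (norm a)\<^sup>2 + 2 * (norm b)\<^sup>2" for a b :: 'b
    proof -
      have "(norm (a - b))\<^sup>2 \<le> (norm a + norm b)\<^sup>2"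
        by (intro power_mono norm_triangle_ineq4) auto
      also have "\<dots> \<le> 2 * (norm a)\<^sup>2 + 2 * (norm b)\<^sup>2"
        using sum_squares_bound[of "norm a" "norm b"] by (simp add: power2_sum)
      finally show ?thesis .
    qed
    have i: "integrable M (\<lambda>\<omega>. 2 * (norm (Y N \<omega>))\<^sup>2 + 2 * (norm (Z \<omega>))\<^sup>2)"
      using int[of N] iZ by simp
    show "integrable M (\<lambda>\<omega>. (norm (Y N \<omega> - Z \<omega>))\<^sup>2)"
      by (rule Bochner_Integration.integrable_bound[OF i]) (auto intro!: AE_I2 p order_trans[OF p])
    then have "expectation (\<lambda>\<omega>. (norm (Y N \<omega> - Z \<omega>))\<^sup>2)
        \<le> expectation (\<lambda>\<omega>. 2 * (norm (Y N \<omega>))\<^sup>2 + 2 * (norm (Z \<omega>))\<^sup>2)"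
      by (rule integral_mono[OF _ i]) (rule p)
    also have "\<dots> \<le> 4 * K" using int[of N] iZ bd[of N] bZ by simp
    finally show "expectation (\<lambda>\<omega>. (norm (Y N \<omega> - Z \<omega>))\<^sup>2) \<le> 4 * K" .
  qed
  show "(\<lambda>N. expectation (Y N)) \<longlonglongrightarrow> expectation Z"
  proof (rule LIMSEQ_I)
    fix r :: real assume r: "0 < r"
    \<comment> \<open>Bounded second moments give uniform integrability: a \<le> min a T + a^2 / T
      splits off a tail of expectation at most 4 K / T, and this choice of T keeps it below r / 2.
      The truncated part is left to dominated convergence.\<close>
    define T where "T = 8 * (K + 1) / r"
    have T: "0 < T" using r K by (simp add: T_def)
    have "(\<lambda>N. expectation (\<lambda>\<omega>. min (norm (Y N \<omega> - Z \<omega>)) T)) \<longlonglongrightarrow> expectation (\<lambda>\<omega>. min (norm (Z \<omega> - Z \<omega>)) T)"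
    proof (rule integral_dominated_convergence[where w = "\<lambda>_. T"])
      show "AE \<omega> in M. (\<lambda>N. min (norm (Y N \<omega> - Z \<omega>)) T) \<longlonglongrightarrow> min (norm (Z \<omega> - Z \<omega>)) T"
        using lim by eventually_elim (intro tendsto_intros, auto)
    qed (use T in auto)
    then have "\<forall>\<^sub>F N in sequentially. expectation (\<lambda>\<omega>. min (norm (Y N \<omega> - Z \<omega>)) T) < r / 2"
      using r T by (intro order_tendstoD(2)[of _ 0]) (auto simp: min_def)
    then obtain N0 where N0: "\<And>N. N \<ge> N0 \<Longrightarrow> expectation (\<lambda>\<omega>. min (norm (Y N \<omega> - Z \<omega>)) T) < r / 2"
      by (auto simp: eventually_sequentially)
    have "norm (expectation (Y N) - expectation Z) < r" if "N \<ge> N0" for N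
    proof -
      have mT: "integrable M (\<lambda>\<omega>. min (norm (Y N \<omega> - Z \<omega>)) T)"
        by (rule integrable_const_bound[where B = T]) (use T in auto)
      have pt: "a \<le> min a T + a\<^sup>2 / T" if "a \<ge> 0" for a
      proof (cases "a \<le> T")
        case False
        then have "a * T \<le> a * a" using that by (intro mult_left_mono) auto
        then have "a \<le> a\<^sup>2 / T" using T by (simp add: field_simps power2_eq_square)
        then show ?thesis using False T by auto
      qed (use T in auto)
      have "norm (expectation (Y N) - expectation Z) = norm (expectation (\<lambda>\<omega>. Y N \<omega> - Z \<omega>))"
        using i1Y i1Z by simp
      also have "\<dots> \<le> expectation (\<lambda>\<omega>. norm (Y N \<omega> - Z \<omega>))" by (rule integral_norm_bound)
      also have "\<dots> \<le> expectation (\<lambda>\<omega>. min (norm (Y N \<omega> - Z \<omega>)) T + (norm (Y N \<omega> - Z \<omega>))\<^sup>2 / T)"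
        by (rule integral_mono) (use i1Y i1Z mT id pt in auto)
      also have "\<dots> = expectation (\<lambda>\<omega>. min (norm (Y N \<omega> - Z \<omega>)) T)
          + expectation (\<lambda>\<omega>. (norm (Y N \<omega> - Z \<omega>))\<^sup>2) / T"
        using mT id by simp
      also have "\<dots> < r / 2 + 4 * K / T"
        using N0[OF that] bd2[of N] T by (intro add_less_le_mono divide_right_mono) auto
      also have "4 * K / T \<le> r / 2" using K r by (simp add: T_def field_simps)
      finally show ?thesis by simp
    qed
    then show "\<exists>N0. \<forall>N\<ge>N0. norm (expectation (Y N) - expectation Z) < r" by blast
  qed
qed

section \<open>Polynomial growth and differentiable test functions\<close>

text \<open>Complex values admit monomials multiplied by exp(i \<tau> S). The summand 1 keeps the
  gauge at least 1, so its powers increase with the exponent; this closes the class under sums and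
  products.\<close>

definition poly_bounded :: "'i set \<Rightarrow> (('i \<Rightarrow> real) \<Rightarrow> complex) \<Rightarrow> bool" where
  "poly_bounded A F \<longleftrightarrow> (\<exists>C p. 0 \<le> C \<and> (\<forall>z. norm (F z) \<le> C * (1 + (\<Sum>j\<in>A. \<bar>z j\<bar>)) ^ p))"

lemma one_le_gauge: "1 \<le> 1 + (\<Sum>j\<in>A. \<bar>z j :: real\<bar>)"
  by (simp add: sum_nonneg)

lemma poly_bounded_const: "poly_bounded A (\<lambda>z. c)"
  unfolding poly_bounded_def by (rule exI[of _ "norm c"], rule exI[of _ 0]) auto

lemma poly_bounded_coord: "finite A \<Longrightarrow> j \<in> A \<Longrightarrow> poly_bounded A (\<lambda>z. of_real (z j))"
  unfolding poly_bounded_def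
  by (rule exI[of _ 1], rule exI[of _ 1])
     (auto intro: order_trans[OF member_le_sum[of j A "\<lambda>j. \<bar>_ j\<bar>"]])

lemma poly_bounded_mult:
  assumes "poly_bounded A F" "poly_bounded A G"
  shows "poly_bounded A (\<lambda>z. F z * G z)"
proof -
  from assms obtain C p C' p' where
    C: "0 \<le> C" "\<And>z. norm (F z) \<le> C * (1 + (\<Sum>j\<in>A. \<bar>z j\<bar>)) ^ p" and
    C': "0 \<le> C'" "\<And>z. norm (G z) \<le> C' * (1 + (\<Sum>j\<in>A. \<bar>z j\<bar>)) ^ p'"
    unfolding poly_bounded_def by blast
  have "norm (F z * G z) \<le> (C * C') * (1 + (\<Sum>j\<in>A. \<bar>z j\<bar>)) ^ (p + p')" for z
  proof -
    have "norm (F z) * norm (G z) \<le> (C * (1 + (\<Sum>j\<in>A. \<bar>z j\<bar>)) ^ p) * (C' * (1 + (\<Sum>j\<in>A. \<bar>z j\<bar>)) ^ p')"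
      by (intro mult_mono C C') (use C(1) one_le_gauge[of z A] in \<open>auto intro!: mult_nonneg_nonneg\<close>)
    then show ?thesis by (simp add: norm_mult power_add mult_ac)
  qed
  then show ?thesis unfolding poly_bounded_def using C(1) C'(1) by (intro exI[of _ "C * C'"]) auto
qed

lemma poly_bounded_add:
  assumes "poly_bounded A F" "poly_bounded A G"
  shows "poly_bounded A (\<lambda>z. F z + G z)"
proof -
  from assms obtain C p C' p' where
    C: "0 \<le> C" "\<And>z. norm (F z) \<le> C * (1 + (\<Sum>j\<in>A. \<bar>z j\<bar>)) ^ p" and
    C': "0 \<le> C'" "\<And>z. norm (G z) \<le> C' * (1 + (\<Sum>j\<in>A. \<bar>z j\<bar>)) ^ p'"
    unfolding poly_bounded_def by blast
  have "norm (F z + G z) \<le> (C + C') * (1 + (\<Sum>j\<in>A. \<bar>z j\<bar>)) ^ (p + p')" for z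
  proof -
    let ?g = "1 + (\<Sum>j\<in>A. \<bar>z j\<bar>)"
    have "C * ?g ^ p \<le> C * ?g ^ (p + p')" "C' * ?g ^ p' \<le> C' * ?g ^ (p + p')"
      using C(1) C'(1) one_le_gauge[of z A] by (auto intro!: mult_left_mono power_increasing simp del: power_add)
    then show ?thesis using C(2)[of z] C'(2)[of z] norm_triangle_ineq[of "F z" "G z"]
      by (simp add: distrib_right)
  qed
  then show ?thesis unfolding poly_bounded_def using C(1) C'(1) by (intro exI[of _ "C + C'"]) auto
qed

lemma poly_bounded_sum:
  "(\<And>i. i \<in> I \<Longrightarrow> poly_bounded A (F i)) \<Longrightarrow> poly_bounded A (\<lambda>z. \<Sum>i\<in>I. F i z)"
  by (induction I rule: infinite_finite_induct) (auto intro: poly_bounded_const poly_bounded_add)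

text \<open>Only growth of \<open>L\<close> of order one is asked for, so that scalar multiples,
  shifts, linear and affine substitutions are all covered by the same statement.\<close>

lemma poly_bounded_linear:
  assumes fin: "finite B" "finite A" and F: "poly_bounded B F"
    and L: "\<And>z i. i \<in> B \<Longrightarrow> \<bar>L z i\<bar> \<le> K * (1 + (\<Sum>j\<in>A. \<bar>z j\<bar>))"
  shows "poly_bounded A (\<lambda>z. F (L z))"
proof -
  from F obtain C p where C: "0 \<le> C" "\<And>z. norm (F z) \<le> C * (1 + (\<Sum>j\<in>B. \<bar>z j\<bar>)) ^ p"
    unfolding poly_bounded_def by blast
  define K' where "K' = 1 + real (card B) * \<bar>K\<bar>"
  have "norm (F (L z)) \<le> (C * K' ^ p) * (1 + (\<Sum>j\<in>A. \<bar>z j\<bar>)) ^ p" for z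
  proof -
    let ?g = "1 + (\<Sum>j\<in>A. \<bar>z j\<bar>)"
    have g: "1 \<le> ?g" by (rule one_le_gauge)
    have "(\<Sum>j\<in>B. \<bar>L z j\<bar>) \<le> (\<Sum>j\<in>B. \<bar>K\<bar> * ?g)"
    proof (rule sum_mono)
      fix i assume "i \<in> B"
      then have "\<bar>L z i\<bar> \<le> K * ?g" by (rule L)
      also have "\<dots> \<le> \<bar>K\<bar> * ?g" using g by (intro mult_right_mono) auto
      finally show "\<bar>L z i\<bar> \<le> \<bar>K\<bar> * ?g" .
    qed
    then have "1 + (\<Sum>j\<in>B. \<bar>L z j\<bar>) \<le> K' * ?g" using g unfolding K'_def by (simp add: algebra_simps) (use g in linarith)
    then have "(1 + (\<Sum>j\<in>B. \<bar>L z j\<bar>)) ^ p \<le> (K' * ?g) ^ p"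
      by (rule power_mono) (use one_le_gauge[of "L z" B] in linarith)
    then have "C * (1 + (\<Sum>j\<in>B. \<bar>L z j\<bar>)) ^ p \<le> C * (K' * ?g) ^ p" using C(1) by (rule mult_left_mono)
    then show ?thesis using C(2)[of "L z"] by (simp add: power_mult_distrib mult_ac)
  qed
  moreover have "0 \<le> C * K' ^ p" using C(1) by (simp add: K'_def)
  ultimately show ?thesis unfolding poly_bounded_def by blast
qed

text \<open>The derivative clause makes \<^term>\<open>D\<close> the gradient of \<^term>\<open>F\<close> and forces
  \<^term>\<open>F\<close> to depend on the coordinates in \<^term>\<open>A\<close> only.\<close>

definition test_fun :: "'i set \<Rightarrow> (('i \<Rightarrow> real) \<Rightarrow> complex) \<Rightarrow> ('i \<Rightarrow> ('i \<Rightarrow> real) \<Rightarrow> complex) \<Rightarrow> bool" where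
  "test_fun A F D \<longleftrightarrow>
     continuous_on UNIV F \<and> (\<forall>j\<in>A. continuous_on UNIV (D j)) \<and>
     (\<forall>z v. ((\<lambda>s. F (\<lambda>j. z j + s * v j)) has_vector_derivative (\<Sum>j\<in>A. of_real (v j) * D j z)) (at 0)) \<and>
     poly_bounded A F \<and> (\<forall>j\<in>A. poly_bounded A (D j))"

lemma test_fun_deriv0:
  "test_fun A F D \<Longrightarrow>
    ((\<lambda>s. F (\<lambda>j. z j + s * v j)) has_vector_derivative (\<Sum>j\<in>A. of_real (v j) * D j z)) (at 0)"
  by (simp add: test_fun_def)

lemma test_fun_deriv:
  assumes "test_fun A F D"
  shows "((\<lambda>s. F (\<lambda>j. z j + s * v j)) has_vector_derivative
    (\<Sum>j\<in>A. of_real (v j) * D j (\<lambda>j. z j + s * v j))) (at s)"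
proof -
  have "((\<lambda>r. F (\<lambda>j. (z j + s * v j) + r * v j)) has_vector_derivative
    (\<Sum>j\<in>A. of_real (v j) * D j (\<lambda>j. z j + s * v j))) (at (s - s))"
    using assms by (simp add: test_fun_def)
  then have "((\<lambda>r. F (\<lambda>j. (z j + s * v j) + r * v j)) \<circ> (\<lambda>r. r - s) has_vector_derivative
    1 *\<^sub>R (\<Sum>j\<in>A. of_real (v j) * D j (\<lambda>j. z j + s * v j))) (at s)"
    by (intro vector_diff_chain_at) (auto intro!: derivative_eq_intros)
  moreover have "(\<lambda>r. F (\<lambda>j. (z j + s * v j) + r * v j)) \<circ> (\<lambda>r. r - s) = (\<lambda>r. F (\<lambda>j. z j + r * v j))"
    by (auto simp: fun_eq_iff algebra_simps)
  ultimately show ?thesis by simp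
qed

lemma test_fun_const: "test_fun A (\<lambda>z. c) (\<lambda>j z. 0)"
  by (auto simp: test_fun_def poly_bounded_const)

lemma test_fun_coord:
  assumes "finite A" "i \<in> A"
  shows "test_fun A (\<lambda>z. of_real (z i)) (\<lambda>j z. if j = i then 1 else 0)"
proof -
  have "(\<Sum>j\<in>A. complex_of_real (v j) * (if j = i then 1 else 0)) = of_real (v i)" for v
    using assms by (simp add: if_distrib cong: if_cong)
  moreover have "((\<lambda>s. complex_of_real (z i + s * v i)) has_vector_derivative of_real (v i)) (at 0)" for z v
    by (auto intro!: derivative_eq_intros has_vector_derivative_real_field
        simp: has_vector_derivative_def scaleR_conv_of_real)
  ultimately show ?thesis using assms
    by (auto simp: test_fun_def intro!: poly_bounded_coord poly_bounded_const continuous_intros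
        continuous_on_product_coordinates)
qed

lemma test_fun_mult:
  assumes "test_fun A F D" "test_fun A G E"
  shows "test_fun A (\<lambda>z. F z * G z) (\<lambda>j z. D j z * G z + F z * E j z)"
proof -
  have "((\<lambda>s. F (\<lambda>j. z j + s * v j) * G (\<lambda>j. z j + s * v j)) has_vector_derivative
      (\<Sum>j\<in>A. of_real (v j) * (D j z * G z + F z * E j z))) (at 0)" for z v
  proof -
    have "((\<lambda>s. F (\<lambda>j. z j + s * v j) * G (\<lambda>j. z j + s * v j)) has_vector_derivative
      (F (\<lambda>j. z j + 0 * v j) * (\<Sum>j\<in>A. of_real (v j) * E j z)
        + (\<Sum>j\<in>A. of_real (v j) * D j z) * G (\<lambda>j. z j + 0 * v j))) (at 0)"
      using assms unfolding test_fun_def by (intro has_vector_derivative_mult) blast+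
    then show ?thesis
      by (simp add: sum.distrib sum_distrib_left sum_distrib_right algebra_simps)
  qed
  with assms show ?thesis unfolding test_fun_def
    by (auto intro!: continuous_intros poly_bounded_mult poly_bounded_add)
qed

lemma test_fun_linear:
  fixes a :: "'k \<Rightarrow> 'i \<Rightarrow> real"
  assumes fin: "finite A" "finite B" and F: "test_fun B F D"
  shows "test_fun A (\<lambda>z. F (\<lambda>i. y i + (\<Sum>j\<in>A. a i j * z j)))
    (\<lambda>j z. \<Sum>i\<in>B. of_real (a i j) * D i (\<lambda>i. y i + (\<Sum>j\<in>A. a i j * z j)))"
proof -
  let ?L = "\<lambda>z i. y i + (\<Sum>j\<in>A. a i j * z j)"
  have cont: "continuous_on UNIV (\<lambda>z. G (?L z))" if "continuous_on UNIV G" for G :: "('k \<Rightarrow> real) \<Rightarrow> complex"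
    by (rule continuous_on_compose2[OF that])
       (auto intro!: continuous_intros continuous_on_product_coordinates)
  define K where "K = (\<Sum>i\<in>B. \<bar>y i\<bar> + (\<Sum>j\<in>A. \<bar>a i j\<bar>))"
  have bd: "\<bar>?L z i\<bar> \<le> K * (1 + (\<Sum>j\<in>A. \<bar>z j\<bar>))" if "i \<in> B" for z i
  proof -
    have *: "\<bar>y i\<bar> + (\<Sum>j\<in>A. \<bar>a i j\<bar>) \<le> K" unfolding K_def
      by (rule member_le_sum[OF that]) (auto simp: fin sum_nonneg)
    have "\<bar>\<Sum>j\<in>A. a i j * z j\<bar> \<le> (\<Sum>j\<in>A. \<bar>a i j\<bar> * \<bar>z j\<bar>)"
      by (rule order_trans[OF sum_abs]) (simp add: abs_mult)
    also have "\<dots> \<le> (\<Sum>j\<in>A. \<bar>a i j\<bar> * (1 + (\<Sum>j\<in>A. \<bar>z j\<bar>)))"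
      by (intro sum_mono mult_left_mono order_trans[OF member_le_sum[of _ A "\<lambda>j. \<bar>z j\<bar>"]]) (auto simp: fin)
    also have "\<dots> = (\<Sum>j\<in>A. \<bar>a i j\<bar>) * (1 + (\<Sum>j\<in>A. \<bar>z j\<bar>))" by (simp add: sum_distrib_right)
    finally have "\<bar>?L z i\<bar> \<le> \<bar>y i\<bar> * 1 + (\<Sum>j\<in>A. \<bar>a i j\<bar>) * (1 + (\<Sum>j\<in>A. \<bar>z j\<bar>))" by linarith
    also have "\<dots> \<le> \<bar>y i\<bar> * (1 + (\<Sum>j\<in>A. \<bar>z j\<bar>)) + (\<Sum>j\<in>A. \<bar>a i j\<bar>) * (1 + (\<Sum>j\<in>A. \<bar>z j\<bar>))"
      by (intro add_right_mono mult_left_mono one_le_gauge) auto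
    also have "\<dots> \<le> K * (1 + (\<Sum>j\<in>A. \<bar>z j\<bar>))"
      unfolding distrib_right[symmetric] using one_le_gauge[of z A] by (intro mult_right_mono *) auto
    finally show ?thesis .
  qed
  have pb: "poly_bounded A (\<lambda>z. G (?L z))" if "poly_bounded B G" for G
    by (rule poly_bounded_linear[OF fin(2,1) that bd])
  have der: "((\<lambda>s. F (?L (\<lambda>j. z j + s * v j))) has_vector_derivative
      (\<Sum>j\<in>A. of_real (v j) * (\<Sum>i\<in>B. of_real (a i j) * D i (?L z)))) (at 0)" for z v
  proof -
    have "((\<lambda>s. F (\<lambda>i. ?L z i + s * (\<Sum>j\<in>A. a i j * v j))) has_vector_derivative
      (\<Sum>i\<in>B. of_real (\<Sum>j\<in>A. a i j * v j) * D i (?L z))) (at 0)"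
      by (rule test_fun_deriv0[OF F, of "?L z" "\<lambda>i. \<Sum>j\<in>A. a i j * v j"])
    moreover have "(\<lambda>i. ?L z i + s * (\<Sum>j\<in>A. a i j * v j)) = ?L (\<lambda>j. z j + s * v j)" for s
      by (simp add: algebra_simps sum.distrib sum_distrib_left)
    moreover have "(\<Sum>i\<in>B. of_real (\<Sum>j\<in>A. a i j * v j) * D i (?L z)) =
      (\<Sum>j\<in>A. of_real (v j) * (\<Sum>i\<in>B. of_real (a i j) * D i (?L z)))"
      unfolding of_real_sum sum_distrib_right sum_distrib_left
      by (subst sum.swap) (simp add: mult_ac)
    ultimately show ?thesis by simp
  qed
  show ?thesis unfolding test_fun_def
    using F unfolding test_fun_def
    by (intro conjI ballI allI der cont pb poly_bounded_sum poly_bounded_mult poly_bounded_const continuous_intros) auto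
qed

section \<open>Gaussian families\<close>

lemma integrable_normal_poly:
  fixes g :: "real \<Rightarrow> complex"
  assumes [measurable]: "g \<in> borel_measurable borel" and s: "s > 0"
    and bd: "\<And>x. norm (g x) \<le> C * (1 + \<bar>x\<bar>) ^ p"
  shows "integrable lborel (\<lambda>x. normal_density 0 s x *\<^sub>R g x)"
proof (rule Bochner_Integration.integrable_bound)
  show "integrable lborel (\<lambda>x. \<bar>C\<bar> * 2 ^ p * (normal_density 0 s x + normal_density 0 s x * \<bar>x - 0\<bar> ^ p))"
    by (intro integrable_mult_right Bochner_Integration.integrable_add integrable_normal_moment_abs
        integrable_normal_density s)
  have "norm (normal_density 0 s x *\<^sub>R g x)
      \<le> norm (\<bar>C\<bar> * 2 ^ p * (normal_density 0 s x + normal_density 0 s x * \<bar>x - 0\<bar> ^ p))" for x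
  proof -
    have "(1 + \<bar>x\<bar>) ^ p \<le> (2 * max 1 \<bar>x\<bar>) ^ p" by (rule power_mono) auto
    also have "\<dots> \<le> 2 ^ p * (1 + \<bar>x\<bar> ^ p)" by (auto simp: power_mult_distrib max_def)
    finally have *: "(1 + \<bar>x\<bar>) ^ p \<le> 2 ^ p * (1 + \<bar>x\<bar> ^ p)" .
    have "norm (g x) \<le> \<bar>C\<bar> * (1 + \<bar>x\<bar>) ^ p"
      by (rule order_trans[OF bd]) (auto intro: mult_right_mono)
    also have "\<dots> \<le> \<bar>C\<bar> * (2 ^ p * (1 + \<bar>x\<bar> ^ p))" by (rule mult_left_mono[OF *]) auto
    finally have "normal_density 0 s x * norm (g x) \<le> normal_density 0 s x * (\<bar>C\<bar> * (2 ^ p * (1 + \<bar>x\<bar> ^ p)))"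
      by (rule mult_left_mono) auto
    then show ?thesis by (simp add: algebra_simps)
  qed
  then show "AE x in lborel. norm (normal_density 0 s x *\<^sub>R g x)
      \<le> norm (\<bar>C\<bar> * 2 ^ p * (normal_density 0 s x + normal_density 0 s x * \<bar>x - 0\<bar> ^ p))" by auto
qed simp

lemma normal_density_has_derivative:
  assumes "s > 0"
  shows "(normal_density 0 s has_real_derivative - (x / s\<^sup>2) * normal_density 0 s x) (at x)"
  using assms unfolding normal_density_def[abs_def]
  by (auto intro!: derivative_eq_intros simp: field_simps power2_eq_square)

lemma power_le_fact_exp: "(y::real) \<ge> 0 \<Longrightarrow> y ^ p \<le> fact p * exp y"
proof -
  assume y: "y \<ge> 0"
  have "inverse (fact p) *\<^sub>R y ^ p \<le> (\<Sum>n. inverse (fact n) *\<^sub>R y ^ n)"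
    using summable_exp_generic[of y] y by (intro sum_le_suminf[of _ "{p}", simplified]) auto
  then show ?thesis by (simp add: exp_def field_simps)
qed

text \<open>The polynomial factor is first replaced by p! exp(1 + |x|). What remains is a fixed
  exponential expression without the symbolic exponent \<open>p\<close>, whose limits are elementary
  asymptotics.\<close>

lemma normal_density_poly_tendsto_0:
  fixes f :: "real \<Rightarrow> complex"
  assumes s: "s > 0" and bd: "\<And>x. norm (f x) \<le> C * (1 + \<bar>x\<bar>) ^ p"
  shows "((\<lambda>x. normal_density 0 s x *\<^sub>R f x) \<longlongrightarrow> 0) at_top"
    "((\<lambda>x. normal_density 0 s x *\<^sub>R f x) \<longlongrightarrow> 0) at_bot"
proof -
  have le: "norm (normal_density 0 s x *\<^sub>R f x)
      \<le> 1 / sqrt (2 * pi * s\<^sup>2) * exp (- x\<^sup>2 / (2 * s\<^sup>2)) * (\<bar>C\<bar> * fact p * exp (1 + \<bar>x\<bar>))" for x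
  proof -
    have "norm (f x) \<le> \<bar>C\<bar> * (1 + \<bar>x\<bar>) ^ p"
      by (rule order_trans[OF bd]) (auto intro: mult_right_mono)
    also have "\<dots> \<le> \<bar>C\<bar> * (fact p * exp (1 + \<bar>x\<bar>))" by (intro mult_left_mono power_le_fact_exp) auto
    finally have "normal_density 0 s x * norm (f x) \<le> normal_density 0 s x * (\<bar>C\<bar> * (fact p * exp (1 + \<bar>x\<bar>)))"
      by (rule mult_left_mono) auto
    then show ?thesis by (simp add: normal_density_def mult_ac)
  qed
  have "((\<lambda>x. 1 / sqrt (2 * pi * s\<^sup>2) * exp (- x\<^sup>2 / (2 * s\<^sup>2)) * (\<bar>C\<bar> * fact p * exp (1 + \<bar>x\<bar>))) \<longlongrightarrow> 0) at_top"
    using s by real_asymp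
  then show "((\<lambda>x. normal_density 0 s x *\<^sub>R f x) \<longlongrightarrow> 0) at_top"
    by (rule tendsto_0_le[where K = 1]) (use le in \<open>auto intro!: always_eventually order_trans[OF le]\<close>)
  have "((\<lambda>x. 1 / sqrt (2 * pi * s\<^sup>2) * exp (- x\<^sup>2 / (2 * s\<^sup>2)) * (\<bar>C\<bar> * fact p * exp (1 + \<bar>x\<bar>))) \<longlongrightarrow> 0) at_bot"
    using s by real_asymp
  then show "((\<lambda>x. normal_density 0 s x *\<^sub>R f x) \<longlongrightarrow> 0) at_bot"
    by (rule tendsto_0_le[where K = 1]) (use le in \<open>auto intro!: always_eventually order_trans[OF le]\<close>)
qed

text \<open>Stein's identity. The density satisfies \<phi>' = -(x / s^2) \<phi>, so \<phi> f' - (x /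
  s^2) \<phi> f is the derivative of \<phi> f, and \<phi> f vanishes at both ends because f grows
  polynomially.\<close>

lemma stein_normal:
  fixes f f' :: "real \<Rightarrow> complex"
  assumes s: "s > 0"
    and d: "\<And>x. (f has_vector_derivative f' x) (at x)"
    and c: "continuous_on UNIV f'"
    and bf: "\<And>x. norm (f x) \<le> C * (1 + \<bar>x\<bar>) ^ p"
    and bf': "\<And>x. norm (f' x) \<le> C' * (1 + \<bar>x\<bar>) ^ p'"
  shows "(LBINT x. normal_density 0 s x *\<^sub>R (of_real x * f x)) = s\<^sup>2 *\<^sub>R (LBINT x. normal_density 0 s x *\<^sub>R f' x)"
proof -
  have cf: "continuous_on UNIV f"
    by (auto intro!: continuous_at_imp_continuous_on has_vector_derivative_continuous[OF d])
  have [measurable]: "f \<in> borel_measurable borel" "f' \<in> borel_measurable borel"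
    using cf c by (auto intro: borel_measurable_continuous_onI)
  have i1: "integrable lborel (\<lambda>x. normal_density 0 s x *\<^sub>R (of_real x * f x))"
  proof (rule integrable_normal_poly)
    show "norm (of_real x * f x) \<le> C * (1 + \<bar>x\<bar>) ^ Suc p" for x
    proof -
      have "\<bar>x\<bar> * norm (f x) \<le> (1 + \<bar>x\<bar>) * (C * (1 + \<bar>x\<bar>) ^ p)"
        by (intro mult_mono bf) auto
      then show ?thesis by (simp add: norm_mult mult_ac)
    qed
  qed (use s in simp_all)
  have i2: "integrable lborel (\<lambda>x. normal_density 0 s x *\<^sub>R f' x)"
    by (rule integrable_normal_poly) (use bf' s in auto)
  let ?H = "\<lambda>x. normal_density 0 s x *\<^sub>R f x"
  let ?H' = "\<lambda>x. normal_density 0 s x *\<^sub>R f' x - (1 / s\<^sup>2) *\<^sub>R (normal_density 0 s x *\<^sub>R (of_real x * f x))"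
  have i: "integrable lborel ?H'"
    by (intro Bochner_Integration.integrable_diff integrable_scaleR_right i1 i2)
  have "(LBINT x=-\<infinity>..\<infinity>. ?H' x) = 0 - 0"
  proof (rule interval_integral_FTC_integrable[where F = ?H])
    fix x :: real
    have "(?H has_vector_derivative (normal_density 0 s x *\<^sub>R f' x + (- (x / s\<^sup>2) * normal_density 0 s x) *\<^sub>R f x)) (at x)"
      by (rule has_vector_derivative_scaleR[OF normal_density_has_derivative[OF s] d])
    moreover have "normal_density 0 s x *\<^sub>R f' x + (- (x / s\<^sup>2) * normal_density 0 s x) *\<^sub>R f x = ?H' x"
      by (simp add: scaleR_conv_of_real)
    ultimately show "(?H has_vector_derivative ?H' x) (at x)" by simp
    have "continuous_on UNIV ?H'"
      unfolding normal_density_def using s by (intro continuous_intros cf c) auto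
    then show "isCont ?H' x" by (auto simp: continuous_on_eq_continuous_at)
  next
    show "set_integrable lborel (einterval (- \<infinity>) \<infinity>) ?H'"
      using i by (simp add: set_integrable_def)
    show "((?H \<circ> real_of_ereal) \<longlongrightarrow> 0) (at_right (- \<infinity>))" "((?H \<circ> real_of_ereal) \<longlongrightarrow> 0) (at_left \<infinity>)"
      using normal_density_poly_tendsto_0[OF s bf] by (simp_all add: ereal_tendsto_simps)
  qed auto
  then have "(LBINT x. ?H' x) = 0"
    by (simp add: interval_lebesgue_integral_def set_lebesgue_integral_def)
  then have "(LBINT x. normal_density 0 s x *\<^sub>R f' x)
      = (1 / s\<^sup>2) *\<^sub>R (LBINT x. normal_density 0 s x *\<^sub>R (of_real x * f x))"
    unfolding Bochner_Integration.integral_diff[OF i2 integrable_scaleR_right[OF i1]]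
      integral_scaleR_right by simp
  then show ?thesis using s by simp
qed

text \<open>A centred Gaussian family is characterised by the integration by parts formula. In this form
  Gaussianity passes to linear images, independent sums and limits without any appeal to
  multivariate characteristic functions.\<close>

definition gauss :: "'a measure \<Rightarrow> 'i set \<Rightarrow> ('i \<Rightarrow> 'a \<Rightarrow> real) \<Rightarrow> bool" where
  "gauss M A X \<longleftrightarrow> finite A \<and> (\<forall>j. X j \<in> borel_measurable M) \<and>
     (\<forall>p. integrable M (\<lambda>\<omega>. (1 + (\<Sum>j\<in>A. \<bar>X j \<omega>\<bar>)) ^ p)) \<and>
     (\<forall>i\<in>A. \<forall>F D. test_fun A F D \<longrightarrow>
        (LINT \<omega>|M. of_real (X i \<omega>) * F (\<lambda>j. X j \<omega>)) =
        (\<Sum>j\<in>A. of_real (LINT \<omega>|M. X i \<omega> * X j \<omega>) * (LINT \<omega>|M. D j (\<lambda>j. X j \<omega>))))"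

lemma gaussD:
  assumes "gauss M A X"
  shows "finite A" "X j \<in> borel_measurable M" "integrable M (\<lambda>\<omega>. (1 + (\<Sum>j\<in>A. \<bar>X j \<omega>\<bar>)) ^ p)"
    "i \<in> A \<Longrightarrow> test_fun A F D \<Longrightarrow> (LINT \<omega>|M. of_real (X i \<omega>) * F (\<lambda>j. X j \<omega>)) =
        (\<Sum>j\<in>A. of_real (LINT \<omega>|M. X i \<omega> * X j \<omega>) * (LINT \<omega>|M. D j (\<lambda>j. X j \<omega>)))"
  using assms unfolding gauss_def by blast+

lemma continuous_on_gauge: "finite A \<Longrightarrow> continuous_on UNIV (\<lambda>z. complex_of_real ((1 + (\<Sum>j\<in>A. \<bar>z j\<bar>)) ^ p))"
  by (intro continuous_intros continuous_on_product_coordinates)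

lemma poly_bounded_gauge: "poly_bounded A (\<lambda>z. complex_of_real ((1 + (\<Sum>j\<in>A. \<bar>z j\<bar>)) ^ p))"
  unfolding poly_bounded_def
  by (rule exI[of _ 1], rule exI[of _ p]) (auto simp: norm_power sum_nonneg simp del: of_real_add of_real_power)

lemma measurable_comp_continuous:
  fixes X :: "'i::countable \<Rightarrow> 'a \<Rightarrow> real" and F :: "('i \<Rightarrow> real) \<Rightarrow> 'b::topological_space"
  assumes "continuous_on UNIV F" "\<And>j. X j \<in> borel_measurable M"
  shows "(\<lambda>\<omega>. F (\<lambda>j. X j \<omega>)) \<in> borel_measurable M"
  by (rule measurable_compose[OF measurable_coordinatewise_then_product borel_measurable_continuous_onI])
     (use assms in auto)

lemma integrable_poly_bounded:
  fixes X :: "'i::countable \<Rightarrow> 'a \<Rightarrow> real"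
  assumes m: "\<And>j. X j \<in> borel_measurable M"
    and i: "\<And>p. integrable M (\<lambda>\<omega>. (1 + (\<Sum>j\<in>A. \<bar>X j \<omega>\<bar>)) ^ p)"
    and F: "continuous_on UNIV F" "poly_bounded A F"
  shows "integrable M (\<lambda>\<omega>. F (\<lambda>j. X j \<omega>))"
proof -
  from F(2) obtain C p where C: "0 \<le> C" "\<And>z. norm (F z) \<le> C * (1 + (\<Sum>j\<in>A. \<bar>z j\<bar>)) ^ p"
    unfolding poly_bounded_def by blast
  show ?thesis
  proof (rule Bochner_Integration.integrable_bound)
    show "integrable M (\<lambda>\<omega>. C * (1 + (\<Sum>j\<in>A. \<bar>X j \<omega>\<bar>)) ^ p)"
      by (intro integrable_mult_right i)
    show "AE \<omega> in M. norm (F (\<lambda>j. X j \<omega>)) \<le> norm (C * (1 + (\<Sum>j\<in>A. \<bar>X j \<omega>\<bar>)) ^ p)"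
      using C by (auto simp: sum_nonneg)
  qed (rule measurable_comp_continuous[OF F(1) m])
qed

lemma gauss_integrable:
  fixes X :: "'i::countable \<Rightarrow> 'a \<Rightarrow> real"
  assumes "gauss M A X" "continuous_on UNIV F" "poly_bounded A F"
  shows "integrable M (\<lambda>\<omega>. F (\<lambda>j. X j \<omega>))"
  by (rule integrable_poly_bounded[OF gaussD(2,3)[OF assms(1)] assms(2,3)])

lemma gauss_integrable_mult:
  fixes X :: "'i::countable \<Rightarrow> 'a \<Rightarrow> real"
  assumes "gauss M A X" "continuous_on UNIV F" "poly_bounded A F" "i \<in> A"
  shows "integrable M (\<lambda>\<omega>. of_real (X i \<omega>) * F (\<lambda>j. X j \<omega>))"
  by (rule gauss_integrable[OF assms(1)])
     (intro continuous_intros continuous_on_product_coordinates poly_bounded_mult poly_bounded_coord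
       assms gaussD(1)[OF assms(1)])+

lemma gauss_integrable_prod:
  fixes X :: "'i::countable \<Rightarrow> 'a \<Rightarrow> real"
  assumes "gauss M A X" "i \<in> A" "j \<in> A"
  shows "integrable M (\<lambda>\<omega>. X i \<omega> * X j \<omega>)"
proof -
  have "integrable M (\<lambda>\<omega>. complex_of_real (X i \<omega>) * of_real (X j \<omega>))"
    by (rule gauss_integrable_mult[OF assms(1)])
       (intro continuous_intros continuous_on_product_coordinates poly_bounded_coord
         assms gaussD(1)[OF assms(1)])+
  then show ?thesis by (simp flip: of_real_mult add: complex_of_real_integrable_eq)
qed

lemma test_funD:
  assumes "test_fun A F D"
  shows "continuous_on UNIV F" "poly_bounded A F" "j \<in> A \<Longrightarrow> continuous_on UNIV (D j)" "j \<in> A \<Longrightarrow> poly_bounded A (D j)"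
  using assms unfolding test_fun_def by blast+

lemma (in prob_space) gauss_integrable1:
  fixes X :: "'i::countable \<Rightarrow> 'a \<Rightarrow> real"
  assumes "gauss M A X" "i \<in> A"
  shows "integrable M (X i)"
  using gauss_integrable_mult[OF assms(1) _ _ assms(2), of "\<lambda>_. 1"]
  by (auto simp: poly_bounded_const complex_of_real_integrable_eq)

lemma (in prob_space) gauss_expectation:
  fixes X :: "'i::countable \<Rightarrow> 'a \<Rightarrow> real"
  assumes "gauss M A X" "i \<in> A"
  shows "expectation (X i) = 0"
  using gaussD(4)[OF assms(1,2) test_fun_const[of _ 1]] by (simp add: integral_of_real)

text \<open>The rank one case: all coordinates are multiples of one normal variable, so a test
  function restricts to a line and Stein's identity applies there. Independent sums of such families
  produce the others.\<close>

lemma (in prob_space) gauss_normal: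
  fixes a :: "'i::countable \<Rightarrow> real"
  assumes fin: "finite A" and s: "s > 0"
    and \<xi>: "distributed M lborel \<xi> (\<lambda>y. ennreal (normal_density 0 s y))"
  shows "gauss M A (\<lambda>j \<omega>. a j * \<xi> \<omega>)"
proof -
  have [measurable]: "\<xi> \<in> borel_measurable M" using distributed_measurable[OF \<xi>] by simp
  have dd: "distr M borel \<xi> = density lborel (\<lambda>y. ennreal (normal_density 0 s y))"
  proof -
    have "distr M borel \<xi> = distr M lborel \<xi>" by (rule distr_cong) auto
    then show ?thesis using distributed_distr_eq_density[OF \<xi>] by simp
  qed
  have E: "(LINT \<omega>|M. g (\<xi> \<omega>)) = (LBINT x. normal_density 0 s x *\<^sub>R g x)"
    and I: "integrable M (\<lambda>\<omega>. g (\<xi> \<omega>)) \<longleftrightarrow> integrable lborel (\<lambda>x. normal_density 0 s x *\<^sub>R g x)"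
    if [measurable]: "g \<in> borel_measurable borel" for g :: "real \<Rightarrow> 'c::{banach,second_countable_topology}"
  proof -
    have "(LINT \<omega>|M. g (\<xi> \<omega>)) = (LINT x|distr M borel \<xi>. g x)" by (subst integral_distr) auto
    then show "(LINT \<omega>|M. g (\<xi> \<omega>)) = (LBINT x. normal_density 0 s x *\<^sub>R g x)"
      unfolding dd by (simp add: integral_density)
    have "integrable M (\<lambda>\<omega>. g (\<xi> \<omega>)) \<longleftrightarrow> integrable (distr M borel \<xi>) g"
      by (subst integrable_distr_eq) auto
    then show "integrable M (\<lambda>\<omega>. g (\<xi> \<omega>)) \<longleftrightarrow> integrable lborel (\<lambda>x. normal_density 0 s x *\<^sub>R g x)"
      unfolding dd by (simp add: integrable_density)
  qed
  have var: "expectation (\<lambda>\<omega>. (\<xi> \<omega>)\<^sup>2) = s\<^sup>2"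
    using E[of "\<lambda>x. x\<^sup>2"] normal_moment_even[OF s, of 0 1] by (auto dest!: has_bochner_integral_integral_eq)
  have bd: "\<exists>C p. \<forall>x. norm (F (\<lambda>j. x * a j)) \<le> C * (1 + \<bar>x\<bar>) ^ p" if F: "poly_bounded A F" for F
  proof -
    \<comment> \<open>The line x a is treated as a family with the single index \<open>()\<close>,
      which turns growth in the coordinates into growth in |x|.\<close>
    have "poly_bounded {()} (\<lambda>z. F (\<lambda>j. z () * a j))"
    proof (rule poly_bounded_linear[where B = A and K = "\<Sum>j\<in>A. \<bar>a j\<bar>"])
      fix z :: "unit \<Rightarrow> real" and i assume "i \<in> A"
      then have "\<bar>a i\<bar> \<le> (\<Sum>j\<in>A. \<bar>a j\<bar>)" using fin by (intro member_le_sum) auto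
      then have "\<bar>z ()\<bar> * \<bar>a i\<bar> \<le> (1 + \<bar>z ()\<bar>) * (\<Sum>j\<in>A. \<bar>a j\<bar>)" by (intro mult_mono) (auto simp: sum_nonneg)
      then show "\<bar>z () * a i\<bar> \<le> (\<Sum>j\<in>A. \<bar>a j\<bar>) * (1 + (\<Sum>j\<in>{()}. \<bar>z j\<bar>))" by (simp add: abs_mult mult_ac)
    qed (use fin F in auto)
    then obtain C p where "\<And>z. norm (F (\<lambda>j. z () * a j)) \<le> C * (1 + (\<Sum>j\<in>{()}. \<bar>z j\<bar>)) ^ p"
      unfolding poly_bounded_def by blast
    from this[of "\<lambda>_. _"] show ?thesis by auto
  qed
  have cont: "continuous_on UNIV (\<lambda>x. F (\<lambda>j. x * a j))" if "continuous_on UNIV F" for F :: "('i \<Rightarrow> real) \<Rightarrow> complex"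
    by (rule continuous_on_compose2[OF that]) (auto intro!: continuous_intros)
  have int: "integrable M (\<lambda>\<omega>. F (\<lambda>j. a j * \<xi> \<omega>))" if F: "poly_bounded A F" and c: "continuous_on UNIV F" for F
  proof -
    from bd[OF F] obtain C p where "\<And>x. norm (F (\<lambda>j. x * a j)) \<le> C * (1 + \<bar>x\<bar>) ^ p" by blast
    then have "integrable lborel (\<lambda>x. normal_density 0 s x *\<^sub>R F (\<lambda>j. x * a j))"
      by (intro integrable_normal_poly) (auto intro: borel_measurable_continuous_onI cont[OF c] s)
    then show ?thesis
      using I[of "\<lambda>x. F (\<lambda>j. x * a j)"] cont[OF c] by (simp add: borel_measurable_continuous_onI mult.commute)
  qed
  show ?thesis unfolding gauss_def
  proof (intro conjI allI ballI impI fin)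
    fix p show "integrable M (\<lambda>\<omega>. (1 + (\<Sum>j\<in>A. \<bar>a j * \<xi> \<omega>\<bar>)) ^ p)"
      using int[OF poly_bounded_gauge continuous_on_gauge[OF fin], of p]
      by (simp only: complex_of_real_integrable_eq)
  next
    fix i F D assume i: "i \<in> A" and T: "test_fun A F D"
    note TD = test_funD[OF T]
    let ?f = "\<lambda>x. F (\<lambda>j. x * a j)" and ?f' = "\<lambda>x. \<Sum>j\<in>A. of_real (a j) * D j (\<lambda>j. x * a j)"
    have m: "?f \<in> borel_measurable borel" "?f' \<in> borel_measurable borel"
      by (intro borel_measurable_continuous_onI cont TD continuous_intros; assumption)+
    from bd[OF TD(2)] obtain C p where C: "\<And>x. norm (?f x) \<le> C * (1 + \<bar>x\<bar>) ^ p" by blast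
    have "poly_bounded A (\<lambda>z. \<Sum>j\<in>A. of_real (a j) * D j z)"
      by (intro poly_bounded_sum poly_bounded_mult poly_bounded_const TD)
    from bd[OF this] obtain C' p' where C': "\<And>x. norm (?f' x) \<le> C' * (1 + \<bar>x\<bar>) ^ p'" by blast
    have d: "(?f has_vector_derivative ?f' x) (at x)" for x
      using test_fun_deriv[OF T, of "\<lambda>_. 0" a x] by simp
    have "(LINT \<omega>|M. of_real (a i * \<xi> \<omega>) * F (\<lambda>j. a j * \<xi> \<omega>))
        = (LINT \<omega>|M. of_real (a i) * (of_real (\<xi> \<omega>) * ?f (\<xi> \<omega>)))"
      by (simp add: mult_ac)
    also have "\<dots> = of_real (a i) * (LINT \<omega>|M. of_real (\<xi> \<omega>) * ?f (\<xi> \<omega>))" by simp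
    also have "(LINT \<omega>|M. of_real (\<xi> \<omega>) * ?f (\<xi> \<omega>)) = (LBINT x. normal_density 0 s x *\<^sub>R (of_real x * ?f x))"
      by (rule E) (use m in measurable)
    also have "\<dots> = s\<^sup>2 *\<^sub>R (LBINT x. normal_density 0 s x *\<^sub>R ?f' x)"
      by (rule stein_normal[OF s d _ C C']) (intro continuous_intros cont TD)
    also have "(LBINT x. normal_density 0 s x *\<^sub>R ?f' x) = (LINT \<omega>|M. ?f' (\<xi> \<omega>))"
      by (rule E[symmetric]) (use m in measurable)
    also have "\<dots> = (\<Sum>j\<in>A. of_real (a j) * (LINT \<omega>|M. D j (\<lambda>j. a j * \<xi> \<omega>)))"
      by (subst Bochner_Integration.integral_sum)
         (auto simp: mult.commute[of "\<xi> _"] intro!: integrable_mult_right int TD)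
    finally show "(LINT \<omega>|M. of_real (a i * \<xi> \<omega>) * F (\<lambda>j. a j * \<xi> \<omega>)) =
       (\<Sum>j\<in>A. of_real (LINT \<omega>|M. a i * \<xi> \<omega> * (a j * \<xi> \<omega>)) * (LINT \<omega>|M. D j (\<lambda>j. a j * \<xi> \<omega>)))"
    proof -
      assume eq: "(LINT \<omega>|M. of_real (a i * \<xi> \<omega>) * F (\<lambda>j. a j * \<xi> \<omega>)) =
        of_real (a i) * (s\<^sup>2 *\<^sub>R (\<Sum>j\<in>A. of_real (a j) * (LINT \<omega>|M. D j (\<lambda>j. a j * \<xi> \<omega>))))"
      have "(LINT \<omega>|M. a i * \<xi> \<omega> * (a j * \<xi> \<omega>)) = a i * a j * s\<^sup>2" for j
      proof -
        have "(LINT \<omega>|M. a i * \<xi> \<omega> * (a j * \<xi> \<omega>)) = (LINT \<omega>|M. (a i * a j) * (\<xi> \<omega>)\<^sup>2)"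
          by (simp add: mult_ac power2_eq_square)
        then show ?thesis using var by simp
      qed
      then show ?thesis unfolding eq
        by (simp add: scaleR_conv_of_real sum_distrib_left mult_ac)
    qed
  qed simp
qed

section \<open>Independent sums and linear images\<close>

lemma (in prob_space) expectation_indep_Fubini:
  fixes U V :: "'a \<Rightarrow> 'b::second_countable_topology" and G :: "'b \<times> 'b \<Rightarrow> complex"
  assumes ind: "indep_var borel U borel V"
    and G [measurable]: "G \<in> borel_measurable (borel \<Otimes>\<^sub>M borel)"
    and int: "integrable M (\<lambda>\<omega>. G (U \<omega>, V \<omega>))"
  shows "expectation (\<lambda>\<omega>. G (U \<omega>, V \<omega>)) = (LINT y|distr M borel V. (LINT \<omega>|M. G (U \<omega>, y)))"
proof -
  have [measurable]: "U \<in> borel_measurable M" "V \<in> borel_measurable M"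
    using indep_var_rv1[OF ind] indep_var_rv2[OF ind] by auto
  interpret U: prob_space "distr M borel U" by (rule prob_space_distr) simp
  interpret V: prob_space "distr M borel V" by (rule prob_space_distr) simp
  interpret P: pair_sigma_finite "distr M borel U" "distr M borel V" ..
  have eq: "distr M borel U \<Otimes>\<^sub>M distr M borel V = distr M (borel \<Otimes>\<^sub>M borel) (\<lambda>\<omega>. (U \<omega>, V \<omega>))"
    using ind by (simp add: indep_var_distribution_eq)
  have i: "integrable (distr M borel U \<Otimes>\<^sub>M distr M borel V) (\<lambda>(x, y). G (x, y))"
    unfolding eq using int by (subst integrable_distr_eq) auto
  have "expectation (\<lambda>\<omega>. G (U \<omega>, V \<omega>)) = (LINT z|distr M (borel \<Otimes>\<^sub>M borel) (\<lambda>\<omega>. (U \<omega>, V \<omega>)). G z)"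
    by (subst integral_distr) auto
  also have "\<dots> = (LINT y|distr M borel V. (LINT x|distr M borel U. G (x, y)))"
    unfolding eq[symmetric] using P.integral_snd[OF i] by simp
  also have "\<dots> = (LINT y|distr M borel V. (LINT \<omega>|M. G (U \<omega>, y)))"
    by (intro Bochner_Integration.integral_cong refl integral_distr) auto
  finally show ?thesis .
qed

lemma (in prob_space) indep_set_sym:
  assumes "indep_set A B"
  shows "indep_set B A"
proof (rule indep_setI)
  show "B \<subseteq> events" by (rule indep_setD_ev2[OF assms])
  show "A \<subseteq> events" by (rule indep_setD_ev1[OF assms])
  show "prob (b \<inter> a) = prob b * prob a" if "b \<in> B" "a \<in> A" for a b
    using indep_setD[OF assms that(2,1)] by (simp only: Int_commute mult.commute)
qed

lemma (in prob_space) indep_var_sym: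
  assumes "indep_var S U T V" shows "indep_var T V S U"
  using assms indep_set_sym unfolding indep_var_eq by blast

lemma continuous_on_coord_add:
  "continuous_on UNIV (\<lambda>p. (\<lambda>j. fst p j + snd p j) :: ('i \<Rightarrow> real))"
proof (rule continuous_on_coordinatewise_then_product)
  fix i
  show "continuous_on UNIV (\<lambda>p. fst p i + snd p i :: real)"
    by (intro continuous_intros continuous_on_product_then_coordinatewise)
qed

lemma test_fun_shift:
  assumes "finite A" "test_fun A F D"
  shows "test_fun A (\<lambda>z. F (\<lambda>j. z j + y j)) (\<lambda>j z. D j (\<lambda>j. z j + y j))"
proof -
  have c: "continuous_on UNIV (\<lambda>z. G (\<lambda>j. z j + y j))" if "continuous_on UNIV G" for G :: "('a \<Rightarrow> real) \<Rightarrow> complex"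
    by (rule continuous_on_compose2[OF that])
       (auto intro!: continuous_intros continuous_on_product_coordinates)
  have pb: "poly_bounded A (\<lambda>z. G (\<lambda>j. z j + y j))" if "poly_bounded A G" for G
  proof (rule poly_bounded_linear[OF assms(1,1) that])
    fix z :: "'a \<Rightarrow> real" and i assume i: "i \<in> A"
    have "\<bar>z i\<bar> \<le> (\<Sum>j\<in>A. \<bar>z j\<bar>)" "\<bar>y i\<bar> \<le> (\<Sum>j\<in>A. \<bar>y j\<bar>)"
      using assms(1) i by (auto intro!: member_le_sum[of i A "\<lambda>j. \<bar>_ j\<bar>"])
    moreover have "0 \<le> (\<Sum>j\<in>A. \<bar>y j\<bar>) * (\<Sum>j\<in>A. \<bar>z j\<bar>)" by (simp add: sum_nonneg)
    ultimately show "\<bar>z i + y i\<bar> \<le> (1 + (\<Sum>j\<in>A. \<bar>y j\<bar>)) * (1 + (\<Sum>j\<in>A. \<bar>z j\<bar>))"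
      unfolding ring_distribs by (simp only: mult_1_left mult_1_right)
  qed
  have d: "((\<lambda>s. F (\<lambda>j. z j + s * v j + y j)) has_vector_derivative
      (\<Sum>j\<in>A. of_real (v j) * D j (\<lambda>j. z j + y j))) (at 0)" for z v
    using test_fun_deriv0[OF assms(2), of "\<lambda>j. z j + y j" v] by (simp add: algebra_simps)
  show ?thesis using test_funD[OF assms(2)] unfolding test_fun_def by (intro conjI ballI allI c pb d) auto
qed

text \<open>With Y frozen at y the function F(. + y) is again a test function, so integration by
  parts holds for X alone, and Fubini averages it over Y. Exchanging the roles and adding gives the
  formula for X + Y, because mixed covariances vanish and the covariances therefore add.\<close>

lemma (in prob_space) gauss_add_indep:
  fixes X Y :: "'i::countable \<Rightarrow> 'a \<Rightarrow> real"
  assumes X: "gauss M A X" and Y: "gauss M A Y"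
    and ind: "indep_var borel (\<lambda>\<omega> j. X j \<omega>) borel (\<lambda>\<omega> j. Y j \<omega>)"
  shows "gauss M A (\<lambda>j \<omega>. X j \<omega> + Y j \<omega>)"
    and "\<And>i j. i \<in> A \<Longrightarrow> j \<in> A \<Longrightarrow> expectation (\<lambda>\<omega>. (X i \<omega> + Y i \<omega>) * (X j \<omega> + Y j \<omega>))
      = expectation (\<lambda>\<omega>. X i \<omega> * X j \<omega>) + expectation (\<lambda>\<omega>. Y i \<omega> * Y j \<omega>)"
proof -
  note fin = gaussD(1)[OF X]
  note mX [measurable] = gaussD(2)[OF X] note mY [measurable] = gaussD(2)[OF Y]
  have int_XY: "integrable M (\<lambda>\<omega>. X i \<omega> * Y j \<omega>)" and cov: "expectation (\<lambda>\<omega>. X i \<omega> * Y j \<omega>) = 0"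
    if "i \<in> A" "j \<in> A" for i j
  proof -
    have "indep_var borel ((\<lambda>z. z i) \<circ> (\<lambda>\<omega> j. X j \<omega>)) borel ((\<lambda>z. z j) \<circ> (\<lambda>\<omega> j. Y j \<omega>))"
      by (rule indep_var_compose[OF ind]) (auto intro!: borel_measurable_continuous_onI continuous_on_product_coordinates)
    then have "indep_var borel (X i) borel (Y j)" by (simp add: comp_def)
    from indep_var_integrable[OF this] indep_var_lebesgue_integral[OF this]
    show "integrable M (\<lambda>\<omega>. X i \<omega> * Y j \<omega>)" "expectation (\<lambda>\<omega>. X i \<omega> * Y j \<omega>) = 0"
      using gauss_integrable1[OF X \<open>i \<in> A\<close>] gauss_integrable1[OF Y \<open>j \<in> A\<close>] gauss_expectation[OF X \<open>i \<in> A\<close>]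
      by auto
  qed
  show cov_sum: "expectation (\<lambda>\<omega>. (X i \<omega> + Y i \<omega>) * (X j \<omega> + Y j \<omega>))
      = expectation (\<lambda>\<omega>. X i \<omega> * X j \<omega>) + expectation (\<lambda>\<omega>. Y i \<omega> * Y j \<omega>)" if "i \<in> A" "j \<in> A" for i j
  proof -
    have "expectation (\<lambda>\<omega>. (X i \<omega> + Y i \<omega>) * (X j \<omega> + Y j \<omega>))
      = expectation (\<lambda>\<omega>. (X i \<omega> * X j \<omega> + Y i \<omega> * Y j \<omega>) + (X i \<omega> * Y j \<omega> + X j \<omega> * Y i \<omega>))"
      by (simp add: algebra_simps)
    then show ?thesis
      using int_XY[OF that] int_XY[OF that(2,1)] gauss_integrable_prod[OF X that]
        gauss_integrable_prod[OF Y that] cov[OF that] cov[OF that(2,1)] by simp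
  qed
  have max2: "s \<le> a + b \<Longrightarrow> 1 + s \<le> 2 * max (1 + a) (1 + b)" for s a b :: real
    by (simp add: max_def)
  have mom: "integrable M (\<lambda>\<omega>. (1 + (\<Sum>j\<in>A. \<bar>X j \<omega> + Y j \<omega>\<bar>)) ^ p)" for p
  proof (rule Bochner_Integration.integrable_bound)
    show "integrable M (\<lambda>\<omega>. 2 ^ p * ((1 + (\<Sum>j\<in>A. \<bar>X j \<omega>\<bar>)) ^ p + (1 + (\<Sum>j\<in>A. \<bar>Y j \<omega>\<bar>)) ^ p))"
      by (intro integrable_mult_right Bochner_Integration.integrable_add gaussD(3)[OF X] gaussD(3)[OF Y])
    have "(1 + (\<Sum>j\<in>A. \<bar>X j \<omega> + Y j \<omega>\<bar>)) ^ p
        \<le> 2 ^ p * ((1 + (\<Sum>j\<in>A. \<bar>X j \<omega>\<bar>)) ^ p + (1 + (\<Sum>j\<in>A. \<bar>Y j \<omega>\<bar>)) ^ p)" for \<omega>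
    proof -
      let ?a = "1 + (\<Sum>j\<in>A. \<bar>X j \<omega>\<bar>)" and ?b = "1 + (\<Sum>j\<in>A. \<bar>Y j \<omega>\<bar>)"
      have "(\<Sum>j\<in>A. \<bar>X j \<omega> + Y j \<omega>\<bar>) \<le> (\<Sum>j\<in>A. \<bar>X j \<omega>\<bar> + \<bar>Y j \<omega>\<bar>)" by (intro sum_mono) auto
      then have "1 + (\<Sum>j\<in>A. \<bar>X j \<omega> + Y j \<omega>\<bar>) \<le> 2 * max ?a ?b"
        unfolding sum.distrib by (rule max2)
      then have "(1 + (\<Sum>j\<in>A. \<bar>X j \<omega> + Y j \<omega>\<bar>)) ^ p \<le> (2 * max ?a ?b) ^ p"
        by (rule power_mono) (simp add: sum_nonneg)
      also have "\<dots> = 2 ^ p * max ?a ?b ^ p" by (simp add: power_mult_distrib)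
      also have "\<dots> \<le> 2 ^ p * (?a ^ p + ?b ^ p)"
        by (intro mult_left_mono) (auto simp: max_def sum_nonneg)
      finally show ?thesis .
    qed
    then show "AE \<omega> in M. norm ((1 + (\<Sum>j\<in>A. \<bar>X j \<omega> + Y j \<omega>\<bar>)) ^ p)
        \<le> norm (2 ^ p * ((1 + (\<Sum>j\<in>A. \<bar>X j \<omega>\<bar>)) ^ p + (1 + (\<Sum>j\<in>A. \<bar>Y j \<omega>\<bar>)) ^ p))"
      by (auto simp: sum_nonneg)
  qed simp
  have int: "integrable M (\<lambda>\<omega>. F (\<lambda>j. X j \<omega> + Y j \<omega>))" if "continuous_on UNIV F" "poly_bounded A F" for F
    using integrable_poly_bounded[of "\<lambda>j \<omega>. X j \<omega> + Y j \<omega>" M A F] mom that by simp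
  \<comment> \<open>Formulated for arbitrary \<open>U\<close> and \<open>V\<close> because it is
    applied to (X, Y) and to (Y, X).\<close>
  have split: "expectation (\<lambda>\<omega>. of_real (U i \<omega>) * F (\<lambda>j. U j \<omega> + V j \<omega>))
      = (\<Sum>j\<in>A. of_real (expectation (\<lambda>\<omega>. U i \<omega> * U j \<omega>)) * expectation (\<lambda>\<omega>. D j (\<lambda>j. U j \<omega> + V j \<omega>)))"
    and split_int: "integrable M (\<lambda>\<omega>. of_real (U i \<omega>) * F (\<lambda>j. U j \<omega> + V j \<omega>))"
    if i: "i \<in> A" and T: "test_fun A F D" and U: "gauss M A U" and V: "gauss M A V"
      and ind: "indep_var borel (\<lambda>\<omega> j. U j \<omega>) borel (\<lambda>\<omega> j. V j \<omega>)"
      and int: "\<And>F. continuous_on UNIV F \<Longrightarrow> poly_bounded A F \<Longrightarrow> integrable M (\<lambda>\<omega>. F (\<lambda>j. U j \<omega> + V j \<omega>))"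
    for U V :: "'i \<Rightarrow> 'a \<Rightarrow> real" and i F D
  proof -
    note TD = test_funD[OF T]
    note [measurable] = gaussD(2)[OF U] gaussD(2)[OF V]
    have meas: "(\<lambda>p. G (\<lambda>j. fst p j + snd p j)) \<in> borel_measurable (borel \<Otimes>\<^sub>M borel)"
      if "continuous_on UNIV G" for G :: "('i \<Rightarrow> real) \<Rightarrow> complex"
      unfolding borel_prod
      by (intro borel_measurable_continuous_onI continuous_on_compose2[OF that continuous_on_coord_add]) auto
    have [measurable]: "(\<lambda>p::('i \<Rightarrow> real) \<times> ('i \<Rightarrow> real). complex_of_real (fst p i)) \<in> borel_measurable (borel \<Otimes>\<^sub>M borel)"
      unfolding borel_prod
      by (intro borel_measurable_continuous_onI continuous_intros continuous_on_product_then_coordinatewise)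
    show iUF: "integrable M (\<lambda>\<omega>. of_real (U i \<omega>) * F (\<lambda>j. U j \<omega> + V j \<omega>))"
    proof (rule Bochner_Integration.integrable_bound)
      show "integrable M (\<lambda>\<omega>. \<bar>U i \<omega>\<bar>\<^sup>2 + (norm (F (\<lambda>j. U j \<omega> + V j \<omega>)))\<^sup>2)"
      proof (rule Bochner_Integration.integrable_add)
        show "integrable M (\<lambda>\<omega>. \<bar>U i \<omega>\<bar>\<^sup>2)"
          using gauss_integrable_prod[OF U i i] by (simp add: power2_eq_square)
        have "integrable M (\<lambda>\<omega>. F (\<lambda>j. U j \<omega> + V j \<omega>) * F (\<lambda>j. U j \<omega> + V j \<omega>))"
          by (intro int[of "\<lambda>z. F z * F z"] continuous_intros poly_bounded_mult TD)
        then have "integrable M (\<lambda>\<omega>. norm (F (\<lambda>j. U j \<omega> + V j \<omega>) * F (\<lambda>j. U j \<omega> + V j \<omega>)))"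
          by (rule integrable_norm)
        then show "integrable M (\<lambda>\<omega>. (norm (F (\<lambda>j. U j \<omega> + V j \<omega>)))\<^sup>2)"
          by (simp add: norm_mult power2_eq_square)
      qed
      have "a * b \<le> a\<^sup>2 + b\<^sup>2" if "a \<ge> 0" "b \<ge> 0" for a b :: real
      proof -
        have "2 * a * b \<le> a\<^sup>2 + b\<^sup>2" by (rule sum_squares_bound)
        moreover have "0 \<le> a * b" using that by simp
        ultimately show ?thesis by linarith
      qed
      note ab = this
      have "norm (of_real (U i \<omega>) * F (\<lambda>j. U j \<omega> + V j \<omega>))
          \<le> \<bar>U i \<omega>\<bar>\<^sup>2 + (norm (F (\<lambda>j. U j \<omega> + V j \<omega>)))\<^sup>2" for \<omega>
        unfolding norm_mult norm_of_real by (rule ab) auto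
      then show "AE \<omega> in M. norm (of_real (U i \<omega>) * F (\<lambda>j. U j \<omega> + V j \<omega>))
          \<le> norm (\<bar>U i \<omega>\<bar>\<^sup>2 + (norm (F (\<lambda>j. U j \<omega> + V j \<omega>)))\<^sup>2)"
        by (intro AE_I2) (unfold real_norm_def, rule order_trans[OF _ abs_ge_self])
    next
      have "(\<lambda>\<omega>. F (\<lambda>j. U j \<omega> + V j \<omega>)) \<in> borel_measurable M"
        by (rule measurable_comp_continuous[OF TD(1)]) simp
      then show "(\<lambda>\<omega>. of_real (U i \<omega>) * F (\<lambda>j. U j \<omega> + V j \<omega>)) \<in> borel_measurable M" by simp
    qed
    let ?VD = "distr M borel (\<lambda>\<omega> j. V j \<omega>)"
    have mV: "(\<lambda>\<omega> j. V j \<omega>) \<in> borel_measurable M" by (rule measurable_coordinatewise_then_product) simp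
    have "expectation (\<lambda>\<omega>. of_real (U i \<omega>) * F (\<lambda>j. U j \<omega> + V j \<omega>))
        = (LINT y|?VD. (LINT \<omega>|M. of_real (U i \<omega>) * F (\<lambda>j. U j \<omega> + y j)))"
      using expectation_indep_Fubini[OF ind, of "\<lambda>p. of_real (fst p i) * F (\<lambda>j. fst p j + snd p j)"]
        meas[OF TD(1)] iUF by simp
    also have "\<dots> = (LINT y|?VD. (\<Sum>j\<in>A. of_real (expectation (\<lambda>\<omega>. U i \<omega> * U j \<omega>)) * expectation (\<lambda>\<omega>. D j (\<lambda>j. U j \<omega> + y j))))"
      by (intro Bochner_Integration.integral_cong refl gaussD(4)[OF U i test_fun_shift[OF fin T]])
    also have "\<dots> = (\<Sum>j\<in>A. of_real (expectation (\<lambda>\<omega>. U i \<omega> * U j \<omega>)) * (LINT y|?VD. expectation (\<lambda>\<omega>. D j (\<lambda>j. U j \<omega> + y j))))"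
    proof (subst Bochner_Integration.integral_sum)
      fix j assume j: "j \<in> A"
      have "integrable ?VD (\<lambda>y. expectation (\<lambda>\<omega>. D j (\<lambda>j. U j \<omega> + y j)))"
      proof -
        interpret V: prob_space ?VD by (rule prob_space_distr[OF mV])
        have mU: "(\<lambda>\<omega> j. U j \<omega>) \<in> borel_measurable M" by (rule measurable_coordinatewise_then_product) simp
        interpret U: prob_space "distr M borel (\<lambda>\<omega> j. U j \<omega>)" by (rule prob_space_distr[OF mU])
        interpret P: pair_sigma_finite "distr M borel (\<lambda>\<omega> j. U j \<omega>)" ?VD ..
        have "integrable (distr M (borel \<Otimes>\<^sub>M borel) (\<lambda>\<omega>. (\<lambda>j. U j \<omega>, \<lambda>j. V j \<omega>))) (\<lambda>p. D j (\<lambda>j. fst p j + snd p j))"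
          using meas[OF TD(3)[OF j]] int[OF TD(3,4)[OF j]] mU mV by (subst integrable_distr_eq) auto
        then have "integrable (distr M borel (\<lambda>\<omega> j. U j \<omega>) \<Otimes>\<^sub>M ?VD) (\<lambda>(x,y). D j (\<lambda>j. x j + y j))"
          using ind unfolding case_prod_unfold by (simp add: indep_var_distribution_eq)
        from P.integrable_snd[OF this]
        have "integrable ?VD (\<lambda>y. LINT x|distr M borel (\<lambda>\<omega> j. U j \<omega>). D j (\<lambda>j. x j + y j))" .
        moreover have "(LINT x|distr M borel (\<lambda>\<omega> j. U j \<omega>). D j (\<lambda>j. x j + y j)) = expectation (\<lambda>\<omega>. D j (\<lambda>j. U j \<omega> + y j))" for y
          by (subst integral_distr[OF mU])
             (use test_funD(3)[OF test_fun_shift[OF fin T] j] in \<open>auto intro: borel_measurable_continuous_onI\<close>)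
        ultimately show ?thesis by simp
      qed
      then show "integrable ?VD (\<lambda>y. complex_of_real (expectation (\<lambda>\<omega>. U i \<omega> * U j \<omega>)) * expectation (\<lambda>\<omega>. D j (\<lambda>j. U j \<omega> + y j)))"
        by (rule integrable_mult_right)
    qed simp
    also have "\<dots> = (\<Sum>j\<in>A. of_real (expectation (\<lambda>\<omega>. U i \<omega> * U j \<omega>)) * expectation (\<lambda>\<omega>. D j (\<lambda>j. U j \<omega> + V j \<omega>)))"
    proof (intro sum.cong refl arg_cong2[where f = "(*)"])
      fix j assume j: "j \<in> A"
      show "(LINT y|?VD. expectation (\<lambda>\<omega>. D j (\<lambda>j. U j \<omega> + y j))) = expectation (\<lambda>\<omega>. D j (\<lambda>j. U j \<omega> + V j \<omega>))"
        using expectation_indep_Fubini[OF ind, of "\<lambda>p. D j (\<lambda>j. fst p j + snd p j)"]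
          meas[OF TD(3)[OF j]] int[OF TD(3,4)[OF j]] by simp
    qed
    finally show "expectation (\<lambda>\<omega>. of_real (U i \<omega>) * F (\<lambda>j. U j \<omega> + V j \<omega>))
      = (\<Sum>j\<in>A. of_real (expectation (\<lambda>\<omega>. U i \<omega> * U j \<omega>)) * expectation (\<lambda>\<omega>. D j (\<lambda>j. U j \<omega> + V j \<omega>)))" .
  qed
  show "gauss M A (\<lambda>j \<omega>. X j \<omega> + Y j \<omega>)" unfolding gauss_def
  proof (intro conjI allI ballI impI fin mom)
    fix i F D assume i: "i \<in> A" and T: "test_fun A F D"
    note X' = split[OF i T X Y ind int] split_int[OF i T X Y ind int]
    have int': "integrable M (\<lambda>\<omega>. F (\<lambda>j. Y j \<omega> + X j \<omega>))" if "continuous_on UNIV F" "poly_bounded A F" for F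
      using int[OF that] by (simp add: add.commute)
    note Y' = split[OF i T Y X indep_var_sym[OF ind] int'] split_int[OF i T Y X indep_var_sym[OF ind] int']
    have "expectation (\<lambda>\<omega>. of_real (X i \<omega> + Y i \<omega>) * F (\<lambda>j. X j \<omega> + Y j \<omega>))
      = expectation (\<lambda>\<omega>. of_real (X i \<omega>) * F (\<lambda>j. X j \<omega> + Y j \<omega>)) + expectation (\<lambda>\<omega>. of_real (Y i \<omega>) * F (\<lambda>j. Y j \<omega> + X j \<omega>))"
      using X'(2) Y'(2) by (simp add: distrib_right add.commute[of "Y _ _"])
    also have "\<dots> = (\<Sum>j\<in>A. of_real (expectation (\<lambda>\<omega>. X i \<omega> * X j \<omega>)) * expectation (\<lambda>\<omega>. D j (\<lambda>j. X j \<omega> + Y j \<omega>)))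
        + (\<Sum>j\<in>A. of_real (expectation (\<lambda>\<omega>. Y i \<omega> * Y j \<omega>)) * expectation (\<lambda>\<omega>. D j (\<lambda>j. Y j \<omega> + X j \<omega>)))"
      by (rule arg_cong2[where f = "(+)", OF X'(1) Y'(1)])
    also have "\<dots> = (\<Sum>j\<in>A. of_real (expectation (\<lambda>\<omega>. (X i \<omega> + Y i \<omega>) * (X j \<omega> + Y j \<omega>))) * expectation (\<lambda>\<omega>. D j (\<lambda>j. X j \<omega> + Y j \<omega>)))"
      unfolding add.commute[of "Y _ _" "X _ _"] sum.distrib[symmetric]
      by (intro sum.cong refl) (subst cov_sum[OF i], assumption, simp only: of_real_add distrib_right)
    finally show "expectation (\<lambda>\<omega>. of_real (X i \<omega> + Y i \<omega>) * F (\<lambda>j. X j \<omega> + Y j \<omega>)) =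
      (\<Sum>j\<in>A. of_real (expectation (\<lambda>\<omega>. (X i \<omega> + Y i \<omega>) * (X j \<omega> + Y j \<omega>))) * expectation (\<lambda>\<omega>. D j (\<lambda>j. X j \<omega> + Y j \<omega>)))" .
  qed simp
qed

text \<open>By the chain rule each derivative picks up a factor \<open>a k j'\<close>; contracted
  with the covariances of X and with the row \<open>a i\<close> it gives the covariance of the
  images.\<close>

lemma (in prob_space) gauss_linear:
  fixes X :: "'i::countable \<Rightarrow> 'a \<Rightarrow> real" and a :: "'k::countable \<Rightarrow> 'i \<Rightarrow> real"
  assumes X: "gauss M A X" and B: "finite B"
  shows "gauss M B (\<lambda>i \<omega>. \<Sum>j\<in>A. a i j * X j \<omega>)"
proof -
  note A = gaussD(1)[OF X] note [measurable] = gaussD(2)[OF X]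
  let ?Y = "\<lambda>i \<omega>. \<Sum>j\<in>A. a i j * X j \<omega>"
  have lin: "\<bar>\<Sum>j\<in>A. a i j * z j\<bar> \<le> (\<Sum>i\<in>B. \<Sum>j\<in>A. \<bar>a i j\<bar>) * (1 + (\<Sum>j\<in>A. \<bar>z j\<bar>))" if "i \<in> B" for i z
  proof -
    have "\<bar>\<Sum>j\<in>A. a i j * z j\<bar> \<le> (\<Sum>j\<in>A. \<bar>a i j\<bar> * \<bar>z j\<bar>)"
      by (rule order_trans[OF sum_abs]) (simp add: abs_mult)
    also have "\<dots> \<le> (\<Sum>j\<in>A. \<bar>a i j\<bar> * (1 + (\<Sum>j\<in>A. \<bar>z j\<bar>)))"
      by (intro sum_mono mult_left_mono order_trans[OF member_le_sum[of _ A "\<lambda>j. \<bar>z j\<bar>"]]) (auto simp: A)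
    also have "\<dots> = (\<Sum>j\<in>A. \<bar>a i j\<bar>) * (1 + (\<Sum>j\<in>A. \<bar>z j\<bar>))" by (simp add: sum_distrib_right)
    also have "\<dots> \<le> (\<Sum>i\<in>B. \<Sum>j\<in>A. \<bar>a i j\<bar>) * (1 + (\<Sum>j\<in>A. \<bar>z j\<bar>))"
      using B that by (intro mult_right_mono member_le_sum[of i B "\<lambda>i. \<Sum>j\<in>A. \<bar>a i j\<bar>"]) (auto simp: sum_nonneg)
    finally show ?thesis .
  qed
  have contL: "continuous_on UNIV (\<lambda>z i. \<Sum>j\<in>A. a i j * z j)"
    by (auto intro!: continuous_intros continuous_on_product_coordinates)
  have int: "integrable M (\<lambda>\<omega>. F (\<lambda>i. ?Y i \<omega>))" if "continuous_on UNIV F" "poly_bounded B F" for F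
    using gauss_integrable[OF X, of "\<lambda>z. F (\<lambda>i. \<Sum>j\<in>A. a i j * z j)"]
      continuous_on_compose2[OF that(1) contL] poly_bounded_linear[OF B A that(2) lin] by simp
  show ?thesis unfolding gauss_def
  proof (intro conjI allI ballI impI B)
    fix p show "integrable M (\<lambda>\<omega>. (1 + (\<Sum>i\<in>B. \<bar>?Y i \<omega>\<bar>)) ^ p)"
      using int[OF continuous_on_gauge[OF B] poly_bounded_gauge, of p]
      by (simp only: complex_of_real_integrable_eq)
  next
    fix i F D assume i: "i \<in> B" and T: "test_fun B F D"
    note TD = test_funD[OF T]
    let ?FY = "\<lambda>\<omega>. F (\<lambda>i. ?Y i \<omega>)" and ?DY = "\<lambda>k. expectation (\<lambda>\<omega>. D k (\<lambda>i. ?Y i \<omega>))"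
    let ?R = "\<lambda>j j'. expectation (\<lambda>\<omega>. X j \<omega> * X j' \<omega>)"
    have TL: "test_fun A (\<lambda>z. F (\<lambda>i. \<Sum>j\<in>A. a i j * z j))
        (\<lambda>j z. \<Sum>i\<in>B. of_real (a i j) * D i (\<lambda>i. \<Sum>j\<in>A. a i j * z j))"
      using test_fun_linear[OF A B T, of "\<lambda>_. 0" a] by simp
    have ibp: "expectation (\<lambda>\<omega>. of_real (X j \<omega>) * ?FY \<omega>)
        = (\<Sum>j'\<in>A. of_real (?R j j') * (\<Sum>k\<in>B. of_real (a k j') * ?DY k))" if "j \<in> A" for j
      unfolding gaussD(4)[OF X that TL] using int[OF TD(3,4)]
      by (intro sum.cong refl arg_cong2[where f = "(*)"], subst Bochner_Integration.integral_sum)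
         (auto intro!: integrable_mult_right)
    have iXF: "integrable M (\<lambda>\<omega>. of_real (X j \<omega>) * ?FY \<omega>)" if "j \<in> A" for j
      by (rule gauss_integrable_mult[OF X test_funD(1,2)[OF TL] that])
    have "expectation (\<lambda>\<omega>. of_real (?Y i \<omega>) * ?FY \<omega>) = expectation (\<lambda>\<omega>. \<Sum>j\<in>A. of_real (a i j) * (of_real (X j \<omega>) * ?FY \<omega>))"
      by (intro Bochner_Integration.integral_cong refl) (simp add: sum_distrib_left sum_distrib_right mult_ac)
    also have "\<dots> = (\<Sum>j\<in>A. of_real (a i j) * expectation (\<lambda>\<omega>. of_real (X j \<omega>) * ?FY \<omega>))"
      using iXF by (subst Bochner_Integration.integral_sum) auto
    also have "\<dots> = (\<Sum>j\<in>A. of_real (a i j) * (\<Sum>j'\<in>A. of_real (?R j j') * (\<Sum>k\<in>B. of_real (a k j') * ?DY k)))"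
      by (intro sum.cong refl) (simp add: ibp)
    also have "\<dots> = (\<Sum>k\<in>B. of_real (\<Sum>j\<in>A. \<Sum>j'\<in>A. a i j * a k j' * ?R j j') * ?DY k)"
      unfolding of_real_sum sum_distrib_left sum_distrib_right
      by (rule trans[OF sum.cong[OF refl sum.swap]], rule trans[OF sum.swap]) (simp add: mult_ac)
    also have "\<dots> = (\<Sum>k\<in>B. of_real (expectation (\<lambda>\<omega>. ?Y i \<omega> * ?Y k \<omega>)) * ?DY k)"
    proof (intro sum.cong refl arg_cong2[where f = "(*)"] arg_cong[where f = of_real])
      fix k
      have "expectation (\<lambda>\<omega>. ?Y i \<omega> * ?Y k \<omega>) = expectation (\<lambda>\<omega>. \<Sum>j\<in>A. \<Sum>j'\<in>A. a i j * a k j' * (X j \<omega> * X j' \<omega>))"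
        by (simp add: sum_product mult_ac)
      also have "\<dots> = (\<Sum>j\<in>A. \<Sum>j'\<in>A. a i j * a k j' * ?R j j')"
        using gauss_integrable_prod[OF X] by (simp add: Bochner_Integration.integral_sum)
      finally show "(\<Sum>j\<in>A. \<Sum>j'\<in>A. a i j * a k j' * ?R j j') = expectation (\<lambda>\<omega>. ?Y i \<omega> * ?Y k \<omega>)" ..
    qed
    finally show "expectation (\<lambda>\<omega>. of_real (?Y i \<omega>) * F (\<lambda>i. ?Y i \<omega>)) =
      (\<Sum>k\<in>B. of_real (expectation (\<lambda>\<omega>. ?Y i \<omega> * ?Y k \<omega>)) * ?DY k)" .
  qed simp
qed

section \<open>Moments and limits of Gaussian families\<close>

lemma test_fun_power:
  assumes "finite A" "i \<in> A"
  shows "test_fun A (\<lambda>z. of_real (z i) ^ m) (\<lambda>j z. if j = i then of_nat m * of_real (z i) ^ (m - 1) else 0)"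
proof (induction m)
  case 0
  show ?case using test_fun_const[of A 1] by (simp cong: if_cong)
next
  case (Suc m)
  have "(\<lambda>j z. (if j = i then 1 else 0) * of_real (z i) ^ m +
       of_real (z i) * (if j = i then of_nat m * of_real (z i) ^ (m - 1) else 0))
     = (\<lambda>j z. if j = i then of_nat (Suc m) * complex_of_real (z i) ^ (Suc m - 1) else 0)"
    by (cases m) (auto simp: fun_eq_iff algebra_simps)
  then show ?case using test_fun_mult[OF test_fun_coord[OF assms] Suc] by simp
qed

text \<open>Integration by parts against X_i^(2p+1) yields E X_i^(2p+2) = (2p+1) R_ii E X_i^(2p).
  The factorial is a crude substitute for the double factorial.\<close>

lemma (in prob_space) gauss_even_moment:
  fixes X :: "'i::countable \<Rightarrow> 'a \<Rightarrow> real"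
  assumes X: "gauss M A X" and i: "i \<in> A" and B: "expectation (\<lambda>\<omega>. X i \<omega> * X i \<omega>) \<le> B"
  shows "expectation (\<lambda>\<omega>. X i \<omega> ^ (2 * p)) \<le> fact (2 * p) * B ^ p"
proof (induction p)
  case 0 then show ?case by (simp add: prob_space)
next
  case (Suc p)
  note A = gaussD(1)[OF X]
  let ?R = "expectation (\<lambda>\<omega>. X i \<omega> * X i \<omega>)"
  have R: "0 \<le> ?R" by simp
  have "complex_of_real (expectation (\<lambda>\<omega>. X i \<omega> ^ (2 * Suc p)))
      = expectation (\<lambda>\<omega>. of_real (X i \<omega>) * of_real (X i \<omega>) ^ (2 * p + 1))"
    unfolding integral_complex_of_real[symmetric] by (intro Bochner_Integration.integral_cong refl) simp
  also have "\<dots> = (\<Sum>j\<in>A. of_real (expectation (\<lambda>\<omega>. X i \<omega> * X j \<omega>)) *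
      expectation (\<lambda>\<omega>. if j = i then of_nat (2 * p + 1) * of_real (X i \<omega>) ^ (2 * p + 1 - 1) else 0))"
    by (rule gaussD(4)[OF X i test_fun_power[OF A i]])
  also have "\<dots> = (\<Sum>j\<in>A. if j = i then of_real (?R * (2 * p + 1) * expectation (\<lambda>\<omega>. X i \<omega> ^ (2 * p))) else 0)"
    by (intro sum.cong refl) (auto simp flip: of_real_power simp: integral_complex_of_real)
  also have "\<dots> = of_real (?R * (2 * p + 1) * expectation (\<lambda>\<omega>. X i \<omega> ^ (2 * p)))"
    using A i by simp
  finally have eq: "expectation (\<lambda>\<omega>. X i \<omega> ^ (2 * Suc p)) = ?R * (2 * p + 1) * expectation (\<lambda>\<omega>. X i \<omega> ^ (2 * p))"
    using of_real_eq_iff by blast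
  have B0: "0 \<le> B" using R B by linarith
  have "?R * (2 * p + 1) * expectation (\<lambda>\<omega>. X i \<omega> ^ (2 * p)) \<le> B * ((2 * p + 2) * (2 * p + 1)) * (fact (2 * p) * B ^ p)"
  proof (rule mult_mono[OF _ Suc])
    show "?R * real (2 * p + 1) \<le> B * real ((2 * p + 2) * (2 * p + 1))"
      by (intro mult_mono B) (use B0 in auto)
  qed (use B0 in \<open>auto simp: power_mult\<close>)
  also have "\<dots> = fact (2 * Suc p) * B ^ Suc p"
    by (simp add: algebra_simps)
  finally show ?case unfolding eq .
qed

text \<open>The gauge is at most 1 + card A times its largest term m, and m^(2p) is either 1 or one
  of the summands on the right. Even powers remove the absolute values, so that moments of single
  coordinates suffice.\<close>

lemma gauge_power_le:
  fixes x :: "'i \<Rightarrow> real"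
  assumes "finite A"
  shows "(1 + (\<Sum>j\<in>A. \<bar>x j\<bar>)) ^ p \<le> (1 + real (card A)) ^ (2 * p) * (1 + (\<Sum>j\<in>A. x j ^ (2 * p)))"
proof -
  let ?S = "insert 1 ((\<lambda>j. \<bar>x j\<bar>) ` A)" and ?g = "1 + (\<Sum>j\<in>A. \<bar>x j\<bar>)"
  define m where "m = Max ?S"
  have fin: "finite ?S" using assms by simp
  have m1: "1 \<le> m" and mx: "\<And>j. j \<in> A \<Longrightarrow> \<bar>x j\<bar> \<le> m" unfolding m_def using fin by (auto intro: Max_ge)
  have "m \<in> ?S" unfolding m_def using fin by (intro Max_in) auto
  have nn: "0 \<le> (\<Sum>j\<in>A. x j ^ (2 * p))" by (intro sum_nonneg) (auto simp: power_mult)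
  have "m ^ (2 * p) \<le> 1 + (\<Sum>j\<in>A. x j ^ (2 * p))"
  proof (cases "m = 1")
    case False
    with \<open>m \<in> ?S\<close> obtain j where j: "j \<in> A" "m = \<bar>x j\<bar>" by auto
    have "x j ^ (2 * p) \<le> (\<Sum>j\<in>A. x j ^ (2 * p))"
      by (rule member_le_sum[OF j(1)]) (use assms in \<open>auto simp: power_mult\<close>)
    then show ?thesis unfolding j(2) by (simp add: power_mult)
  qed (use nn in simp)
  have "(\<Sum>j\<in>A. \<bar>x j\<bar>) \<le> card A * m" by (rule sum_bounded_above) (rule mx)
  then have "?g \<le> (1 + card A) * m" using m1 by (simp add: algebra_simps)
  then have "?g ^ (2 * p) \<le> ((1 + card A) * m) ^ (2 * p)" by (rule power_mono) (simp add: sum_nonneg)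
  also have "\<dots> = (1 + real (card A)) ^ (2 * p) * m ^ (2 * p)" by (simp add: power_mult_distrib)
  also have "\<dots> \<le> (1 + real (card A)) ^ (2 * p) * (1 + (\<Sum>j\<in>A. x j ^ (2 * p)))"
    by (rule mult_left_mono) (fact, simp)
  finally have "?g ^ (2 * p) \<le> (1 + real (card A)) ^ (2 * p) * (1 + (\<Sum>j\<in>A. x j ^ (2 * p)))" .
  moreover have "?g ^ p \<le> ?g ^ (2 * p)" by (rule power_increasing) (auto simp: one_le_gauge)
  ultimately show ?thesis by linarith
qed

lemma gauss_integrable_power:
  fixes X :: "'i::countable \<Rightarrow> 'a \<Rightarrow> real"
  assumes X: "gauss M A X" and i: "i \<in> A"
  shows "integrable M (\<lambda>\<omega>. X i \<omega> ^ m)"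
proof -
  note T = test_fun_power[OF gaussD(1)[OF X] i, of m]
  have "integrable M (\<lambda>\<omega>. complex_of_real (X i \<omega>) ^ m)"
    by (rule gauss_integrable[OF X test_funD(1,2)[OF T]])
  then show ?thesis by (simp flip: of_real_power add: complex_of_real_integrable_eq)
qed

lemma (in prob_space) gauss_gauge_moment:
  fixes X :: "'i::countable \<Rightarrow> 'a \<Rightarrow> real"
  assumes X: "gauss M A X" and B: "\<And>i. i \<in> A \<Longrightarrow> expectation (\<lambda>\<omega>. X i \<omega> * X i \<omega>) \<le> B"
  shows "expectation (\<lambda>\<omega>. (1 + (\<Sum>j\<in>A. \<bar>X j \<omega>\<bar>)) ^ p)
    \<le> (1 + real (card A)) ^ (2 * p) * (1 + real (card A) * (fact (2 * p) * B ^ p))"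
proof -
  note A = gaussD(1)[OF X]
  have "expectation (\<lambda>\<omega>. (1 + (\<Sum>j\<in>A. \<bar>X j \<omega>\<bar>)) ^ p)
    \<le> expectation (\<lambda>\<omega>. (1 + real (card A)) ^ (2 * p) * (1 + (\<Sum>j\<in>A. X j \<omega> ^ (2 * p))))"
    by (rule integral_mono[OF gaussD(3)[OF X]])
       (auto intro!: gauge_power_le[OF A] integrable_mult_right Bochner_Integration.integrable_add
         Bochner_Integration.integrable_sum gauss_integrable_power[OF X])
  also have "\<dots> = (1 + real (card A)) ^ (2 * p) * (1 + (\<Sum>j\<in>A. expectation (\<lambda>\<omega>. X j \<omega> ^ (2 * p))))"
    using gauss_integrable_power[OF X] by (simp add: Bochner_Integration.integral_sum prob_space)
  also have "\<dots> \<le> (1 + real (card A)) ^ (2 * p) * (1 + (\<Sum>j\<in>A. fact (2 * p) * B ^ p))"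
    by (intro mult_left_mono add_left_mono sum_mono gauss_even_moment[OF X] B) auto
  finally show ?thesis by simp
qed

lemma tendsto_fun_coordinatewise:
  fixes f :: "nat \<Rightarrow> 'i \<Rightarrow> real"
  assumes "\<And>j. (\<lambda>N. f N j) \<longlonglongrightarrow> l j"
  shows "f \<longlonglongrightarrow> l"
proof -
  have "limitin (product_topology (\<lambda>i. euclidean) UNIV) f l sequentially"
    unfolding limitin_componentwise using assms by (auto simp: limitin_canonical_iff)
  then show ?thesis by (simp add: euclidean_product_topology limitin_canonical_iff)
qed

text \<open>For Gaussian families a common variance bound controls all moments, hence the second
  moments of every F of polynomial growth. Expectations of such F therefore converge along almost
  sure limits, and both sides of the integration by parts formula pass to the limit.\<close>

lemma (in prob_space) gauss_limit:
  fixes X :: "nat \<Rightarrow> 'i::countable \<Rightarrow> 'a \<Rightarrow> real"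
  assumes X: "\<And>N. gauss M A (X N)" and Y [measurable]: "\<And>j. Y j \<in> borel_measurable M"
    and lim: "AE \<omega> in M. \<forall>j. (\<lambda>N. X N j \<omega>) \<longlonglongrightarrow> Y j \<omega>"
    and B: "\<And>N i. i \<in> A \<Longrightarrow> expectation (\<lambda>\<omega>. X N i \<omega> * X N i \<omega>) \<le> B"
  shows "gauss M A Y"
    and "i \<in> A \<Longrightarrow> j \<in> A \<Longrightarrow>
      (\<lambda>N. expectation (\<lambda>\<omega>. X N i \<omega> * X N j \<omega>)) \<longlonglongrightarrow> expectation (\<lambda>\<omega>. Y i \<omega> * Y j \<omega>)"
proof -
  note A = gaussD(1)[OF X] note [measurable] = gaussD(2)[OF X]
  have conv: "integrable M (\<lambda>\<omega>. F (\<lambda>j. Y j \<omega>))"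
      "(\<lambda>N. expectation (\<lambda>\<omega>. F (\<lambda>j. X N j \<omega>))) \<longlonglongrightarrow> expectation (\<lambda>\<omega>. F (\<lambda>j. Y j \<omega>))"
    if c: "continuous_on UNIV F" and pb: "poly_bounded A F" for F
  proof -
    from pb obtain C p where C: "0 \<le> C" "\<And>z. norm (F z) \<le> C * (1 + (\<Sum>j\<in>A. \<bar>z j\<bar>)) ^ p"
      unfolding poly_bounded_def by blast
    \<comment> \<open>Bounds E |F|^2: squaring doubles the exponent of the gauge, and the bound for
      the gauge doubles it once more by passing to even moments.\<close>
    define K where "K = C\<^sup>2 * ((1 + real (card A)) ^ (2 * (2 * p)) * (1 + real (card A) * (fact (2 * (2 * p)) * B ^ (2 * p))))"
    have sq: "(norm (F z))\<^sup>2 \<le> C\<^sup>2 * (1 + (\<Sum>j\<in>A. \<bar>z j\<bar>)) ^ (2 * p)" for z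
      using power_mono[OF C(2)[of z], of 2] by (simp add: power_mult_distrib power_mult[symmetric] mult.commute)
    have mF: "(\<lambda>\<omega>. F (\<lambda>j. X N j \<omega>)) \<in> borel_measurable M" for N
      by (rule measurable_comp_continuous[OF c]) simp
    have iF: "integrable M (\<lambda>\<omega>. (norm (F (\<lambda>j. X N j \<omega>)))\<^sup>2)" for N
      by (rule Bochner_Integration.integrable_bound[OF integrable_mult_right[OF gaussD(3)[OF X, of N "2 * p"], of "C\<^sup>2"]])
         (use mF in \<open>auto intro!: AE_I2 order_trans[OF sq]\<close>)
    have eF: "expectation (\<lambda>\<omega>. (norm (F (\<lambda>j. X N j \<omega>)))\<^sup>2) \<le> K" for N
    proof -
      have "expectation (\<lambda>\<omega>. (norm (F (\<lambda>j. X N j \<omega>)))\<^sup>2) \<le> expectation (\<lambda>\<omega>. C\<^sup>2 * (1 + (\<Sum>j\<in>A. \<bar>X N j \<omega>\<bar>)) ^ (2 * p))"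
        by (rule integral_mono[OF iF integrable_mult_right[OF gaussD(3)[OF X]]]) (rule sq)
      also have "\<dots> = C\<^sup>2 * expectation (\<lambda>\<omega>. (1 + (\<Sum>j\<in>A. \<bar>X N j \<omega>\<bar>)) ^ (2 * p))" by simp
      also have "\<dots> \<le> K" unfolding K_def by (intro mult_left_mono gauss_gauge_moment[OF X B]) auto
      finally show ?thesis .
    qed
    have lF: "AE \<omega> in M. (\<lambda>N. F (\<lambda>j. X N j \<omega>)) \<longlonglongrightarrow> F (\<lambda>j. Y j \<omega>)"
      using lim
    proof eventually_elim
      case (elim \<omega>)
      have "(\<lambda>N j. X N j \<omega>) \<longlonglongrightarrow> (\<lambda>j. Y j \<omega>)" by (rule tendsto_fun_coordinatewise) (use elim in auto)
      then show ?case by (rule continuous_on_tendsto_compose[OF c]) auto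
    qed
    note * = integral_tendsto_of_AE_L2_bounded[OF mF
        measurable_comp_continuous[OF c Y] lF iF eF]
    from *(2) *(4) show "integrable M (\<lambda>\<omega>. F (\<lambda>j. Y j \<omega>))"
      "(\<lambda>N. expectation (\<lambda>\<omega>. F (\<lambda>j. X N j \<omega>))) \<longlonglongrightarrow> expectation (\<lambda>\<omega>. F (\<lambda>j. Y j \<omega>))" .
  qed
  show cov: "(\<lambda>N. expectation (\<lambda>\<omega>. X N i \<omega> * X N j \<omega>)) \<longlonglongrightarrow> expectation (\<lambda>\<omega>. Y i \<omega> * Y j \<omega>)"
    if "i \<in> A" "j \<in> A" for i j
  proof -
    have "(\<lambda>N. expectation (\<lambda>\<omega>. complex_of_real (X N i \<omega>) * of_real (X N j \<omega>)))
        \<longlonglongrightarrow> expectation (\<lambda>\<omega>. complex_of_real (Y i \<omega>) * of_real (Y j \<omega>))"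
      by (rule conv(2)[of "\<lambda>z. of_real (z i) * of_real (z j)"])
         (intro continuous_intros continuous_on_product_coordinates poly_bounded_mult poly_bounded_coord A that)+
    then show ?thesis
      unfolding of_real_mult[symmetric] integral_complex_of_real tendsto_of_real_iff .
  qed
  show "gauss M A Y" unfolding gauss_def
  proof (intro conjI allI ballI impI A Y)
    fix p show "integrable M (\<lambda>\<omega>. (1 + (\<Sum>j\<in>A. \<bar>Y j \<omega>\<bar>)) ^ p)"
      using conv(1)[OF continuous_on_gauge[OF A] poly_bounded_gauge, of p]
      by (simp only: complex_of_real_integrable_eq)
  next
    fix i F D assume i: "i \<in> A" and T: "test_fun A F D"
    note TD = test_funD[OF T]
    have "(\<lambda>N. expectation (\<lambda>\<omega>. of_real (X N i \<omega>) * F (\<lambda>j. X N j \<omega>)))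
        \<longlonglongrightarrow> expectation (\<lambda>\<omega>. of_real (Y i \<omega>) * F (\<lambda>j. Y j \<omega>))"
      by (rule conv(2)[of "\<lambda>z. of_real (z i) * F z"])
         (intro continuous_intros continuous_on_product_coordinates poly_bounded_mult poly_bounded_coord A i TD)+
    moreover have "(\<lambda>N. expectation (\<lambda>\<omega>. of_real (X N i \<omega>) * F (\<lambda>j. X N j \<omega>)))
        \<longlonglongrightarrow> (\<Sum>j\<in>A. of_real (expectation (\<lambda>\<omega>. Y i \<omega> * Y j \<omega>)) * expectation (\<lambda>\<omega>. D j (\<lambda>j. Y j \<omega>)))"
      unfolding gaussD(4)[OF X i T]
      by (intro tendsto_sum tendsto_mult tendsto_of_real cov i conv(2) TD) auto
    ultimately show "expectation (\<lambda>\<omega>. of_real (Y i \<omega>) * F (\<lambda>j. Y j \<omega>)) =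
       (\<Sum>j\<in>A. of_real (expectation (\<lambda>\<omega>. Y i \<omega> * Y j \<omega>)) * expectation (\<lambda>\<omega>. D j (\<lambda>j. Y j \<omega>)))"
      by (rule LIMSEQ_unique)
  qed
qed

section \<open>Wick recursion and quartic functionals\<close>

text \<open>Deletion by position rather than by value: a list codes a monomial with multiplicities,
  and Wick's formula sums over positions.\<close>

definition remove_nth :: "nat \<Rightarrow> 'b list \<Rightarrow> 'b list" where
  "remove_nth p L = take p L @ drop (Suc p) L"

lemma remove_nth_simps [simp]:
  "remove_nth 0 (l # L) = L" "remove_nth (Suc p) (l # L) = l # remove_nth p L"
  by (simp_all add: remove_nth_def)

lemma length_remove_nth: "p < length L \<Longrightarrow> length (remove_nth p L) = length L - 1"
  by (simp add: remove_nth_def)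

lemma set_remove_nth: "set (remove_nth p L) \<subseteq> set L"
  unfolding remove_nth_def using set_take_subset[of p L] set_drop_subset[of "Suc p" L] by auto

lemma remove_nth_append1: "p < length L \<Longrightarrow> remove_nth p (L @ K) = remove_nth p L @ K"
  by (simp add: remove_nth_def)

lemma remove_nth_append2: "remove_nth (length L + q) (L @ K) = L @ remove_nth q K"
  by (simp add: remove_nth_def)

lemma sum_list_remove_nth_le:
  fixes f :: "'b \<Rightarrow> real"
  assumes "p < length L" "\<And>a. 0 \<le> f a"
  shows "sum_list (map f (remove_nth p L)) \<le> sum_list (map f L)"
proof -
  have "sum_list (map f L) = sum_list (map f (take p L @ L ! p # drop (Suc p) L))"
    using id_take_nth_drop[OF assms(1)] by simp
  then show ?thesis using assms(2)[of "L ! p"] by (simp add: remove_nth_def)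
qed

lemma test_fun_prod_list:
  assumes A: "finite A" and L: "set L \<subseteq> A"
  shows "test_fun A (\<lambda>z. of_real (prod_list (map z L)))
    (\<lambda>j z. \<Sum>p<length L. if L ! p = j then of_real (prod_list (map z (remove_nth p L))) else 0)"
  using L
proof (induction L)
  case Nil
  show ?case using test_fun_const[of A 1] by simp
next
  case (Cons l L)
  then have T: "test_fun A (\<lambda>z. of_real (prod_list (map z L)))
    (\<lambda>j z. \<Sum>p<length L. if L ! p = j then of_real (prod_list (map z (remove_nth p L))) else 0)" and l: "l \<in> A"
    by auto
  have "(\<lambda>j z. (if j = l then 1 else 0) * complex_of_real (prod_list (map z L)) + of_real (z l) *
       (\<Sum>p<length L. if L ! p = j then of_real (prod_list (map z (remove_nth p L))) else 0)) =
     (\<lambda>j z. \<Sum>p<length (l # L). if (l # L) ! p = j then of_real (prod_list (map z (remove_nth p (l # L)))) else 0)"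
    by (auto simp: fun_eq_iff sum.lessThan_Suc_shift sum_distrib_left intro!: sum.cong simp del: sum.lessThan_Suc)
  with test_fun_mult[OF test_fun_coord[OF A l] T] show ?case by simp
qed

lemma has_vector_derivative_cis: "(cis has_vector_derivative \<i> * cis x) (at x)"
  using has_vector_derivative_iexp[of x UNIV] by (simp flip: cis_conv_exp)

lemma test_fun_cis_quartic:
  assumes A: "finite A"
  shows "test_fun A (\<lambda>z. cis (\<tau> * (\<Sum>j\<in>A. z j ^ 4)))
    (\<lambda>j z. 4 * \<i> * of_real \<tau> * (of_real (z j) ^ 3 * cis (\<tau> * (\<Sum>j\<in>A. z j ^ 4))))"
proof -
  have cis: "continuous_on UNIV (\<lambda>z. cis (\<tau> * (\<Sum>j\<in>A. z j ^ 4)))"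
    by (intro continuous_intros continuous_on_product_coordinates)
  have bd: "poly_bounded A (\<lambda>z. cis (\<tau> * (\<Sum>j\<in>A. z j ^ 4)))"
    unfolding poly_bounded_def by (rule exI[of _ 1], rule exI[of _ 0]) simp
  have bd3: "poly_bounded A (\<lambda>z. complex_of_real (z j) ^ 3)" if "j \<in> A" for j
    unfolding power3_eq_cube by (intro poly_bounded_mult poly_bounded_coord A that)
  have der: "((\<lambda>s. cis (\<tau> * (\<Sum>j\<in>A. (z j + s * v j) ^ 4))) has_vector_derivative
     (\<Sum>j\<in>A. of_real (v j) * (4 * \<i> * of_real \<tau> * (of_real (z j) ^ 3 * cis (\<tau> * (\<Sum>j\<in>A. z j ^ 4)))))) (at 0)" for z v
  proof -
    have "((\<lambda>s. \<tau> * (\<Sum>j\<in>A. (z j + s * v j) ^ 4)) has_real_derivative (\<tau> * (\<Sum>j\<in>A. 4 * z j ^ 3 * v j))) (at 0)"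
      by (auto intro!: derivative_eq_intros sum.cong)
    from vector_diff_chain_at[OF this[unfolded has_real_derivative_iff_has_vector_derivative] has_vector_derivative_cis]
    have "((\<lambda>s. cis (\<tau> * (\<Sum>j\<in>A. (z j + s * v j) ^ 4))) has_vector_derivative
      (\<tau> * (\<Sum>j\<in>A. 4 * z j ^ 3 * v j)) *\<^sub>R (\<i> * cis (\<tau> * (\<Sum>j\<in>A. z j ^ 4)))) (at 0)"
      by (simp add: comp_def)
    then show ?thesis
      by (simp add: scaleR_conv_of_real sum_distrib_left sum_distrib_right mult_ac)
  qed
  show ?thesis unfolding test_fun_def
    by (intro conjI ballI allI cis bd der poly_bounded_mult poly_bounded_const bd3 continuous_intros
        continuous_on_product_coordinates)
qed

locale gauss_family = prob_space +
  fixes A :: "'i::countable set" and X :: "'i \<Rightarrow> 'a \<Rightarrow> real"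
  assumes gauss: "gauss M A X"
begin

lemmas fin = gaussD(1)[OF gauss]
lemmas meas [measurable] = gaussD(2)[OF gauss]

definition R :: "'i \<Rightarrow> 'i \<Rightarrow> real" where "R i j = expectation (\<lambda>\<omega>. X i \<omega> * X j \<omega>)"

definition S :: "'a \<Rightarrow> real" where "S \<omega> = (\<Sum>j\<in>A. X j \<omega> ^ 4)"

definition mom :: "'i list \<Rightarrow> real" where "mom L = expectation (\<lambda>\<omega>. prod_list (map (\<lambda>i. X i \<omega>) L))"

text \<open>Moments twisted by the exponential of the quartic sum. One recursion serves two
  purposes: at \<tau> = 0 it is Wick's formula, and for general \<tau> it drives the differential
  equation of the characteristic function.\<close>

definition cmom :: "real \<Rightarrow> 'i list \<Rightarrow> complex" where
  "cmom \<tau> L = expectation (\<lambda>\<omega>. of_real (prod_list (map (\<lambda>i. X i \<omega>) L)) * cis (\<tau> * S \<omega>))"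

lemma R_sym: "R i j = R j i"
  by (simp add: R_def mult.commute)

lemma S_meas [measurable]: "S \<in> borel_measurable M"
  unfolding S_def[abs_def] by measurable

lemma test_fun_cmom:
  assumes "set L \<subseteq> A"
  shows "test_fun A (\<lambda>z. of_real (prod_list (map z L)) * cis (\<tau> * (\<Sum>j\<in>A. z j ^ 4)))
   (\<lambda>j z. (\<Sum>p<length L. if L ! p = j then of_real (prod_list (map z (remove_nth p L))) else 0)
        * cis (\<tau> * (\<Sum>j\<in>A. z j ^ 4))
     + of_real (prod_list (map z L)) * (4 * \<i> * of_real \<tau> * (of_real (z j) ^ 3 * cis (\<tau> * (\<Sum>j\<in>A. z j ^ 4)))))"
  by (rule test_fun_mult[OF test_fun_prod_list[OF fin assms] test_fun_cis_quartic[OF fin]])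

lemma integrable_cmom:
  assumes "set L \<subseteq> A"
  shows "integrable M (\<lambda>\<omega>. of_real (prod_list (map (\<lambda>i. X i \<omega>) L)) * cis (\<tau> * S \<omega>))"
  using gauss_integrable[OF gauss test_funD(1,2)[OF test_fun_cmom[OF assms, of \<tau>]]]
  by (simp add: S_def)

lemma integrable_mom:
  assumes "set L \<subseteq> A"
  shows "integrable M (\<lambda>\<omega>. prod_list (map (\<lambda>i. X i \<omega>) L))"
  using integrable_cmom[OF assms, of 0] by (simp add: complex_of_real_integrable_eq)

lemma cmom_0: "cmom 0 L = of_real (mom L)"
  by (simp add: cmom_def mom_def integral_complex_of_real)

text \<open>Integration by parts on the head \<open>i\<close>. Differentiating the monomial pairs
  \<open>i\<close> with each position of \<open>L\<close>; differentiating the exponential brings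
  down 4 i \<tau> X_j^3, which puts three further copies of \<open>j\<close> in front.\<close>

lemma cmom_Cons:
  assumes i: "i \<in> A" and L: "set L \<subseteq> A"
  shows "cmom \<tau> (i # L) = (\<Sum>p<length L. of_real (R i (L ! p)) * cmom \<tau> (remove_nth p L))
    + 4 * \<i> * of_real \<tau> * (\<Sum>j\<in>A. of_real (R i j) * cmom \<tau> (j # j # j # L))"
proof -
  let ?c = "\<lambda>\<omega>. cis (\<tau> * S \<omega>)" and ?P = "\<lambda>L \<omega>. complex_of_real (prod_list (map (\<lambda>i. X i \<omega>) L))"
  have sub: "set (remove_nth p L) \<subseteq> A" for p using set_remove_nth[of p L] L by blast
  have D: "expectation (\<lambda>\<omega>. (\<Sum>p<length L. if L ! p = j then ?P (remove_nth p L) \<omega> else 0) * ?c \<omega>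
     + ?P L \<omega> * (4 * \<i> * of_real \<tau> * (of_real (X j \<omega>) ^ 3 * ?c \<omega>)))
     = (\<Sum>p<length L. if L ! p = j then cmom \<tau> (remove_nth p L) else 0)
       + 4 * \<i> * of_real \<tau> * cmom \<tau> (j # j # j # L)" if "j \<in> A" for j
  proof -
    have "expectation (\<lambda>\<omega>. (\<Sum>p<length L. if L ! p = j then ?P (remove_nth p L) \<omega> else 0) * ?c \<omega>
       + ?P L \<omega> * (4 * \<i> * of_real \<tau> * (of_real (X j \<omega>) ^ 3 * ?c \<omega>)))
      = expectation (\<lambda>\<omega>. (\<Sum>p<length L. (if L ! p = j then 1 else 0) * (?P (remove_nth p L) \<omega> * ?c \<omega>))
         + 4 * \<i> * of_real \<tau> * (?P (j # j # j # L) \<omega> * ?c \<omega>))"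
      by (intro Bochner_Integration.integral_cong refl)
         (auto simp: sum_distrib_right sum_distrib_left power3_eq_cube mult_ac intro!: sum.cong)
    also have "\<dots> = (\<Sum>p<length L. (if L ! p = j then 1 else 0) * cmom \<tau> (remove_nth p L))
        + 4 * \<i> * of_real \<tau> * cmom \<tau> (j # j # j # L)"
      unfolding cmom_def
      by (subst Bochner_Integration.integral_add)
         (use integrable_cmom[OF sub] integrable_cmom[of "j # j # j # L"] L that in
           \<open>auto simp: Bochner_Integration.integral_sum intro!: Bochner_Integration.integrable_sum integrable_mult_right simp del: of_real_mult prod_list.Cons list.map\<close>)
    also have "(\<Sum>p<length L. (if L ! p = j then 1 else 0) * cmom \<tau> (remove_nth p L)) =
       (\<Sum>p<length L. if L ! p = j then cmom \<tau> (remove_nth p L) else 0)" by (intro sum.cong) auto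
    finally show ?thesis .
  qed
  have "cmom \<tau> (i # L) = expectation (\<lambda>\<omega>. of_real (X i \<omega>) * (?P L \<omega> * ?c \<omega>))"
    by (simp add: cmom_def mult_ac)
  also have "\<dots> = (\<Sum>j\<in>A. of_real (R i j) * ((\<Sum>p<length L. if L ! p = j then cmom \<tau> (remove_nth p L) else 0)
       + 4 * \<i> * of_real \<tau> * cmom \<tau> (j # j # j # L)))"
    using gaussD(4)[OF gauss i test_fun_cmom[OF L, of \<tau>]] D unfolding S_def R_def by simp
  also have "\<dots> = (\<Sum>j\<in>A. \<Sum>p<length L. of_real (R i j) * (if L ! p = j then cmom \<tau> (remove_nth p L) else 0))
    + 4 * \<i> * of_real \<tau> * (\<Sum>j\<in>A. of_real (R i j) * cmom \<tau> (j # j # j # L))"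
    by (simp add: distrib_left sum.distrib sum_distrib_left mult_ac)
  also have "(\<Sum>j\<in>A. \<Sum>p<length L. of_real (R i j) * (if L ! p = j then cmom \<tau> (remove_nth p L) else 0))
     = (\<Sum>p<length L. \<Sum>j\<in>A. if L ! p = j then of_real (R i j) * cmom \<tau> (remove_nth p L) else 0)"
    by (subst sum.swap) (intro sum.cong refl, simp)
  also have "\<dots> = (\<Sum>p<length L. of_real (R i (L ! p)) * cmom \<tau> (remove_nth p L))"
    using L nth_mem by (intro sum.cong refl) (auto simp: fin subset_iff)
  finally show ?thesis .
qed

lemma mom_Nil [simp]: "mom [] = 1"
  by (simp add: mom_def prob_space)

lemma mom_Cons:
  assumes "i \<in> A" "set L \<subseteq> A"
  shows "mom (i # L) = (\<Sum>p<length L. R i (L ! p) * mom (remove_nth p L))"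
proof -
  have "complex_of_real (mom (i # L)) = of_real (\<Sum>p<length L. R i (L ! p) * mom (remove_nth p L))"
    using cmom_Cons[OF assms, of 0] by (simp add: cmom_0)
  then show ?thesis by (simp only: of_real_eq_iff)
qed

text \<open>The factorial dominates the number of pairings. Since B \<ge> 1, the length can serve as
  exponent although each pairing has only half as many factors.\<close>

lemma mom_bound:
  assumes B: "1 \<le> B" "\<And>i j. i \<in> A \<Longrightarrow> j \<in> A \<Longrightarrow> \<bar>R i j\<bar> \<le> B"
  shows "set L \<subseteq> A \<Longrightarrow> \<bar>mom L\<bar> \<le> fact (length L) * B ^ length L"
proof (induction "length L" arbitrary: L rule: less_induct)
  case less
  show ?case
  proof (cases L)
    case (Cons i K)
    with less.prems have i: "i \<in> A" and K: "set K \<subseteq> A" by auto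
    have "\<bar>mom L\<bar> \<le> (\<Sum>p<length K. \<bar>R i (K ! p)\<bar> * \<bar>mom (remove_nth p K)\<bar>)"
      unfolding Cons mom_Cons[OF i K] by (rule order_trans[OF sum_abs]) (simp add: abs_mult)
    also have "\<dots> \<le> (\<Sum>p<length K. B * (fact (length K) * B ^ length K))"
    proof (intro sum_mono mult_mono)
      fix p assume p: "p \<in> {..<length K}"
      then show "\<bar>R i (K ! p)\<bar> \<le> B" using K nth_mem by (intro B(2) i) auto
      have "\<bar>mom (remove_nth p K)\<bar> \<le> fact (length (remove_nth p K)) * B ^ length (remove_nth p K)"
        using p set_remove_nth[of p K] K by (intro less.hyps) (auto simp: Cons length_remove_nth)
      also have "\<dots> \<le> fact (length K) * B ^ length K"
        using p B(1) by (intro mult_mono fact_mono power_increasing) (auto simp: length_remove_nth)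
      finally show "\<bar>mom (remove_nth p K)\<bar> \<le> fact (length K) * B ^ length K" .
    qed (use B in auto)
    also have "\<dots> = real (length K) * (fact (length K) * B ^ length L)" by (simp add: Cons)
    also have "\<dots> \<le> real (length L) * (fact (length K) * B ^ length L)"
      using B(1) by (intro mult_right_mono) (auto simp: Cons)
    also have "\<dots> = fact (length L) * B ^ length L" by (simp add: Cons)
    finally show ?thesis .
  qed simp
qed

text \<open>Pairings that never connect \<open>L\<close> with \<open>K\<close> cancel against
  \<open>mom L * mom K\<close>; every other pairing contains a factor \<open>R a b\<close> with
  \<open>a\<close> in \<open>L\<close> and \<open>b\<close> in \<open>K\<close>. The induction
  removes the head of \<open>L\<close>: its partner lies either in the rest of \<open>L\<close>,
  where the hypothesis applies, or in \<open>K\<close>, where the linking factor is visible.\<close>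

lemma mom_cov_bound:
  assumes B: "1 \<le> B" "\<And>i j. i \<in> A \<Longrightarrow> j \<in> A \<Longrightarrow> \<bar>R i j\<bar> \<le> B"
  shows "set L \<subseteq> A \<Longrightarrow> set K \<subseteq> A \<Longrightarrow> \<bar>mom (L @ K) - mom L * mom K\<bar>
    \<le> fact (length L + length K) * B ^ (length L + length K) * (\<Sum>a\<leftarrow>L. \<Sum>b\<leftarrow>K. \<bar>R a b\<bar>)"
proof (induction "length L + length K" arbitrary: L K rule: less_induct)
  case less
  show ?case
  proof (cases L)
    case (Cons i L')
    with less.prems have i: "i \<in> A" and L': "set L' \<subseteq> A" and K: "set K \<subseteq> A" by auto
    \<comment> \<open>One letter less than \<open>L @ K\<close>, and at least the length of every
      list that the recursion produces, so that \<open>G\<close> dominates all their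
      prefactors.\<close>
    define n where "n = length L' + length K"
    define G where "G = fact n * B ^ n"
    have G: "0 \<le> G" using B(1) by (simp add: G_def)
    have Gm: "fact m * B ^ m \<le> G" if "m \<le> n" for m
      unfolding G_def using that B(1) by (intro mult_mono fact_mono power_increasing) auto
    let ?d = "\<lambda>L. \<Sum>a\<leftarrow>L. \<Sum>b\<leftarrow>K. \<bar>R a b\<bar>"
    have "mom (L @ K) = (\<Sum>p<length L' + length K. R i ((L' @ K) ! p) * mom (remove_nth p (L' @ K)))"
      using mom_Cons[OF i, of "L' @ K"] L' K by (simp add: Cons)
    also have "\<dots> = (\<Sum>p<length L'. R i (L' ! p) * mom (remove_nth p L' @ K))
       + (\<Sum>q<length K. R i (K ! q) * mom (L' @ remove_nth q K))"
    proof -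
      have "{..<length L' + length K} = {..<length L'} \<union> (+) (length L') ` {..<length K}"
        unfolding lessThan_atLeast0 image_add_atLeastLessThan by auto
      then have "(\<Sum>p<length L' + length K. R i ((L' @ K) ! p) * mom (remove_nth p (L' @ K)))
        = (\<Sum>p<length L'. R i ((L' @ K) ! p) * mom (remove_nth p (L' @ K)))
         + (\<Sum>p\<in>(+) (length L') ` {..<length K}. R i ((L' @ K) ! p) * mom (remove_nth p (L' @ K)))"
        by (simp only:) (rule sum.union_disjoint, auto)
      also have "(\<Sum>p\<in>(+) (length L') ` {..<length K}. R i ((L' @ K) ! p) * mom (remove_nth p (L' @ K)))
        = (\<Sum>q<length K. R i (K ! q) * mom (L' @ remove_nth q K))"
        by (subst sum.reindex) (auto simp: remove_nth_append2)
      finally show ?thesis by (simp add: nth_append remove_nth_append1)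
    qed
    finally have eq: "mom (L @ K) - mom L * mom K
       = (\<Sum>p<length L'. R i (L' ! p) * (mom (remove_nth p L' @ K) - mom (remove_nth p L') * mom K))
       + (\<Sum>q<length K. R i (K ! q) * mom (L' @ remove_nth q K))"
      unfolding Cons mom_Cons[OF i L'] by (simp add: sum_distrib_left sum_distrib_right right_diff_distrib sum_subtractf mult_ac)
    have "\<bar>\<Sum>p<length L'. R i (L' ! p) * (mom (remove_nth p L' @ K) - mom (remove_nth p L') * mom K)\<bar>
        \<le> (\<Sum>p<length L'. B * (G * ?d L'))"
    proof (rule order_trans[OF sum_abs sum_mono])
      fix p assume p: "p \<in> {..<length L'}"
      have "\<bar>mom (remove_nth p L' @ K) - mom (remove_nth p L') * mom K\<bar>
         \<le> fact (length (remove_nth p L') + length K) * B ^ (length (remove_nth p L') + length K) * ?d (remove_nth p L')"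
        using p set_remove_nth[of p L'] L' K by (intro less.hyps) (auto simp: Cons length_remove_nth)
      also have "\<dots> \<le> G * ?d L'"
        using p by (intro mult_mono Gm sum_list_remove_nth_le)
          (auto simp: length_remove_nth n_def intro!: sum_list_nonneg G)
      finally have "\<bar>mom (remove_nth p L' @ K) - mom (remove_nth p L') * mom K\<bar> \<le> G * ?d L'" .
      moreover have "\<bar>R i (L' ! p)\<bar> \<le> B" using p L' nth_mem by (intro B(2) i) auto
      ultimately show "\<bar>R i (L' ! p) * (mom (remove_nth p L' @ K) - mom (remove_nth p L') * mom K)\<bar> \<le> B * (G * ?d L')"
        unfolding abs_mult using B(1) by (intro mult_mono) auto
    qed
    also have "\<dots> = real (length L') * B * G * ?d L'" by simp
    finally have 1: "\<bar>\<Sum>p<length L'. R i (L' ! p) * (mom (remove_nth p L' @ K) - mom (remove_nth p L') * mom K)\<bar>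
        \<le> real (length L') * B * G * ?d L'" .
    have "\<bar>\<Sum>q<length K. R i (K ! q) * mom (L' @ remove_nth q K)\<bar> \<le> (\<Sum>q<length K. \<bar>R i (K ! q)\<bar> * G)"
    proof (rule order_trans[OF sum_abs sum_mono])
      fix q assume q: "q \<in> {..<length K}"
      have "\<bar>mom (L' @ remove_nth q K)\<bar> \<le> fact (length (L' @ remove_nth q K)) * B ^ length (L' @ remove_nth q K)"
        using set_remove_nth[of q K] L' K by (intro mom_bound B) auto
      also have "\<dots> \<le> G" using q by (intro Gm) (auto simp: length_remove_nth n_def)
      finally show "\<bar>R i (K ! q) * mom (L' @ remove_nth q K)\<bar> \<le> \<bar>R i (K ! q)\<bar> * G"
        unfolding abs_mult by (intro mult_left_mono) auto
    qed
    also have "\<dots> = G * (\<Sum>b\<leftarrow>K. \<bar>R i b\<bar>)"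
      by (simp add: sum_list_sum_nth sum_distrib_left mult_ac atLeast0LessThan)
    finally have 2: "\<bar>\<Sum>q<length K. R i (K ! q) * mom (L' @ remove_nth q K)\<bar> \<le> G * (\<Sum>b\<leftarrow>K. \<bar>R i b\<bar>)" .
    have d0: "0 \<le> ?d L'" "0 \<le> (\<Sum>b\<leftarrow>K. \<bar>R i b\<bar>)" by (auto intro!: sum_list_nonneg)
    have c: "real (length L') * B * G \<le> fact (Suc n) * B ^ Suc n" "G \<le> fact (Suc n) * B ^ Suc n"
    proof -
      have "real (length L') * B * G \<le> real (Suc n) * B * G"
        using B(1) G by (intro mult_right_mono) (auto simp: n_def)
      then show "real (length L') * B * G \<le> fact (Suc n) * B ^ Suc n" by (simp add: G_def mult_ac)
      show "G \<le> fact (Suc n) * B ^ Suc n" unfolding G_def using B(1)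
        by (intro mult_mono fact_mono power_increasing) auto
    qed
    have "\<bar>mom (L @ K) - mom L * mom K\<bar> \<le> real (length L') * B * G * ?d L' + G * (\<Sum>b\<leftarrow>K. \<bar>R i b\<bar>)"
      unfolding eq using 1 2 by linarith
    also have "\<dots> \<le> (fact (Suc n) * B ^ Suc n) * ?d L' + (fact (Suc n) * B ^ Suc n) * (\<Sum>b\<leftarrow>K. \<bar>R i b\<bar>)"
      by (intro add_mono mult_right_mono c d0)
    finally show ?thesis by (simp add: Cons n_def distrib_left add_ac)
  qed simp
qed

end

section \<open>The differential equation for the characteristic function\<close>

lemma borel_measurable_cis [measurable]: "cis \<in> borel_measurable borel"
  by (intro borel_measurable_continuous_onI continuous_intros)

text \<open>The remainder of exp(iu) after the linear term is at most u^2 / 2, so a finite second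
  moment makes the error of the difference quotient linear in y - \<tau>.\<close>

lemma (in prob_space) has_vector_derivative_expectation_cis:
  fixes Y :: "'a \<Rightarrow> real"
  assumes [measurable]: "Y \<in> borel_measurable M" and i1: "integrable M Y" and i2: "integrable M (\<lambda>\<omega>. (Y \<omega>)\<^sup>2)"
  shows "((\<lambda>\<tau>. expectation (\<lambda>\<omega>. cis (\<tau> * Y \<omega>))) has_vector_derivative
    expectation (\<lambda>\<omega>. \<i> * of_real (Y \<omega>) * cis (\<tau> * Y \<omega>))) (at \<tau>)"
  unfolding has_vector_derivative_def
proof (rule has_derivativeI_sandwich[of 1])
  show "bounded_linear (\<lambda>h. h *\<^sub>R expectation (\<lambda>\<omega>. \<i> * of_real (Y \<omega>) * cis (\<tau> * Y \<omega>)))"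
    by (rule bounded_linear_scaleR_left)
  have ic: "integrable M (\<lambda>\<omega>. cis (t * Y \<omega>))" for t
    by (rule integrable_const_bound[where B = 1]) auto
  have iY: "integrable M (\<lambda>\<omega>. \<i> * of_real (Y \<omega>) * cis (\<tau> * Y \<omega>))"
    by (rule Bochner_Integration.integrable_bound[OF i1]) (auto simp: norm_mult)
  fix y assume y: "y \<noteq> \<tau>"
  have pt: "norm (cis (y * a) - cis (\<tau> * a) - (y - \<tau>) *\<^sub>R (\<i> * of_real a * cis (\<tau> * a))) \<le> (y - \<tau>)\<^sup>2 / 2 * a\<^sup>2" for a :: real
  proof -
    have "cis (y * a) = cis (\<tau> * a) * cis ((y - \<tau>) * a)" by (simp add: cis_mult algebra_simps)
    then have "cis (y * a) - cis (\<tau> * a) - (y - \<tau>) *\<^sub>R (\<i> * of_real a * cis (\<tau> * a))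
       = cis (\<tau> * a) * (cis ((y - \<tau>) * a) - (1 + \<i> * of_real ((y - \<tau>) * a)))"
      by (simp add: algebra_simps scaleR_conv_of_real)
    moreover have "norm (cis ((y - \<tau>) * a) - (1 + \<i> * of_real ((y - \<tau>) * a))) \<le> \<bar>(y - \<tau>) * a\<bar> ^ 2 / 2"
      using iexp_approx1[of "(y - \<tau>) * a" 1] by (simp add: cis_conv_exp numeral_2_eq_2)
    ultimately show ?thesis by (simp add: norm_mult power_mult_distrib abs_mult)
  qed
  have "norm (expectation (\<lambda>\<omega>. cis (y * Y \<omega>)) - expectation (\<lambda>\<omega>. cis (\<tau> * Y \<omega>)) -
      (y - \<tau>) *\<^sub>R expectation (\<lambda>\<omega>. \<i> * of_real (Y \<omega>) * cis (\<tau> * Y \<omega>)))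
    = norm (expectation (\<lambda>\<omega>. cis (y * Y \<omega>) - cis (\<tau> * Y \<omega>) - (y - \<tau>) *\<^sub>R (\<i> * of_real (Y \<omega>) * cis (\<tau> * Y \<omega>))))"
    unfolding Bochner_Integration.integral_diff[OF Bochner_Integration.integrable_diff[OF ic ic] integrable_scaleR_right[OF iY]]
      Bochner_Integration.integral_diff[OF ic ic] integral_scaleR_right by simp
  also have "\<dots> \<le> expectation (\<lambda>\<omega>. norm (cis (y * Y \<omega>) - cis (\<tau> * Y \<omega>) - (y - \<tau>) *\<^sub>R (\<i> * of_real (Y \<omega>) * cis (\<tau> * Y \<omega>))))"
    by (rule integral_norm_bound)
  also have "\<dots> \<le> expectation (\<lambda>\<omega>. (y - \<tau>)\<^sup>2 / 2 * (Y \<omega>)\<^sup>2)"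
    by (rule integral_mono[OF _ _ pt])
       (intro integrable_norm Bochner_Integration.integrable_diff ic integrable_scaleR_right iY integrable_mult_right i2)+
  finally have "norm (expectation (\<lambda>\<omega>. cis (y * Y \<omega>)) - expectation (\<lambda>\<omega>. cis (\<tau> * Y \<omega>)) -
      (y - \<tau>) *\<^sub>R expectation (\<lambda>\<omega>. \<i> * of_real (Y \<omega>) * cis (\<tau> * Y \<omega>))) \<le> (y - \<tau>)\<^sup>2 / 2 * expectation (\<lambda>\<omega>. (Y \<omega>)\<^sup>2)"
    by simp
  then have "norm (expectation (\<lambda>\<omega>. cis (y * Y \<omega>)) - expectation (\<lambda>\<omega>. cis (\<tau> * Y \<omega>)) -
      (y - \<tau>) *\<^sub>R expectation (\<lambda>\<omega>. \<i> * of_real (Y \<omega>) * cis (\<tau> * Y \<omega>))) / norm (y - \<tau>)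
      \<le> (y - \<tau>)\<^sup>2 / 2 * expectation (\<lambda>\<omega>. (Y \<omega>)\<^sup>2) / norm (y - \<tau>)"
    by (rule divide_right_mono) simp
  also have "\<dots> = \<bar>y - \<tau>\<bar> * (expectation (\<lambda>\<omega>. (Y \<omega>)\<^sup>2) / 2)"
  proof -
    have "(y - \<tau>)\<^sup>2 = \<bar>y - \<tau>\<bar> * \<bar>y - \<tau>\<bar>" by (simp add: power2_eq_square)
    then show ?thesis using y by (simp add: field_simps)
  qed
  finally show "norm (expectation (\<lambda>\<omega>. cis (y * Y \<omega>)) - expectation (\<lambda>\<omega>. cis (\<tau> * Y \<omega>)) -
      (y - \<tau>) *\<^sub>R expectation (\<lambda>\<omega>. \<i> * of_real (Y \<omega>) * cis (\<tau> * Y \<omega>))) / norm (y - \<tau>)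
      \<le> \<bar>y - \<tau>\<bar> * (expectation (\<lambda>\<omega>. (Y \<omega>)\<^sup>2) / 2)" .
next
  show "((\<lambda>y. \<bar>y - \<tau>\<bar> * (expectation (\<lambda>\<omega>. (Y \<omega>)\<^sup>2) / 2)) \<longlongrightarrow> 0) (at \<tau>)"
    by (auto intro!: tendsto_eq_intros)
qed simp

lemma (in prob_space) expectation_square_sum:
  fixes P :: "'b \<Rightarrow> 'a \<Rightarrow> real"
  assumes i1: "\<And>x. x \<in> I \<Longrightarrow> integrable M (P x)"
    and i2: "\<And>x y. x \<in> I \<Longrightarrow> y \<in> I \<Longrightarrow> integrable M (\<lambda>\<omega>. P x \<omega> * P y \<omega>)"
  shows "integrable M (\<lambda>\<omega>. ((\<Sum>x\<in>I. c x * P x \<omega>) - (\<Sum>x\<in>I. c x * expectation (P x)))\<^sup>2)"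
    "expectation (\<lambda>\<omega>. ((\<Sum>x\<in>I. c x * P x \<omega>) - (\<Sum>x\<in>I. c x * expectation (P x)))\<^sup>2)
     = (\<Sum>x\<in>I. \<Sum>y\<in>I. c x * c y * (expectation (\<lambda>\<omega>. P x \<omega> * P y \<omega>) - expectation (P x) * expectation (P y)))"
proof -
  have eq: "((\<Sum>x\<in>I. c x * P x \<omega>) - (\<Sum>x\<in>I. c x * expectation (P x)))\<^sup>2
     = (\<Sum>x\<in>I. \<Sum>y\<in>I. c x * c y * (P x \<omega> * P y \<omega> - expectation (P y) * P x \<omega> - expectation (P x) * P y \<omega>
          + expectation (P x) * expectation (P y)))" for \<omega>
    unfolding sum_subtractf[symmetric] power2_eq_square sum_product
    by (intro sum.cong refl) (simp add: algebra_simps)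
  have i: "integrable M (\<lambda>\<omega>. c x * c y * (P x \<omega> * P y \<omega> - expectation (P y) * P x \<omega> - expectation (P x) * P y \<omega>
          + expectation (P x) * expectation (P y)))" if "x \<in> I" "y \<in> I" for x y
    using i1 i2 that by (intro integrable_mult_right Bochner_Integration.integrable_add Bochner_Integration.integrable_diff) auto
  show "integrable M (\<lambda>\<omega>. ((\<Sum>x\<in>I. c x * P x \<omega>) - (\<Sum>x\<in>I. c x * expectation (P x)))\<^sup>2)"
    unfolding eq by (intro Bochner_Integration.integrable_sum i)
  show "expectation (\<lambda>\<omega>. ((\<Sum>x\<in>I. c x * P x \<omega>) - (\<Sum>x\<in>I. c x * expectation (P x)))\<^sup>2)
     = (\<Sum>x\<in>I. \<Sum>y\<in>I. c x * c y * (expectation (\<lambda>\<omega>. P x \<omega> * P y \<omega>) - expectation (P x) * expectation (P y)))"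
    unfolding eq using i i1 i2
    by (simp add: Bochner_Integration.integral_sum Bochner_Integration.integrable_sum prob_space algebra_simps)
qed

lemma (in prob_space) expectation_abs_le_sqrt:
  fixes Y :: "'a \<Rightarrow> real"
  assumes [measurable]: "Y \<in> borel_measurable M" and i2: "integrable M (\<lambda>\<omega>. (Y \<omega>)\<^sup>2)"
  shows "integrable M Y" "expectation (\<lambda>\<omega>. \<bar>Y \<omega>\<bar>) \<le> sqrt (expectation (\<lambda>\<omega>. (Y \<omega>)\<^sup>2))"
proof -
  show i1: "integrable M Y"
    by (rule square_integrable_imp_integrable[OF _ i2]) simp
  have "(expectation (\<lambda>\<omega>. \<bar>Y \<omega>\<bar>))\<^sup>2 \<le> expectation (\<lambda>\<omega>. (Y \<omega>)\<^sup>2)"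
    using variance_positive[of "\<lambda>\<omega>. \<bar>Y \<omega>\<bar>"] variance_eq[of "\<lambda>\<omega>. \<bar>Y \<omega>\<bar>"] i1 i2 by simp
  then show "expectation (\<lambda>\<omega>. \<bar>Y \<omega>\<bar>) \<le> sqrt (expectation (\<lambda>\<omega>. (Y \<omega>)\<^sup>2))"
    by (rule real_le_rsqrt)
qed

context gauss_family
begin

definition \<mu> :: real where "\<mu> = (\<Sum>j\<in>A. 3 * (R j j)\<^sup>2)"

text \<open>What two integrations by parts of X_j^4 leave at the index k: the first contributes
  X_k^3 X_j^3, the second, applied to the remaining X_j^2, contributes 3 R_jj X_k^3 X_j.\<close>

definition P :: "'i \<times> 'i \<Rightarrow> 'a \<Rightarrow> real" where
  "P = (\<lambda>(j, k) \<omega>. X k \<omega> ^ 3 * X j \<omega> ^ 3 + 3 * R j j * (X k \<omega> ^ 3 * X j \<omega>))"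

definition Q :: "'a \<Rightarrow> real" where
  "Q \<omega> = (\<Sum>x\<in>A \<times> A. 4 * R (fst x) (snd x) * P x \<omega>)"

text \<open>The mean of \<open>Q\<close>. By Wick's formula E P(j,k) = 18 R_jj R_kk R_jk + 6 R_jk^3,
  and the weight 4 R_jk gives 72 and 24, the constants in \<open>sbar2\<close> and
  \<open>sbar4\<close>.\<close>

definition q :: real where
  "q = (\<Sum>j\<in>A. \<Sum>k\<in>A. 72 * R j j * R k k * (R j k)\<^sup>2 + 24 * (R j k) ^ 4)"

lemma mom_4: "j \<in> A \<Longrightarrow> mom [j, j, j, j] = 3 * (R j j)\<^sup>2"
  by (simp add: mom_Cons power2_eq_square)

lemma mom_3_1: "j \<in> A \<Longrightarrow> k \<in> A \<Longrightarrow> mom [k, k, k, j] = 3 * R k k * R j k"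
  by (simp add: mom_Cons R_sym[of k j] numeral_2_eq_2)

lemma mom_3_3: "j \<in> A \<Longrightarrow> k \<in> A \<Longrightarrow> mom [k, k, k, j, j, j] = 9 * R j j * R k k * R j k + 6 * (R j k) ^ 3"
  by (simp add: mom_Cons R_sym[of k j] power3_eq_cube algebra_simps)

text \<open>Two applications of the recursion isolate the mean 3 R_jj^2 times the characteristic
  function; everything else carries the factor \<tau>.\<close>

lemma cmom_4:
  assumes "j \<in> A"
  shows "cmom \<tau> [j, j, j, j] = 3 * (of_real (R j j))\<^sup>2 * cmom \<tau> []
    + 4 * \<i> * of_real \<tau> * (\<Sum>k\<in>A. of_real (R j k) * (cmom \<tau> [k, k, k, j, j, j] + 3 * of_real (R j j) * cmom \<tau> [k, k, k, j]))"
proof -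
  have 2: "cmom \<tau> [j, j] = of_real (R j j) * cmom \<tau> [] + 4 * \<i> * of_real \<tau> * (\<Sum>k\<in>A. of_real (R j k) * cmom \<tau> [k, k, k, j])"
    using assms by (subst cmom_Cons) auto
  have "cmom \<tau> [j, j, j, j] = 3 * of_real (R j j) * cmom \<tau> [j, j]
      + 4 * \<i> * of_real \<tau> * (\<Sum>k\<in>A. of_real (R j k) * cmom \<tau> [k, k, k, j, j, j])"
    using assms by (subst cmom_Cons) auto
  then show ?thesis unfolding 2
    by (simp add: distrib_left sum.distrib sum_distrib_left power2_eq_square algebra_simps)
qed

lemma P_eq: "P (j, k) \<omega> = prod_list (map (\<lambda>i. X i \<omega>) [k, k, k, j, j, j]) + 3 * R j j * prod_list (map (\<lambda>i. X i \<omega>) [k, k, k, j])"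
  by (simp add: P_def power3_eq_cube mult_ac)

lemma integrable_P: "x \<in> A \<times> A \<Longrightarrow> integrable M (P x)"
proof -
  assume "x \<in> A \<times> A"
  then obtain j k where x: "x = (j, k)" "j \<in> A" "k \<in> A" by auto
  then show ?thesis unfolding x(1) P_eq[abs_def]
    by (intro Bochner_Integration.integrable_add integrable_mult_right integrable_mom) auto
qed

lemma expectation_P: "j \<in> A \<Longrightarrow> k \<in> A \<Longrightarrow> expectation (P (j, k)) = mom [k, k, k, j, j, j] + 3 * R j j * mom [k, k, k, j]"
  unfolding P_eq[abs_def] mom_def
  by (subst Bochner_Integration.integral_add) (auto intro!: integrable_mult_right integrable_mom simp del: prod_list.Cons list.map)

lemma P_mult_eq: "P (j, k) \<omega> * P (l, m) \<omega> =
    prod_list (map (\<lambda>i. X i \<omega>) ([k, k, k, j, j, j] @ [m, m, m, l, l, l]))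
  + 3 * R l l * prod_list (map (\<lambda>i. X i \<omega>) ([k, k, k, j, j, j] @ [m, m, m, l]))
  + 3 * R j j * prod_list (map (\<lambda>i. X i \<omega>) ([k, k, k, j] @ [m, m, m, l, l, l]))
  + 9 * R j j * R l l * prod_list (map (\<lambda>i. X i \<omega>) ([k, k, k, j] @ [m, m, m, l]))"
  unfolding P_eq map_append prod_list.append by (simp only: ring_distribs) (simp add: mult_ac)

lemma expectation_P_mult:
  assumes "j \<in> A" "k \<in> A" "l \<in> A" "m \<in> A"
  shows "integrable M (\<lambda>\<omega>. P (j, k) \<omega> * P (l, m) \<omega>)"
    "expectation (\<lambda>\<omega>. P (j, k) \<omega> * P (l, m) \<omega>) =
       mom ([k, k, k, j, j, j] @ [m, m, m, l, l, l])
     + 3 * R l l * mom ([k, k, k, j, j, j] @ [m, m, m, l])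
     + 3 * R j j * mom ([k, k, k, j] @ [m, m, m, l, l, l])
     + 9 * R j j * R l l * mom ([k, k, k, j] @ [m, m, m, l])"
proof -
  let ?p = "\<lambda>L \<omega>. prod_list (map (\<lambda>i. X i \<omega>) L)"
  have i: "integrable M (?p ([k, k, k, j, j, j] @ [m, m, m, l, l, l]))"
     "integrable M (?p ([k, k, k, j, j, j] @ [m, m, m, l]))"
     "integrable M (?p ([k, k, k, j] @ [m, m, m, l, l, l]))"
     "integrable M (?p ([k, k, k, j] @ [m, m, m, l]))"
    by (intro integrable_mom; use assms in simp)+
  note i' = i(1) integrable_mult_right[OF i(2), of "3 * R l l"] integrable_mult_right[OF i(3), of "3 * R j j"]
    integrable_mult_right[OF i(4), of "9 * R j j * R l l"]
  note a = Bochner_Integration.integrable_add[OF Bochner_Integration.integrable_add[OF i'(1,2)] i'(3)]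
  show "integrable M (\<lambda>\<omega>. P (j, k) \<omega> * P (l, m) \<omega>)"
    unfolding P_mult_eq by (rule Bochner_Integration.integrable_add[OF a i'(4)])
  show "expectation (\<lambda>\<omega>. P (j, k) \<omega> * P (l, m) \<omega>) =
       mom ([k, k, k, j, j, j] @ [m, m, m, l, l, l])
     + 3 * R l l * mom ([k, k, k, j, j, j] @ [m, m, m, l])
     + 3 * R j j * mom ([k, k, k, j] @ [m, m, m, l, l, l])
     + 9 * R j j * R l l * mom ([k, k, k, j] @ [m, m, m, l])"
    unfolding P_mult_eq Bochner_Integration.integral_add[OF a i'(4)]
      Bochner_Integration.integral_add[OF Bochner_Integration.integrable_add[OF i'(1,2)] i'(3)]
      Bochner_Integration.integral_add[OF i'(1,2)] integral_mult_right_zero mom_def ..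
qed

lemma sum_expectation_P: "(\<Sum>x\<in>A \<times> A. 4 * R (fst x) (snd x) * expectation (P x)) = q"
  unfolding q_def sum.cartesian_product[symmetric] case_prod_unfold[symmetric]
proof -
  have "(\<Sum>x\<in>A \<times> A. 4 * R (fst x) (snd x) * expectation (P x)) = (\<Sum>(j, k)\<in>A \<times> A. 4 * R j k * expectation (P (j, k)))"
    by (intro sum.cong) auto
  also have "\<dots> = (\<Sum>j\<in>A. \<Sum>k\<in>A. 4 * R j k * expectation (P (j, k)))"
    by (rule sum.cartesian_product[symmetric])
  also have "\<dots> = (\<Sum>j\<in>A. \<Sum>k\<in>A. 72 * R j j * R k k * (R j k)\<^sup>2 + 24 * (R j k) ^ 4)"
    by (intro sum.cong refl)
       (simp add: expectation_P mom_3_1 mom_3_3 power2_eq_square power3_eq_cube power4_eq_xxxx algebra_simps)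
  finally show "(\<Sum>x\<in>A \<times> A. 4 * R (fst x) (snd x) * expectation (P x)) =
     (\<Sum>j\<in>A. \<Sum>k\<in>A. 72 * R j j * R k k * (R j k)\<^sup>2 + 24 * (R j k) ^ 4)" .
qed

lemma integrable_Q: "integrable M Q"
  unfolding Q_def[abs_def] by (intro Bochner_Integration.integrable_sum integrable_mult_right integrable_P)

lemma S_eq_sum: "S \<omega> = (\<Sum>j\<in>A. 1 * prod_list (map (\<lambda>i. X i \<omega>) [j, j, j, j]))"
  by (simp add: S_def power4_eq_xxxx mult_ac)

lemma \<mu>_eq_sum: "\<mu> = (\<Sum>j\<in>A. 1 * expectation (\<lambda>\<omega>. prod_list (map (\<lambda>i. X i \<omega>) [j, j, j, j])))"
  unfolding \<mu>_def mom_def[symmetric] by (intro sum.cong) (auto simp: mom_4)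

lemma S_square:
  "integrable M (\<lambda>\<omega>. (S \<omega> - \<mu>)\<^sup>2)"
  "expectation (\<lambda>\<omega>. (S \<omega> - \<mu>)\<^sup>2) = (\<Sum>j\<in>A. \<Sum>k\<in>A. mom ([j, j, j, j] @ [k, k, k, k]) - mom [j, j, j, j] * mom [k, k, k, k])"
proof -
  have i1: "integrable M (\<lambda>\<omega>. prod_list (map (\<lambda>i. X i \<omega>) [j, j, j, j]))" if "j \<in> A" for j
    by (rule integrable_mom) (use that in auto)
  have i2: "integrable M (\<lambda>\<omega>. prod_list (map (\<lambda>i. X i \<omega>) [j, j, j, j]) * prod_list (map (\<lambda>i. X i \<omega>) [k, k, k, k]))"
    if "j \<in> A" "k \<in> A" for j k
    unfolding prod_list.append[symmetric] map_append[symmetric] by (rule integrable_mom) (use that in auto)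
  note * = expectation_square_sum[of A "\<lambda>j \<omega>. prod_list (map (\<lambda>i. X i \<omega>) [j, j, j, j])" "\<lambda>_. 1", OF i1 i2]
  show "integrable M (\<lambda>\<omega>. (S \<omega> - \<mu>)\<^sup>2)" unfolding S_eq_sum \<mu>_eq_sum by (rule *(1))
  show "expectation (\<lambda>\<omega>. (S \<omega> - \<mu>)\<^sup>2) = (\<Sum>j\<in>A. \<Sum>k\<in>A. mom ([j, j, j, j] @ [k, k, k, k]) - mom [j, j, j, j] * mom [k, k, k, k])"
  proof -
    let ?p = "\<lambda>j \<omega>. prod_list (map (\<lambda>i. X i \<omega>) [j, j, j, j])"
    have c: "1 * 1 * (expectation (\<lambda>\<omega>. ?p j \<omega> * ?p k \<omega>) - expectation (?p j) * expectation (?p k))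
      = mom ([j, j, j, j] @ [k, k, k, k]) - mom [j, j, j, j] * mom [k, k, k, k]" for j k
      unfolding mom_def map_append prod_list.append by (simp only: mult_1_left)
    show ?thesis using *(2) unfolding c S_eq_sum[symmetric] \<mu>_eq_sum[symmetric] .
  qed
qed

definition char_S :: "real \<Rightarrow> complex" where
  "char_S \<tau> = expectation (\<lambda>\<omega>. cis (\<tau> * (S \<omega> - \<mu>)))"

text \<open>The leading terms of \<open>cmom_4\<close> add up to \<mu> times the characteristic
  function and cancel against the centring. Only terms with the additional factor 4 i \<tau>
  survive, and they assemble to \<open>Q\<close>.\<close>

lemma char_S_deriv:
  "(char_S has_vector_derivative - of_real \<tau> * expectation (\<lambda>\<omega>. of_real (Q \<omega>) * cis (\<tau> * (S \<omega> - \<mu>)))) (at \<tau>)"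
proof -
  let ?e = "cis (- (\<tau> * \<mu>))"
  let ?p = "\<lambda>L \<omega>. complex_of_real (prod_list (map (\<lambda>i. X i \<omega>) L))"
  have cs: "cis (\<tau> * (S \<omega> - \<mu>)) = ?e * cis (\<tau> * S \<omega>)" for \<omega>
    by (simp add: cis_mult algebra_simps)
  have im: "integrable M (\<lambda>\<omega>. ?p L \<omega> * cis (\<tau> * S \<omega>))" if "set L \<subseteq> A" for L
    by (rule integrable_cmom[OF that])
  have "expectation (\<lambda>\<omega>. \<i> * of_real (S \<omega> - \<mu>) * cis (\<tau> * (S \<omega> - \<mu>)))
     = expectation (\<lambda>\<omega>. \<i> * ?e * ((\<Sum>j\<in>A. ?p [j, j, j, j] \<omega> * cis (\<tau> * S \<omega>)) - of_real \<mu> * (?p [] \<omega> * cis (\<tau> * S \<omega>))))"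
    unfolding cs by (intro Bochner_Integration.integral_cong refl)
       (simp add: S_eq_sum sum_distrib_left sum_distrib_right algebra_simps)
  also have "\<dots> = \<i> * ?e * ((\<Sum>j\<in>A. cmom \<tau> [j, j, j, j]) - of_real \<mu> * cmom \<tau> [])"
  proof -
    have "expectation (\<lambda>\<omega>. (\<Sum>j\<in>A. ?p [j, j, j, j] \<omega> * cis (\<tau> * S \<omega>)) - of_real \<mu> * (?p [] \<omega> * cis (\<tau> * S \<omega>)))
      = (\<Sum>j\<in>A. cmom \<tau> [j, j, j, j]) - of_real \<mu> * cmom \<tau> []"
      unfolding cmom_def
      by (subst Bochner_Integration.integral_diff[OF Bochner_Integration.integrable_sum integrable_mult_right])
         (use im in \<open>auto simp: Bochner_Integration.integral_sum simp del: prod_list.Cons list.map\<close>)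
    then show ?thesis by (simp only: integral_mult_right_zero)
  qed
  also have "(\<Sum>j\<in>A. cmom \<tau> [j, j, j, j]) = of_real \<mu> * cmom \<tau> [] +
     4 * \<i> * of_real \<tau> * (\<Sum>j\<in>A. \<Sum>k\<in>A. of_real (R j k) * (cmom \<tau> [k, k, k, j, j, j] + 3 * of_real (R j j) * cmom \<tau> [k, k, k, j]))"
    by (simp add: cmom_4 sum.distrib sum_distrib_left sum_distrib_right \<mu>_def mult_ac)
  also have "(\<Sum>j\<in>A. \<Sum>k\<in>A. of_real (R j k) * (cmom \<tau> [k, k, k, j, j, j] + 3 * of_real (R j j) * cmom \<tau> [k, k, k, j]))
     = (\<Sum>j\<in>A. \<Sum>k\<in>A. expectation (\<lambda>\<omega>. of_real (R j k) * (of_real (P (j, k) \<omega>) * cis (\<tau> * S \<omega>))))"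
  proof (intro sum.cong refl)
    fix j k assume jk: "j \<in> A" "k \<in> A"
    have i1: "integrable M (\<lambda>\<omega>. ?p [k, k, k, j, j, j] \<omega> * cis (\<tau> * S \<omega>))"
      and i2: "integrable M (\<lambda>\<omega>. 3 * of_real (R j j) * (?p [k, k, k, j] \<omega> * cis (\<tau> * S \<omega>)))"
      by (intro im integrable_mult_right; use jk in simp)+
    have "expectation (\<lambda>\<omega>. of_real (P (j, k) \<omega>) * cis (\<tau> * S \<omega>))
      = expectation (\<lambda>\<omega>. ?p [k, k, k, j, j, j] \<omega> * cis (\<tau> * S \<omega>) + 3 * of_real (R j j) * (?p [k, k, k, j] \<omega> * cis (\<tau> * S \<omega>)))"
      unfolding P_eq by (intro Bochner_Integration.integral_cong refl) (simp add: distrib_right)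
    also have "\<dots> = cmom \<tau> [k, k, k, j, j, j] + 3 * of_real (R j j) * cmom \<tau> [k, k, k, j]"
      unfolding Bochner_Integration.integral_add[OF i1 i2] integral_mult_right_zero cmom_def ..
    finally show "of_real (R j k) * (cmom \<tau> [k, k, k, j, j, j] + 3 * of_real (R j j) * cmom \<tau> [k, k, k, j])
      = expectation (\<lambda>\<omega>. of_real (R j k) * (of_real (P (j, k) \<omega>) * cis (\<tau> * S \<omega>)))"
      by simp
  qed
  also have "4 * \<i> * of_real \<tau> * (\<Sum>j\<in>A. \<Sum>k\<in>A. expectation (\<lambda>\<omega>. of_real (R j k) * (of_real (P (j, k) \<omega>) * cis (\<tau> * S \<omega>))))
      = \<i> * of_real \<tau> * expectation (\<lambda>\<omega>. of_real (Q \<omega>) * cis (\<tau> * S \<omega>))"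
  proof -
    have i: "integrable M (\<lambda>\<omega>. of_real (R j k) * (of_real (P (j, k) \<omega>) * cis (\<tau> * S \<omega>)))" if "j \<in> A" "k \<in> A" for j k
    proof (rule integrable_mult_right, rule Bochner_Integration.integrable_bound[OF integrable_P])
      show "(j, k) \<in> A \<times> A" using that by simp
      show "(\<lambda>\<omega>. of_real (P (j, k) \<omega>) * cis (\<tau> * S \<omega>)) \<in> borel_measurable M"
        unfolding P_def prod.case by measurable
    qed (simp add: norm_mult)
    have E: "expectation (\<lambda>\<omega>. \<Sum>j\<in>A. \<Sum>k\<in>A. of_real (R j k) * (of_real (P (j, k) \<omega>) * cis (\<tau> * S \<omega>)))
      = (\<Sum>j\<in>A. \<Sum>k\<in>A. expectation (\<lambda>\<omega>. of_real (R j k) * (of_real (P (j, k) \<omega>) * cis (\<tau> * S \<omega>))))"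
      by (rule trans[OF Bochner_Integration.integral_sum])
         (auto intro!: Bochner_Integration.integrable_sum i sum.cong Bochner_Integration.integral_sum simp del: integral_mult_right_zero)
    have "of_real (Q \<omega>) * cis (\<tau> * S \<omega>) = 4 * (\<Sum>j\<in>A. \<Sum>k\<in>A. of_real (R j k) * (of_real (P (j, k) \<omega>) * cis (\<tau> * S \<omega>)))" for \<omega>
    proof -
      have "Q \<omega> = (\<Sum>(j, k)\<in>A \<times> A. 4 * R j k * P (j, k) \<omega>)" unfolding Q_def by (intro sum.cong) auto
      also have "\<dots> = (\<Sum>j\<in>A. \<Sum>k\<in>A. 4 * R j k * P (j, k) \<omega>)" by (rule sum.cartesian_product[symmetric])
      finally show ?thesis by (simp add: sum_distrib_left sum_distrib_right mult_ac)
    qed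
    then have "expectation (\<lambda>\<omega>. of_real (Q \<omega>) * cis (\<tau> * S \<omega>))
       = 4 * (\<Sum>j\<in>A. \<Sum>k\<in>A. expectation (\<lambda>\<omega>. of_real (R j k) * (of_real (P (j, k) \<omega>) * cis (\<tau> * S \<omega>))))"
      by (simp only: integral_mult_right_zero E)
    then show ?thesis by simp
  qed
  also have "\<i> * ?e * (of_real \<mu> * cmom \<tau> [] + \<i> * of_real \<tau> * expectation (\<lambda>\<omega>. of_real (Q \<omega>) * cis (\<tau> * S \<omega>)) - of_real \<mu> * cmom \<tau> [])
     = - of_real \<tau> * (?e * expectation (\<lambda>\<omega>. of_real (Q \<omega>) * cis (\<tau> * S \<omega>)))"
    by (simp add: algebra_simps)
  also have "?e * expectation (\<lambda>\<omega>. of_real (Q \<omega>) * cis (\<tau> * S \<omega>)) = expectation (\<lambda>\<omega>. of_real (Q \<omega>) * cis (\<tau> * (S \<omega> - \<mu>)))"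
    unfolding cs integral_mult_right_zero[symmetric] by (simp add: mult_ac)
  finally have eq: "expectation (\<lambda>\<omega>. \<i> * of_real (S \<omega> - \<mu>) * cis (\<tau> * (S \<omega> - \<mu>)))
     = - of_real \<tau> * expectation (\<lambda>\<omega>. of_real (Q \<omega>) * cis (\<tau> * (S \<omega> - \<mu>)))" .
  have m: "(\<lambda>\<omega>. S \<omega> - \<mu>) \<in> borel_measurable M" by simp
  from has_vector_derivative_expectation_cis[OF m expectation_abs_le_sqrt(1)[OF m S_square(1)] S_square(1), of \<tau>]
  show ?thesis unfolding eq char_S_def[abs_def] .
qed

end

context gauss_family
begin

text \<open>Writing Q = q + (Q - q), the equation is that of a Gaussian characteristic function with
  a perturbation. The integrating factor exp(q \<tau>^2 / 2) leaves only the perturbation in the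
  derivative; one factor t comes from \<tau> in the equation, the other from the distance between 0
  and t.\<close>

lemma char_S_approx:
  assumes q: "0 \<le> q" and iQ: "integrable M (\<lambda>\<omega>. (Q \<omega> - q)\<^sup>2)"
  shows "norm (char_S t - exp (- of_real (q * t\<^sup>2 / 2))) \<le> t\<^sup>2 * sqrt (expectation (\<lambda>\<omega>. (Q \<omega> - q)\<^sup>2))"
proof -
  define V where "V = sqrt (expectation (\<lambda>\<omega>. (Q \<omega> - q)\<^sup>2))"
  have mQ [measurable]: "Q \<in> borel_measurable M" using integrable_Q by blast
  have ic: "integrable M (\<lambda>\<omega>. cis (\<tau> * (S \<omega> - \<mu>)))" for \<tau>
    by (rule integrable_const_bound[where B = 1]) auto
  have iQc: "integrable M (\<lambda>\<omega>. of_real (Q \<omega>) * cis (\<tau> * (S \<omega> - \<mu>)))" for \<tau>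
    by (rule Bochner_Integration.integrable_bound[OF integrable_Q]) (auto simp: norm_mult)
  define \<psi> where "\<psi> \<tau> = char_S \<tau> * of_real (exp (q * \<tau>\<^sup>2 / 2))" for \<tau>
  define \<psi>' where "\<psi>' \<tau> = - of_real \<tau> * expectation (\<lambda>\<omega>. of_real (Q \<omega> - q) * cis (\<tau> * (S \<omega> - \<mu>))) * of_real (exp (q * \<tau>\<^sup>2 / 2))" for \<tau>
  have d: "(\<psi> has_vector_derivative \<psi>' \<tau>) (at \<tau>)" for \<tau>
  proof -
    have e: "((\<lambda>\<tau>. complex_of_real (exp (q * \<tau>\<^sup>2 / 2))) has_vector_derivative of_real (exp (q * \<tau>\<^sup>2 / 2) * (q * \<tau>))) (at \<tau>)"
      by (rule has_vector_derivative_of_real) (auto intro!: derivative_eq_intros simp: has_real_derivative_iff_has_vector_derivative[symmetric])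
    have "expectation (\<lambda>\<omega>. of_real (Q \<omega> - q) * cis (\<tau> * (S \<omega> - \<mu>)))
      = expectation (\<lambda>\<omega>. of_real (Q \<omega>) * cis (\<tau> * (S \<omega> - \<mu>)) - of_real q * cis (\<tau> * (S \<omega> - \<mu>)))"
      by (simp add: algebra_simps)
    also have "\<dots> = expectation (\<lambda>\<omega>. of_real (Q \<omega>) * cis (\<tau> * (S \<omega> - \<mu>))) - of_real q * char_S \<tau>"
      unfolding char_S_def Bochner_Integration.integral_diff[OF iQc integrable_mult_right[OF ic]] integral_mult_right_zero ..
    finally have eq: "expectation (\<lambda>\<omega>. of_real (Q \<omega> - q) * cis (\<tau> * (S \<omega> - \<mu>))) =
      expectation (\<lambda>\<omega>. of_real (Q \<omega>) * cis (\<tau> * (S \<omega> - \<mu>))) - of_real q * char_S \<tau>" .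
    show ?thesis unfolding \<psi>_def[abs_def] \<psi>'_def eq
      using has_vector_derivative_mult[OF char_S_deriv e] by (simp add: algebra_simps)
  qed
  have b: "norm (\<psi>' \<tau>) \<le> \<bar>t\<bar> * V * exp (q * t\<^sup>2 / 2)" if "\<bar>\<tau>\<bar> \<le> \<bar>t\<bar>" for \<tau>
  proof -
    have "norm (expectation (\<lambda>\<omega>. of_real (Q \<omega> - q) * cis (\<tau> * (S \<omega> - \<mu>)))) \<le> expectation (\<lambda>\<omega>. norm (of_real (Q \<omega> - q) * cis (\<tau> * (S \<omega> - \<mu>))))"
      by (rule integral_norm_bound)
    also have "\<dots> = expectation (\<lambda>\<omega>. \<bar>Q \<omega> - q\<bar>)"
      unfolding norm_mult norm_of_real norm_cis mult_1_right ..
    also have "\<dots> \<le> V" unfolding V_def by (rule expectation_abs_le_sqrt(2)[OF _ iQ]) simp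
    finally have *: "norm (expectation (\<lambda>\<omega>. of_real (Q \<omega> - q) * cis (\<tau> * (S \<omega> - \<mu>)))) \<le> V" .
    have t2: "\<tau>\<^sup>2 \<le> t\<^sup>2" using that by (simp add: abs_le_square_iff)
    have V0: "0 \<le> V" by (simp add: V_def)
    have "exp (q * \<tau>\<^sup>2 / 2) \<le> exp (q * t\<^sup>2 / 2)" using mult_left_mono[OF t2 q] by simp
    then have "\<bar>\<tau>\<bar> * norm (expectation (\<lambda>\<omega>. of_real (Q \<omega> - q) * cis (\<tau> * (S \<omega> - \<mu>)))) * exp (q * \<tau>\<^sup>2 / 2)
       \<le> \<bar>t\<bar> * V * exp (q * t\<^sup>2 / 2)"
      using that * V0 by (intro mult_mono) auto
    then show ?thesis by (simp add: \<psi>'_def norm_mult)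
  qed
  have "norm (\<psi> t - \<psi> 0) \<le> \<bar>t\<bar> * V * exp (q * t\<^sup>2 / 2) * norm (t - 0)"
  proof (rule differentiable_bound[where S = "{-\<bar>t\<bar>..\<bar>t\<bar>}" and f' = "\<lambda>\<tau> h. h *\<^sub>R \<psi>' \<tau>"])
    fix \<tau> assume \<tau>: "\<tau> \<in> {-\<bar>t\<bar>..\<bar>t\<bar>}"
    show "(\<psi> has_derivative (\<lambda>h. h *\<^sub>R \<psi>' \<tau>)) (at \<tau> within {-\<bar>t\<bar>..\<bar>t\<bar>})"
      using has_vector_derivative_at_within[OF d] unfolding has_vector_derivative_def .
    show "onorm (\<lambda>h. h *\<^sub>R \<psi>' \<tau>) \<le> \<bar>t\<bar> * V * exp (q * t\<^sup>2 / 2)"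
    proof (rule onorm_le)
      fix h :: real
      show "norm (h *\<^sub>R \<psi>' \<tau>) \<le> \<bar>t\<bar> * V * exp (q * t\<^sup>2 / 2) * norm h"
        using mult_left_mono[OF b[of \<tau>], of "\<bar>h\<bar>"] \<tau> by (auto simp: mult.commute)
    qed
  qed auto
  also have "\<dots> = t\<^sup>2 * V * exp (q * t\<^sup>2 / 2)"
    by (simp add: power2_eq_square mult_ac abs_mult_self_eq flip: abs_mult)
  finally have 1: "norm (\<psi> t - 1) \<le> t\<^sup>2 * V * exp (q * t\<^sup>2 / 2)"
    by (simp add: \<psi>_def char_S_def prob_space)
  \<comment> \<open>The growth factor exp(q t^2 / 2) in the bound is exactly the one in \<psi>, so
    it cancels and the final estimate does not grow exponentially in q.\<close>
  have "\<psi> t - 1 = of_real (exp (q * t\<^sup>2 / 2)) * (char_S t - exp (- of_real (q * t\<^sup>2 / 2)))"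
    by (simp add: \<psi>_def algebra_simps exp_minus flip: exp_of_real)
  then have "exp (q * t\<^sup>2 / 2) * norm (char_S t - exp (- of_real (q * t\<^sup>2 / 2))) \<le> exp (q * t\<^sup>2 / 2) * (t\<^sup>2 * V)"
    using 1 by (simp add: norm_mult mult_ac)
  then show ?thesis unfolding V_def by simp
qed

section \<open>Variance bounds for \<open>Q\<close> and \<open>S\<close>\<close>

text \<open>Each term is a path with three edges on four indices. Summing from one end, each of
  three vertices costs a row sum \<rho> and the last one costs card A. The four terms differ only in
  which endpoints are joined, and symmetry of \<open>r\<close> reduces them to one.\<close>

lemma chain_sum_bound:
  fixes r :: "'i \<Rightarrow> 'i \<Rightarrow> real"
  assumes sym: "\<And>i j. r i j = r j i" and nn: "\<And>i j. 0 \<le> r i j"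
    and \<rho>: "\<And>i. i \<in> A \<Longrightarrow> (\<Sum>j\<in>A. r i j) \<le> \<rho>" "0 \<le> \<rho>"
  shows "(\<Sum>j\<in>A. \<Sum>k\<in>A. \<Sum>l\<in>A. \<Sum>m\<in>A. r j k * r l m * (r k m + r k l + r j m + r j l))
    \<le> 4 * (real (card A) * \<rho> ^ 3)"
proof -
  have chain: "(\<Sum>i\<in>A. \<Sum>j\<in>A. \<Sum>k\<in>A. \<Sum>l\<in>A. r i j * r k l * r j k) \<le> real (card A) * \<rho> ^ 3"
  proof -
    have "(\<Sum>i\<in>A. \<Sum>j\<in>A. \<Sum>k\<in>A. \<Sum>l\<in>A. r i j * r k l * r j k)
      = (\<Sum>i\<in>A. \<Sum>j\<in>A. r i j * (\<Sum>k\<in>A. r j k * (\<Sum>l\<in>A. r k l)))"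
      by (simp add: sum_distrib_left mult_ac)
    also have "\<dots> \<le> (\<Sum>i\<in>A. \<Sum>j\<in>A. r i j * (\<Sum>k\<in>A. r j k * \<rho>))"
      by (intro sum_mono mult_left_mono \<rho> nn)
    also have "\<dots> = (\<Sum>i\<in>A. \<Sum>j\<in>A. r i j * ((\<Sum>k\<in>A. r j k) * \<rho>))"
      by (simp add: sum_distrib_right)
    also have "\<dots> \<le> (\<Sum>i\<in>A. \<Sum>j\<in>A. r i j * (\<rho> * \<rho>))"
      by (intro sum_mono mult_left_mono mult_right_mono \<rho> nn)
    also have "\<dots> = (\<Sum>i\<in>A. (\<Sum>j\<in>A. r i j) * (\<rho> * \<rho>))" by (simp add: sum_distrib_right)
    also have "\<dots> \<le> (\<Sum>i\<in>A. \<rho> * (\<rho> * \<rho>))" by (intro sum_mono mult_right_mono \<rho>) (use \<rho>(2) in auto)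
    finally show ?thesis by (simp add: power3_eq_cube mult_ac)
  qed
  have 1: "(\<Sum>j\<in>A. \<Sum>k\<in>A. \<Sum>l\<in>A. \<Sum>m\<in>A. r j k * r l m * r k m) \<le> real (card A) * \<rho> ^ 3"
  proof -
    have "(\<Sum>j\<in>A. \<Sum>k\<in>A. \<Sum>l\<in>A. \<Sum>m\<in>A. r j k * r l m * r k m) = (\<Sum>j\<in>A. \<Sum>k\<in>A. \<Sum>m\<in>A. \<Sum>l\<in>A. r j k * r m l * r k m)"
      by (rule sum.cong[OF refl], rule sum.cong[OF refl], subst sum.swap) (simp add: sym)
    then show ?thesis using chain by simp
  qed
  have 3: "(\<Sum>j\<in>A. \<Sum>k\<in>A. \<Sum>l\<in>A. \<Sum>m\<in>A. r j k * r l m * r j m) \<le> real (card A) * \<rho> ^ 3"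
  proof -
    have "(\<Sum>j\<in>A. \<Sum>k\<in>A. \<Sum>l\<in>A. \<Sum>m\<in>A. r j k * r l m * r j m) = (\<Sum>k\<in>A. \<Sum>j\<in>A. \<Sum>l\<in>A. \<Sum>m\<in>A. r k j * r l m * r j m)"
      by (subst sum.swap) (simp add: sym)
    then show ?thesis using 1 by simp
  qed
  have 4: "(\<Sum>j\<in>A. \<Sum>k\<in>A. \<Sum>l\<in>A. \<Sum>m\<in>A. r j k * r l m * r j l) \<le> real (card A) * \<rho> ^ 3"
  proof -
    have "(\<Sum>j\<in>A. \<Sum>k\<in>A. \<Sum>l\<in>A. \<Sum>m\<in>A. r j k * r l m * r j l) = (\<Sum>k\<in>A. \<Sum>j\<in>A. \<Sum>l\<in>A. \<Sum>m\<in>A. r k j * r l m * r j l)"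
      by (subst sum.swap) (simp add: sym)
    then show ?thesis using chain by simp
  qed
  show ?thesis using 1 chain 3 4 by (simp add: distrib_left sum.distrib)
qed

text \<open>The covariance of P(j,k) and P(l,m) contains a factor R linking {j, k} with {l, m}.
  Together with the weights R_jk and R_lm this makes a chain of three correlations, so the fourfold
  sum is linear in card A instead of quartic.\<close>

lemma Q_variance_bound:
  assumes B: "1 \<le> B" "\<And>i j. i \<in> A \<Longrightarrow> j \<in> A \<Longrightarrow> \<bar>R i j\<bar> \<le> B"
    and \<rho>: "\<And>i. i \<in> A \<Longrightarrow> (\<Sum>j\<in>A. \<bar>R i j\<bar>) \<le> \<rho>" "0 \<le> \<rho>"
  shows "integrable M (\<lambda>\<omega>. (Q \<omega> - q)\<^sup>2)"
    "expectation (\<lambda>\<omega>. (Q \<omega> - q)\<^sup>2) \<le> 9216 * (fact 12 * B ^ 14) * (real (card A) * \<rho> ^ 3)"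
proof -
  have iPP: "integrable M (\<lambda>\<omega>. P x \<omega> * P y \<omega>)" if "x \<in> A \<times> A" "y \<in> A \<times> A" for x y
    using that by (auto intro: expectation_P_mult(1))
  note * = expectation_square_sum[of "A \<times> A" P "\<lambda>x. 4 * R (fst x) (snd x)", OF integrable_P iPP]
  show "integrable M (\<lambda>\<omega>. (Q \<omega> - q)\<^sup>2)"
    using *(1) unfolding Q_def[symmetric] sum_expectation_P .
  define K where "K = fact 12 * B ^ 12"
  have K0: "0 \<le> K" using B(1) by (simp add: K_def)
  define r where "r i j = \<bar>R i j\<bar>" for i j
  have r0: "0 \<le> r i j" for i j by (simp add: r_def)
  \<comment> \<open>Each of the four links occurs at most 3 * 3 = 9 times between the two letter
    lists, and the four covariances of monomials have total weight 1 + 3 + 3 + 9 = 16 up to powers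
    of B; hence 144 = 9 * 16. The factors R_jj and R_ll account for B^2.\<close>
  have cov: "\<bar>expectation (\<lambda>\<omega>. P (j, k) \<omega> * P (l, m) \<omega>) - expectation (P (j, k)) * expectation (P (l, m))\<bar>
      \<le> 144 * B\<^sup>2 * K * (r k m + r k l + r j m + r j l)"
    if A: "j \<in> A" "k \<in> A" "l \<in> A" "m \<in> A" for j k l m
  proof -
    define d where "d = r k m + r k l + r j m + r j l"
    have d0: "0 \<le> d" by (simp add: d_def r_def)
    have Bf: "fact n * B ^ n \<le> K" if "n \<le> 12" for n
      unfolding K_def using that B(1) by (intro mult_mono fact_mono power_increasing) auto
    have cb: "\<bar>mom (L1 @ L2) - mom L1 * mom L2\<bar> \<le> K * (9 * d)"
      if L: "set L1 \<subseteq> A" "set L2 \<subseteq> A" "length L1 + length L2 \<le> 12"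
        and s: "(\<Sum>a\<leftarrow>L1. \<Sum>b\<leftarrow>L2. \<bar>R a b\<bar>) \<le> 9 * d" for L1 L2
    proof -
      have "\<bar>mom (L1 @ L2) - mom L1 * mom L2\<bar>
        \<le> fact (length L1 + length L2) * B ^ (length L1 + length L2) * (\<Sum>a\<leftarrow>L1. \<Sum>b\<leftarrow>L2. \<bar>R a b\<bar>)"
        using L by (intro mom_cov_bound B) auto
      also have "\<dots> \<le> K * (9 * d)"
        by (intro mult_mono Bf L s) (auto intro!: sum_list_nonneg K0)
      finally show ?thesis .
    qed
    define c1 where "c1 = mom ([k, k, k, j, j, j] @ [m, m, m, l, l, l]) - mom [k, k, k, j, j, j] * mom [m, m, m, l, l, l]"
    define c2 where "c2 = mom ([k, k, k, j, j, j] @ [m, m, m, l]) - mom [k, k, k, j, j, j] * mom [m, m, m, l]"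
    define c3 where "c3 = mom ([k, k, k, j] @ [m, m, m, l, l, l]) - mom [k, k, k, j] * mom [m, m, m, l, l, l]"
    define c4 where "c4 = mom ([k, k, k, j] @ [m, m, m, l]) - mom [k, k, k, j] * mom [m, m, m, l]"
    have c: "\<bar>c1\<bar> \<le> K * (9 * d)" "\<bar>c2\<bar> \<le> K * (9 * d)" "\<bar>c3\<bar> \<le> K * (9 * d)" "\<bar>c4\<bar> \<le> K * (9 * d)"
      unfolding c1_def c2_def c3_def c4_def using A r0[of k m] r0[of k l] r0[of j m] r0[of j l]
      by (intro cb; simp add: d_def r_def)+
    have "expectation (\<lambda>\<omega>. P (j, k) \<omega> * P (l, m) \<omega>) - expectation (P (j, k)) * expectation (P (l, m))
      = c1 + 3 * R l l * c2 + 3 * R j j * c3 + 9 * (R j j * R l l) * c4"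
      unfolding expectation_P_mult(2)[OF A] expectation_P[OF A(1,2)] expectation_P[OF A(3,4)] c1_def c2_def c3_def c4_def
      by (simp only: ring_distribs) (simp add: mult_ac)
    moreover have "\<bar>3 * R l l * c2\<bar> \<le> 3 * B * (K * (9 * d))" "\<bar>3 * R j j * c3\<bar> \<le> 3 * B * (K * (9 * d))"
      "\<bar>9 * (R j j * R l l) * c4\<bar> \<le> 9 * (B * B) * (K * (9 * d))"
    proof -
      have mm: "\<bar>u * v\<bar> \<le> U * V" if "\<bar>u\<bar> \<le> U" "\<bar>v\<bar> \<le> V" for u v U V :: real
        unfolding abs_mult by (rule mult_mono) (use that in linarith)+
      have RB: "\<bar>R l l\<bar> \<le> B" "\<bar>R j j\<bar> \<le> B" using B A by auto
      show "\<bar>3 * R l l * c2\<bar> \<le> 3 * B * (K * (9 * d))" "\<bar>3 * R j j * c3\<bar> \<le> 3 * B * (K * (9 * d))"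
        "\<bar>9 * (R j j * R l l) * c4\<bar> \<le> 9 * (B * B) * (K * (9 * d))"
        by (intro mm RB c; simp)+
    qed
    moreover have "K * (9 * d) \<le> B\<^sup>2 * (K * (9 * d))" "3 * B * (K * (9 * d)) \<le> 3 * B\<^sup>2 * (K * (9 * d))"
    proof -
      have "B * 1 \<le> B * B" using B(1) by (intro mult_left_mono) auto
      then have "1 \<le> B\<^sup>2" "B \<le> B\<^sup>2" using B(1) unfolding power2_eq_square by linarith+
      then show "K * (9 * d) \<le> B\<^sup>2 * (K * (9 * d))" "3 * B * (K * (9 * d)) \<le> 3 * B\<^sup>2 * (K * (9 * d))"
        using K0 d0 mult_right_mono[of 1 "B\<^sup>2" "K * (9 * d)"] by (auto intro!: mult_right_mono)
    qed
    moreover have "e = a1 + a2 + a3 + a4 \<Longrightarrow> \<bar>a2\<bar> \<le> b2 \<Longrightarrow> \<bar>a3\<bar> \<le> b3 \<Longrightarrow> \<bar>a4\<bar> \<le> b4 \<Longrightarrow> u \<le> u' \<Longrightarrow> b2 \<le> b2' \<Longrightarrow>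
      b3 \<le> b2' \<Longrightarrow> \<bar>a1\<bar> \<le> u \<Longrightarrow> \<bar>e\<bar> \<le> u' + b2' + b2' + b4"
      for e a1 a2 a3 a4 b2 b3 b4 u u' b2' :: real by linarith
    ultimately have "\<bar>expectation (\<lambda>\<omega>. P (j, k) \<omega> * P (l, m) \<omega>) - expectation (P (j, k)) * expectation (P (l, m))\<bar>
      \<le> B\<^sup>2 * (K * (9 * d)) + 3 * B\<^sup>2 * (K * (9 * d)) + 3 * B\<^sup>2 * (K * (9 * d)) + 9 * (B * B) * (K * (9 * d))"
      using c(1) by blast
    also have "\<dots> = 144 * B\<^sup>2 * K * d" by (simp add: power2_eq_square algebra_simps)
    finally show ?thesis unfolding d_def .
  qed
  have "expectation (\<lambda>\<omega>. (Q \<omega> - q)\<^sup>2) = (\<Sum>x\<in>A \<times> A. \<Sum>y\<in>A \<times> A. 4 * R (fst x) (snd x) * (4 * R (fst y) (snd y))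
      * (expectation (\<lambda>\<omega>. P x \<omega> * P y \<omega>) - expectation (P x) * expectation (P y)))"
    using *(2) unfolding Q_def[symmetric] sum_expectation_P .
  also have "\<dots> \<le> (\<Sum>x\<in>A \<times> A. \<Sum>y\<in>A \<times> A. 4 * r (fst x) (snd x) * (4 * r (fst y) (snd y))
      * (144 * B\<^sup>2 * K * (r (snd x) (snd y) + r (snd x) (fst y) + r (fst x) (snd y) + r (fst x) (fst y))))"
  proof (intro sum_mono)
    fix x y assume "x \<in> A \<times> A" "y \<in> A \<times> A"
    then obtain j k l m where xy: "x = (j, k)" "y = (l, m)" and A: "j \<in> A" "k \<in> A" "l \<in> A" "m \<in> A" by auto
    have "4 * R j k * (4 * R l m) * (expectation (\<lambda>\<omega>. P (j, k) \<omega> * P (l, m) \<omega>) - expectation (P (j, k)) * expectation (P (l, m)))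
      \<le> \<bar>4 * R j k * (4 * R l m) * (expectation (\<lambda>\<omega>. P (j, k) \<omega> * P (l, m) \<omega>) - expectation (P (j, k)) * expectation (P (l, m)))\<bar>"
      by simp
    also have "\<dots> \<le> 4 * r j k * (4 * r l m) * (144 * B\<^sup>2 * K * (r k m + r k l + r j m + r j l))"
      unfolding abs_mult r_def[symmetric]
      using cov[OF A] by (intro mult_mono) (auto simp: r0)
    finally show "4 * R (fst x) (snd x) * (4 * R (fst y) (snd y))
      * (expectation (\<lambda>\<omega>. P x \<omega> * P y \<omega>) - expectation (P x) * expectation (P y)) \<le> 4 * r (fst x) (snd x) * (4 * r (fst y) (snd y))
      * (144 * B\<^sup>2 * K * (r (snd x) (snd y) + r (snd x) (fst y) + r (fst x) (snd y) + r (fst x) (fst y)))"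
      unfolding xy by simp
  qed
  also have "\<dots> = 2304 * B\<^sup>2 * K * (\<Sum>j\<in>A. \<Sum>k\<in>A. \<Sum>l\<in>A. \<Sum>m\<in>A. r j k * r l m * (r k m + r k l + r j m + r j l))"
    by (simp add: sum.cartesian_product' sum_distrib_left mult_ac)
  also have "\<dots> \<le> 2304 * B\<^sup>2 * K * (4 * (real (card A) * \<rho> ^ 3))"
    by (intro mult_left_mono chain_sum_bound \<rho>) (use K0 in \<open>auto simp: r_def R_sym intro: \<rho>\<close>)
  also have "\<dots> = 9216 * (fact 12 * B ^ 14) * (real (card A) * \<rho> ^ 3)"
  proof -
    have "B ^ 14 = B\<^sup>2 * B ^ 12" by (simp flip: power_add)
    then show ?thesis unfolding K_def by simp
  qed
  finally show "expectation (\<lambda>\<omega>. (Q \<omega> - q)\<^sup>2) \<le> 9216 * (fact 12 * B ^ 14) * (real (card A) * \<rho> ^ 3)" .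
qed

text \<open>A quartic monomial in X_j and one in X_k have 4 * 4 pairs of letters and 8 letters in
  all, which explains 16, fact 8 and B^8.\<close>

lemma S_variance_bound:
  assumes B: "1 \<le> B" "\<And>i j. i \<in> A \<Longrightarrow> j \<in> A \<Longrightarrow> \<bar>R i j\<bar> \<le> B"
    and \<rho>: "\<And>i. i \<in> A \<Longrightarrow> (\<Sum>j\<in>A. \<bar>R i j\<bar>) \<le> \<rho>"
  shows "expectation (\<lambda>\<omega>. (S \<omega> - \<mu>)\<^sup>2) \<le> 16 * (fact 8 * B ^ 8) * (real (card A) * \<rho>)"
proof -
  have "expectation (\<lambda>\<omega>. (S \<omega> - \<mu>)\<^sup>2) \<le> (\<Sum>j\<in>A. \<Sum>k\<in>A. 16 * (fact 8 * B ^ 8) * \<bar>R j k\<bar>)"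
    unfolding S_square(2)
  proof (intro sum_mono)
    fix j k assume "j \<in> A" "k \<in> A"
    then have "\<bar>mom ([j, j, j, j] @ [k, k, k, k]) - mom [j, j, j, j] * mom [k, k, k, k]\<bar>
       \<le> fact (length [j, j, j, j] + length [k, k, k, k]) * B ^ (length [j, j, j, j] + length [k, k, k, k])
         * (\<Sum>a\<leftarrow>[j, j, j, j]. \<Sum>b\<leftarrow>[k, k, k, k]. \<bar>R a b\<bar>)"
      by (intro mom_cov_bound B) auto
    also have "\<dots> = 16 * (fact 8 * B ^ 8) * \<bar>R j k\<bar>"
    proof -
      have l: "length [j, j, j, j] + length [k, k, k, k] = 8" by simp
      show ?thesis unfolding l by simp
    qed
    finally show "mom ([j, j, j, j] @ [k, k, k, k]) - mom [j, j, j, j] * mom [k, k, k, k] \<le> 16 * (fact 8 * B ^ 8) * \<bar>R j k\<bar>"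
      by linarith
  qed
  also have "\<dots> = 16 * (fact 8 * B ^ 8) * (\<Sum>j\<in>A. \<Sum>k\<in>A. \<bar>R j k\<bar>)" by (simp add: sum_distrib_left)
  also have "\<dots> \<le> 16 * (fact 8 * B ^ 8) * (\<Sum>j\<in>A. \<rho>)"
    using B(1) by (intro mult_left_mono sum_mono \<rho>) auto
  finally show ?thesis by simp
qed

end

section \<open>Convergence in probability and in distribution\<close>

context prob_space
begin

section \<open>Limit theorem for quartic sums\<close>

lemma gauss_quartic_second_moment:
  fixes X :: "nat \<Rightarrow> 'a \<Rightarrow> real"
  defines "R \<equiv> \<lambda>j k. expectation (\<lambda>\<omega>. X j \<omega> * X k \<omega>)"
  assumes g: "gauss M {..<n} X" and n: "n > 0" and B: "1 \<le> B" "\<And>i j. i < n \<Longrightarrow> j < n \<Longrightarrow> \<bar>R i j\<bar> \<le> B"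
    and \<rho>: "\<And>i. i < n \<Longrightarrow> (\<Sum>j<n. \<bar>R i j\<bar>) \<le> \<rho>"
  defines "T \<equiv> \<lambda>\<omega>. ((\<Sum>j<n. X j \<omega> ^ 4) - (\<Sum>j<n. 3 * (R j j)\<^sup>2)) / sqrt (real n)"
  shows "integrable M (\<lambda>\<omega>. (T \<omega>)\<^sup>2)"
    "expectation (\<lambda>\<omega>. (T \<omega>)\<^sup>2) \<le> 16 * (fact 8 * B ^ 8) * \<rho>"
proof -
  interpret G: gauss_family M "{..<n}" X by unfold_locales (rule g)
  have T: "T \<omega> = (G.S \<omega> - G.\<mu>) / sqrt (real n)" for \<omega>
    unfolding T_def G.S_def G.\<mu>_def R_def G.R_def ..
  have RR: "R = G.R" unfolding R_def G.R_def[abs_def] ..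
  have sq: "(T \<omega>)\<^sup>2 = (G.S \<omega> - G.\<mu>)\<^sup>2 / real n" for \<omega>
    unfolding T by (simp add: power_divide)
  show "integrable M (\<lambda>\<omega>. (T \<omega>)\<^sup>2)" unfolding sq using G.S_square(1) by simp
  have "expectation (\<lambda>\<omega>. (G.S \<omega> - G.\<mu>)\<^sup>2) \<le> 16 * (fact 8 * B ^ 8) * (real (card {..<n}) * \<rho>)"
    by (rule G.S_variance_bound) (use B \<rho> in \<open>auto simp: RR\<close>)
  then show "expectation (\<lambda>\<omega>. (T \<omega>)\<^sup>2) \<le> 16 * (fact 8 * B ^ 8) * \<rho>"
    unfolding sq using n by (simp add: field_simps)
qed

text \<open>At \<tau> = t / sqrt n the factor \<tau>^2 contributes 1 / n, while the standard
  deviation of \<open>Q\<close> is at most a multiple of sqrt n; the rate 1 / sqrt n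
  remains.\<close>

lemma gauss_quartic_char:
  fixes X :: "nat \<Rightarrow> 'a \<Rightarrow> real"
  defines "R \<equiv> \<lambda>j k. expectation (\<lambda>\<omega>. X j \<omega> * X k \<omega>)"
  assumes g: "gauss M {..<n} X" and n: "n > 0" and B: "1 \<le> B" "\<And>i j. i < n \<Longrightarrow> j < n \<Longrightarrow> \<bar>R i j\<bar> \<le> B"
    and \<rho>: "\<And>i. i < n \<Longrightarrow> (\<Sum>j<n. \<bar>R i j\<bar>) \<le> \<rho>" "0 \<le> \<rho>"
  defines "T \<equiv> \<lambda>\<omega>. ((\<Sum>j<n. X j \<omega> ^ 4) - (\<Sum>j<n. 3 * (R j j)\<^sup>2)) / sqrt (real n)"
    and "q \<equiv> (\<Sum>j<n. \<Sum>k<n. 72 * R j j * R k k * (R j k)\<^sup>2 + 24 * R j k ^ 4)"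
  shows "norm (expectation (\<lambda>\<omega>. cis (t * T \<omega>)) - of_real (exp (- (q / n) * t\<^sup>2 / 2)))
    \<le> t\<^sup>2 * sqrt (9216 * (fact 12 * B ^ 14) * \<rho> ^ 3) / sqrt n"
proof -
  interpret G: gauss_family M "{..<n}" X by unfold_locales (rule g)
  have RR: "R = G.R" unfolding R_def G.R_def[abs_def] ..
  have q: "q = G.q" unfolding q_def G.q_def RR ..
  have q0: "0 \<le> G.q" unfolding G.q_def
    by (intro sum_nonneg add_nonneg_nonneg mult_nonneg_nonneg) (auto simp: G.R_def)
  have T: "t * T \<omega> = (t / sqrt n) * (G.S \<omega> - G.\<mu>)" for \<omega>
    unfolding T_def G.S_def G.\<mu>_def R_def G.R_def by simp
  let ?C = "9216 * (fact 12 * B ^ 14)"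
  have V: "integrable M (\<lambda>\<omega>. (G.Q \<omega> - G.q)\<^sup>2)"
    "expectation (\<lambda>\<omega>. (G.Q \<omega> - G.q)\<^sup>2) \<le> ?C * (real (card {..<n}) * \<rho> ^ 3)"
    by (rule G.Q_variance_bound; use B \<rho> in \<open>auto simp: RR\<close>)+
  have "norm (G.char_S (t / sqrt n) - exp (- of_real (G.q * (t / sqrt n)\<^sup>2 / 2)))
     \<le> (t / sqrt n)\<^sup>2 * sqrt (expectation (\<lambda>\<omega>. (G.Q \<omega> - G.q)\<^sup>2))"
    by (rule G.char_S_approx[OF q0 V(1)])
  also have "\<dots> \<le> (t / sqrt n)\<^sup>2 * sqrt (?C * \<rho> ^ 3 * n)"
    using V(2) by (intro mult_left_mono real_sqrt_le_mono) (auto simp: mult_ac)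
  also have "\<dots> = t\<^sup>2 * sqrt (?C * \<rho> ^ 3) / sqrt n"
    using n by (simp add: real_sqrt_mult power_divide field_simps)
  finally show ?thesis
    unfolding G.char_S_def T q using n
    by (simp add: power_divide mult_ac exp_of_real[symmetric])
qed

lemma gauss_quartic_clt:
  fixes X :: "nat \<Rightarrow> nat \<Rightarrow> 'a \<Rightarrow> real"
  defines "R \<equiv> \<lambda>n j k. expectation (\<lambda>\<omega>. X n j \<omega> * X n k \<omega>)"
  assumes g: "\<And>n. n > 0 \<Longrightarrow> gauss M {..<n} (X n)"
    and B: "1 \<le> B" "\<And>n i j. i < n \<Longrightarrow> j < n \<Longrightarrow> \<bar>R n i j\<bar> \<le> B"
    and \<rho>: "\<And>n i. i < n \<Longrightarrow> (\<Sum>j<n. \<bar>R n i j\<bar>) \<le> \<rho>" "0 \<le> \<rho>"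
    and v: "(\<lambda>n. (\<Sum>j<n. \<Sum>k<n. 72 * R n j j * R n k k * (R n j k)\<^sup>2 + 24 * R n j k ^ 4) / real n) \<longlonglongrightarrow> v"
  shows "(\<lambda>n. expectation (\<lambda>\<omega>. cis (t * (((\<Sum>j<n. X n j \<omega> ^ 4) - (\<Sum>j<n. 3 * (R n j j)\<^sup>2)) / sqrt (real n)))))
     \<longlonglongrightarrow> of_real (exp (- v * t\<^sup>2 / 2))"
proof (rule Lim_transform)
  let ?q = "\<lambda>n. (\<Sum>j<n. \<Sum>k<n. 72 * R n j j * R n k k * (R n j k)\<^sup>2 + 24 * R n j k ^ 4) / real n"
  show "(\<lambda>n. of_real (exp (- (?q n) * t\<^sup>2 / 2))) \<longlonglongrightarrow> complex_of_real (exp (- v * t\<^sup>2 / 2))"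
    by (intro tendsto_intros v) auto
  let ?e = "\<lambda>n. t\<^sup>2 * sqrt (9216 * (fact 12 * B ^ 14) * \<rho> ^ 3) / sqrt (real n)"
  have e: "?e \<longlonglongrightarrow> 0" by real_asymp
  have "norm (expectation (\<lambda>\<omega>. cis (t * (((\<Sum>j<n. X n j \<omega> ^ 4) - (\<Sum>j<n. 3 * (R n j j)\<^sup>2)) / sqrt (real n))))
     - of_real (exp (- (?q n) * t\<^sup>2 / 2))) \<le> ?e n" if "n > 0" for n
    using gauss_quartic_char[OF g[OF that] that B(1), where \<rho> = \<rho> and t = t] B(2)[of _ n] \<rho>(1)[of _ n] \<rho>(2)
    unfolding R_def by blast
  then have "\<forall>\<^sub>F n in sequentially. norm (expectation (\<lambda>\<omega>. cis (t * (((\<Sum>j<n. X n j \<omega> ^ 4) - (\<Sum>j<n. 3 * (R n j j)\<^sup>2)) / sqrt (real n))))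
     - of_real (exp (- (?q n) * t\<^sup>2 / 2))) \<le> ?e n"
    using eventually_gt_at_top[of 0] by (rule eventually_mono[rotated])
  then show "(\<lambda>n. expectation (\<lambda>\<omega>. cis (t * (((\<Sum>j<n. X n j \<omega> ^ 4) - (\<Sum>j<n. 3 * (R n j j)\<^sup>2)) / sqrt (real n))))
     - of_real (exp (- (?q n) * t\<^sup>2 / 2))) \<longlonglongrightarrow> 0"
    using e by (rule Lim_null_comparison)
qed

section \<open>From characteristic functions and second moments to convergence\<close>

lemma conv_in_distr_normalI:
  assumes [measurable]: "\<And>n. Y n \<in> borel_measurable M" and v: "v > 0"
    and c: "\<And>t. (\<lambda>n. expectation (\<lambda>\<omega>. cis (t * Y n \<omega>))) \<longlonglongrightarrow> of_real (exp (- v * t\<^sup>2 / 2))"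
  shows "conv_in_distr_normal M Y v"
  unfolding conv_in_distr_normal_def
proof (rule levy_continuity)
  show "real_distribution (distr M borel (Y n))" for n
    by (rule real_distribution_distr) simp
  interpret N: prob_space std_normal_distribution
    using real_dist_normal_dist unfolding real_distribution_def by simp
  \<comment> \<open>The law is written as the image of the standard normal law under scaling, which
    reduces its characteristic function to the standard one.\<close>
  have N: "density lborel (normal_density 0 (sqrt v)) = distr std_normal_distribution borel (\<lambda>x. sqrt v * x)"
  proof -
    have "distributed std_normal_distribution lborel (\<lambda>x. x) (\<lambda>x. ennreal (std_normal_density x))"
      unfolding distributed_def by (auto simp: distr_id2)
    from N.normal_density_affine[OF this, of "sqrt v" 0] v
    have "distributed std_normal_distribution lborel (\<lambda>x. sqrt v * x) (\<lambda>x. ennreal (normal_density 0 (sqrt v) x))" by simp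
    then have "distr std_normal_distribution lborel (\<lambda>x. sqrt v * x) = density lborel (normal_density 0 (sqrt v))"
      by (rule distributed_distr_eq_density)
    moreover have "distr std_normal_distribution lborel (\<lambda>x. sqrt v * x) = distr std_normal_distribution borel (\<lambda>x. sqrt v * x)"
      by (rule distr_cong) auto
    ultimately show ?thesis by simp
  qed
  show "real_distribution (density lborel (normal_density 0 (sqrt v)))"
    unfolding N by (rule N.real_distribution_distr) simp
  fix t
  have "char (distr M borel (Y n)) t = expectation (\<lambda>\<omega>. cis (t * Y n \<omega>))" for n
    unfolding char_def by (subst integral_distr) (auto simp: cis_conv_exp)
  moreover have "char (density lborel (normal_density 0 (sqrt v))) t = of_real (exp (- v * t\<^sup>2 / 2))"
  proof -
    have "char (density lborel (normal_density 0 (sqrt v))) t = char std_normal_distribution (t * sqrt v)"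
      unfolding N char_def by (subst integral_distr) (auto simp: mult.assoc)
    then show ?thesis using v by (simp add: char_std_normal_distribution power_mult_distrib mult.commute)
  qed
  ultimately show "(\<lambda>n. char (distr M borel (Y n)) t) \<longlonglongrightarrow> char (density lborel (normal_density 0 (sqrt v))) t"
    using c by simp
qed

lemma char_shift_tendsto:
  assumes c: "(\<lambda>n. expectation (\<lambda>\<omega>. cis (t * T n \<omega>))) \<longlonglongrightarrow> l" and e: "e \<longlonglongrightarrow> 0"
  shows "(\<lambda>n. expectation (\<lambda>\<omega>. cis (t * (T n \<omega> + e n)))) \<longlonglongrightarrow> l"
proof -
  have "expectation (\<lambda>\<omega>. cis (t * (T n \<omega> + e n))) = cis (t * e n) * expectation (\<lambda>\<omega>. cis (t * T n \<omega>))" for n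
    unfolding integral_mult_right_zero[symmetric] by (simp add: cis_mult algebra_simps)
  moreover have "(\<lambda>n. cis (t * e n)) \<longlonglongrightarrow> cis (t * 0)"
    by (intro tendsto_intros e)
  ultimately show ?thesis using tendsto_mult[OF _ c, of "\<lambda>n. cis (t * e n)" 1] by simp
qed

lemma prob_abs_gt_le:
  fixes Y :: "'a \<Rightarrow> real"
  assumes [measurable]: "Y \<in> borel_measurable M" and i: "integrable M (\<lambda>\<omega>. (Y \<omega>)\<^sup>2)" and \<epsilon>: "\<epsilon> > 0"
  shows "prob {\<omega> \<in> space M. \<epsilon> < \<bar>Y \<omega>\<bar>} \<le> expectation (\<lambda>\<omega>. (Y \<omega>)\<^sup>2) / \<epsilon>\<^sup>2"
proof -
  have "prob {\<omega> \<in> space M. \<epsilon> < \<bar>Y \<omega>\<bar>} = expectation (indicator {\<omega> \<in> space M. \<epsilon> < \<bar>Y \<omega>\<bar>})"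
    by (simp add: Int_absorb1 subset_eq)
  also have "\<dots> \<le> expectation (\<lambda>\<omega>. (Y \<omega>)\<^sup>2 / \<epsilon>\<^sup>2)"
  proof (rule integral_mono)
    fix \<omega> show "indicator {\<omega> \<in> space M. \<epsilon> < \<bar>Y \<omega>\<bar>} \<omega> \<le> (Y \<omega>)\<^sup>2 / \<epsilon>\<^sup>2"
    proof (cases "\<epsilon> < \<bar>Y \<omega>\<bar>")
      case True
      then have "\<epsilon>\<^sup>2 \<le> (Y \<omega>)\<^sup>2" using \<epsilon> by (intro abs_le_square_iff[THEN iffD1]) auto
      then show ?thesis using \<epsilon> by (auto simp: indicator_def)
    qed auto
  qed (use i in \<open>auto intro!: integrable_real_indicator simp: emeasure_eq_measure\<close>)
  finally show ?thesis by simp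
qed

lemma conv_in_prob_of_second_moment:
  assumes [measurable]: "\<And>n. T n \<in> borel_measurable M"
    and i: "\<And>n. n > 0 \<Longrightarrow> integrable M (\<lambda>\<omega>. (T n \<omega>)\<^sup>2)"
    and C: "\<And>n. n > 0 \<Longrightarrow> expectation (\<lambda>\<omega>. (T n \<omega>)\<^sup>2) \<le> C"
    and a: "a \<longlonglongrightarrow> 0" and Y: "\<And>n \<omega>. n > 0 \<Longrightarrow> Y n \<omega> - L = a n * T n \<omega>"
  shows "conv_in_prob M Y L"
  unfolding conv_in_prob_def
proof (intro allI impI)
  fix \<epsilon> :: real assume \<epsilon>: "\<epsilon> > 0"
  have le: "prob {\<omega> \<in> space M. \<epsilon> < \<bar>Y n \<omega> - L\<bar>} \<le> (a n)\<^sup>2 * C / \<epsilon>\<^sup>2" if n: "n > 0" for n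
  proof -
    have sq: "(a n * T n \<omega>)\<^sup>2 = (a n)\<^sup>2 * (T n \<omega>)\<^sup>2" for \<omega> by (rule power_mult_distrib)
    have "prob {\<omega> \<in> space M. \<epsilon> < \<bar>Y n \<omega> - L\<bar>} = prob {\<omega> \<in> space M. \<epsilon> < \<bar>a n * T n \<omega>\<bar>}"
      by (simp add: Y[OF n])
    also have "\<dots> \<le> expectation (\<lambda>\<omega>. (a n * T n \<omega>)\<^sup>2) / \<epsilon>\<^sup>2"
      by (rule prob_abs_gt_le[OF _ _ \<epsilon>]) (use i[OF n] in \<open>auto simp: sq\<close>)
    also have "\<dots> \<le> (a n)\<^sup>2 * C / \<epsilon>\<^sup>2"
      unfolding sq integral_mult_right_zero by (intro divide_right_mono mult_left_mono C n) auto
    finally show ?thesis .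
  qed
  have lim: "(\<lambda>n. (a n)\<^sup>2 * C / \<epsilon>\<^sup>2) \<longlonglongrightarrow> 0"
    using \<epsilon> by (auto intro!: tendsto_eq_intros a)
  show "(\<lambda>n. prob {\<omega> \<in> space M. \<epsilon> < \<bar>Y n \<omega> - L\<bar>}) \<longlonglongrightarrow> 0"
    by (rule tendsto_sandwich[OF always_eventually eventually_mono[OF eventually_gt_at_top[of 0] le] tendsto_const lim]) simp
qed

text \<open>The map may vary with n as long as it is close to L near u0 for all large n. This
  absorbs the deterministic prefactors of the estimators.\<close>

lemma conv_in_prob_compose:
  assumes [measurable]: "\<And>n. U n \<in> borel_measurable M" and U: "conv_in_prob M U u0"
    and f: "\<And>\<epsilon>. \<epsilon> > 0 \<Longrightarrow> \<exists>\<eta>>0. \<forall>\<^sub>F n in sequentially. \<forall>u. \<bar>u - u0\<bar> \<le> \<eta> \<longrightarrow> \<bar>f n u - L\<bar> \<le> \<epsilon>"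
    and Y: "\<And>n \<omega>. n > 0 \<Longrightarrow> Y n \<omega> = f n (U n \<omega>)"
  shows "conv_in_prob M Y L"
  unfolding conv_in_prob_def
proof (intro allI impI)
  fix \<epsilon> :: real assume "\<epsilon> > 0"
  from f[OF this] obtain \<eta> where \<eta>: "\<eta> > 0" "\<forall>\<^sub>F n in sequentially. \<forall>u. \<bar>u - u0\<bar> \<le> \<eta> \<longrightarrow> \<bar>f n u - L\<bar> \<le> \<epsilon>" by blast
  have le: "\<forall>\<^sub>F n in sequentially. prob {\<omega> \<in> space M. \<epsilon> < \<bar>Y n \<omega> - L\<bar>} \<le> prob {\<omega> \<in> space M. \<eta> < \<bar>U n \<omega> - u0\<bar>}"
    using \<eta>(2) eventually_gt_at_top[of 0]
  proof eventually_elim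
    case (elim n)
    show ?case
    proof (rule finite_measure_mono)
      show "{\<omega> \<in> space M. \<epsilon> < \<bar>Y n \<omega> - L\<bar>} \<subseteq> {\<omega> \<in> space M. \<eta> < \<bar>U n \<omega> - u0\<bar>}"
      proof safe
        fix \<omega> assume "\<epsilon> < \<bar>Y n \<omega> - L\<bar>"
        then have "\<not> \<bar>f n (U n \<omega>) - L\<bar> \<le> \<epsilon>" using Y[OF \<open>0 < n\<close>, of \<omega>] by simp
        then have "\<not> \<bar>U n \<omega> - u0\<bar> \<le> \<eta>" using elim(1) by blast
        then show "\<eta> < \<bar>U n \<omega> - u0\<bar>" by simp
      qed
    qed simp
  qed
  have lim: "(\<lambda>n. prob {\<omega> \<in> space M. \<eta> < \<bar>U n \<omega> - u0\<bar>}) \<longlonglongrightarrow> 0"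
    using U \<eta>(1) unfolding conv_in_prob_def by blast
  show "(\<lambda>n. prob {\<omega> \<in> space M. \<epsilon> < \<bar>Y n \<omega> - L\<bar>}) \<longlonglongrightarrow> 0"
    by (rule tendsto_sandwich[OF always_eventually le tendsto_const lim]) simp
qed

lemma norm_cis_diff_le: "norm (cis a - cis b) \<le> \<bar>a - b\<bar>"
proof -
  have "cis a - cis b = cis b * (cis (a - b) - 1)" by (simp add: cis_mult algebra_simps)
  moreover have "norm (cis (a - b) - 1) \<le> \<bar>a - b\<bar>"
    using iexp_approx1[of "a - b" 0] by (simp add: cis_conv_exp)
  ultimately show ?thesis by (simp add: norm_mult)
qed

text \<open>A Slutsky argument with relative error. Where U n is near u0, Y n differs from c T n by
  at most \<epsilon> |T n|, and E |T n| \<le> sqrt C turns this into a bound for the characteristic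
  functions; elsewhere the integrand is at most 2 on an event of vanishing probability.\<close>

lemma char_slutsky:
  assumes mU [measurable]: "\<And>n. U n \<in> borel_measurable M" and mT [measurable]: "\<And>n. T n \<in> borel_measurable M"
    and mY [measurable]: "\<And>n. Y n \<in> borel_measurable M"
    and U: "conv_in_prob M U u0"
    and i: "\<And>n. n > 0 \<Longrightarrow> integrable M (\<lambda>\<omega>. (T n \<omega>)\<^sup>2)"
    and C: "\<And>n. n > 0 \<Longrightarrow> expectation (\<lambda>\<omega>. (T n \<omega>)\<^sup>2) \<le> C"
    and g: "\<And>\<epsilon>. \<epsilon> > 0 \<Longrightarrow> \<exists>\<eta>>0. \<forall>\<^sub>F n in sequentially. \<forall>\<omega>\<in>space M. \<bar>U n \<omega> - u0\<bar> \<le> \<eta> \<longrightarrow>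
      \<bar>Y n \<omega> - c * T n \<omega>\<bar> \<le> \<epsilon> * \<bar>T n \<omega>\<bar>"
    and T: "\<And>t. (\<lambda>n. expectation (\<lambda>\<omega>. cis (t * T n \<omega>))) \<longlonglongrightarrow> of_real (exp (- v * t\<^sup>2 / 2))"
  shows "(\<lambda>n. expectation (\<lambda>\<omega>. cis (t * Y n \<omega>))) \<longlonglongrightarrow> of_real (exp (- (c\<^sup>2 * v) * t\<^sup>2 / 2))"
proof (rule Lim_transform)
  show "(\<lambda>n. expectation (\<lambda>\<omega>. cis ((t * c) * T n \<omega>))) \<longlonglongrightarrow> of_real (exp (- (c\<^sup>2 * v) * t\<^sup>2 / 2))"
    using T[of "t * c"] by (simp add: power_mult_distrib mult_ac)
  have ic: "integrable M (\<lambda>\<omega>. cis (Z \<omega>))" if "Z \<in> borel_measurable M" for Z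
    by (rule integrable_const_bound[where B = 1]) (use that in auto)
  show "(\<lambda>n. expectation (\<lambda>\<omega>. cis (t * Y n \<omega>)) - expectation (\<lambda>\<omega>. cis ((t * c) * T n \<omega>))) \<longlonglongrightarrow> 0"
  proof (rule LIMSEQ_I)
    fix r :: real assume r: "r > 0"
    have "0 \<le> expectation (\<lambda>\<omega>. (T 1 \<omega>)\<^sup>2)" by simp
    also have "\<dots> \<le> C" by (rule C) simp
    finally have C0: "0 \<le> C" .
    \<comment> \<open>Chosen so that the good event contributes at most r / 2; the bad event, of
      probability below r / 4, contributes less than the other half.\<close>
    define \<epsilon> where "\<epsilon> = r / (2 * (\<bar>t\<bar> * sqrt C + 1))"
    have den: "0 < \<bar>t\<bar> * sqrt C + 1" using C0 by (intro add_nonneg_pos) auto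
    have \<epsilon>: "\<epsilon> > 0" using r den by (simp add: \<epsilon>_def)
    have "\<bar>t\<bar> * sqrt C * r \<le> (\<bar>t\<bar> * sqrt C + 1) * r" using r by (intro mult_right_mono) auto
    then have \<epsilon>2: "\<bar>t\<bar> * \<epsilon> * sqrt C \<le> r / 2" using den by (simp add: \<epsilon>_def field_simps)
    from g[OF \<epsilon>] obtain \<eta> where \<eta>: "\<eta> > 0" and ev: "\<forall>\<^sub>F n in sequentially. \<forall>\<omega>\<in>space M. \<bar>U n \<omega> - u0\<bar> \<le> \<eta> \<longrightarrow>
      \<bar>Y n \<omega> - c * T n \<omega>\<bar> \<le> \<epsilon> * \<bar>T n \<omega>\<bar>" by blast
    have "(\<lambda>n. prob {\<omega> \<in> space M. \<eta> < \<bar>U n \<omega> - u0\<bar>}) \<longlonglongrightarrow> 0" using U \<eta> unfolding conv_in_prob_def by blast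
    then have "\<forall>\<^sub>F n in sequentially. prob {\<omega> \<in> space M. \<eta> < \<bar>U n \<omega> - u0\<bar>} < r / 4"
      using r by (intro order_tendstoD(2)[of _ 0]) auto
    with ev eventually_gt_at_top[of 0]
    have "\<forall>\<^sub>F n in sequentially. norm (expectation (\<lambda>\<omega>. cis (t * Y n \<omega>)) - expectation (\<lambda>\<omega>. cis ((t * c) * T n \<omega>)) - 0) < r"
    proof eventually_elim
      case (elim n)
      let ?E = "{\<omega> \<in> space M. \<eta> < \<bar>U n \<omega> - u0\<bar>}"
      have iT: "integrable M (T n)" and bT: "expectation (\<lambda>\<omega>. \<bar>T n \<omega>\<bar>) \<le> sqrt C"
        using expectation_abs_le_sqrt[OF mT i[OF \<open>0 < n\<close>]] real_sqrt_le_mono[OF C[OF \<open>0 < n\<close>]]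
        by (auto intro: order_trans)
      have "norm (expectation (\<lambda>\<omega>. cis (t * Y n \<omega>)) - expectation (\<lambda>\<omega>. cis ((t * c) * T n \<omega>)))
        = norm (expectation (\<lambda>\<omega>. cis (t * Y n \<omega>) - cis ((t * c) * T n \<omega>)))"
        by (subst Bochner_Integration.integral_diff) (auto intro!: ic)
      also have "\<dots> \<le> expectation (\<lambda>\<omega>. norm (cis (t * Y n \<omega>) - cis ((t * c) * T n \<omega>)))"
        by (rule integral_norm_bound)
      also have "\<dots> \<le> expectation (\<lambda>\<omega>. \<bar>t\<bar> * \<epsilon> * \<bar>T n \<omega>\<bar> + 2 * indicator ?E \<omega>)"
      proof (rule integral_mono)
        fix \<omega> assume \<omega>: "\<omega> \<in> space M"
        show "norm (cis (t * Y n \<omega>) - cis ((t * c) * T n \<omega>)) \<le> \<bar>t\<bar> * \<epsilon> * \<bar>T n \<omega>\<bar> + 2 * indicator ?E \<omega>"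
        proof (cases "\<eta> < \<bar>U n \<omega> - u0\<bar>")
          case True
          have "norm (cis (t * Y n \<omega>) - cis ((t * c) * T n \<omega>)) \<le> norm (cis (t * Y n \<omega>)) + norm (cis ((t * c) * T n \<omega>))"
            by (rule norm_triangle_ineq4)
          also have "\<dots> = 2" by simp
          also have "\<dots> \<le> \<bar>t\<bar> * \<epsilon> * \<bar>T n \<omega>\<bar> + 2 * indicator ?E \<omega>" using True \<omega> \<epsilon> by simp
          finally show ?thesis .
        next
          case False
          then have *: "\<bar>Y n \<omega> - c * T n \<omega>\<bar> \<le> \<epsilon> * \<bar>T n \<omega>\<bar>" using elim \<omega> by auto
          have "norm (cis (t * Y n \<omega>) - cis ((t * c) * T n \<omega>)) \<le> \<bar>t * Y n \<omega> - (t * c) * T n \<omega>\<bar>"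
            by (rule norm_cis_diff_le)
          also have "\<dots> = \<bar>t\<bar> * \<bar>Y n \<omega> - c * T n \<omega>\<bar>" by (simp add: abs_mult[symmetric] algebra_simps)
          also have "\<dots> \<le> \<bar>t\<bar> * (\<epsilon> * \<bar>T n \<omega>\<bar>)" by (rule mult_left_mono[OF *]) simp
          finally show ?thesis using False by simp
        qed
      qed (auto intro!: ic integrable_norm Bochner_Integration.integrable_diff Bochner_Integration.integrable_add
          integrable_mult_right iT integrable_abs integrable_real_indicator simp: emeasure_eq_measure)
      also have "\<dots> = \<bar>t\<bar> * \<epsilon> * expectation (\<lambda>\<omega>. \<bar>T n \<omega>\<bar>) + 2 * prob ?E"
        using iT by (subst Bochner_Integration.integral_add)
          (auto intro!: integrable_mult_right integrable_real_indicator simp: emeasure_eq_measure Int_absorb1 subset_eq)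
      also have "\<dots> \<le> \<bar>t\<bar> * \<epsilon> * sqrt C + 2 * prob ?E"
        using bT \<epsilon> by (intro add_right_mono mult_left_mono) auto
      also have "\<dots> < r" using \<epsilon>2 elim by linarith
      finally show ?case by simp
    qed
    then show "\<exists>no. \<forall>n\<ge>no. norm (expectation (\<lambda>\<omega>. cis (t * Y n \<omega>)) - expectation (\<lambda>\<omega>. cis ((t * c) * T n \<omega>)) - 0) < r"
      by (simp add: eventually_sequentially)
  qed
qed

end

section \<open>Brownian motion and the Fourier modes\<close>

text \<open>Path properties such as w 0 = 0 hold only on \<open>space M\<close>, so families have to
  be identified there rather than everywhere.\<close>

lemma gauss_cong:
  assumes "\<And>j \<omega>. \<omega> \<in> space M \<Longrightarrow> X j \<omega> = Y j \<omega>"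
  shows "gauss M A X \<longleftrightarrow> gauss M A Y"
proof -
  have eq: "(\<lambda>j. X j \<omega>) = (\<lambda>j. Y j \<omega>)" if "\<omega> \<in> space M" for \<omega> using assms[OF that] by auto
  have 1: "X j \<in> borel_measurable M \<longleftrightarrow> Y j \<in> borel_measurable M" for j
    by (rule measurable_cong) (rule assms)
  have 2: "integrable M (\<lambda>\<omega>. (1 + (\<Sum>j\<in>A. \<bar>X j \<omega>\<bar>)) ^ p) \<longleftrightarrow> integrable M (\<lambda>\<omega>. (1 + (\<Sum>j\<in>A. \<bar>Y j \<omega>\<bar>)) ^ p)" for p
    by (rule Bochner_Integration.integrable_cong) (auto simp: assms)
  have 3: "(LINT \<omega>|M. of_real (X i \<omega>) * F (\<lambda>j. X j \<omega>)) = (LINT \<omega>|M. of_real (Y i \<omega>) * F (\<lambda>j. Y j \<omega>))" for F :: "_ \<Rightarrow> complex" and i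
    by (rule Bochner_Integration.integral_cong) (auto simp: assms eq)
  have 4: "(LINT \<omega>|M. X i \<omega> * X j \<omega>) = (LINT \<omega>|M. Y i \<omega> * Y j \<omega>)" for i j
    by (rule Bochner_Integration.integral_cong) (auto simp: assms)
  have 5: "(LINT \<omega>|M. D j (\<lambda>j. X j \<omega>)) = (LINT \<omega>|M. D j (\<lambda>j. Y j \<omega>))" for D :: "_ \<Rightarrow> _ \<Rightarrow> complex" and j
    by (rule Bochner_Integration.integral_cong) (auto simp: eq)
  show ?thesis unfolding gauss_def 1 2 3 4 5 ..
qed

context prob_space
begin

lemma gauss_zero: "finite A \<Longrightarrow> gauss M A (\<lambda>j \<omega>. 0)"
  unfolding gauss_def by simp

text \<open>The variables are added one at a time as rank one families; a partial family and the
  next variable are functions of disjoint coordinates of an independent family. The value 0 outside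
  the range matters because \<open>gauss\<close> demands measurability at every index.\<close>

lemma gauss_indep_normal:
  fixes \<xi> :: "nat \<Rightarrow> 'a \<Rightarrow> real"
  assumes ind: "indep_vars (\<lambda>_. borel) \<xi> {..<m}"
    and N: "\<And>l. l < m \<Longrightarrow> s l > 0 \<and> distributed M lborel (\<xi> l) (\<lambda>y. ennreal (normal_density 0 (s l) y))"
  shows "gauss M {..<m} (\<lambda>l \<omega>. if l < m then \<xi> l \<omega> else 0)"
proof -
  have "gauss M {..<m} (\<lambda>l \<omega>. if l < p then \<xi> l \<omega> else 0)" if "p \<le> m" for p
    using that
  proof (induction p)
    case 0
    show ?case by (simp add: gauss_zero)
  next
    case (Suc p)
    have 1: "gauss M {..<m} (\<lambda>l \<omega>. (if l = p then 1 else 0) * \<xi> p \<omega>)"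
      using N[of p] Suc.prems by (intro gauss_normal) auto
    have r: "indep_var (PiM {..<p} (\<lambda>_. borel)) (\<lambda>\<omega>. restrict (\<lambda>i. \<xi> i \<omega>) {..<p}) (PiM {p} (\<lambda>_. borel)) (\<lambda>\<omega>. restrict (\<lambda>i. \<xi> i \<omega>) {p})"
      by (rule indep_var_restrict[OF ind]) (use Suc.prems in auto)
    have "indep_var borel ((\<lambda>z l. if l < p then z l else 0) \<circ> (\<lambda>\<omega>. restrict (\<lambda>i. \<xi> i \<omega>) {..<p}))
        borel ((\<lambda>z l. (if l = p then 1 else 0) * z p) \<circ> (\<lambda>\<omega>. restrict (\<lambda>i. \<xi> i \<omega>) {p}))"
    proof (rule indep_var_compose[OF r])
      show "(\<lambda>z l. if l < p then z l else 0) \<in> measurable (PiM {..<p} (\<lambda>_. borel)) (borel :: (nat \<Rightarrow> real) measure)"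
      proof (rule measurable_coordinatewise_then_product)
        fix l show "(\<lambda>z. if l < p then z l else 0) \<in> borel_measurable (PiM {..<p} (\<lambda>_. borel :: real measure))"
          by (cases "l < p") auto
      qed
      show "(\<lambda>z l. (if l = p then 1 else 0) * z p) \<in> measurable (PiM {p} (\<lambda>_. borel)) (borel :: (nat \<Rightarrow> real) measure)"
        by (rule measurable_coordinatewise_then_product) auto
    qed
    moreover have "(\<lambda>z l. if l < p then z l else 0) \<circ> (\<lambda>\<omega>. restrict (\<lambda>i. \<xi> i \<omega>) {..<p}) = (\<lambda>\<omega> l. if l < p then \<xi> l \<omega> else 0)"
      by (auto simp: fun_eq_iff)
    moreover have "(\<lambda>z l. (if l = p then 1 else 0) * z p) \<circ> (\<lambda>\<omega>. restrict (\<lambda>i. \<xi> i \<omega>) {p}) = (\<lambda>\<omega> l. (if l = p then 1 else 0) * \<xi> p \<omega>)"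
      by (auto simp: fun_eq_iff)
    ultimately have "indep_var borel (\<lambda>\<omega> l. if l < p then \<xi> l \<omega> else 0) borel (\<lambda>\<omega> l. (if l = p then 1 else 0) * \<xi> p \<omega>)"
      by simp
    from gauss_add_indep(1)[OF Suc.IH 1 this] Suc.prems
    have "gauss M {..<m} (\<lambda>l \<omega>. (if l < p then \<xi> l \<omega> else 0) + (if l = p then 1 else 0) * \<xi> p \<omega>)" by simp
    moreover have "(\<lambda>l \<omega>. (if l < p then \<xi> l \<omega> else 0) + (if l = p then 1 else 0) * \<xi> p \<omega>) = (\<lambda>l \<omega>. if l < Suc p then \<xi> l \<omega> else 0)"
      by (auto simp: fun_eq_iff less_Suc_eq)
    ultimately show ?case by simp
  qed
  then show ?thesis by blast
qed

text \<open>Each w (r i) is the sum of the increments between the sorted times below r i, hence a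
  linear image with a 0-1 matrix of independent normal variables.\<close>

lemma std_BM_gauss:
  fixes r :: "'i::countable \<Rightarrow> real"
  assumes BM: "std_BM M w" and A: "finite A" and r: "\<And>i. i \<in> A \<Longrightarrow> 0 \<le> r i"
  shows "gauss M A (\<lambda>i \<omega>. if i \<in> A then w (r i) \<omega> else 0)"
proof -
  \<comment> \<open>Including 0 lets the telescoping start at w 0 = 0; passing through a set merges
    equal times, so every increment has positive variance.\<close>
  define xs where "xs = sorted_list_of_set (insert 0 (r ` A))"
  define m where "m = length xs - 1"
  have fin: "finite (insert 0 (r ` A))" using A by simp
  have set: "set xs = insert 0 (r ` A)" unfolding xs_def by (rule set_sorted_list_of_set[OF fin])
  have len: "length xs = Suc m" using set unfolding m_def by (cases xs) auto
  have srt: "sorted_wrt (<) xs" unfolding xs_def using strict_sorted_list_of_set[of "insert 0 (r ` A)"] by simp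
  have less: "xs ! i < xs ! j" if "i < j" "j \<le> m" for i j
    using sorted_wrt_nth_less[OF srt] that len by auto
  have x0: "xs ! 0 = 0"
  proof -
    have "0 \<in> set xs" using set by simp
    then obtain i where i: "i < length xs" "xs ! i = 0" by (auto simp: in_set_conv_nth)
    have "xs ! 0 \<in> set xs" using len by simp
    then have "0 \<le> xs ! 0" using set r by auto
    then show ?thesis using less[of 0 i] i len by (cases "i = 0") auto
  qed
  define \<xi> where "\<xi> l \<omega> = w (xs ! Suc l) \<omega> - w (xs ! l) \<omega>" for l \<omega>
  have nn: "0 \<le> xs ! l" if "l \<le> m" for l
    using less[of 0 l] x0 that by (cases "l = 0") auto
  have "gauss M {..<m} (\<lambda>l \<omega>. if l < m then \<xi> l \<omega> else 0)"
  proof (rule gauss_indep_normal[where s = "\<lambda>l. sqrt (xs ! Suc l - xs ! l)"])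
    have "0 \<le> xs ! 0 \<and> (\<forall>i<m. xs ! i < xs ! Suc i)" using x0 less by simp
    then show "indep_vars (\<lambda>_. borel) \<xi> {..<m}"
      using BM unfolding std_BM_def \<xi>_def[abs_def] by blast
    fix l assume l: "l < m"
    then have "0 \<le> xs ! l \<and> xs ! l < xs ! Suc l" using nn less by simp
    then show "0 < sqrt (xs ! Suc l - xs ! l) \<and> distributed M lborel (\<xi> l) (\<lambda>y. ennreal (normal_density 0 (sqrt (xs ! Suc l - xs ! l)) y))"
      using BM unfolding std_BM_def \<xi>_def[abs_def] by simp
  qed
  from gauss_linear[OF this A, of "\<lambda>i l. if i \<in> A \<and> xs ! l < r i then 1 else 0"]
  have "gauss M A (\<lambda>i \<omega>. \<Sum>l<m. (if i \<in> A \<and> xs ! l < r i then 1 else 0) * (if l < m then \<xi> l \<omega> else 0))" .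
  moreover have "(\<Sum>l<m. (if i \<in> A \<and> xs ! l < r i then 1 else 0) * (if l < m then \<xi> l \<omega> else 0)) = (if i \<in> A then w (r i) \<omega> else 0)"
    if \<omega>: "\<omega> \<in> space M" for i \<omega>
  proof (cases "i \<in> A")
    case True
    then have "r i \<in> set xs" using set by simp
    then obtain k where k: "k < length xs" "xs ! k = r i" by (auto simp: in_set_conv_nth)
    then have km: "k \<le> m" using len by simp
    have "(\<Sum>l<m. (if i \<in> A \<and> xs ! l < r i then 1 else 0) * (if l < m then \<xi> l \<omega> else 0)) = (\<Sum>l<m. if l < k then \<xi> l \<omega> else 0)"
    proof (intro sum.cong refl)
      fix l assume "l \<in> {..<m}"
      then have "xs ! l < xs ! k \<longleftrightarrow> l < k" using less[of l k] less[of k l] km by (cases l k rule: linorder_cases) auto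
      then show "(if i \<in> A \<and> xs ! l < r i then 1 else 0) * (if l < m then \<xi> l \<omega> else 0) = (if l < k then \<xi> l \<omega> else 0)"
        using True k \<open>l \<in> {..<m}\<close> by simp
    qed
    also have "\<dots> = (\<Sum>l<k. \<xi> l \<omega>)"
      using km by (subst sum.inter_filter[symmetric]) (auto intro!: sum.cong)
    also have "\<dots> = w (xs ! k) \<omega> - w (xs ! 0) \<omega>"
      unfolding \<xi>_def by (rule sum_lessThan_telescope)
    also have "\<dots> = w (r i) \<omega>" using BM \<omega> k x0 unfolding std_BM_def by simp
    finally show ?thesis using True by simp
  qed simp
  ultimately show ?thesis by (subst gauss_cong[symmetric]) auto
qed

lemma std_BM_square:
  assumes BM: "std_BM M w" and s: "0 \<le> s" "s < t"
  shows "expectation (\<lambda>\<omega>. (w t \<omega> - w s \<omega>)\<^sup>2) = t - s" "integrable M (\<lambda>\<omega>. w t \<omega> - w s \<omega>)"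
    "expectation (\<lambda>\<omega>. w t \<omega> - w s \<omega>) = 0"
proof -
  have d: "distributed M lborel (\<lambda>\<omega>. w t \<omega> - w s \<omega>) (\<lambda>y. ennreal (normal_density 0 (sqrt (t - s)) y))"
    using BM s unfolding std_BM_def by blast
  have pos: "0 < sqrt (t - s)" using s by simp
  show e: "expectation (\<lambda>\<omega>. w t \<omega> - w s \<omega>) = 0"
    by (rule normal_distributed_expectation[OF pos d])
  show "expectation (\<lambda>\<omega>. (w t \<omega> - w s \<omega>)\<^sup>2) = t - s"
    using normal_distributed_variance[OF pos d] s by (simp add: e)
  have "gauss M {()} (\<lambda>_ \<omega>. 1 * (w t \<omega> - w s \<omega>))" by (rule gauss_normal[OF _ pos d]) simp
  from gauss_integrable1[OF this] show "integrable M (\<lambda>\<omega>. w t \<omega> - w s \<omega>)" by simp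
qed

lemma std_BM_cov:
  assumes BM: "std_BM M w" and s: "0 \<le> s" "0 \<le> t"
  shows "expectation (\<lambda>\<omega>. w s \<omega> * w t \<omega>) = min s t"
proof -
  have w0: "w 0 \<omega> = 0" if "\<omega> \<in> space M" for \<omega> using BM that unfolding std_BM_def by blast
  have sq: "expectation (\<lambda>\<omega>. w s \<omega> * w s \<omega>) = s" if "0 \<le> s" for s
  proof (cases "s = 0")
    case True
    then show ?thesis using w0 by (simp cong: Bochner_Integration.integral_cong)
  next
    case False
    then have "expectation (\<lambda>\<omega>. (w s \<omega> - w 0 \<omega>)\<^sup>2) = s" using std_BM_square(1)[OF BM, of 0 s] that by simp
    moreover have "expectation (\<lambda>\<omega>. (w s \<omega> - w 0 \<omega>)\<^sup>2) = expectation (\<lambda>\<omega>. w s \<omega> * w s \<omega>)"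
      by (rule Bochner_Integration.integral_cong) (auto simp: w0 power2_eq_square)
    ultimately show ?thesis by simp
  qed
  have le: "expectation (\<lambda>\<omega>. w s \<omega> * w t \<omega>) = s" if st: "0 \<le> s" "s < t" for s t
  proof (cases "s = 0")
    case True
    then have "expectation (\<lambda>\<omega>. w s \<omega> * w t \<omega>) = expectation (\<lambda>\<omega>. 0)"
      by (intro Bochner_Integration.integral_cong) (auto simp: w0)
    then show ?thesis using True by simp
  next
    case False
    have pos: "0 < s" using False st by simp
    let ?ts = "\<lambda>i::nat. if i = 0 then 0 else if i = 1 then s else t"
    have "0 \<le> ?ts 0 \<and> (\<forall>i<2. ?ts i < ?ts (Suc i))"
      using False st by (auto simp: less_2_cases_iff)
    then have "indep_vars (\<lambda>_. borel) (\<lambda>i \<omega>. w (?ts (Suc i)) \<omega> - w (?ts i) \<omega>) {..<2}"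
      using BM[unfolded std_BM_def, THEN conjunct2, THEN conjunct2, THEN conjunct2, THEN conjunct2, rule_format, of ?ts 2] by blast
    then have "indep_var (PiM {0} (\<lambda>_. borel)) (\<lambda>\<omega>. restrict (\<lambda>i. w (?ts (Suc i)) \<omega> - w (?ts i) \<omega>) {0})
        (PiM {1} (\<lambda>_. borel)) (\<lambda>\<omega>. restrict (\<lambda>i. w (?ts (Suc i)) \<omega> - w (?ts i) \<omega>) {1})"
      by (rule indep_var_restrict) auto
    from indep_var_compose[OF this, of "\<lambda>z. z 0" borel "\<lambda>z. z 1" borel]
    have "indep_var borel (\<lambda>\<omega>. w s \<omega> - w 0 \<omega>) borel (\<lambda>\<omega>. w t \<omega> - w s \<omega>)"
      by (simp add: comp_def)
    note i = indep_var_lebesgue_integral[OF this std_BM_square(2)[OF BM order_refl pos] std_BM_square(2)[OF BM st]]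
      indep_var_integrable[OF this std_BM_square(2)[OF BM order_refl pos] std_BM_square(2)[OF BM st]]
    have g: "gauss M {True, False} (\<lambda>b \<omega>. if b \<in> {True, False} then w (if b then s else t) \<omega> else 0)"
      by (rule std_BM_gauss[OF BM]) (use st in auto)
    have iss: "integrable M (\<lambda>\<omega>. w s \<omega> * w s \<omega>)" using gauss_integrable_prod[OF g, of True True] by simp
    have "expectation (\<lambda>\<omega>. w s \<omega> * w t \<omega>) = expectation (\<lambda>\<omega>. w s \<omega> * w s \<omega> + (w s \<omega> - w 0 \<omega>) * (w t \<omega> - w s \<omega>))"
      by (rule Bochner_Integration.integral_cong) (auto simp: w0 algebra_simps)
    also have "\<dots> = s + 0" using iss i pos sq[OF st(1)] std_BM_square(3)[OF BM st] by simp
    finally show ?thesis by simp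
  qed
  show ?thesis
  proof (cases s t rule: linorder_cases)
    case less then show ?thesis using le s by simp
  next
    case equal then show ?thesis using sq s by simp
  next
    case greater then show ?thesis using le[of t s] s by (simp add: mult.commute)
  qed
qed

end

section \<open>Ornstein-Uhlenbeck modes as limits of Riemann sums\<close>

lemma Riemann_sum_tendsto:
  fixes g :: "real \<Rightarrow> real"
  assumes t: "0 \<le> t" and g: "continuous_on {0..t} g"
  shows "(\<lambda>N. (t / real N) * (\<Sum>l<N. g (t * real l / real N))) \<longlonglongrightarrow> integral {0..t} g"
proof (rule LIMSEQ_I)
  fix r :: real assume r: "0 < r"
  define \<epsilon> where "\<epsilon> = r / (2 * (t + 1))"
  have \<epsilon>: "\<epsilon> > 0" and \<epsilon>t: "\<epsilon> * t < r"
  proof -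
    show "\<epsilon> > 0" using r t by (simp add: \<epsilon>_def)
    have "r * t < r * (2 * (t + 1))" using r t by (intro mult_strict_left_mono) auto
    then show "\<epsilon> * t < r" using t by (simp add: \<epsilon>_def field_simps)
  qed
  have "uniformly_continuous_on {0..t} g" by (rule compact_uniformly_continuous[OF g]) simp
  then obtain \<delta> where \<delta>: "\<delta> > 0" and u: "\<And>x y. x \<in> {0..t} \<Longrightarrow> y \<in> {0..t} \<Longrightarrow> dist y x < \<delta> \<Longrightarrow> dist (g y) (g x) < \<epsilon>"
    unfolding uniformly_continuous_on_def using \<epsilon> by metis
  obtain N0 :: nat where N0: "t / \<delta> < real N0" using reals_Archimedean2 by blast
  have "norm ((t / real N) * (\<Sum>l<N. g (t * real l / real N)) - integral {0..t} g) < r" if N: "N \<ge> Suc N0" for N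
  proof -
    have N0': "0 < real N" using N by simp
    have "t / \<delta> < real N" using N N0 by linarith
    then have h: "t / real N < \<delta>" using \<delta> N0' by (simp add: field_simps)
    define s where "s l = t * real l / real N" for l
    have s0: "s 0 = 0" "s N = t" using N0' by (auto simp: s_def)
    have smono: "s l \<le> s m" if "l \<le> m" for l m
      unfolding s_def using t that by (intro divide_right_mono mult_left_mono) auto
    have s1: "s (Suc l) - s l = t / real N" for l
      by (simp add: s_def add_divide_distrib distrib_left)
    have ig: "g integrable_on {0..t}" by (rule integrable_continuous_real[OF g])
    have split: "integral {0..s m} g = (\<Sum>l<m. integral {s l..s (Suc l)} g)" if "m \<le> N" for m
      using that
    proof (induction m)
      case 0 then show ?case by (simp add: s0)
    next
      case (Suc m)
      have "integral {0..s m} g + integral {s m..s (Suc m)} g = integral {0..s (Suc m)} g"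
        using smono[of 0 m] smono[of m "Suc m"] smono[of "Suc m" N] Suc.prems s0
        by (intro Henstock_Kurzweil_Integration.integral_combine integrable_on_subinterval[OF ig]) auto
      then show ?case using Suc by simp
    qed
    have piece: "norm (t / real N * g (s l) - integral {s l..s (Suc l)} g) \<le> \<epsilon> * (t / real N)" if l: "l < N" for l
    proof -
      have sub: "{s l..s (Suc l)} \<subseteq> {0..t}"
        using smono[of 0 l] smono[of "Suc l" N] l s0 by auto
      have c: "continuous_on {s l..s (Suc l)} g" by (rule continuous_on_subset[OF g sub])
      have le: "s l \<le> s (Suc l)" by (rule smono) simp
      have "norm (integral {s l..s (Suc l)} (\<lambda>x. g x - g (s l))) \<le> \<epsilon> * (s (Suc l) - s l)"
      proof (rule integral_bound[OF le])
        show "continuous_on {s l..s (Suc l)} (\<lambda>x. g x - g (s l))" by (intro continuous_intros c)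
        fix x assume x: "x \<in> {s l..s (Suc l)}"
        then have "dist x (s l) < \<delta>" using s1[of l] h by (auto simp: dist_real_def)
        then have "dist (g x) (g (s l)) < \<epsilon>" using x sub le by (intro u) auto
        then show "norm (g x - g (s l)) \<le> \<epsilon>" by (simp add: dist_norm)
      qed
      moreover have "integral {s l..s (Suc l)} (\<lambda>x. g x - g (s l)) = integral {s l..s (Suc l)} g - t / real N * g (s l)"
        using le s1[of l] integrable_continuous_real[OF c]
        by (subst Henstock_Kurzweil_Integration.integral_diff) auto
      ultimately show ?thesis by (simp add: s1 norm_minus_commute abs_minus_commute)
    qed
    have "(t / real N) * (\<Sum>l<N. g (s l)) - integral {0..t} g = (\<Sum>l<N. t / real N * g (s l) - integral {s l..s (Suc l)} g)"
      using split[of N] s0 by (simp add: sum_subtractf sum_distrib_left)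
    also have "norm \<dots> \<le> (\<Sum>l<N. \<epsilon> * (t / real N))"
      by (intro sum_norm_le piece) simp
    also have "\<dots> = \<epsilon> * t" using N0' by simp
    finally show ?thesis unfolding s_def using \<epsilon>t by simp
  qed
  then show "\<exists>no. \<forall>N\<ge>no. norm ((t / real N) * (\<Sum>l<N. g (t * real l / real N)) - integral {0..t} g) < r" by blast
qed

text \<open>The integral of exp(-\<kappa> (t - s)) dp(s) after integration by parts, for paths with
  p 0 = 0. It is kept as a functional of an arbitrary p because it is applied to Brownian paths and
  also to covariance functions.\<close>

definition ou_mode :: "real \<Rightarrow> real \<Rightarrow> (real \<Rightarrow> real) \<Rightarrow> real" where
  "ou_mode \<kappa> t p = p t - \<kappa> * integral {0..t} (\<lambda>s. exp (- \<kappa> * (t - s)) * p s)"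

text \<open>Weights of the left Riemann sum for \<open>ou_mode\<close>. The node l = N does not
  occur in a left sum, so it is free to carry the boundary term p t.\<close>

definition ou_coeff :: "real \<Rightarrow> real \<Rightarrow> nat \<Rightarrow> nat \<Rightarrow> real" where
  "ou_coeff \<kappa> t N l = (if l = N then 1 else - (\<kappa> * (t / real N)) * exp (- \<kappa> * (t - t * real l / real N)))"

definition ou_approx :: "real \<Rightarrow> nat \<Rightarrow> real \<Rightarrow> (real \<Rightarrow> real) \<Rightarrow> real" where
  "ou_approx \<kappa> N t p = (\<Sum>l\<le>N. ou_coeff \<kappa> t N l * p (t * real l / real N))"

lemma ou_approx_eq:
  assumes "N > 0"
  shows "ou_approx \<kappa> N t p = p t - \<kappa> * ((t / real N) * (\<Sum>l<N. exp (- \<kappa> * (t - t * real l / real N)) * p (t * real l / real N)))"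
  using assms by (simp add: ou_approx_def ou_coeff_def lessThan_Suc_atMost[symmetric] sum_distrib_left
      sum_negf[symmetric] mult_ac)

lemma ou_approx_tendsto:
  assumes "0 \<le> t" "continuous_on {0..} p"
  shows "(\<lambda>N. ou_approx \<kappa> (Suc N) t p) \<longlonglongrightarrow> ou_mode \<kappa> t p"
proof -
  have "continuous_on {0..t} p" by (rule continuous_on_subset[OF assms(2)]) auto
  then have "(\<lambda>N. (t / real N) * (\<Sum>l<N. exp (- \<kappa> * (t - t * real l / real N)) * p (t * real l / real N)))
     \<longlonglongrightarrow> integral {0..t} (\<lambda>s. exp (- \<kappa> * (t - s)) * p s)"
    by (intro Riemann_sum_tendsto[OF assms(1), of "\<lambda>s. exp (- \<kappa> * (t - s)) * p s"] continuous_intros)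
  then have "(\<lambda>N. p t - \<kappa> * ((t / real (Suc N)) * (\<Sum>l<Suc N. exp (- \<kappa> * (t - t * real l / real (Suc N))) * p (t * real l / real (Suc N)))))
     \<longlonglongrightarrow> ou_mode \<kappa> t p"
    unfolding ou_mode_def by (intro tendsto_intros LIMSEQ_Suc)
  then show ?thesis by (simp only: ou_approx_eq zero_less_Suc)
qed

lemma sum_abs_ou_coeff:
  assumes "0 \<le> \<kappa>" "0 \<le> t" "0 < N"
  shows "(\<Sum>l\<le>N. \<bar>ou_coeff \<kappa> t N l\<bar>) \<le> 1 + \<kappa> * t"
proof -
  have "(\<Sum>l<N. \<bar>ou_coeff \<kappa> t N l\<bar>) \<le> (\<Sum>l<N. \<kappa> * (t / real N))"
  proof (intro sum_mono)
    fix l assume l: "l \<in> {..<N}"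
    have "t * real l / real N \<le> t" using l assms by (simp add: divide_le_eq mult_left_mono)
    then have "exp (- \<kappa> * (t - t * real l / real N)) \<le> 1" using assms by (simp add: mult_nonneg_nonneg)
    then have "\<kappa> * (t / real N) * exp (- \<kappa> * (t - t * real l / real N)) \<le> \<kappa> * (t / real N)"
      using assms by (intro mult_left_le) auto
    then show "\<bar>ou_coeff \<kappa> t N l\<bar> \<le> \<kappa> * (t / real N)"
      using l assms by (simp add: ou_coeff_def abs_mult)
  qed
  also have "\<dots> = \<kappa> * t" using assms by simp
  finally have "(\<Sum>l<N. \<bar>ou_coeff \<kappa> t N l\<bar>) \<le> \<kappa> * t" .
  moreover have "(\<Sum>l\<le>N. \<bar>ou_coeff \<kappa> t N l\<bar>) = (\<Sum>l<N. \<bar>ou_coeff \<kappa> t N l\<bar>) + 1"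
    unfolding lessThan_Suc_atMost[symmetric] by (simp add: ou_coeff_def)
  ultimately show ?thesis by simp
qed

text \<open>Covariance of the Ornstein-Uhlenbeck process of unit noise started at 0: the stationary
  covariance minus the memory of the start.\<close>

definition ou_cov :: "real \<Rightarrow> real \<Rightarrow> real \<Rightarrow> real" where
  "ou_cov \<kappa> s t = (exp (- \<kappa> * \<bar>s - t\<bar>) - exp (- \<kappa> * (s + t))) / (2 * \<kappa>)"

lemma ou_mode_FTC:
  assumes t: "0 \<le> t"
    and q: "\<And>s. s \<in> {0..t} \<Longrightarrow> (q has_real_derivative (exp (- \<kappa> * (t - s)) * p s)) (at s)"
  shows "ou_mode \<kappa> t p = p t - \<kappa> * (q t - q 0)"
proof -
  have "((\<lambda>s. exp (- \<kappa> * (t - s)) * p s) has_integral (q t - q 0)) {0..t}"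
    by (rule fundamental_theorem_of_calculus[OF t])
       (use q in \<open>auto intro: has_vector_derivative_at_within simp: has_real_derivative_iff_has_vector_derivative\<close>)
  then show ?thesis by (simp add: ou_mode_def integral_unique)
qed

text \<open>Since min s r is the Brownian covariance, this value is the covariance of the mode at t
  with w r. The integral is split at the kink s = r.\<close>

lemma ou_mode_min:
  assumes \<kappa>: "\<kappa> > 0" and r: "0 \<le> r" "r \<le> t"
  shows "ou_mode \<kappa> t (\<lambda>s. min s r) = (exp (- \<kappa> * (t - r)) - exp (- \<kappa> * t)) / \<kappa>"
proof -
  have t: "0 \<le> t" using r by simp
  let ?f = "\<lambda>s. exp (- \<kappa> * (t - s)) * min s r"
  have 1: "(?f has_integral (exp (- \<kappa> * (t - r)) * (r / \<kappa> - 1 / \<kappa>\<^sup>2) - exp (- \<kappa> * (t - 0)) * (0 / \<kappa> - 1 / \<kappa>\<^sup>2))) {0..r}"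
  proof (rule has_integral_eq[rotated])
    show "((\<lambda>s. exp (- \<kappa> * (t - s)) * s) has_integral (exp (- \<kappa> * (t - r)) * (r / \<kappa> - 1 / \<kappa>\<^sup>2) - exp (- \<kappa> * (t - 0)) * (0 / \<kappa> - 1 / \<kappa>\<^sup>2))) {0..r}"
      by (rule fundamental_theorem_of_calculus[OF r(1)])
         (use \<kappa> in \<open>auto intro!: derivative_eq_intros simp: has_real_derivative_iff_has_vector_derivative[symmetric] field_simps power2_eq_square\<close>)
  qed auto
  have 2: "(?f has_integral (exp (- \<kappa> * (t - t)) * r / \<kappa> - exp (- \<kappa> * (t - r)) * r / \<kappa>)) {r..t}"
  proof (rule has_integral_eq[rotated])
    show "((\<lambda>s. exp (- \<kappa> * (t - s)) * r) has_integral (exp (- \<kappa> * (t - t)) * r / \<kappa> - exp (- \<kappa> * (t - r)) * r / \<kappa>)) {r..t}"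
      by (rule fundamental_theorem_of_calculus[OF r(2)])
         (use \<kappa> in \<open>auto intro!: derivative_eq_intros simp: has_real_derivative_iff_has_vector_derivative[symmetric] field_simps\<close>)
  qed auto
  note 3 = has_integral_combine[OF r 1 2]
  have "ou_mode \<kappa> t (\<lambda>s. min s r) = r - \<kappa> * ((exp (- \<kappa> * (t - r)) * (r / \<kappa> - 1 / \<kappa>\<^sup>2) - exp (- \<kappa> * (t - 0)) * (0 / \<kappa> - 1 / \<kappa>\<^sup>2))
     + (exp (- \<kappa> * (t - t)) * r / \<kappa> - exp (- \<kappa> * (t - r)) * r / \<kappa>))"
    unfolding ou_mode_def integral_unique[OF 3] using r by (simp add: min_def)
  also have "\<dots> = (exp (- \<kappa> * (t - r)) - exp (- \<kappa> * t)) / \<kappa>"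
    using \<kappa> by (simp add: field_simps power2_eq_square)
  finally show ?thesis .
qed

text \<open>The functional acts a second time, now in the other variable, on the covariance between
  a mode and Brownian motion.\<close>

lemma ou_mode_cross:
  assumes \<kappa>: "\<kappa> > 0" and r: "0 \<le> r" "r \<le> t"
  shows "ou_mode \<kappa> r (\<lambda>s. (exp (- \<kappa> * (t - s)) - exp (- \<kappa> * t)) / \<kappa>) = ou_cov \<kappa> t r"
proof -
  let ?q = "\<lambda>s. exp (- \<kappa> * (r - s) - \<kappa> * (t - s)) / (2 * \<kappa>\<^sup>2) - exp (- \<kappa> * (r - s) - \<kappa> * t) / \<kappa>\<^sup>2"
  have "ou_mode \<kappa> r (\<lambda>s. (exp (- \<kappa> * (t - s)) - exp (- \<kappa> * t)) / \<kappa>)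
     = (exp (- \<kappa> * (t - r)) - exp (- \<kappa> * t)) / \<kappa> - \<kappa> * (?q r - ?q 0)"
  proof (rule ou_mode_FTC[OF r(1)])
    fix s
    have "exp (- \<kappa> * (r - s) - \<kappa> * (t - s)) = exp (- \<kappa> * (r - s)) * exp (- \<kappa> * (t - s))"
      "exp (- \<kappa> * (r - s) - \<kappa> * t) = exp (- \<kappa> * (r - s)) * exp (- \<kappa> * t)"
      by (simp_all flip: exp_add)
    then show "(?q has_real_derivative exp (- \<kappa> * (r - s)) * ((exp (- \<kappa> * (t - s)) - exp (- \<kappa> * t)) / \<kappa>)) (at s)"
      using \<kappa> by (auto intro!: derivative_eq_intros simp: power2_eq_square) (simp add: field_simps)
  qed
  also have "\<dots> = ou_cov \<kappa> t r"
    using \<kappa> r by (simp add: ou_cov_def field_simps power2_eq_square)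
  finally show ?thesis .
qed

text \<open>With \<kappa> = 0 the approximation is plain evaluation, so facts about pairs of
  approximations also cover a Brownian value as second member.\<close>

lemma ou_approx_zero: "N > 0 \<Longrightarrow> ou_approx 0 N t p = p t"
  by (simp add: ou_approx_eq)

context prob_space
begin

lemma std_BM_measurable: "std_BM M w \<Longrightarrow> 0 \<le> t \<Longrightarrow> w t \<in> borel_measurable M"
  unfolding std_BM_def by blast

lemma ou_approx_measurable:
  "std_BM M w \<Longrightarrow> 0 \<le> t \<Longrightarrow> (\<lambda>\<omega>. ou_approx \<kappa> N t (\<lambda>s. w s \<omega>)) \<in> borel_measurable M"
  unfolding ou_approx_def
  by (intro borel_measurable_sum borel_measurable_times borel_measurable_const std_BM_measurable) auto

lemma ou_approx_gauss:
  fixes n :: nat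
  assumes BM: "std_BM M w" and t: "\<And>j. j < n \<Longrightarrow> 0 \<le> t j"
  shows "gauss M {..<n} (\<lambda>j \<omega>. if j < n then g * ou_approx (\<kappa> j) (N j) (t j) (\<lambda>s. w s \<omega>) else 0)"
proof -
  let ?A = "SIGMA j:{..<n}. {..N j}"
  have A: "finite ?A" by simp
  have r: "0 \<le> (\<lambda>(j, l). t j * real l / real (N j)) i" if "i \<in> ?A" for i using t that by auto
  have "gauss M ?A (\<lambda>i \<omega>. if i \<in> ?A then w ((\<lambda>(j, l). t j * real l / real (N j)) i) \<omega> else 0)"
    by (rule std_BM_gauss[OF BM A]) (rule r)
  from gauss_linear[OF this, of "{..<n}" "\<lambda>i (j, l). if i = j then g * ou_coeff (\<kappa> j) (t j) (N j) l else 0"]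
  have "gauss M {..<n} (\<lambda>i \<omega>. \<Sum>x\<in>?A. (case x of (j, l) \<Rightarrow> if i = j then g * ou_coeff (\<kappa> j) (t j) (N j) l else 0) *
      (if x \<in> ?A then w ((\<lambda>(j, l). t j * real l / real (N j)) x) \<omega> else 0))" by simp
  moreover have "(\<Sum>x\<in>?A. (case x of (j, l) \<Rightarrow> if i = j then g * ou_coeff (\<kappa> j) (t j) (N j) l else 0) *
      (if x \<in> ?A then w ((\<lambda>(j, l). t j * real l / real (N j)) x) \<omega> else 0))
    = (if i < n then g * ou_approx (\<kappa> i) (N i) (t i) (\<lambda>s. w s \<omega>) else 0)" for i \<omega>
  proof -
    have "(\<Sum>x\<in>?A. (case x of (j, l) \<Rightarrow> if i = j then g * ou_coeff (\<kappa> j) (t j) (N j) l else 0) *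
      (if x \<in> ?A then w ((\<lambda>(j, l). t j * real l / real (N j)) x) \<omega> else 0))
     = (\<Sum>(j, l)\<in>?A. if i = j then g * (ou_coeff (\<kappa> j) (t j) (N j) l * w (t j * real l / real (N j)) \<omega>) else 0)"
      by (intro sum.cong) auto
    also have "\<dots> = (\<Sum>j<n. \<Sum>l\<le>N j. if i = j then g * (ou_coeff (\<kappa> j) (t j) (N j) l * w (t j * real l / real (N j)) \<omega>) else 0)"
      by (subst sum.Sigma) auto
    also have "\<dots> = (\<Sum>j<n. if i = j then g * ou_approx (\<kappa> j) (N j) (t j) (\<lambda>s. w s \<omega>) else 0)"
      by (intro sum.cong refl) (auto simp: ou_approx_def sum_distrib_left)
    finally show ?thesis by simp
  qed
  ultimately show ?thesis by simp
qed

lemma integrable_std_BM_prod: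
  assumes BM: "std_BM M w" and s: "0 \<le> s" "0 \<le> t"
  shows "integrable M (\<lambda>\<omega>. w s \<omega> * w t \<omega>)"
proof -
  have g: "gauss M {True, False} (\<lambda>b \<omega>. if b \<in> {True, False} then w (if b then s else t) \<omega> else 0)"
    by (rule std_BM_gauss[OF BM]) (use s in auto)
  show ?thesis using gauss_integrable_prod[OF g, of True False] by simp
qed

text \<open>The total absolute weight of the nodes is at most 1 + \<kappa> t whatever N is, which
  makes the bound uniform in N as the passage to the limit requires.\<close>

lemma ou_approx_second_moment:
  assumes BM: "std_BM M w" and t: "0 \<le> t" "t \<le> T" and \<kappa>: "0 \<le> \<kappa>" "\<kappa> \<le> K" and N: "0 < N"
  shows "expectation (\<lambda>\<omega>. ou_approx \<kappa> N t (\<lambda>s. w s \<omega>) * ou_approx \<kappa> N t (\<lambda>s. w s \<omega>)) \<le> T * (1 + K * T)\<^sup>2"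
proof -
  let ?c = "ou_coeff \<kappa> t N" and ?r = "\<lambda>l. t * real l / real N"
  have r: "0 \<le> ?r l" "l \<le> N \<Longrightarrow> ?r l \<le> t" for l using t N by (auto simp: divide_le_eq mult_left_mono)
  have "expectation (\<lambda>\<omega>. ou_approx \<kappa> N t (\<lambda>s. w s \<omega>) * ou_approx \<kappa> N t (\<lambda>s. w s \<omega>))
     = expectation (\<lambda>\<omega>. \<Sum>l\<le>N. \<Sum>m\<le>N. ?c l * ?c m * (w (?r l) \<omega> * w (?r m) \<omega>))"
    unfolding ou_approx_def sum_product by (simp add: mult_ac)
  also have "\<dots> = (\<Sum>l\<le>N. \<Sum>m\<le>N. ?c l * ?c m * min (?r l) (?r m))"
  proof -
    have i: "integrable M (\<lambda>\<omega>. w (?r l) \<omega> * w (?r m) \<omega>)" for l m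
      by (rule integrable_std_BM_prod[OF BM r(1) r(1)])
    have "expectation (\<lambda>\<omega>. \<Sum>l\<le>N. \<Sum>m\<le>N. ?c l * ?c m * (w (?r l) \<omega> * w (?r m) \<omega>))
      = (\<Sum>l\<le>N. expectation (\<lambda>\<omega>. \<Sum>m\<le>N. ?c l * ?c m * (w (?r l) \<omega> * w (?r m) \<omega>)))"
      by (rule Bochner_Integration.integral_sum) (intro Bochner_Integration.integrable_sum integrable_mult_right i)
    also have "\<dots> = (\<Sum>l\<le>N. \<Sum>m\<le>N. expectation (\<lambda>\<omega>. ?c l * ?c m * (w (?r l) \<omega> * w (?r m) \<omega>)))"
      by (intro sum.cong refl Bochner_Integration.integral_sum integrable_mult_right i)
    also have "\<dots> = (\<Sum>l\<le>N. \<Sum>m\<le>N. ?c l * ?c m * min (?r l) (?r m))"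
      unfolding integral_mult_right_zero std_BM_cov[OF BM r(1) r(1)] ..
    finally show ?thesis .
  qed
  also have "\<dots> \<le> (\<Sum>l\<le>N. \<Sum>m\<le>N. \<bar>?c l\<bar> * \<bar>?c m\<bar> * T)"
  proof (intro sum_mono)
    fix l m assume "l \<in> {..N}" "m \<in> {..N}"
    then have "0 \<le> min (?r l) (?r m)" "min (?r l) (?r m) \<le> T" using r t by (auto intro: order_trans min.coboundedI1)
    then have "\<bar>?c l * ?c m\<bar> * min (?r l) (?r m) \<le> \<bar>?c l * ?c m\<bar> * T" by (intro mult_left_mono) auto
    moreover have "?c l * ?c m * min (?r l) (?r m) \<le> \<bar>?c l * ?c m\<bar> * min (?r l) (?r m)"
      by (rule mult_right_mono) (use \<open>0 \<le> min (?r l) (?r m)\<close> in auto)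
    ultimately show "?c l * ?c m * min (?r l) (?r m) \<le> \<bar>?c l\<bar> * \<bar>?c m\<bar> * T" by (simp add: abs_mult)
  qed
  also have "\<dots> = T * (\<Sum>l\<le>N. \<bar>?c l\<bar>)\<^sup>2"
    by (simp add: power2_eq_square sum_product sum_distrib_left mult_ac)
  also have "\<dots> \<le> T * (1 + K * T)\<^sup>2"
  proof (intro mult_left_mono power_mono)
    have "\<kappa> * t \<le> K * T" using t \<kappa> by (intro mult_mono) auto
    then show "(\<Sum>l\<le>N. \<bar>?c l\<bar>) \<le> 1 + K * T" using sum_abs_ou_coeff[OF \<kappa>(1) t(1) N] by linarith
  qed (use t in \<open>auto intro: sum_nonneg\<close>)
  finally show ?thesis .
qed

lemma ou_mode_measurable:
  assumes BM: "std_BM M w" and t: "0 \<le> t"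
  shows "(\<lambda>\<omega>. ou_mode \<kappa> t (\<lambda>s. w s \<omega>)) \<in> borel_measurable M"
proof (rule borel_measurable_LIMSEQ_real)
  show "(\<lambda>\<omega>. ou_approx \<kappa> (Suc N) t (\<lambda>s. w s \<omega>)) \<in> borel_measurable M" for N
    by (rule ou_approx_measurable[OF BM t])
  show "(\<lambda>N. ou_approx \<kappa> (Suc N) t (\<lambda>s. w s \<omega>)) \<longlonglongrightarrow> ou_mode \<kappa> t (\<lambda>s. w s \<omega>)" if "\<omega> \<in> space M" for \<omega>
    by (rule ou_approx_tendsto[OF t]) (use BM that in \<open>auto simp: std_BM_def\<close>)
qed

text \<open>Only the first coordinate is taken to the limit. The covariance of two modes is reached
  by two successive limits, each moving the functional from a random path to a covariance
  function.\<close>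

lemma ou_mode_approx_gauss:
  assumes BM: "std_BM M w" and t: "0 \<le> t" "0 \<le> r" and \<kappa>: "0 \<le> \<kappa>" "0 \<le> \<kappa>'" and N: "0 < N"
  defines "Y \<equiv> \<lambda>j::nat. \<lambda>\<omega>. if j = 0 then ou_mode \<kappa> t (\<lambda>s. w s \<omega>) else if j = 1 then ou_approx \<kappa>' N r (\<lambda>s. w s \<omega>) else 0"
  shows "gauss M {..<2} Y"
    and "(\<lambda>m. expectation (\<lambda>\<omega>. ou_approx \<kappa> (Suc m) t (\<lambda>s. w s \<omega>) * ou_approx \<kappa>' N r (\<lambda>s. w s \<omega>)))
      \<longlonglongrightarrow> expectation (\<lambda>\<omega>. ou_mode \<kappa> t (\<lambda>s. w s \<omega>) * ou_approx \<kappa>' N r (\<lambda>s. w s \<omega>))"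
    and "expectation (\<lambda>\<omega>. ou_mode \<kappa> t (\<lambda>s. w s \<omega>) * ou_mode \<kappa> t (\<lambda>s. w s \<omega>)) \<le> max t r * (1 + max \<kappa> \<kappa>' * max t r)\<^sup>2"
proof -
  let ?X = "\<lambda>m (j::nat) \<omega>. if j < 2 then 1 * ou_approx (if j = 0 then \<kappa> else \<kappa>') (if j = 0 then Suc m else N) (if j = 0 then t else r) (\<lambda>s. w s \<omega>) else 0"
  have X: "gauss M {..<2} (?X m)" for m
    by (rule ou_approx_gauss[OF BM]) (use t in auto)
  have mY: "Y j \<in> borel_measurable M" for j
    unfolding Y_def using ou_mode_measurable[OF BM t(1)] ou_approx_measurable[OF BM t(2)] by simp
  have lim: "AE \<omega> in M. \<forall>j. (\<lambda>m. ?X m j \<omega>) \<longlonglongrightarrow> Y j \<omega>"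
  proof (rule AE_I2, rule allI)
    fix \<omega> j assume \<omega>: "\<omega> \<in> space M"
    then have "continuous_on {0..} (\<lambda>s. w s \<omega>)" using BM by (auto simp: std_BM_def)
    from ou_approx_tendsto[OF t(1) this, of \<kappa>]
    show "(\<lambda>m. ?X m j \<omega>) \<longlonglongrightarrow> Y j \<omega>" by (cases "j = 0") (auto simp: Y_def)
  qed
  have B: "expectation (\<lambda>\<omega>. ?X m i \<omega> * ?X m i \<omega>) \<le> max t r * (1 + max \<kappa> \<kappa>' * max t r)\<^sup>2" if "i \<in> {..<2}" for m i
    using ou_approx_second_moment[OF BM t(1) _ \<kappa>(1), of "max t r" "max \<kappa> \<kappa>'" "Suc m"]
      ou_approx_second_moment[OF BM t(2) _ \<kappa>(2), of "max t r" "max \<kappa> \<kappa>'" N] N that by auto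
  note G = gauss_limit[OF X mY lim B]
  from G(1) show "gauss M {..<2} Y" by simp
  from G(2)[of 0 1] show "(\<lambda>m. expectation (\<lambda>\<omega>. ou_approx \<kappa> (Suc m) t (\<lambda>s. w s \<omega>) * ou_approx \<kappa>' N r (\<lambda>s. w s \<omega>)))
      \<longlonglongrightarrow> expectation (\<lambda>\<omega>. ou_mode \<kappa> t (\<lambda>s. w s \<omega>) * ou_approx \<kappa>' N r (\<lambda>s. w s \<omega>))"
    by (simp add: Y_def)
  from G(2)[of 0 0] have "(\<lambda>m. expectation (\<lambda>\<omega>. ?X m 0 \<omega> * ?X m 0 \<omega>)) \<longlonglongrightarrow> expectation (\<lambda>\<omega>. ou_mode \<kappa> t (\<lambda>s. w s \<omega>) * ou_mode \<kappa> t (\<lambda>s. w s \<omega>))"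
    by (simp add: Y_def)
  then show "expectation (\<lambda>\<omega>. ou_mode \<kappa> t (\<lambda>s. w s \<omega>) * ou_mode \<kappa> t (\<lambda>s. w s \<omega>)) \<le> max t r * (1 + max \<kappa> \<kappa>' * max t r)\<^sup>2"
    by (rule LIMSEQ_le_const2) (use B[of 0] in auto)
qed

lemma integrable_ou_mode_BM:
  assumes BM: "std_BM M w" and t: "0 \<le> t" "0 \<le> r" and \<kappa>: "0 \<le> \<kappa>"
  shows "integrable M (\<lambda>\<omega>. ou_mode \<kappa> t (\<lambda>s. w s \<omega>) * w r \<omega>)"
  using gauss_integrable_prod[OF ou_mode_approx_gauss(1)[OF BM t \<kappa>, of 0 1], of 0 1]
  by (simp add: ou_approx_zero)

text \<open>The discretised functional is a finite sum, so it commutes with the expectation and then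
  acts on the deterministic function s \<mapsto> E[Z w s].\<close>

lemma expectation_ou_approx_mult:
  assumes Z: "\<And>s. 0 \<le> s \<Longrightarrow> integrable M (\<lambda>\<omega>. Z \<omega> * w s \<omega>)" and t: "0 \<le> t"
  shows "expectation (\<lambda>\<omega>. Z \<omega> * ou_approx \<kappa> N t (\<lambda>s. w s \<omega>)) = ou_approx \<kappa> N t (\<lambda>s. expectation (\<lambda>\<omega>. Z \<omega> * w s \<omega>))"
proof -
  have "expectation (\<lambda>\<omega>. Z \<omega> * ou_approx \<kappa> N t (\<lambda>s. w s \<omega>))
     = expectation (\<lambda>\<omega>. \<Sum>l\<le>N. ou_coeff \<kappa> t N l * (Z \<omega> * w (t * real l / real N) \<omega>))"
    by (simp add: ou_approx_def sum_distrib_left mult_ac)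
  also have "\<dots> = (\<Sum>l\<le>N. expectation (\<lambda>\<omega>. ou_coeff \<kappa> t N l * (Z \<omega> * w (t * real l / real N) \<omega>)))"
    by (rule Bochner_Integration.integral_sum) (use t in \<open>auto intro!: integrable_mult_right Z\<close>)
  finally show ?thesis by (simp add: ou_approx_def)
qed

lemma ou_approx_cong: "0 \<le> t \<Longrightarrow> (\<And>s. 0 \<le> s \<Longrightarrow> s \<le> t \<Longrightarrow> p s = p' s) \<Longrightarrow> 0 < N \<Longrightarrow> ou_approx \<kappa> N t p = ou_approx \<kappa> N t p'"
  unfolding ou_approx_def by (intro sum.cong refl) (auto simp: divide_le_eq mult_left_mono)

lemma ou_mode_BM_cov:
  assumes BM: "std_BM M w" and t: "0 \<le> r" "r \<le> t" and \<kappa>: "0 < \<kappa>"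
  shows "expectation (\<lambda>\<omega>. ou_mode \<kappa> t (\<lambda>s. w s \<omega>) * w r \<omega>) = (exp (- \<kappa> * (t - r)) - exp (- \<kappa> * t)) / \<kappa>"
proof -
  have t0: "0 \<le> t" using t by simp
  have "expectation (\<lambda>\<omega>. ou_approx \<kappa> (Suc m) t (\<lambda>s. w s \<omega>) * w r \<omega>) = ou_approx \<kappa> (Suc m) t (\<lambda>s. min s r)" for m
  proof -
    have "expectation (\<lambda>\<omega>. w r \<omega> * ou_approx \<kappa> (Suc m) t (\<lambda>s. w s \<omega>)) = ou_approx \<kappa> (Suc m) t (\<lambda>s. expectation (\<lambda>\<omega>. w r \<omega> * w s \<omega>))"
      by (rule expectation_ou_approx_mult[OF _ t0]) (rule integrable_std_BM_prod[OF BM t(1)])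
    also have "\<dots> = ou_approx \<kappa> (Suc m) t (\<lambda>s. min s r)"
      by (rule ou_approx_cong[OF t0]) (auto simp: std_BM_cov[OF BM t(1)] min.commute)
    finally show ?thesis by (simp add: mult.commute)
  qed
  moreover have "(\<lambda>m. expectation (\<lambda>\<omega>. ou_approx \<kappa> (Suc m) t (\<lambda>s. w s \<omega>) * w r \<omega>)) \<longlonglongrightarrow> expectation (\<lambda>\<omega>. ou_mode \<kappa> t (\<lambda>s. w s \<omega>) * w r \<omega>)"
    using ou_mode_approx_gauss(2)[OF BM t0 t(1) less_imp_le[OF \<kappa>], of 0 1] by (simp add: ou_approx_zero)
  moreover have "(\<lambda>m. ou_approx \<kappa> (Suc m) t (\<lambda>s. min s r)) \<longlonglongrightarrow> ou_mode \<kappa> t (\<lambda>s. min s r)"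
    by (rule ou_approx_tendsto[OF t0]) (intro continuous_intros)
  ultimately have "expectation (\<lambda>\<omega>. ou_mode \<kappa> t (\<lambda>s. w s \<omega>) * w r \<omega>) = ou_mode \<kappa> t (\<lambda>s. min s r)"
    by (auto intro: LIMSEQ_unique)
  then show ?thesis using ou_mode_min[OF \<kappa> t] by simp
qed

lemma ou_mode_cov_le:
  assumes BM: "std_BM M w" and t: "0 \<le> r" "r \<le> t" and \<kappa>: "0 < \<kappa>"
  shows "expectation (\<lambda>\<omega>. ou_mode \<kappa> t (\<lambda>s. w s \<omega>) * ou_mode \<kappa> r (\<lambda>s. w s \<omega>)) = ou_cov \<kappa> t r"
proof -
  have t0: "0 \<le> t" and \<kappa>0: "0 \<le> \<kappa>" using t \<kappa> by auto
  let ?U = "\<lambda>\<omega>. ou_mode \<kappa> t (\<lambda>s. w s \<omega>)"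
  let ?\<kappa> = "\<lambda>s. (exp (- \<kappa> * (t - s)) - exp (- \<kappa> * t)) / \<kappa>"
  have eq: "expectation (\<lambda>\<omega>. ?U \<omega> * ou_approx \<kappa> (Suc m) r (\<lambda>s. w s \<omega>)) = ou_approx \<kappa> (Suc m) r ?\<kappa>" for m
  proof -
    have "expectation (\<lambda>\<omega>. ?U \<omega> * ou_approx \<kappa> (Suc m) r (\<lambda>s. w s \<omega>)) = ou_approx \<kappa> (Suc m) r (\<lambda>s. expectation (\<lambda>\<omega>. ?U \<omega> * w s \<omega>))"
      by (rule expectation_ou_approx_mult[OF _ t(1)]) (rule integrable_ou_mode_BM[OF BM t0 _ \<kappa>0])
    also have "\<dots> = ou_approx \<kappa> (Suc m) r ?\<kappa>"
      by (rule ou_approx_cong[OF t(1)]) (use t in \<open>simp_all add: ou_mode_BM_cov[OF BM _ _ \<kappa>]\<close>)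
    finally show ?thesis .
  qed
  have l1: "(\<lambda>m. ou_approx \<kappa> (Suc m) r ?\<kappa>) \<longlonglongrightarrow> ou_cov \<kappa> t r"
    unfolding ou_mode_cross[OF \<kappa> t, symmetric] by (rule ou_approx_tendsto[OF t(1)]) (use \<kappa> in \<open>intro continuous_intros; auto\<close>)
  let ?X = "\<lambda>m (j::nat) \<omega>. if j = 0 then ?U \<omega> else if j = 1 then ou_approx \<kappa> (Suc m) r (\<lambda>s. w s \<omega>) else 0"
  let ?Y = "\<lambda>(j::nat) \<omega>. if j = 0 then ?U \<omega> else if j = 1 then ou_mode \<kappa> r (\<lambda>s. w s \<omega>) else 0"
  have X: "gauss M {..<2} (?X m)" for m
    by (rule ou_mode_approx_gauss(1)[OF BM t0 t(1) \<kappa>0 \<kappa>0]) simp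
  have mY: "?Y j \<in> borel_measurable M" for j
    using ou_mode_measurable[OF BM t0] ou_mode_measurable[OF BM t(1)] by simp
  have lim: "AE \<omega> in M. \<forall>j. (\<lambda>m. ?X m j \<omega>) \<longlonglongrightarrow> ?Y j \<omega>"
  proof (rule AE_I2, rule allI)
    fix \<omega> j assume \<omega>: "\<omega> \<in> space M"
    then have "continuous_on {0..} (\<lambda>s. w s \<omega>)" using BM by (auto simp: std_BM_def)
    from ou_approx_tendsto[OF t(1) this, of \<kappa>]
    show "(\<lambda>m. ?X m j \<omega>) \<longlonglongrightarrow> ?Y j \<omega>" by simp
  qed
  have B: "expectation (\<lambda>\<omega>. ?X m i \<omega> * ?X m i \<omega>) \<le> t * (1 + \<kappa> * t)\<^sup>2" if "i \<in> {..<2}" for m i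
    using ou_mode_approx_gauss(3)[OF BM t0 t(1) \<kappa>0 \<kappa>0, of 1] that
      ou_approx_second_moment[OF BM t \<kappa>0 order_refl, of "Suc m"] t by (cases "i = 0") (auto simp: max_def)
  from gauss_limit(2)[OF X mY lim B, of 0 1]
  have "(\<lambda>m. expectation (\<lambda>\<omega>. ?U \<omega> * ou_approx \<kappa> (Suc m) r (\<lambda>s. w s \<omega>))) \<longlonglongrightarrow> expectation (\<lambda>\<omega>. ?U \<omega> * ou_mode \<kappa> r (\<lambda>s. w s \<omega>))"
    by simp
  with l1 show ?thesis unfolding eq by (rule LIMSEQ_unique[symmetric])
qed

lemma ou_mode_cov:
  assumes BM: "std_BM M w" and t: "0 \<le> r" "0 \<le> t" and \<kappa>: "0 < \<kappa>"
  shows "expectation (\<lambda>\<omega>. ou_mode \<kappa> t (\<lambda>s. w s \<omega>) * ou_mode \<kappa> r (\<lambda>s. w s \<omega>)) = ou_cov \<kappa> t r"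
proof (cases "r \<le> t")
  case True then show ?thesis using ou_mode_cov_le[OF BM t(1) _ \<kappa>] by simp
next
  case False
  then have "expectation (\<lambda>\<omega>. ou_mode \<kappa> r (\<lambda>s. w s \<omega>) * ou_mode \<kappa> t (\<lambda>s. w s \<omega>)) = ou_cov \<kappa> r t"
    using ou_mode_cov_le[OF BM t(2) _ \<kappa>] by simp
  then show ?thesis by (simp add: mult.commute ou_cov_def abs_minus_commute add.commute)
qed

lemma ou_approx_cov_tendsto:
  assumes BM: "std_BM M w" and t: "0 \<le> r" "0 \<le> t" and \<kappa>: "0 < \<kappa>"
  shows "(\<lambda>N. expectation (\<lambda>\<omega>. ou_approx \<kappa> (Suc N) t (\<lambda>s. w s \<omega>) * ou_approx \<kappa> (Suc N) r (\<lambda>s. w s \<omega>))) \<longlonglongrightarrow> ou_cov \<kappa> t r"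
proof -
  let ?t = "\<lambda>j::nat. if j = 0 then t else r"
  let ?X = "\<lambda>m (j::nat) \<omega>. if j < 2 then 1 * ou_approx \<kappa> (Suc m) (?t j) (\<lambda>s. w s \<omega>) else 0"
  let ?Y = "\<lambda>(j::nat) \<omega>. if j < 2 then ou_mode \<kappa> (?t j) (\<lambda>s. w s \<omega>) else 0"
  have X: "gauss M {..<2} (?X m)" for m
    by (rule ou_approx_gauss[OF BM]) (use t in auto)
  have mY: "?Y j \<in> borel_measurable M" for j
    using ou_mode_measurable[OF BM t(1)] ou_mode_measurable[OF BM t(2)] by simp
  have lim: "AE \<omega> in M. \<forall>j. (\<lambda>m. ?X m j \<omega>) \<longlonglongrightarrow> ?Y j \<omega>"
  proof (rule AE_I2, rule allI)
    fix \<omega> j assume \<omega>: "\<omega> \<in> space M"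
    then have "continuous_on {0..} (\<lambda>s. w s \<omega>)" using BM by (auto simp: std_BM_def)
    from ou_approx_tendsto[OF t(1) this, of \<kappa>] ou_approx_tendsto[OF t(2) this, of \<kappa>]
    show "(\<lambda>m. ?X m j \<omega>) \<longlonglongrightarrow> ?Y j \<omega>" by simp
  qed
  have B: "expectation (\<lambda>\<omega>. ?X m i \<omega> * ?X m i \<omega>) \<le> max t r * (1 + \<kappa> * max t r)\<^sup>2" if "i \<in> {..<2}" for m i
    using ou_approx_second_moment[OF BM t(1) _ less_imp_le[OF \<kappa>] order_refl, of "max t r" "Suc m"]
      ou_approx_second_moment[OF BM t(2) _ less_imp_le[OF \<kappa>] order_refl, of "max t r" "Suc m"] that by auto
  from gauss_limit(2)[OF X mY lim B, of 0 1] ou_mode_cov[OF BM t \<kappa>]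
  show ?thesis by simp
qed

end

section \<open>Almost sure convergence of orthogonal series\<close>

lemma AE_summable_of_expectation:
  fixes f :: "nat \<Rightarrow> 'a \<Rightarrow> real"
  assumes i: "\<And>j. integrable M (f j)" and nn: "\<And>j \<omega>. 0 \<le> f j \<omega>"
    and s: "summable (\<lambda>j. integral\<^sup>L M (f j))"
  shows "AE \<omega> in M. summable (\<lambda>j. f j \<omega>)"
proof -
  have [measurable]: "f j \<in> borel_measurable M" for j using i by blast
  have "(\<integral>\<^sup>+\<omega>. (\<Sum>j. ennreal (f j \<omega>)) \<partial>M) = (\<Sum>j. \<integral>\<^sup>+\<omega>. ennreal (f j \<omega>) \<partial>M)"
    by (rule nn_integral_suminf) simp
  also have "\<dots> = (\<Sum>j. ennreal (integral\<^sup>L M (f j)))"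
    by (subst nn_integral_eq_integral[OF i]) (use nn in auto)
  also have "\<dots> = ennreal (\<Sum>j. integral\<^sup>L M (f j))"
    by (rule suminf_ennreal2[OF _ s]) (use nn in auto)
  finally have "(\<integral>\<^sup>+\<omega>. (\<Sum>j. ennreal (f j \<omega>)) \<partial>M) \<noteq> \<infinity>" by simp
  then have "AE \<omega> in M. (\<Sum>j. ennreal (f j \<omega>)) \<noteq> \<infinity>"
    by (intro nn_integral_PInf_AE) auto
  then show ?thesis
    by eventually_elim (auto intro!: summable_suminf_not_top simp: nn)
qed

lemma ex_cube_between: "\<exists>j::nat. j ^ 3 \<le> m \<and> m < Suc j ^ 3"
proof -
  have "\<exists>j. m < Suc j ^ 3 \<and> (\<forall>i<j. \<not> m < Suc i ^ 3)"
  proof -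
    have "m < Suc m ^ 3" using power_increasing[of 1 3 "Suc m"] by simp
    then show ?thesis using exists_least_iff[of "\<lambda>j. m < Suc j ^ 3"] by blast
  qed
  then obtain j where j: "m < Suc j ^ 3" "\<forall>i<j. \<not> m < Suc i ^ 3" by blast
  then show ?thesis by (cases j) (auto intro!: exI[of _ j] simp: not_less)
qed

text \<open>Within a block between consecutive cubes there are so few indices that even the sum of all
  squared deviations has summable expectation, so no maximal inequality is needed.\<close>

lemma (in prob_space) AE_convergent_orthogonal_sums:
  fixes S :: "nat \<Rightarrow> 'a \<Rightarrow> real"
  assumes [measurable]: "\<And>m. S m \<in> borel_measurable M" and C: "0 \<le> C"
    and i: "\<And>k m. k \<le> m \<Longrightarrow> integrable M (\<lambda>\<omega>. (S m \<omega> - S k \<omega>)\<^sup>2)"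
    and e: "\<And>k m. k \<le> m \<Longrightarrow> expectation (\<lambda>\<omega>. (S m \<omega> - S k \<omega>)\<^sup>2) \<le> (\<Sum>l\<in>{k..<m}. C / (real (Suc l))\<^sup>2)"
  shows "AE \<omega> in M. convergent (\<lambda>m. S m \<omega>)"
proof -
  have bsize: "real (card {j ^ 3..<Suc j ^ 3}) \<le> 3 * (real (Suc j))\<^sup>2" for j
    by (simp add: power3_eq_cube power2_eq_square of_nat_diff algebra_simps)
  have cube: "(real (Suc j)) ^ 3 \<le> 4 * (real (j ^ 3) + 1)" for j
  proof -
    have "0 \<le> 3 * (real j + 1) * (real j - 1)\<^sup>2" by simp
    then show ?thesis by (simp add: power3_eq_cube power2_eq_square algebra_simps)
  qed
  \<comment> \<open>A block has at most 3 (j+1)^2 indices, each with a term O(j^-6), so deviations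
    within it have variance O(j^-4). Summing all their squares over the block still leaves
    O(j^-2).\<close>
  have var: "expectation (\<lambda>\<omega>. (S m \<omega> - S (j ^ 3) \<omega>)\<^sup>2) \<le> 48 * C / (real (Suc j)) ^ 4"
    if m: "j ^ 3 \<le> m" "m \<le> Suc j ^ 3" for j m
  proof -
    have "expectation (\<lambda>\<omega>. (S m \<omega> - S (j ^ 3) \<omega>)\<^sup>2) \<le> (\<Sum>l\<in>{j ^ 3..<m}. C / (real (Suc l))\<^sup>2)" by (rule e[OF m(1)])
    also have "\<dots> \<le> (\<Sum>l\<in>{j ^ 3..<Suc j ^ 3}. C / (real (Suc l))\<^sup>2)"
      by (rule sum_mono2) (use m C in auto)
    also have "\<dots> \<le> (\<Sum>l\<in>{j ^ 3..<Suc j ^ 3}. 16 * C / (real (Suc j)) ^ 6)"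
    proof (rule sum_mono)
      fix l assume "l \<in> {j ^ 3..<Suc j ^ 3}"
      then have "real (j ^ 3) \<le> real l" by (subst of_nat_le_iff) simp
      then have "real (j ^ 3) + 1 \<le> real (Suc l)"
        by (simp only: of_nat_Suc add.commute[of 1] add_le_cancel_right)
      then have "(real (Suc j)) ^ 3 \<le> 4 * real (Suc l)"
        by (intro order_trans[OF cube] mult_left_mono) simp_all
      then have "((real (Suc j)) ^ 3)\<^sup>2 \<le> (4 * real (Suc l))\<^sup>2" by (rule power_mono) simp
      then have "(real (Suc j)) ^ 6 \<le> 16 * (real (Suc l))\<^sup>2" by (simp add: power_mult[symmetric] power_mult_distrib del: of_nat_Suc)
      then have "C * (real (Suc j)) ^ 6 \<le> C * (16 * (real (Suc l))\<^sup>2)" using C by (rule mult_left_mono)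
      then show "C / (real (Suc l))\<^sup>2 \<le> 16 * C / (real (Suc j)) ^ 6"
        by (simp add: divide_le_eq pos_le_divide_eq mult_ac del: of_nat_Suc)
    qed
    also have "\<dots> = real (card {j ^ 3..<Suc j ^ 3}) * (16 * C / (real (Suc j)) ^ 6)" by simp
    also have "\<dots> \<le> 3 * (real (Suc j))\<^sup>2 * (16 * C / (real (Suc j)) ^ 6)"
      using C by (intro mult_right_mono bsize) auto
    also have "\<dots> = 48 * C / (real (Suc j)) ^ 4"
    proof -
      have "3 * x\<^sup>2 * (16 * C / x ^ 6) = 48 * C / x ^ 4" if "x \<noteq> 0" for x :: real
        using that by (simp add: field_simps eval_nat_numeral)
      then show ?thesis by simp
    qed
    finally show ?thesis .
  qed
  have isq: "summable (\<lambda>j. K * (1 / (real (Suc j))\<^sup>2))" for K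
    by (intro summable_mult) (use inverse_squares_sums in \<open>auto simp: sums_iff\<close>)
  \<comment> \<open>\<open>d\<close> controls the subsequence along the cubes and \<open>b\<close>
    the excursions inside a block; their expectations are both O(j^-2).\<close>
  define d where "d j \<omega> = \<bar>S (Suc j ^ 3) \<omega> - S (j ^ 3) \<omega>\<bar>" for j \<omega>
  define b where "b j \<omega> = (\<Sum>m\<in>{j ^ 3..<Suc j ^ 3}. (S m \<omega> - S (j ^ 3) \<omega>)\<^sup>2)" for j \<omega>
  have le3: "j ^ 3 \<le> Suc j ^ 3" for j :: nat by (rule power_mono) auto
  have 1: "AE \<omega> in M. summable (\<lambda>j. d j \<omega>)"
  proof (rule AE_summable_of_expectation)
    show "integrable M (d j)" for j
      unfolding d_def using expectation_abs_le_sqrt(1)[OF _ i[OF le3[of j]]] by simp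
    have "expectation (d j) \<le> sqrt (48 * C) * (1 / (real (Suc j))\<^sup>2)" for j
    proof -
      have "expectation (d j) \<le> sqrt (expectation (\<lambda>\<omega>. (S (Suc j ^ 3) \<omega> - S (j ^ 3) \<omega>)\<^sup>2))"
        unfolding d_def using expectation_abs_le_sqrt(2)[OF _ i[OF le3[of j]]] by simp
      also have "\<dots> \<le> sqrt (48 * C / (real (Suc j)) ^ 4)" by (intro real_sqrt_le_mono var le3) simp
      also have "\<dots> = sqrt (48 * C) * (1 / (real (Suc j))\<^sup>2)"
      proof -
        have "sqrt ((real (Suc j)) ^ 4) = (real (Suc j))\<^sup>2"
          by (rule real_sqrt_unique) (simp_all flip: power_mult)
        then show ?thesis by (simp add: real_sqrt_divide)
      qed
      finally show ?thesis .
    qed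
    then show "summable (\<lambda>j. expectation (d j))"
      by (intro summable_comparison_test'[OF isq, of 0]) (auto simp: d_def)
  qed (simp add: d_def)
  have 2: "AE \<omega> in M. summable (\<lambda>j. b j \<omega>)"
  proof (rule AE_summable_of_expectation)
    show ib: "integrable M (b j)" for j
      unfolding b_def[abs_def] by (intro Bochner_Integration.integrable_sum i) auto
    have "expectation (b j) \<le> 144 * C * (1 / (real (Suc j))\<^sup>2)" for j
    proof -
      have "expectation (b j) = (\<Sum>m\<in>{j ^ 3..<Suc j ^ 3}. expectation (\<lambda>\<omega>. (S m \<omega> - S (j ^ 3) \<omega>)\<^sup>2))"
        unfolding b_def by (intro Bochner_Integration.integral_sum i) auto
      also have "\<dots> \<le> (\<Sum>m\<in>{j ^ 3..<Suc j ^ 3}. 48 * C / (real (Suc j)) ^ 4)"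
        by (intro sum_mono var) auto
      also have "\<dots> = real (card {j ^ 3..<Suc j ^ 3}) * (48 * C / (real (Suc j)) ^ 4)" by simp
      also have "\<dots> \<le> 3 * (real (Suc j))\<^sup>2 * (48 * C / (real (Suc j)) ^ 4)"
        using C by (intro mult_right_mono bsize) auto
      also have "\<dots> = 144 * C * (1 / (real (Suc j))\<^sup>2)"
      proof -
        have "3 * x\<^sup>2 * (48 * C / x ^ 4) = 144 * C * (1 / x\<^sup>2)" if "x \<noteq> 0" for x :: real
          using that by (simp add: field_simps power4_eq_xxxx power2_eq_square)
        then show ?thesis by simp
      qed
      finally show ?thesis .
    qed
    moreover have "0 \<le> expectation (b j)" for j by (rule integral_nonneg_AE) (auto simp: b_def intro!: AE_I2 sum_nonneg)
    ultimately show "summable (\<lambda>j. expectation (b j))"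
      by (intro summable_comparison_test'[OF isq, of 0]) auto
  qed (auto simp: b_def intro: sum_nonneg)
  show ?thesis using 1 2
  proof eventually_elim
    case (elim \<omega>)
    have "summable (\<lambda>j. S (Suc j ^ 3) \<omega> - S (j ^ 3) \<omega>)"
      by (rule summable_rabs_cancel) (use elim(1) in \<open>simp add: d_def\<close>)
    then have "convergent (\<lambda>J. \<Sum>j<J. S (Suc j ^ 3) \<omega> - S (j ^ 3) \<omega>)" by (simp add: summable_iff_convergent)
    moreover have "(\<Sum>j<J. S (Suc j ^ 3) \<omega> - S (j ^ 3) \<omega>) = S (J ^ 3) \<omega> - S 0 \<omega>" for J
      by (subst sum_lessThan_telescope[of "\<lambda>j. S (j ^ 3) \<omega>"]) simp
    ultimately have "convergent (\<lambda>J. S (J ^ 3) \<omega> - S 0 \<omega>)" by simp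
    then obtain l where "(\<lambda>J. S (J ^ 3) \<omega> - S 0 \<omega>) \<longlonglongrightarrow> l" unfolding convergent_def by blast
    then have l: "(\<lambda>J. S (J ^ 3) \<omega>) \<longlonglongrightarrow> l + S 0 \<omega>" using tendsto_add[OF _ tendsto_const, of _ l _ "S 0 \<omega>"] by fastforce
    have bl: "(\<lambda>j. b j \<omega>) \<longlonglongrightarrow> 0" by (rule summable_LIMSEQ_zero[OF elim(2)])
    have "(\<lambda>m. S m \<omega>) \<longlonglongrightarrow> l + S 0 \<omega>"
    proof (rule LIMSEQ_I)
      fix r :: real assume r: "0 < r"
      obtain J1 where J1: "\<And>j. j \<ge> J1 \<Longrightarrow> norm (S (j ^ 3) \<omega> - (l + S 0 \<omega>)) < r / 2"
        using LIMSEQ_D[OF l, of "r / 2"] r by auto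
      obtain J2 where J2: "\<And>j. j \<ge> J2 \<Longrightarrow> norm (b j \<omega> - 0) < (r / 2)\<^sup>2"
        using LIMSEQ_D[OF bl, of "(r / 2)\<^sup>2"] r by auto
      have "norm (S m \<omega> - (l + S 0 \<omega>)) < r" if m: "m \<ge> Suc (max J1 J2) ^ 3" for m
      proof -
        obtain j where j: "j ^ 3 \<le> m" "m < Suc j ^ 3" using ex_cube_between by blast
        have "Suc (max J1 J2) ^ 3 < Suc j ^ 3" using m j by linarith
        have jJ: "max J1 J2 \<le> j"
        proof (rule ccontr)
          assume "\<not> max J1 J2 \<le> j"
          then have "Suc j ^ 3 \<le> Suc (max J1 J2) ^ 3" by (intro power_mono) auto
          with \<open>Suc (max J1 J2) ^ 3 < Suc j ^ 3\<close> show False by simp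
        qed
        have "(S m \<omega> - S (j ^ 3) \<omega>)\<^sup>2 \<le> b j \<omega>"
          unfolding b_def by (rule member_le_sum[of m _ "\<lambda>m. (S m \<omega> - S (j ^ 3) \<omega>)\<^sup>2"]) (use j in auto)
        also have "\<dots> < (r / 2)\<^sup>2" using J2[of j] jJ by auto
        finally have "\<bar>S m \<omega> - S (j ^ 3) \<omega>\<bar>\<^sup>2 < (r / 2)\<^sup>2" by simp
        then have "\<bar>S m \<omega> - S (j ^ 3) \<omega>\<bar> < r / 2" by (rule power2_less_imp_less) (use r in simp)
        then show ?thesis using J1[of j] jJ unfolding real_norm_def by linarith
      qed
      then show "\<exists>no. \<forall>m\<ge>no. norm (S m \<omega> - (l + S 0 \<omega>)) < r" by blast
    qed
    then show ?case by (rule convergentI)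
  qed
qed

section \<open>The solution at finitely many times as a Gaussian vector\<close>

locale she = prob_space +
  fixes w :: "nat \<Rightarrow> real \<Rightarrow> 'a \<Rightarrow> real" and \<theta> :: real
  assumes \<theta>: "\<theta> > 0"
    and BM: "\<And>k. std_BM M (w (Suc k))"
    and indep: "indep_vars (\<lambda>_. PiM UNIV (\<lambda>_. borel)) (\<lambda>k \<omega> t. w k t \<omega>) {1..}"
begin

definition \<kappa> :: "nat \<Rightarrow> real" where "\<kappa> k = \<theta> * (real (Suc k))\<^sup>2"

lemma \<kappa>_pos: "0 < \<kappa> k"
  using \<theta> by (simp add: \<kappa>_def)

definition md :: "nat \<Rightarrow> real \<Rightarrow> 'a \<Rightarrow> real" where "md k t \<omega> = ou_mode (\<kappa> k) t (\<lambda>s. w (Suc k) s \<omega>)"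

definition apx :: "nat \<Rightarrow> nat \<Rightarrow> real \<Rightarrow> 'a \<Rightarrow> real" where
  "apx N k t \<omega> = ou_approx (\<kappa> k) (Suc N) t (\<lambda>s. w (Suc k) s \<omega>)"

lemma md_measurable: "0 \<le> t \<Longrightarrow> md k t \<in> borel_measurable M"
  unfolding md_def[abs_def] by (rule ou_mode_measurable[OF BM])

text \<open>Independence of the Brownian motions is given on the product sigma-algebra, where
  evaluation at finitely many times is measurable, whereas \<open>md\<close> integrates along the
  whole path. The modes are therefore added in discretised form, and N tends to infinity only
  afterwards.\<close>

lemma apx_sum_gauss:
  fixes n :: nat
  assumes t: "\<And>j. j < n \<Longrightarrow> 0 \<le> t j"
  shows "gauss M {..<n} (\<lambda>j \<omega>. if j < n then \<Sum>k<K. g k * apx N k (t j) \<omega> else 0) \<and>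
    (\<forall>i<n. \<forall>j<n. expectation (\<lambda>\<omega>. (\<Sum>k<K. g k * apx N k (t i) \<omega>) * (\<Sum>k<K. g k * apx N k (t j) \<omega>))
      = (\<Sum>k<K. (g k)\<^sup>2 * expectation (\<lambda>\<omega>. apx N k (t i) \<omega> * apx N k (t j) \<omega>)))"
proof (induction K)
  case 0
  then show ?case by (simp add: gauss_zero cong: if_cong)
next
  case (Suc K)
  let ?X = "\<lambda>j \<omega>. if j < n then \<Sum>k<K. g k * apx N k (t j) \<omega> else 0"
  let ?Y = "\<lambda>j \<omega>. if j < n then g K * apx N K (t j) \<omega> else 0"
  have Y: "gauss M {..<n} ?Y"
    unfolding apx_def by (rule ou_approx_gauss[OF BM t])
  let ?P = "\<lambda>_::nat. PiM UNIV (\<lambda>_::real. borel :: real measure)"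
  have r: "indep_var (PiM {1..K} ?P) (\<lambda>\<omega>. restrict (\<lambda>k t. w k t \<omega>) {1..K}) (PiM {Suc K} ?P) (\<lambda>\<omega>. restrict (\<lambda>k t. w k t \<omega>) {Suc K})"
    by (rule indep_var_restrict[OF indep]) auto
  let ?f = "\<lambda>z j. if j < n then \<Sum>k<K. g k * ou_approx (\<kappa> k) (Suc N) (t j) (z (Suc k)) else 0"
  let ?h = "\<lambda>z j. if j < n then g K * ou_approx (\<kappa> K) (Suc N) (t j) (z (Suc K)) else 0"
  have m: "(\<lambda>z. ou_approx (\<kappa> k) (Suc N) (t j) (z (Suc k))) \<in> borel_measurable (PiM I ?P)" if "Suc k \<in> I" for I k j
    unfolding ou_approx_def using that
    by (intro borel_measurable_sum borel_measurable_times borel_measurable_const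
        measurable_compose[OF measurable_component_singleton[of "Suc k"] measurable_component_singleton]) auto
  have "indep_var borel (?f \<circ> (\<lambda>\<omega>. restrict (\<lambda>k t. w k t \<omega>) {1..K})) borel (?h \<circ> (\<lambda>\<omega>. restrict (\<lambda>k t. w k t \<omega>) {Suc K}))"
  proof (rule indep_var_compose[OF r])
    show "?f \<in> measurable (PiM {1..K} ?P) (borel :: (nat \<Rightarrow> real) measure)"
    proof (rule measurable_coordinatewise_then_product)
      fix j show "(\<lambda>z. ?f z j) \<in> borel_measurable (PiM {1..K} ?P)"
        by (cases "j < n") (auto intro!: borel_measurable_sum borel_measurable_times m)
    qed
    show "?h \<in> measurable (PiM {Suc K} ?P) (borel :: (nat \<Rightarrow> real) measure)"
    proof (rule measurable_coordinatewise_then_product)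
      fix j show "(\<lambda>z. ?h z j) \<in> borel_measurable (PiM {Suc K} ?P)"
        by (cases "j < n") (auto intro!: borel_measurable_times m)
    qed
  qed
  moreover have "?f \<circ> (\<lambda>\<omega>. restrict (\<lambda>k t. w k t \<omega>) {1..K}) = (\<lambda>\<omega> j. ?X j \<omega>)"
    by (auto simp: fun_eq_iff apx_def intro!: sum.cong)
  moreover have "?h \<circ> (\<lambda>\<omega>. restrict (\<lambda>k t. w k t \<omega>) {Suc K}) = (\<lambda>\<omega> j. ?Y j \<omega>)"
    by (auto simp: fun_eq_iff apx_def)
  ultimately have ind: "indep_var borel (\<lambda>\<omega> j. ?X j \<omega>) borel (\<lambda>\<omega> j. ?Y j \<omega>)" by simp
  have eq: "(\<lambda>j \<omega>. ?X j \<omega> + ?Y j \<omega>) = (\<lambda>j \<omega>. if j < n then \<Sum>k<Suc K. g k * apx N k (t j) \<omega> else 0)"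
    by (auto simp: fun_eq_iff)
  note G = gauss_add_indep[OF Suc.IH[THEN conjunct1] Y ind]
  have "expectation (\<lambda>\<omega>. (\<Sum>k<Suc K. g k * apx N k (t i) \<omega>) * (\<Sum>k<Suc K. g k * apx N k (t j) \<omega>))
      = (\<Sum>k<Suc K. (g k)\<^sup>2 * expectation (\<lambda>\<omega>. apx N k (t i) \<omega> * apx N k (t j) \<omega>))" if ij: "i < n" "j < n" for i j
  proof -
    have "expectation (\<lambda>\<omega>. (g K * apx N K (t i) \<omega>) * (g K * apx N K (t j) \<omega>))
      = expectation (\<lambda>\<omega>. (g K)\<^sup>2 * (apx N K (t i) \<omega> * apx N K (t j) \<omega>))"
      by (simp add: power2_eq_square mult_ac)
    then show ?thesis using G(2)[of i j] Suc.IH ij by simp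
  qed
  then show ?case using G(1) unfolding eq by blast
qed

lemma md_sum_gauss:
  fixes n :: nat
  assumes t: "\<And>j. j < n \<Longrightarrow> 0 \<le> t j"
  shows "gauss M {..<n} (\<lambda>j \<omega>. if j < n then \<Sum>k<K. g k * md k (t j) \<omega> else 0)"
    "\<And>i j. i < n \<Longrightarrow> j < n \<Longrightarrow> expectation (\<lambda>\<omega>. (\<Sum>k<K. g k * md k (t i) \<omega>) * (\<Sum>k<K. g k * md k (t j) \<omega>))
      = (\<Sum>k<K. (g k)\<^sup>2 * ou_cov (\<kappa> k) (t i) (t j))"
proof -
  let ?X = "\<lambda>N j \<omega>. if j < n then \<Sum>k<K. g k * apx N k (t j) \<omega> else 0"
  let ?Y = "\<lambda>j \<omega>. if j < n then \<Sum>k<K. g k * md k (t j) \<omega> else 0"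
  have X: "gauss M {..<n} (?X N)" for N using apx_sum_gauss[of n t, OF t] by blast
  have mY: "?Y j \<in> borel_measurable M" for j
    using t by (cases "j < n") (auto intro!: borel_measurable_sum borel_measurable_times md_measurable)
  have lim: "AE \<omega> in M. \<forall>j. (\<lambda>N. ?X N j \<omega>) \<longlonglongrightarrow> ?Y j \<omega>"
  proof (rule AE_I2, rule allI)
    fix \<omega> j assume \<omega>: "\<omega> \<in> space M"
    have c: "continuous_on {0..} (\<lambda>s. w (Suc k) s \<omega>)" for k using BM[of k] \<omega> by (auto simp: std_BM_def)
    show "(\<lambda>N. ?X N j \<omega>) \<longlonglongrightarrow> ?Y j \<omega>"
    proof (cases "j < n")
      case True
      have "(\<lambda>N. \<Sum>k<K. g k * apx N k (t j) \<omega>) \<longlonglongrightarrow> (\<Sum>k<K. g k * md k (t j) \<omega>)"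
        unfolding apx_def md_def by (intro tendsto_intros ou_approx_tendsto t True c)
      then show ?thesis using True by simp
    qed simp
  qed
  define T where "T = (\<Sum>j<n. t j)"
  have T: "t j \<le> T" if "j < n" for j unfolding T_def by (rule member_le_sum) (use t that in auto)
  have B: "expectation (\<lambda>\<omega>. ?X N i \<omega> * ?X N i \<omega>) \<le> (\<Sum>k<K. (g k)\<^sup>2 * (T * (1 + \<kappa> k * T)\<^sup>2))" if "i \<in> {..<n}" for N i
  proof -
    have "expectation (\<lambda>\<omega>. ?X N i \<omega> * ?X N i \<omega>) = (\<Sum>k<K. (g k)\<^sup>2 * expectation (\<lambda>\<omega>. apx N k (t i) \<omega> * apx N k (t i) \<omega>))"
      using apx_sum_gauss[of n t, OF t] that by simp
    also have "\<dots> \<le> (\<Sum>k<K. (g k)\<^sup>2 * (T * (1 + \<kappa> k * T)\<^sup>2))"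
      unfolding apx_def
      by (intro sum_mono mult_left_mono ou_approx_second_moment[OF BM]) (use that t T \<kappa>_pos in \<open>auto intro: less_imp_le\<close>)
    finally show ?thesis .
  qed
  note G = gauss_limit[OF X mY lim B]
  show "gauss M {..<n} ?Y" using G(1) by simp
  fix i j assume ij: "i < n" "j < n"
  have "(\<lambda>N. expectation (\<lambda>\<omega>. ?X N i \<omega> * ?X N j \<omega>)) \<longlonglongrightarrow> expectation (\<lambda>\<omega>. ?Y i \<omega> * ?Y j \<omega>)" using G(2)[of i j] ij by simp
  then have "(\<lambda>N. \<Sum>k<K. (g k)\<^sup>2 * expectation (\<lambda>\<omega>. apx N k (t i) \<omega> * apx N k (t j) \<omega>)) \<longlonglongrightarrow> expectation (\<lambda>\<omega>. ?Y i \<omega> * ?Y j \<omega>)"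
    using apx_sum_gauss[of n t, OF t] ij by simp
  moreover have "(\<lambda>N. \<Sum>k<K. (g k)\<^sup>2 * expectation (\<lambda>\<omega>. apx N k (t i) \<omega> * apx N k (t j) \<omega>)) \<longlonglongrightarrow> (\<Sum>k<K. (g k)\<^sup>2 * ou_cov (\<kappa> k) (t i) (t j))"
    unfolding apx_def by (intro tendsto_intros ou_approx_cov_tendsto[OF BM] t ij \<kappa>_pos)
  ultimately have "expectation (\<lambda>\<omega>. ?Y i \<omega> * ?Y j \<omega>) = (\<Sum>k<K. (g k)\<^sup>2 * ou_cov (\<kappa> k) (t i) (t j))" by (rule LIMSEQ_unique)
  then show "expectation (\<lambda>\<omega>. (\<Sum>k<K. g k * md k (t i) \<omega>) * (\<Sum>k<K. g k * md k (t j) \<omega>)) = (\<Sum>k<K. (g k)\<^sup>2 * ou_cov (\<kappa> k) (t i) (t j))"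
    using ij by simp
qed

lemma ou_cov_diag_le: "0 \<le> t \<Longrightarrow> ou_cov (\<kappa> k) t t \<le> 1 / (2 * \<kappa> k)"
  using \<kappa>_pos[of k] unfolding ou_cov_def by (intro divide_right_mono) auto

lemma ou_cov_diag_nonneg: "0 \<le> t \<Longrightarrow> 0 \<le> ou_cov (\<kappa> k) t t"
  using \<kappa>_pos[of k] unfolding ou_cov_def by simp

lemma md_series_convergent:
  assumes t: "0 \<le> t" and g: "\<And>k. (g k)\<^sup>2 \<le> G"
  shows "AE \<omega> in M. summable (\<lambda>k. g k * md k t \<omega>)"
proof -
  have G0: "0 \<le> G" using g[of 0] by (rule order_trans[OF zero_le_power2])
  have sq: "integrable M (\<lambda>\<omega>. ((\<Sum>l<m. g l * md l t \<omega>) - (\<Sum>l<k. g l * md l t \<omega>))\<^sup>2) \<and>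
     expectation (\<lambda>\<omega>. ((\<Sum>l<m. g l * md l t \<omega>) - (\<Sum>l<k. g l * md l t \<omega>))\<^sup>2) \<le> (\<Sum>l\<in>{k..<m}. (G / (2 * \<theta>)) / (real (Suc l))\<^sup>2)"
    if km: "k \<le> m" for k m
  proof -
    \<comment> \<open>Setting the first k coefficients to 0 makes the difference of two partial sums
      an instance of \<open>md_sum_gauss\<close> at a single time.\<close>
    let ?g = "\<lambda>l. if k \<le> l then g l else 0"
    have diff: "(\<Sum>l<m. g l * md l t \<omega>) - (\<Sum>l<k. g l * md l t \<omega>) = (\<Sum>l<m. ?g l * md l t \<omega>)" for \<omega>
    proof -
      have "(\<Sum>l<m. g l * md l t \<omega>) = (\<Sum>l<k. g l * md l t \<omega>) + (\<Sum>l\<in>{k..<m}. g l * md l t \<omega>)"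
        unfolding lessThan_atLeast0 using sum.atLeastLessThan_concat[of 0 k m "\<lambda>l. g l * md l t \<omega>"] km by simp
      moreover have "(\<Sum>l\<in>{k..<m}. g l * md l t \<omega>) = (\<Sum>l<m. ?g l * md l t \<omega>)"
        by (rule sum.mono_neutral_cong_left) auto
      ultimately show ?thesis by simp
    qed
    note MG = md_sum_gauss[where n = 1 and t = "\<lambda>_. t" and K = m and g = ?g, OF t]
    have "integrable M (\<lambda>\<omega>. (\<Sum>l<m. ?g l * md l t \<omega>) * (\<Sum>l<m. ?g l * md l t \<omega>))"
      using gauss_integrable_prod[OF MG(1), of 0 0] by simp
    moreover have "expectation (\<lambda>\<omega>. (\<Sum>l<m. ?g l * md l t \<omega>) * (\<Sum>l<m. ?g l * md l t \<omega>)) = (\<Sum>l<m. (?g l)\<^sup>2 * ou_cov (\<kappa> l) t t)"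
      using MG(2)[of 0 0] by simp
    moreover have "(\<Sum>l<m. (?g l)\<^sup>2 * ou_cov (\<kappa> l) t t) = (\<Sum>l\<in>{k..<m}. (g l)\<^sup>2 * ou_cov (\<kappa> l) t t)"
      by (rule sum.mono_neutral_cong_right) auto
    moreover have "\<dots> \<le> (\<Sum>l\<in>{k..<m}. (G / (2 * \<theta>)) / (real (Suc l))\<^sup>2)"
    proof (rule sum_mono)
      fix l
      have "(g l)\<^sup>2 * ou_cov (\<kappa> l) t t \<le> G * (1 / (2 * \<kappa> l))"
        using G0 by (intro mult_mono g ou_cov_diag_le t ou_cov_diag_nonneg) auto
      then show "(g l)\<^sup>2 * ou_cov (\<kappa> l) t t \<le> (G / (2 * \<theta>)) / (real (Suc l))\<^sup>2" by (simp add: \<kappa>_def)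
    qed
    ultimately show ?thesis unfolding diff power2_eq_square[of "sum _ _"] by simp
  qed
  have "AE \<omega> in M. convergent (\<lambda>m. \<Sum>l<m. g l * md l t \<omega>)"
  proof (rule AE_convergent_orthogonal_sums)
    show "(\<lambda>\<omega>. \<Sum>l<m. g l * md l t \<omega>) \<in> borel_measurable M" for m
      by (intro borel_measurable_sum borel_measurable_times md_measurable[OF t] borel_measurable_const)
    show "0 \<le> G / (2 * \<theta>)" using G0 \<theta> by simp
    show "integrable M (\<lambda>\<omega>. ((\<Sum>l<m. g l * md l t \<omega>) - (\<Sum>l<k. g l * md l t \<omega>))\<^sup>2)" if "k \<le> m" for k m
      using sq[OF that] by blast
    show "expectation (\<lambda>\<omega>. ((\<Sum>l<m. g l * md l t \<omega>) - (\<Sum>l<k. g l * md l t \<omega>))\<^sup>2) \<le> (\<Sum>l\<in>{k..<m}. (G / (2 * \<theta>)) / (real (Suc l))\<^sup>2)"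
      if "k \<le> m" for k m using sq[OF that] by blast
  qed
  then show ?thesis by (simp add: summable_iff_convergent)
qed

end

locale she_point = she +
  fixes \<sigma> x :: real
begin

definition g :: "nat \<Rightarrow> real" where "g k = \<sigma> * eig_fun (Suc k) x"

definition sol :: "real \<Rightarrow> 'a \<Rightarrow> real" where "sol t \<omega> = she_sol \<theta> \<sigma> w t x \<omega>"

lemma g_square: "(g k)\<^sup>2 = \<sigma>\<^sup>2 * (2 / pi) * (sin (real (Suc k) * x))\<^sup>2"
  by (simp add: g_def eig_fun_def power_mult_distrib del: of_nat_Suc)

lemma g_square_le: "(g k)\<^sup>2 \<le> \<sigma>\<^sup>2 * (2 / pi)"
proof -
  have "(sin (real (Suc k) * x))\<^sup>2 \<le> 1" by (simp add: abs_square_le_1 del: of_nat_Suc)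
  then have "\<sigma>\<^sup>2 * (2 / pi) * (sin (real (Suc k) * x))\<^sup>2 \<le> \<sigma>\<^sup>2 * (2 / pi) * 1"
    by (intro mult_left_mono) auto
  then show ?thesis unfolding g_square by simp
qed

lemma she_mode_eq:
  assumes "\<omega> \<in> space M"
  shows "she_mode \<theta> \<sigma> w (Suc k) t \<omega> = \<sigma> * md k t \<omega>"
proof -
  let ?f = "\<lambda>s. exp (- \<theta> * (real (Suc k))\<^sup>2 * (t - s))"
  have w0: "w (Suc k) 0 \<omega> = 0" using BM[of k] assms by (auto simp: std_BM_def)
  have "deriv ?f s = \<kappa> k * exp (- \<kappa> k * (t - s))" for s
    by (rule DERIV_imp_deriv) (auto intro!: derivative_eq_intros simp: \<kappa>_def)
  then have "integral {0..t} (\<lambda>s. deriv ?f s * w (Suc k) s \<omega>)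
      = integral {0..t} (\<lambda>s. \<kappa> k * (exp (- \<kappa> k * (t - s)) * w (Suc k) s \<omega>))" by (simp only: mult.assoc)
  then show ?thesis
    by (simp add: she_mode_def wiener_integral_def md_def ou_mode_def w0)
qed

lemma sol_eq: "\<omega> \<in> space M \<Longrightarrow> sol t \<omega> = (\<Sum>k. g k * md k t \<omega>)"
  by (simp add: sol_def she_sol_def she_mode_eq g_def mult_ac del: of_nat_Suc)

lemma sol_measurable:
  assumes t: "0 \<le> t"
  shows "sol t \<in> borel_measurable M"
proof -
  have "(\<lambda>\<omega>. \<Sum>k. g k * md k t \<omega>) \<in> borel_measurable M"
    by (intro borel_measurable_suminf borel_measurable_times borel_measurable_const md_measurable[OF t])
  then show ?thesis by (subst measurable_cong[OF sol_eq])
qed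

text \<open>Truncated series are Gaussian with explicit covariances. Almost sure convergence at each
  of finitely many times, with variances bounded by a convergent series, passes this on to the
  pathwise defined solution.\<close>

lemma sol_gauss:
  fixes n :: nat
  assumes t: "\<And>j. j < n \<Longrightarrow> 0 \<le> t j"
  shows "gauss M {..<n} (\<lambda>j \<omega>. if j < n then sol (t j) \<omega> else 0)"
    "\<And>i j. i < n \<Longrightarrow> j < n \<Longrightarrow> (\<lambda>k. (g k)\<^sup>2 * ou_cov (\<kappa> k) (t i) (t j)) sums expectation (\<lambda>\<omega>. sol (t i) \<omega> * sol (t j) \<omega>)"
proof -
  let ?X = "\<lambda>K j \<omega>. if j < n then \<Sum>k<K. g k * md k (t j) \<omega> else 0"
  let ?Y = "\<lambda>j \<omega>. if j < n then sol (t j) \<omega> else 0"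
  have X: "gauss M {..<n} (?X K)" for K by (rule md_sum_gauss(1)[OF t])
  have mY: "?Y j \<in> borel_measurable M" for j
    using t by (cases "j < n") (auto intro!: sol_measurable)
  have lim: "AE \<omega> in M. \<forall>j. (\<lambda>K. ?X K j \<omega>) \<longlonglongrightarrow> ?Y j \<omega>"
    unfolding AE_all_countable
  proof
    fix j
    show "AE \<omega> in M. (\<lambda>K. ?X K j \<omega>) \<longlonglongrightarrow> ?Y j \<omega>"
    proof (cases "j < n")
      case True
      have "AE \<omega> in M. summable (\<lambda>k. g k * md k (t j) \<omega>)"
        by (rule md_series_convergent[OF t[OF True] g_square_le])
      with AE_space show ?thesis
      proof eventually_elim
        case (elim \<omega>)
        then show ?case using summable_LIMSEQ[OF elim(2)] True by (simp add: sol_eq)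
      qed
    qed simp
  qed
  have isq: "summable (\<lambda>l. (\<sigma>\<^sup>2 * (2 / pi) / (2 * \<theta>)) * (1 / (real (Suc l))\<^sup>2))"
    by (intro summable_mult) (use inverse_squares_sums in \<open>auto simp: sums_iff\<close>)
  have B: "expectation (\<lambda>\<omega>. ?X K i \<omega> * ?X K i \<omega>) \<le> (\<Sum>l. (\<sigma>\<^sup>2 * (2 / pi) / (2 * \<theta>)) * (1 / (real (Suc l))\<^sup>2))" if "i \<in> {..<n}" for K i
  proof -
    have i: "i < n" using that by simp
    have "expectation (\<lambda>\<omega>. ?X K i \<omega> * ?X K i \<omega>) = (\<Sum>k<K. (g k)\<^sup>2 * ou_cov (\<kappa> k) (t i) (t i))"
      using md_sum_gauss(2)[where n = n and t = t and g = g, OF t] i by simp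
    also have "\<dots> \<le> (\<Sum>k<K. (\<sigma>\<^sup>2 * (2 / pi) / (2 * \<theta>)) * (1 / (real (Suc k))\<^sup>2))"
    proof (rule sum_mono)
      fix k
      have "(g k)\<^sup>2 * ou_cov (\<kappa> k) (t i) (t i) \<le> \<sigma>\<^sup>2 * (2 / pi) * (1 / (2 * \<kappa> k))"
        by (intro mult_mono g_square_le ou_cov_diag_le ou_cov_diag_nonneg t[OF i]) auto
      then show "(g k)\<^sup>2 * ou_cov (\<kappa> k) (t i) (t i) \<le> (\<sigma>\<^sup>2 * (2 / pi) / (2 * \<theta>)) * (1 / (real (Suc k))\<^sup>2)"
        by (simp add: \<kappa>_def)
    qed
    also have "\<dots> \<le> (\<Sum>l. (\<sigma>\<^sup>2 * (2 / pi) / (2 * \<theta>)) * (1 / (real (Suc l))\<^sup>2))"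
      by (rule sum_le_suminf[OF isq]) (use \<theta> in auto)
    finally show ?thesis .
  qed
  note G = gauss_limit[OF X mY lim B]
  show "gauss M {..<n} ?Y" using G(1) by simp
  fix i j assume ij: "i < n" "j < n"
  have "(\<lambda>K. expectation (\<lambda>\<omega>. ?X K i \<omega> * ?X K j \<omega>)) \<longlonglongrightarrow> expectation (\<lambda>\<omega>. ?Y i \<omega> * ?Y j \<omega>)" using G(2)[of i j] ij by simp
  then show "(\<lambda>k. (g k)\<^sup>2 * ou_cov (\<kappa> k) (t i) (t j)) sums expectation (\<lambda>\<omega>. sol (t i) \<omega> * sol (t j) \<omega>)"
    unfolding sums_def using md_sum_gauss(2)[where n = n and t = t and g = g, OF t] ij by simp
qed

end

section \<open>Asymptotics of the increment covariances\<close>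

text \<open>With truncated subtraction \<open>(j - k) + (k - j)\<close> is |j - k|, and a lag m > 0
  occurs at 2 (n - m) places of the n by n array.\<close>

lemma sum_nat_dist:
  fixes f :: "nat \<Rightarrow> real"
  shows "(\<Sum>j<n. \<Sum>k<n. f ((j - k) + (k - j))) = real n * f 0 + 2 * (\<Sum>m=1..n. (real n - real m) * f m)"
proof (induction n)
  case (Suc n)
  have rev: "(\<Sum>j<n. f (n - j)) = (\<Sum>m=1..n. f m)"
    by (rule sum.reindex_bij_witness[of _ "\<lambda>m. n - m" "\<lambda>j. n - j"]) auto
  have "(\<Sum>j<Suc n. \<Sum>k<Suc n. f ((j - k) + (k - j)))
     = (\<Sum>j<n. \<Sum>k<n. f ((j - k) + (k - j))) + (\<Sum>j<n. f (n - j)) + (\<Sum>k<n. f (n - k)) + f 0"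
    by (simp add: sum.distrib)
  also have "\<dots> = real (Suc n) * f 0 + 2 * (\<Sum>m=1..Suc n. (real (Suc n) - real m) * f m)"
    unfolding Suc rev by (simp add: algebra_simps sum.distrib sum_subtractf)
  finally show ?case .
qed simp

lemma sum_nat_dist_row:
  fixes f :: "nat \<Rightarrow> real"
  assumes f: "\<And>m. 0 \<le> f m" and i: "i < n"
  shows "(\<Sum>j<n. f ((i - j) + (j - i))) \<le> f 0 + 2 * (\<Sum>m=1..n. f m)"
proof -
  have "(\<Sum>j<n. f ((i - j) + (j - i))) = (\<Sum>j<i. f ((i - j) + (j - i))) + (\<Sum>j=i..<n. f ((i - j) + (j - i)))"
    unfolding lessThan_atLeast0 by (rule sum.atLeastLessThan_concat[symmetric]) (use i in auto)
  also have "\<dots> = (\<Sum>j<i. f ((i - j) + (j - i))) + f 0 + (\<Sum>j\<in>{Suc i..<n}. f ((i - j) + (j - i)))"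
    unfolding sum.atLeast_Suc_lessThan[OF i] by simp
  also have "(\<Sum>j<i. f ((i - j) + (j - i))) = (\<Sum>m=1..i. f m)"
    by (rule sum.reindex_bij_witness[of _ "\<lambda>m. i - m" "\<lambda>j. i - j"]) auto
  also have "\<dots> \<le> (\<Sum>m=1..n. f m)" by (rule sum_mono2) (use f i in auto)
  also have "(\<Sum>j\<in>{Suc i..<n}. f ((i - j) + (j - i))) = (\<Sum>m=1..<n - i. f m)"
    by (rule sum.reindex_bij_witness[of _ "\<lambda>m. i + m" "\<lambda>j. j - i"]) auto
  also have "\<dots> \<le> (\<Sum>m=1..n. f m)" by (rule sum_mono2) (use f in auto)
  finally show ?thesis by simp
qed

text \<open>Tannery's theorem for the sum extended by 0 beyond n - 1; the shift by
  \<open>Suc\<close> accounts for lags starting at 1.\<close>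

lemma weighted_sum_tendsto:
  fixes f :: "nat \<Rightarrow> nat \<Rightarrow> real"
  assumes l: "\<And>m. 1 \<le> m \<Longrightarrow> (\<lambda>n. f n m) \<longlonglongrightarrow> l m"
    and b: "\<And>n m. 0 < n \<Longrightarrow> 1 \<le> m \<Longrightarrow> \<bar>f n m\<bar> \<le> b m" and s: "summable (\<lambda>m. b (Suc m))"
  shows "(\<lambda>n. \<Sum>m=1..n-1. (1 - real m / real n) * f n m) \<longlonglongrightarrow> (\<Sum>m. l (Suc m))"
proof -
  define a where "a m n = (if Suc m < n then (1 - real (Suc m) / real n) * f n (Suc m) else 0)" for m n
  have lim: "(\<lambda>n. a m n) \<longlonglongrightarrow> l (Suc m)" for m
  proof -
    have "(\<lambda>n. (1 - real (Suc m) / real n) * f n (Suc m)) \<longlonglongrightarrow> (1 - 0) * l (Suc m)"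
      by (intro tendsto_mult tendsto_diff tendsto_const lim_const_over_n l) simp
    moreover have "\<forall>\<^sub>F n in sequentially. (1 - real (Suc m) / real n) * f n (Suc m) = a m n"
      using eventually_gt_at_top[of "Suc m"] by eventually_elim (simp add: a_def)
    ultimately show ?thesis by (simp add: tendsto_cong)
  qed
  have bd: "norm (a m n) \<le> b (Suc m)" if "n > 0" for m n
  proof (cases "Suc m < n")
    case True
    have "\<bar>1 - real (Suc m) / real n\<bar> * \<bar>f n (Suc m)\<bar> \<le> 1 * b (Suc m)"
      by (intro mult_mono b that) (use True in \<open>auto simp: field_simps\<close>)
    then show ?thesis using True by (simp add: a_def abs_mult)
  next
    case False
    then show ?thesis using b[OF that, of "Suc m"] by (simp add: a_def)
  qed
  have "eventually (\<lambda>(m, n). norm (a m n) \<le> b (Suc m)) (at_top \<times>\<^sub>F sequentially)"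
    unfolding eventually_prod_filter
    by (rule exI[of _ "\<lambda>_. True"], rule exI[of _ "\<lambda>n. n > 0"]) (auto simp: bd[unfolded real_norm_def] eventually_gt_at_top)
  from tannerys_theorem[OF lim this s]
  have "(\<lambda>n. suminf (\<lambda>m. a m n)) \<longlonglongrightarrow> (\<Sum>m. l (Suc m))" by simp
  moreover have "suminf (\<lambda>m. a m n) = (\<Sum>m=1..n-1. (1 - real m / real n) * f n m)" for n
  proof -
    have "suminf (\<lambda>m. a m n) = (\<Sum>m<n-1. a m n)" by (rule suminf_finite) (auto simp: a_def)
    also have "\<dots> = (\<Sum>m=1..n-1. (1 - real m / real n) * f n m)"
      by (rule sum.reindex_bij_witness[of _ "\<lambda>m. m - 1" Suc]) (auto simp: a_def)
    finally show ?thesis .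
  qed
  ultimately show ?thesis by simp
qed

text \<open>\<open>r\<close> is a stationary approximation to the covariance array \<open>R\<close>,
  with error \<open>e\<close>. The bound \<open>rs\<close> keeps row sums bounded, \<open>rb\<close>
  supplies the square-summable majorant for the lag sums, and since n^2 entries are divided by n, an
  error with n e n tending to 0 is negligible.\<close>

locale near_stationary =
  fixes R :: "nat \<Rightarrow> nat \<Rightarrow> nat \<Rightarrow> real" and r :: "nat \<Rightarrow> nat \<Rightarrow> real" and e :: "nat \<Rightarrow> real" and l :: "nat \<Rightarrow> real"
  assumes R: "\<And>n i j. i < n \<Longrightarrow> j < n \<Longrightarrow> \<bar>R n i j - r n ((i - j) + (j - i))\<bar> \<le> e n"
    and e: "(\<lambda>n. real n * e n) \<longlonglongrightarrow> 0"
    and r0: "\<And>n. 0 < n \<Longrightarrow> r n 0 = 1"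
    and rb: "\<And>n m. 0 < n \<Longrightarrow> 1 \<le> m \<Longrightarrow> \<bar>r n m\<bar> \<le> 1 / (2 * real m)"
    and rs: "\<And>n m. 0 < n \<Longrightarrow> (\<Sum>k=1..m. \<bar>r n k\<bar>) \<le> 1 / 2"
    and rl: "\<And>m. 1 \<le> m \<Longrightarrow> (\<lambda>n. r n m) \<longlonglongrightarrow> l m"
begin

lemma e_nonneg: "0 < n \<Longrightarrow> 0 \<le> e n"
  using R[of 0 n 0] by (rule order_trans[OF abs_ge_zero]) auto

lemma row_sum: "\<exists>B\<ge>1. \<forall>n i. i < n \<longrightarrow> (\<Sum>j<n. \<bar>R n i j\<bar>) \<le> B"
proof -
  obtain K where K: "\<And>n. norm (real n * e n) \<le> K"
    using Bseq_eq_bounded[of "\<lambda>n. real n * e n"] convergent_imp_Bseq[OF convergentI[OF e]] by (auto simp: Bseq_def)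
  have "(\<Sum>j<n. \<bar>R n i j\<bar>) \<le> 2 + \<bar>K\<bar>" if i: "i < n" for n i
  proof -
    have n: "0 < n" using i by simp
    have "(\<Sum>j<n. \<bar>R n i j\<bar>) \<le> (\<Sum>j<n. \<bar>r n ((i - j) + (j - i))\<bar> + e n)"
    proof (rule sum_mono)
      fix j assume "j \<in> {..<n}"
      then have "\<bar>R n i j - r n ((i - j) + (j - i))\<bar> \<le> e n" using R i by simp
      then show "\<bar>R n i j\<bar> \<le> \<bar>r n ((i - j) + (j - i))\<bar> + e n" by linarith
    qed
    also have "\<dots> = (\<Sum>j<n. \<bar>r n ((i - j) + (j - i))\<bar>) + real n * e n" by (simp add: sum.distrib)
    also have "\<dots> \<le> (\<bar>r n 0\<bar> + 2 * (\<Sum>m=1..n. \<bar>r n m\<bar>)) + \<bar>K\<bar>"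
      using sum_nat_dist_row[of "\<lambda>m. \<bar>r n m\<bar>" i n] i K[of n] by (intro add_mono) auto
    also have "\<dots> \<le> 2 + \<bar>K\<bar>" using r0[OF n] rs[OF n, of n] by simp
    finally show ?thesis .
  qed
  then show ?thesis by (intro exI[of _ "2 + \<bar>K\<bar>"]) auto
qed

lemma r_le_1: "0 < n \<Longrightarrow> \<bar>r n m\<bar> \<le> 1"
proof (cases "m = 0")
  case False
  assume "0 < n"
  have "1 / (2 * real m) \<le> 1" using False by (simp add: field_simps)
  then show ?thesis using rb[OF \<open>0 < n\<close>, of m] False by linarith
qed (simp add: r0)

text \<open>This is what makes the \<open>lim\<close> in \<open>sbar2\<close> and
  \<open>sbar4\<close> an actual limit: for p \<ge> 2 the powers are dominated by 1 / m^2 uniformly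
  in n.\<close>

lemma power_sum_tendsto:
  assumes p: "2 \<le> p"
  shows "convergent (\<lambda>n. \<Sum>m=1..n-1. (1 - real m / real n) * \<bar>r n m\<bar> ^ p)"
proof (rule convergentI, rule weighted_sum_tendsto)
  show "(\<lambda>n. \<bar>r n m\<bar> ^ p) \<longlonglongrightarrow> \<bar>l m\<bar> ^ p" if "1 \<le> m" for m
    by (intro tendsto_intros rl that)
  show "\<bar>\<bar>r n m\<bar> ^ p\<bar> \<le> 1 / (real m)\<^sup>2" if "0 < n" "1 \<le> m" for n m
  proof -
    have "\<bar>r n m\<bar> ^ p \<le> \<bar>r n m\<bar> ^ 2" using r_le_1[OF that(1)] p by (intro power_decreasing) auto
    also have "\<dots> \<le> (1 / real m) ^ 2"
    proof (rule power_mono)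
      have "1 / (2 * real m) \<le> 1 / real m" using that by (simp add: field_simps)
      then show "\<bar>r n m\<bar> \<le> 1 / real m" using rb[OF that] by linarith
    qed simp
    finally show ?thesis by (simp add: power_divide)
  qed
  show "summable (\<lambda>m. 1 / (real (Suc m))\<^sup>2)" using inverse_squares_sums by (auto simp: sums_iff)
qed

lemma power_sum_lim_nonneg:
  assumes p: "2 \<le> p"
  shows "0 \<le> lim (\<lambda>n. \<Sum>m=1..n-1. (1 - real m / real n) * \<bar>r n m\<bar> ^ p)"
proof (rule LIMSEQ_le_const[OF power_sum_tendsto[OF p, unfolded convergent_LIMSEQ_iff]])
  show "\<exists>N. \<forall>n\<ge>N. 0 \<le> (\<Sum>m=1..n-1. (1 - real m / real n) * \<bar>r n m\<bar> ^ p)"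
    by (intro exI[of _ 0] allI impI sum_nonneg mult_nonneg_nonneg) (auto simp: divide_le_eq)
qed

lemma double_sum_eq:
  assumes n: "0 < n"
  shows "(\<Sum>j<n. \<Sum>k<n. \<bar>r n ((j - k) + (k - j))\<bar> ^ p) / real n
    = 1 + 2 * (\<Sum>m=1..n-1. (1 - real m / real n) * \<bar>r n m\<bar> ^ p)"
proof -
  have "(\<Sum>m=1..n. (real n - real m) * \<bar>r n m\<bar> ^ p) = (\<Sum>m=1..n-1. (real n - real m) * \<bar>r n m\<bar> ^ p)"
    by (rule sum.mono_neutral_right) auto
  also have "\<dots> = real n * (\<Sum>m=1..n-1. (1 - real m / real n) * \<bar>r n m\<bar> ^ p)"
    unfolding sum_distrib_left using n by (intro sum.cong refl) (simp add: field_simps)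
  finally show ?thesis unfolding sum_nat_dist[of "\<lambda>m. \<bar>r n m\<bar> ^ p"] using n by (simp add: r0 field_simps)
qed

lemma abs_prod_diff_le:
  fixes a b c d B :: real
  assumes "\<bar>a - c\<bar> \<le> s" "\<bar>b - d\<bar> \<le> t" "\<bar>b\<bar> \<le> B" "\<bar>c\<bar> \<le> C"
  shows "\<bar>a * b - c * d\<bar> \<le> s * B + C * t"
proof -
  have "a * b - c * d = (a - c) * b + c * (b - d)" by (simp add: algebra_simps)
  also have "\<bar>\<dots>\<bar> \<le> \<bar>a - c\<bar> * \<bar>b\<bar> + \<bar>c\<bar> * \<bar>b - d\<bar>" by (metis abs_mult abs_triangle_ineq)
  also have "\<dots> \<le> s * B + C * t"
    using assms by (intro add_mono mult_mono) (auto intro: order_trans[OF abs_ge_zero])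
  finally show ?thesis .
qed

text \<open>For the stationary array the double sum is a weighted sum over lags, with a known limit.
  Replacing \<open>r\<close> by \<open>R\<close> changes each of the n^2 entries by at most C e n,
  hence the average by at most C n e n.\<close>

lemma q_tendsto:
  "(\<lambda>n. (\<Sum>j<n. \<Sum>k<n. 72 * R n j j * R n k k * (R n j k)\<^sup>2 + 24 * R n j k ^ 4) / real n)
   \<longlonglongrightarrow> (72 + 144 * lim (\<lambda>n. \<Sum>m=1..n-1. (1 - real m / real n) * \<bar>r n m\<bar> ^ 2))
      + (24 + 48 * lim (\<lambda>n. \<Sum>m=1..n-1. (1 - real m / real n) * \<bar>r n m\<bar> ^ 4))" (is "?a \<longlonglongrightarrow> ?L")
proof (rule Lim_transform)
  let ?b = "\<lambda>n. (\<Sum>j<n. \<Sum>k<n. 72 * \<bar>r n ((j - k) + (k - j))\<bar> ^ 2 + 24 * \<bar>r n ((j - k) + (k - j))\<bar> ^ 4) / real n"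
  have eq: "?b n = 72 * (1 + 2 * (\<Sum>m=1..n-1. (1 - real m / real n) * \<bar>r n m\<bar> ^ 2))
     + 24 * (1 + 2 * (\<Sum>m=1..n-1. (1 - real m / real n) * \<bar>r n m\<bar> ^ 4))" if "0 < n" for n
    unfolding double_sum_eq[OF that, symmetric] by (simp only: sum.distrib sum_distrib_left[symmetric] add_divide_distrib times_divide_eq_right)
  have c2: "(\<lambda>n. \<Sum>m=1..n-1. (1 - real m / real n) * \<bar>r n m\<bar> ^ 2) \<longlonglongrightarrow> lim (\<lambda>n. \<Sum>m=1..n-1. (1 - real m / real n) * \<bar>r n m\<bar> ^ 2)"
    using power_sum_tendsto[of 2] by (simp add: convergent_LIMSEQ_iff)
  have c4: "(\<lambda>n. \<Sum>m=1..n-1. (1 - real m / real n) * \<bar>r n m\<bar> ^ 4) \<longlonglongrightarrow> lim (\<lambda>n. \<Sum>m=1..n-1. (1 - real m / real n) * \<bar>r n m\<bar> ^ 4)"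
    using power_sum_tendsto[of 4] by (simp add: convergent_LIMSEQ_iff)
  have "(\<lambda>n. 72 * (1 + 2 * (\<Sum>m=1..n-1. (1 - real m / real n) * \<bar>r n m\<bar> ^ 2))
     + 24 * (1 + 2 * (\<Sum>m=1..n-1. (1 - real m / real n) * \<bar>r n m\<bar> ^ 4))) \<longlonglongrightarrow>
     72 * (1 + 2 * lim (\<lambda>n. \<Sum>m=1..n-1. (1 - real m / real n) * \<bar>r n m\<bar> ^ 2))
     + 24 * (1 + 2 * lim (\<lambda>n. \<Sum>m=1..n-1. (1 - real m / real n) * \<bar>r n m\<bar> ^ 4))"
    by (intro tendsto_add tendsto_mult tendsto_const c2 c4)
  moreover have "\<forall>\<^sub>F n in sequentially. 72 * (1 + 2 * (\<Sum>m=1..n-1. (1 - real m / real n) * \<bar>r n m\<bar> ^ 2))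
     + 24 * (1 + 2 * (\<Sum>m=1..n-1. (1 - real m / real n) * \<bar>r n m\<bar> ^ 4)) = ?b n"
    using eventually_gt_at_top[of 0] by eventually_elim (simp only: eq)
  ultimately show "?b \<longlonglongrightarrow> ?L" by (simp add: tendsto_cong distrib_left)
next
  let ?b = "\<lambda>n. (\<Sum>j<n. \<Sum>k<n. 72 * \<bar>r n ((j - k) + (k - j))\<bar> ^ 2 + 24 * \<bar>r n ((j - k) + (k - j))\<bar> ^ 4) / real n"
  obtain B where B: "1 \<le> B" and rowB: "\<And>n i. i < n \<Longrightarrow> (\<Sum>j<n. \<bar>R n i j\<bar>) \<le> B" using row_sum by blast
  have RB: "\<bar>R n i j\<bar> \<le> B" if "i < n" "j < n" for n i j
    by (rule order_trans[OF member_le_sum[of j "{..<n}" "\<lambda>j. \<bar>R n i j\<bar>"] rowB]) (use that in auto)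
  define C where "C = 72 * ((B + 1) * (B * B) + (B + 1)) + 24 * ((B + 1) * (B * B) + (B + 1))"
  have pt: "\<bar>(72 * R n j j * R n k k * (R n j k)\<^sup>2 + 24 * R n j k ^ 4)
      - (72 * \<bar>r n ((j - k) + (k - j))\<bar> ^ 2 + 24 * \<bar>r n ((j - k) + (k - j))\<bar> ^ 4)\<bar> \<le> C * e n"
    if jk: "j < n" "k < n" for n j k
  proof -
    have n: "0 < n" using jk by simp
    let ?r = "r n ((j - k) + (k - j))"
    have d1: "\<bar>R n j j - 1\<bar> \<le> e n" "\<bar>R n k k - 1\<bar> \<le> e n" "\<bar>R n j k - ?r\<bar> \<le> e n"
      using R[OF jk(1) jk(1)] R[OF jk(2) jk(2)] R[OF jk] r0[OF n] by auto
    have r1: "\<bar>?r\<bar> \<le> 1" by (rule r_le_1[OF n])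
    have dd: "\<bar>R n j j * R n k k - 1 * 1\<bar> \<le> e n * B + 1 * e n"
      by (rule abs_prod_diff_le[OF d1(1,2) RB]) (use jk in auto)
    have d2: "\<bar>R n j k * R n j k - ?r * ?r\<bar> \<le> e n * B + 1 * e n"
      by (rule abs_prod_diff_le[OF d1(3,3) RB r1]) (use jk in auto)
    have BB: "\<bar>R n j k * R n j k\<bar> \<le> B * B" unfolding abs_mult using RB[OF jk] B by (intro mult_mono) auto
    have rr: "\<bar>?r * ?r\<bar> \<le> 1" unfolding abs_mult using mult_mono[OF r1 r1] by simp
    have x: "\<bar>(R n j j * R n k k) * (R n j k * R n j k) - (1 * 1) * (?r * ?r)\<bar> \<le> (e n * B + 1 * e n) * (B * B) + 1 * (e n * B + 1 * e n)"
      by (rule abs_prod_diff_le[OF dd d2 BB]) simp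
    have y: "\<bar>(R n j k * R n j k) * (R n j k * R n j k) - (?r * ?r) * (?r * ?r)\<bar> \<le> (e n * B + 1 * e n) * (B * B) + 1 * (e n * B + 1 * e n)"
      by (rule abs_prod_diff_le[OF d2 d2 BB rr])
    have "\<bar>u1 - v1\<bar> \<le> s \<Longrightarrow> \<bar>u2 - v2\<bar> \<le> s \<Longrightarrow> \<bar>(72 * u1 + 24 * u2) - (72 * v1 + 24 * v2)\<bar> \<le> 72 * s + 24 * s" for u1 v1 u2 v2 s :: real
      by linarith
    from this[OF x y] show ?thesis
      by (simp add: C_def power2_eq_square power4_eq_xxxx algebra_simps)
  qed
  have "norm (?a n - ?b n) \<le> C * (real n * e n)" if n: "0 < n" for n
  proof -
    let ?D = "\<Sum>j<n. \<Sum>k<n. (72 * R n j j * R n k k * (R n j k)\<^sup>2 + 24 * R n j k ^ 4)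
        - (72 * \<bar>r n ((j - k) + (k - j))\<bar> ^ 2 + 24 * \<bar>r n ((j - k) + (k - j))\<bar> ^ 4)"
    have eq: "?a n - ?b n = ?D / real n"
      by (simp only: sum_subtractf diff_divide_distrib)
    have "\<bar>?D\<bar> \<le> (\<Sum>j<n. \<Sum>k<n. C * e n)"
      by (rule order_trans[OF sum_abs sum_mono], rule order_trans[OF sum_abs sum_mono], rule pt) auto
    then have "\<bar>?D\<bar> / real n \<le> (\<Sum>j<n. \<Sum>k<n. C * e n) / real n"
      by (rule divide_right_mono) simp
    then show ?thesis unfolding eq real_norm_def abs_divide abs_of_nat using n by (simp add: mult.left_commute)
  qed
  then have "\<forall>\<^sub>F n in sequentially. norm (?a n - ?b n) \<le> C * (real n * e n)"
    by (rule eventually_mono[OF eventually_gt_at_top[of 0]])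
  moreover have "(\<lambda>n. C * (real n * e n)) \<longlonglongrightarrow> 0" using tendsto_mult_right_zero[OF e] .
  ultimately show "(\<lambda>n. ?a n - ?b n) \<longlonglongrightarrow> 0" by (rule Lim_null_comparison)
qed

text \<open>It permits centring the quartic sum at 3 n, its mean for unit variances, instead of at
  the exact mean.\<close>

lemma mean_tendsto: "(\<lambda>n. ((\<Sum>j<n. 3 * (R n j j)\<^sup>2) - 3 * real n) / sqrt (real n)) \<longlonglongrightarrow> 0"
proof -
  obtain B where B: "1 \<le> B" and rowB: "\<And>n i. i < n \<Longrightarrow> (\<Sum>j<n. \<bar>R n i j\<bar>) \<le> B" using row_sum by blast
  have RB: "\<bar>R n i j\<bar> \<le> B" if "i < n" "j < n" for n i j
    by (rule order_trans[OF member_le_sum[of j "{..<n}" "\<lambda>j. \<bar>R n i j\<bar>"] rowB]) (use that in auto)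
  have "norm (((\<Sum>j<n. 3 * (R n j j)\<^sup>2) - 3 * real n) / sqrt (real n)) \<le> 3 * (B + 1) * (real n * e n)" if n: "0 < n" for n
  proof -
    have "(\<Sum>j<n. 3 * (R n j j)\<^sup>2) - 3 * real n = (\<Sum>j<n. 3 * (R n j j * R n j j - 1 * 1))"
      by (simp add: power2_eq_square sum_subtractf right_diff_distrib)
    also have "\<bar>\<dots>\<bar> \<le> (\<Sum>j<n. 3 * (e n * B + 1 * e n))"
    proof (rule order_trans[OF sum_abs sum_mono])
      fix j assume "j \<in> {..<n}"
      then have j: "j < n" by simp
      have d: "\<bar>R n j j - 1\<bar> \<le> e n" using R[OF j j] r0[OF n] by simp
      have "\<bar>R n j j * R n j j - 1 * 1\<bar> \<le> e n * B + 1 * e n"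
        by (rule abs_prod_diff_le[OF d d RB[OF j j]]) simp
      then show "\<bar>3 * (R n j j * R n j j - 1 * 1)\<bar> \<le> 3 * (e n * B + 1 * e n)" by simp
    qed
    also have "\<dots> = 3 * (B + 1) * (real n * e n)" by (simp add: algebra_simps)
    finally have *: "\<bar>(\<Sum>j<n. 3 * (R n j j)\<^sup>2) - 3 * real n\<bar> \<le> 3 * (B + 1) * (real n * e n)" .
    have s1: "1 \<le> sqrt (real n)" using n by simp
    have nn: "0 \<le> 3 * (B + 1) * (real n * e n)" using B e_nonneg[OF n] by simp
    have "\<bar>(\<Sum>j<n. 3 * (R n j j)\<^sup>2) - 3 * real n\<bar> / sqrt (real n) \<le> 3 * (B + 1) * (real n * e n) / 1"
      by (rule frac_le[OF nn * _ s1]) simp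
    then show ?thesis by (simp add: abs_divide)
  qed
  then have "\<forall>\<^sub>F n in sequentially. norm (((\<Sum>j<n. 3 * (R n j j)\<^sup>2) - 3 * real n) / sqrt (real n)) \<le> 3 * (B + 1) * (real n * e n)"
    by (rule eventually_mono[OF eventually_gt_at_top[of 0]])
  then show ?thesis by (rule Lim_null_comparison[OF _ tendsto_mult_right_zero[OF e]])
qed

end

section \<open>Asymptotics of the heat sums\<close>

lemma Gauss_integral_tendsto:
  "((\<lambda>y. integral {0..y} (\<lambda>u. exp (- u\<^sup>2))) \<longlongrightarrow> sqrt pi / 2) at_top"
proof -
  let ?f = "\<lambda>u::real. indicator {0..} u *\<^sub>R exp (- u\<^sup>2)"
  have i: "integrable lborel ?f" and v: "(LBINT u. ?f u) = sqrt pi / 2"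
    using gaussian_moment_0 by (auto simp: has_bochner_integral_iff)
  have "((\<lambda>y. LBINT u. indicator {..y} u *\<^sub>R ?f u) \<longlongrightarrow> (LBINT u. ?f u)) at_top"
    by (rule tendsto_integral_at_top[OF _ i]) simp
  moreover have "(LBINT u. indicator {..y} u *\<^sub>R ?f u) = integral {0..y} (\<lambda>u. exp (- u\<^sup>2))" for y
  proof -
    have "(LBINT u. indicator {..y} u *\<^sub>R ?f u) = (LINT u:{0..y}|lborel. exp (- u\<^sup>2))"
      unfolding set_lebesgue_integral_def by (intro Bochner_Integration.integral_cong) (auto simp: indicator_def)
    also have "\<dots> = integral {0..y} (\<lambda>u. exp (- u\<^sup>2))"
      by (rule set_borel_integral_eq_integral(2), rule borel_integrable_atLeastAtMost') (intro continuous_intros)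
    finally show ?thesis .
  qed
  ultimately show ?thesis by (simp only: v)
qed

text \<open>The sum over y = 1, 2, ... is compared with the integral over (0, \<infinity>), whose
  value is sqrt (pi a).\<close>

definition heat_term :: "real \<Rightarrow> real \<Rightarrow> real" where
  "heat_term a y = (1 - exp (- (a * y\<^sup>2))) / y\<^sup>2"

lemma heat_term_nonneg: "0 \<le> a \<Longrightarrow> 0 \<le> heat_term a y"
  by (simp add: heat_term_def)

lemma heat_term_le: "0 \<le> a \<Longrightarrow> heat_term a y \<le> a"
proof (cases "y = 0")
  case False
  assume "0 \<le> a"
  have "1 + - (a * y\<^sup>2) \<le> exp (- (a * y\<^sup>2))" by (rule exp_ge_add_one_self)
  then show ?thesis using False by (simp add: heat_term_def divide_le_eq)
qed (simp add: heat_term_def)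

lemma heat_term_antimono:
  assumes a: "0 \<le> a" and y: "0 < y" "y \<le> z"
  shows "heat_term a z \<le> heat_term a y"
proof -
  have "y\<^sup>2 \<le> z\<^sup>2" using y by (intro power_mono) auto
  have "(\<lambda>u. (1 - exp (- (a * u))) / u) (z\<^sup>2) \<le> (\<lambda>u. (1 - exp (- (a * u))) / u) (y\<^sup>2)"
  proof (rule DERIV_nonpos_imp_nonincreasing[OF \<open>y\<^sup>2 \<le> z\<^sup>2\<close>])
    fix u assume u: "y\<^sup>2 \<le> u" "u \<le> z\<^sup>2"
    then have u0: "0 < u" using y by (smt (verit) zero_less_power)
    have "exp (- (a * u)) * (1 + a * u) \<le> exp (- (a * u)) * exp (a * u)"
      by (intro mult_left_mono exp_ge_add_one_self) auto
    then have le: "exp (- (a * u)) * (1 + a * u) \<le> 1" by (simp flip: exp_add)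
    have "((\<lambda>u. (1 - exp (- (a * u))) / u) has_real_derivative (exp (- (a * u)) * (1 + a * u) - 1) / u\<^sup>2) (at u)"
      using u0 by (auto intro!: derivative_eq_intros simp: field_simps power2_eq_square)
    moreover have "(exp (- (a * u)) * (1 + a * u) - 1) / u\<^sup>2 \<le> 0" using le by (simp add: divide_le_0_iff)
    ultimately show "\<exists>D. ((\<lambda>u. (1 - exp (- (a * u))) / u) has_real_derivative D) (at u) \<and> D \<le> 0" by blast
  qed
  then show ?thesis by (simp add: heat_term_def)
qed

text \<open>Antiderivative of \<open>heat_term a\<close> on y > 0: integration by parts of 1 / y^2,
  followed by the substitution u = sqrt a y, leaves a Gaussian integral.\<close>

definition heat_prim :: "real \<Rightarrow> real \<Rightarrow> real" where
  "heat_prim a y = - (1 - exp (- (a * y\<^sup>2))) / y + 2 * sqrt a * integral {0..sqrt a * y} (\<lambda>u. exp (- u\<^sup>2))"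

lemma heat_prim_deriv:
  assumes a: "0 < a" and y: "0 < y"
  shows "(heat_prim a has_real_derivative heat_term a y) (at y)"
proof -
  let ?\<Phi> = "\<lambda>v. integral {0..v} (\<lambda>u. exp (- u\<^sup>2))"
  have v: "0 < sqrt a * y" using a y by simp
  have "(?\<Phi> has_real_derivative exp (- (sqrt a * y)\<^sup>2)) (at (sqrt a * y) within {0..sqrt a * y + 1})"
    by (rule integral_has_real_derivative) (use v in \<open>auto intro!: continuous_intros\<close>)
  then have "(?\<Phi> has_real_derivative exp (- (sqrt a * y)\<^sup>2)) (at (sqrt a * y))"
    using v by (subst (asm) at_within_Icc_at) auto
  then have "((\<lambda>y. ?\<Phi> (sqrt a * y)) has_real_derivative exp (- (sqrt a * y)\<^sup>2) * sqrt a) (at y)"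
    by (rule DERIV_chain2) (auto intro!: derivative_eq_intros)
  then have 1: "((\<lambda>y. 2 * sqrt a * ?\<Phi> (sqrt a * y)) has_real_derivative 2 * sqrt a * (exp (- (sqrt a * y)\<^sup>2) * sqrt a)) (at y)"
    by (rule DERIV_cmult)
  have 2: "((\<lambda>y. - (1 - exp (- (a * y\<^sup>2))) / y) has_real_derivative heat_term a y - 2 * a * exp (- (a * y\<^sup>2))) (at y)"
    using y by (auto intro!: derivative_eq_intros simp: heat_term_def field_simps power2_eq_square)
  have "2 * sqrt a * (exp (- (sqrt a * y)\<^sup>2) * sqrt a) = 2 * a * exp (- (a * y\<^sup>2))"
    using a by (simp add: power_mult_distrib)
  with DERIV_add[OF 2 1] show ?thesis unfolding heat_prim_def[abs_def] by simp
qed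

lemma heat_prim_tendsto:
  assumes a: "0 < a"
  shows "(\<lambda>n. heat_prim a (real (Suc n))) \<longlonglongrightarrow> sqrt (pi * a)"
proof -
  have "filterlim (\<lambda>n. sqrt a * real (Suc n)) at_top sequentially" using a by real_asymp
  from filterlim_compose[OF Gauss_integral_tendsto this]
  have 1: "(\<lambda>n. integral {0..sqrt a * real (Suc n)} (\<lambda>u. exp (- u\<^sup>2))) \<longlonglongrightarrow> sqrt pi / 2" .
  have 2: "(\<lambda>n. - (1 - exp (- (a * (real (Suc n))\<^sup>2))) / real (Suc n)) \<longlonglongrightarrow> 0" using a by real_asymp
  have "(\<lambda>n. heat_prim a (real (Suc n))) \<longlonglongrightarrow> 0 + 2 * sqrt a * (sqrt pi / 2)"
    unfolding heat_prim_def by (intro tendsto_add 2 tendsto_mult tendsto_const 1)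
  then show ?thesis by (simp add: real_sqrt_mult mult.commute)
qed

lemma heat_prim_1:
  assumes a: "0 < a"
  shows "\<bar>heat_prim a 1\<bar> \<le> 2 * a"
proof -
  have c: "continuous_on {0..sqrt a} (\<lambda>u. exp (- u\<^sup>2))" by (intro continuous_intros)
  have "norm (integral {0..sqrt a} (\<lambda>u. exp (- u\<^sup>2))) \<le> 1 * (sqrt a - 0)"
    by (rule integral_bound[OF _ c]) (use a in auto)
  moreover have "0 \<le> integral {0..sqrt a} (\<lambda>u. exp (- u\<^sup>2))"
    by (rule integral_nonneg[OF integrable_continuous_real[OF c]]) auto
  ultimately have I: "0 \<le> 2 * sqrt a * integral {0..sqrt a} (\<lambda>u. exp (- u\<^sup>2))"
    "2 * sqrt a * integral {0..sqrt a} (\<lambda>u. exp (- u\<^sup>2)) \<le> 2 * sqrt a * sqrt a"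
    using a by (auto intro!: mult_left_mono simp del: real_sqrt_mult_self)
  have "1 - exp (- a) \<le> a" using exp_ge_add_one_self[of "-a"] by simp
  moreover have "0 \<le> 1 - exp (- a)" using a by simp
  moreover have "2 * sqrt a * sqrt a = 2 * a" using a by simp
  ultimately show ?thesis using I unfolding heat_prim_def power_one mult_1_right div_by_1 by linarith
qed

lemma heat_prim_diff:
  assumes a: "0 < a" and y: "0 < y"
  shows "heat_term a (y + 1) \<le> heat_prim a (y + 1) - heat_prim a y" "heat_prim a (y + 1) - heat_prim a y \<le> heat_term a y"
proof -
  obtain z where z: "y < z" "z < y + 1" "heat_prim a (y + 1) - heat_prim a y = ((y + 1) - y) * heat_term a z"
    using MVT2[of y "y + 1" "heat_prim a" "heat_term a"] heat_prim_deriv[OF a] y by auto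
  show "heat_term a (y + 1) \<le> heat_prim a (y + 1) - heat_prim a y" "heat_prim a (y + 1) - heat_prim a y \<le> heat_term a y"
    using z y a heat_term_antimono[of a z "y + 1"] heat_term_antimono[of a y z] by auto
qed

lemma summable_heat_term:
  assumes "0 \<le> a" "\<And>k. \<bar>c k\<bar> \<le> 1"
  shows "summable (\<lambda>k. c k * heat_term a (real (Suc k)))"
proof (rule summable_comparison_test'[of "\<lambda>k. 1 / (real (Suc k))\<^sup>2" 0])
  show "summable (\<lambda>k. 1 / (real (Suc k))\<^sup>2)" using inverse_squares_sums by (auto simp: sums_iff)
  fix k
  have "heat_term a (real (Suc k)) \<le> 1 / (real (Suc k))\<^sup>2"
    unfolding heat_term_def by (intro divide_right_mono) auto
  then have "\<bar>c k\<bar> * heat_term a (real (Suc k)) \<le> 1 * (1 / (real (Suc k))\<^sup>2)"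
    using assms heat_term_nonneg[OF assms(1)] by (intro mult_mono) auto
  then show "norm (c k * heat_term a (real (Suc k))) \<le> 1 / (real (Suc k))\<^sup>2"
    using heat_term_nonneg[OF assms(1)] by (simp add: abs_mult)
qed

text \<open>Monotone comparison of sum and integral. The integral over (0, 1] costs at most 2 a and
  the first summand at most a, which gives 3 a.\<close>

lemma heat_term_sum:
  assumes a: "0 < a"
  shows "\<bar>(\<Sum>k. heat_term a (real (Suc k))) - sqrt (pi * a)\<bar> \<le> 3 * a"
proof -
  let ?S = "\<lambda>n. \<Sum>k<n. heat_term a (real (Suc k))"
  have s: "summable (\<lambda>k. heat_term a (real (Suc k)))"
    using summable_heat_term[of a "\<lambda>_. 1"] a by simp
  have lo: "heat_prim a (real (Suc n)) - heat_prim a 1 \<le> ?S n" for n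
  proof (induction n)
    case (Suc n)
    then show ?case using heat_prim_diff(2)[OF a, of "real (Suc n)"] by (simp add: add_ac)
  qed simp
  have up: "?S (Suc n) \<le> a + heat_prim a (real (Suc n)) - heat_prim a 1" for n
  proof (induction n)
    case 0
    then show ?case using heat_term_le[of a 1] a by simp
  next
    case (Suc n)
    then show ?case using heat_prim_diff(1)[OF a, of "real (Suc n)"] by (simp add: add_ac)
  qed
  have L: "?S \<longlonglongrightarrow> (\<Sum>k. heat_term a (real (Suc k)))" by (rule summable_LIMSEQ[OF s])
  have "sqrt (pi * a) - heat_prim a 1 \<le> (\<Sum>k. heat_term a (real (Suc k)))"
    by (rule LIMSEQ_le[OF tendsto_diff[OF heat_prim_tendsto[OF a] tendsto_const] L]) (use lo in blast)
  moreover have "(\<Sum>k. heat_term a (real (Suc k))) \<le> a + sqrt (pi * a) - heat_prim a 1"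
    by (rule LIMSEQ_le[OF LIMSEQ_Suc[OF L] tendsto_diff[OF tendsto_add[OF tendsto_const heat_prim_tendsto[OF a]] tendsto_const]])
       (use up in blast)
  ultimately show ?thesis using heat_prim_1[OF a] by linarith
qed

lemma Abel_sum_bound:
  fixes c f :: "nat \<Rightarrow> real"
  assumes B: "\<And>n. \<bar>\<Sum>k<n. c k\<bar> \<le> B" and f: "\<And>k. f (Suc k) \<le> f k" "\<And>k. 0 \<le> f k"
  shows "\<bar>\<Sum>k<n. c k * f k\<bar> \<le> B * f 0"
proof -
  have eq: "(\<Sum>k<n. c k * f k) = (\<Sum>k<n. c k) * f n + (\<Sum>k<n. (\<Sum>i<Suc k. c i) * (f k - f (Suc k)))"
    by (induction n) (simp_all add: algebra_simps)
  have "\<bar>\<Sum>k<n. (\<Sum>i<Suc k. c i) * (f k - f (Suc k))\<bar> \<le> (\<Sum>k<n. B * (f k - f (Suc k)))"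
  proof (rule order_trans[OF sum_abs sum_mono])
    fix k
    show "\<bar>(\<Sum>i<Suc k. c i) * (f k - f (Suc k))\<bar> \<le> B * (f k - f (Suc k))"
      unfolding abs_mult using f(1)[of k] B[of "Suc k"] by (intro mult_mono) (auto intro: order_trans[OF abs_ge_zero])
  qed
  also have "\<dots> = B * (f 0 - f n)" by (simp add: sum_distrib_left[symmetric] sum_lessThan_telescope')
  finally have 1: "\<bar>\<Sum>k<n. (\<Sum>i<Suc k. c i) * (f k - f (Suc k))\<bar> \<le> B * (f 0 - f n)" .
  have 2: "\<bar>(\<Sum>k<n. c k) * f n\<bar> \<le> B * f n"
    unfolding abs_mult using f(2) B[of n] by (simp add: mult_right_mono)
  show ?thesis unfolding eq using 1 2 abs_triangle_ineq[of "(\<Sum>k<n. c k) * f n" "\<Sum>k<n. (\<Sum>i<Suc k. c i) * (f k - f (Suc k))"]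
    by (simp add: right_diff_distrib)
qed

text \<open>Multiplication by 2 sin x makes the sum telescope, as for the Dirichlet kernel. The
  position of x strictly inside (0, pi) enters through sin x > 0.\<close>

lemma cos_sum_bound:
  assumes "0 < x" "x < pi"
  shows "\<bar>\<Sum>k<n. cos (2 * real (Suc k) * x)\<bar> \<le> 1 / sin x"
proof -
  have sx: "0 < sin x" using assms by (simp add: sin_gt_zero)
  have "2 * sin x * (\<Sum>k<n. cos (2 * real (Suc k) * x)) = sin ((2 * real n + 1) * x) - sin x"
  proof (induction n)
    case (Suc n)
    have "2 * sin x * cos (2 * real (Suc n) * x) = sin ((2 * real (Suc n) + 1) * x) - sin ((2 * real n + 1) * x)"
    proof -
      have "sin ((2 * real (Suc n) + 1) * x) = sin (2 * real (Suc n) * x + x)"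
        "sin ((2 * real n + 1) * x) = sin (2 * real (Suc n) * x - x)" by (simp_all add: algebra_simps)
      then show ?thesis unfolding sin_add sin_diff by simp
    qed
    then show ?case using Suc by (simp only: sum.lessThan_Suc distrib_left)
  qed simp
  then have "\<bar>2 * sin x * (\<Sum>k<n. cos (2 * real (Suc k) * x))\<bar> \<le> 2"
    using abs_sin_le_one[of "(2 * real n + 1) * x"] abs_sin_le_one[of x] by linarith
  then have "2 * sin x * \<bar>\<Sum>k<n. cos (2 * real (Suc k) * x)\<bar> \<le> 2" using sx by (simp add: abs_mult)
  then show ?thesis using sx by (simp add: field_simps)
qed

text \<open>Up to constants, the stationary variance of an increment over time \<delta>. Both
  \<open>sig_n2\<close> and \<open>F_n\<close> are expressed through its values, the latter through
  second differences in \<delta>.\<close>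

definition heat_sum :: "real \<Rightarrow> real \<Rightarrow> real \<Rightarrow> real" where
  "heat_sum \<theta> x \<delta> = (\<Sum>k. (sin (real (Suc k) * x))\<^sup>2 * heat_term (\<theta> * \<delta>) (real (Suc k)))"

lemma summable_heat_sum:
  "0 \<le> \<theta> \<Longrightarrow> 0 \<le> \<delta> \<Longrightarrow> summable (\<lambda>k. (sin (real (Suc k) * x))\<^sup>2 * heat_term (\<theta> * \<delta>) (real (Suc k)))"
  by (rule summable_heat_term) (auto simp: abs_square_le_1 simp del: of_nat_Suc)

text \<open>Split sin^2 into 1/2 minus half a cosine of the double angle. The constant half yields
  the square root; the oscillating half is O(\<delta>) by summation by parts, because
  \<open>heat_term\<close> decreases in k. So the leading term does not depend on x.\<close>

lemma heat_sum_approx: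
  assumes x: "0 < x" "x < pi" and a: "0 < \<theta>" "0 < \<delta>"
  shows "\<bar>heat_sum \<theta> x \<delta> - sqrt (pi * (\<theta> * \<delta>)) / 2\<bar> \<le> (3 + 1 / sin x) / 2 * (\<theta> * \<delta>)"
proof -
  define b where "b = \<theta> * \<delta>"
  have b: "0 < b" using a by (simp add: b_def)
  let ?c = "\<lambda>k. cos (2 * real (Suc k) * x)" and ?h = "\<lambda>k. heat_term b (real (Suc k))"
  have s1: "summable ?h" using summable_heat_term[of b "\<lambda>_. 1"] b by simp
  have s2: "summable (\<lambda>k. ?c k * ?h k)" by (rule summable_heat_term) (use b in auto)
  have "(sin (real (Suc k) * x))\<^sup>2 = 1 / 2 - ?c k / 2" for k
    using cos_double_sin[of "real (Suc k) * x"] by (simp add: mult.assoc diff_divide_distrib del: of_nat_Suc)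
  then have "heat_sum \<theta> x \<delta> = (\<Sum>k. 1 / 2 * ?h k - 1 / 2 * (?c k * ?h k))"
    unfolding heat_sum_def b_def[symmetric] by (simp add: left_diff_distrib del: of_nat_Suc)
  also have "\<dots> = 1 / 2 * (\<Sum>k. ?h k) - 1 / 2 * (\<Sum>k. ?c k * ?h k)"
    using s1 s2 by (simp only: suminf_diff[symmetric] suminf_mult[symmetric] summable_mult)
  finally have eq: "heat_sum \<theta> x \<delta> = 1 / 2 * (\<Sum>k. ?h k) - 1 / 2 * (\<Sum>k. ?c k * ?h k)" .
  have "\<bar>\<Sum>k<n. ?c k * ?h k\<bar> \<le> 1 / sin x * b" for n
  proof -
    have "\<bar>\<Sum>k<n. ?c k * ?h k\<bar> \<le> 1 / sin x * ?h 0"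
      by (rule Abel_sum_bound[OF cos_sum_bound[OF x]]) (use b in \<open>auto intro!: heat_term_antimono heat_term_nonneg\<close>)
    also have "\<dots> \<le> 1 / sin x * b"
      using b sin_gt_zero[OF x] by (intro mult_left_mono heat_term_le) auto
    finally show ?thesis .
  qed
  then have C: "\<bar>\<Sum>k. ?c k * ?h k\<bar> \<le> 1 / sin x * b"
    by (intro LIMSEQ_le_const2[OF tendsto_rabs[OF summable_LIMSEQ[OF s2]]]) blast
  have "u = 1 / 2 * A - 1 / 2 * C \<Longrightarrow> \<bar>A - s\<bar> \<le> 3 * b \<Longrightarrow> \<bar>C\<bar> \<le> K * b \<Longrightarrow> \<bar>u - s / 2\<bar> \<le> (3 + K) / 2 * b" for u A C s K :: real
  proof -
    assume "u = 1 / 2 * A - 1 / 2 * C" "\<bar>A - s\<bar> \<le> 3 * b" "\<bar>C\<bar> \<le> K * b"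
    moreover have "(3 + K) / 2 * b = (3 * b) / 2 + (K * b) / 2" by (simp add: field_simps)
    ultimately show ?thesis by linarith
  qed
  from this[OF eq heat_term_sum[OF b] C] show ?thesis unfolding b_def .
qed

lemma heat_sum_tendsto:
  assumes x: "0 < x" "x < pi" and \<theta>: "0 < \<theta>" and m: "0 \<le> m" and T: "0 < T"
  shows "(\<lambda>n. heat_sum \<theta> x (m * (T / real n)) / sqrt (T / real n)) \<longlonglongrightarrow> sqrt (pi * \<theta>) / 2 * sqrt m"
proof (cases "m = 0")
  case True
  then show ?thesis by (simp add: heat_sum_def heat_term_def)
next
  case False
  with m have m: "0 < m" by simp
  define K where "K = (3 + 1 / sin x) / 2 * \<theta> * m"
  have "norm (heat_sum \<theta> x (m * (T / real n)) / sqrt (T / real n) - sqrt (pi * \<theta>) / 2 * sqrt m) \<le> K * sqrt (T / real n)"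
    if n: "0 < n" for n
  proof -
    let ?d = "T / real n"
    have d: "0 < ?d" using n T by simp
    have sd: "sqrt ?d * sqrt ?d = ?d" using T by simp
    have "\<bar>heat_sum \<theta> x (m * ?d) - sqrt (pi * (\<theta> * (m * ?d))) / 2\<bar> \<le> (3 + 1 / sin x) / 2 * (\<theta> * (m * ?d))"
      by (rule heat_sum_approx[OF x \<theta> mult_pos_pos[OF m d]])
    moreover have "sqrt (pi * (\<theta> * (m * ?d))) = sqrt (pi * \<theta>) * sqrt m * sqrt ?d" by (simp add: real_sqrt_mult real_sqrt_divide)
    ultimately have "\<bar>heat_sum \<theta> x (m * ?d) - sqrt (pi * \<theta>) / 2 * sqrt m * sqrt ?d\<bar> \<le> K * (sqrt ?d * sqrt ?d)"
      unfolding sd K_def by (simp add: mult_ac)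
    then have "\<bar>heat_sum \<theta> x (m * ?d) - sqrt (pi * \<theta>) / 2 * sqrt m * sqrt ?d\<bar> / sqrt ?d \<le> K * (sqrt ?d * sqrt ?d) / sqrt ?d"
      by (rule divide_right_mono) (use d in simp)
    moreover have "heat_sum \<theta> x (m * ?d) / sqrt ?d - sqrt (pi * \<theta>) / 2 * sqrt m
        = (heat_sum \<theta> x (m * ?d) - sqrt (pi * \<theta>) / 2 * sqrt m * sqrt ?d) / sqrt ?d"
    proof -
      have "s > 0 \<Longrightarrow> u / s - v = (u - v * s) / s" for s u v :: real by (simp add: field_simps)
      from this[OF real_sqrt_gt_zero[OF d]] show ?thesis .
    qed
    moreover have "K * (s * s) / s = K * s" for s :: real by (cases "s = 0") auto
    ultimately show ?thesis using d by (simp only: real_norm_def abs_divide abs_of_pos real_sqrt_gt_zero)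
  qed
  then have "\<forall>\<^sub>F n in sequentially. norm (heat_sum \<theta> x (m * (T / real n)) / sqrt (T / real n) - sqrt (pi * \<theta>) / 2 * sqrt m) \<le> K * sqrt (T / real n)"
    by (rule eventually_mono[OF eventually_gt_at_top[of 0]])
  moreover have "(\<lambda>n. K * sqrt (T / real n)) \<longlonglongrightarrow> 0" using T by real_asymp
  ultimately show ?thesis by (rule LIM_zero_cancel[OF Lim_null_comparison])
qed

lemma heat_sum_pos:
  assumes x: "0 < x" "x < pi" and \<theta>: "0 < \<theta>" "0 < \<delta>"
  shows "0 < heat_sum \<theta> x \<delta>"
proof -
  have "0 < heat_term (\<theta> * \<delta>) 1" using \<theta> by (simp add: heat_term_def)
  then show ?thesis unfolding heat_sum_def
    using summable_heat_sum[of \<theta> \<delta> x] \<theta> sin_gt_zero[OF x]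
    by (intro suminf_pos2[where i = 0]) (auto intro!: mult_nonneg_nonneg heat_term_nonneg simp del: of_nat_Suc, simp)
qed

lemma heat_sum_mono:
  assumes \<theta>: "0 < \<theta>" and "0 \<le> s" "s \<le> t"
  shows "heat_sum \<theta> x s \<le> heat_sum \<theta> x t"
  unfolding heat_sum_def
proof (rule suminf_le)
  fix k
  have "\<theta> * s * (real (Suc k))\<^sup>2 \<le> \<theta> * t * (real (Suc k))\<^sup>2" using assms by (intro mult_right_mono mult_left_mono) auto
  then show "(sin (real (Suc k) * x))\<^sup>2 * heat_term (\<theta> * s) (real (Suc k)) \<le> (sin (real (Suc k) * x))\<^sup>2 * heat_term (\<theta> * t) (real (Suc k))"
    unfolding heat_term_def by (intro mult_left_mono divide_right_mono) auto
qed (use assms in \<open>auto intro!: summable_heat_sum simp del: of_nat_Suc\<close>)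

section \<open>Second differences of the heat sums\<close>

text \<open>The sign is such that concavity of \<open>heat_sum\<close> in its last argument makes
  this nonnegative.\<close>

definition heat_diff2 :: "real \<Rightarrow> real \<Rightarrow> real \<Rightarrow> nat \<Rightarrow> real" where
  "heat_diff2 \<theta> x \<delta> m = 2 * heat_sum \<theta> x (real m * \<delta>) - heat_sum \<theta> x ((real m + 1) * \<delta>) - heat_sum \<theta> x ((real m - 1) * \<delta>)"

text \<open>With E = exp(-\<theta> k^2 \<delta>) the second difference of 1 - E^m collapses to
  E^(m-1) (1 - E)^2. In this form positivity and monotonicity in m hold term by term.\<close>

lemma heat_diff2_sums:
  assumes \<theta>: "0 < \<theta>" "0 < \<delta>" and m: "1 \<le> m"
  shows "(\<lambda>k. (sin (real (Suc k) * x))\<^sup>2 / (real (Suc k))\<^sup>2 *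
      (exp (- (\<theta> * (real (Suc k))\<^sup>2 * \<delta>)) ^ (m - 1) * (1 - exp (- (\<theta> * (real (Suc k))\<^sup>2 * \<delta>)))\<^sup>2)) sums heat_diff2 \<theta> x \<delta> m"
proof -
  have s: "(\<lambda>k. (sin (real (Suc k) * x))\<^sup>2 * heat_term (\<theta> * t) (real (Suc k))) sums heat_sum \<theta> x t" if "0 \<le> t" for t
    unfolding heat_sum_def by (rule summable_sums[OF summable_heat_sum]) (use \<theta> that in auto)
  note S = sums_diff[OF sums_diff[OF sums_mult[OF s[of "real m * \<delta>"], of 2] s[of "(real m + 1) * \<delta>"]] s[of "(real m - 1) * \<delta>"]]
  have "2 * ((sin (real (Suc k) * x))\<^sup>2 * heat_term (\<theta> * (real m * \<delta>)) (real (Suc k)))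
     - (sin (real (Suc k) * x))\<^sup>2 * heat_term (\<theta> * ((real m + 1) * \<delta>)) (real (Suc k))
     - (sin (real (Suc k) * x))\<^sup>2 * heat_term (\<theta> * ((real m - 1) * \<delta>)) (real (Suc k))
     = (sin (real (Suc k) * x))\<^sup>2 / (real (Suc k))\<^sup>2 *
      (exp (- (\<theta> * (real (Suc k))\<^sup>2 * \<delta>)) ^ (m - 1) * (1 - exp (- (\<theta> * (real (Suc k))\<^sup>2 * \<delta>)))\<^sup>2)" for k
  proof -
    define E where "E = exp (- (\<theta> * (real (Suc k))\<^sup>2 * \<delta>))"
    obtain l where l: "m = Suc l" using m by (cases m) auto
    have p: "exp (- (\<theta> * (real j * \<delta>) * (real (Suc k))\<^sup>2)) = E ^ j" for j
      unfolding E_def exp_of_nat_mult[symmetric] by (simp add: mult_ac)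
    have "exp (- (\<theta> * (real m * \<delta>) * (real (Suc k))\<^sup>2)) = E ^ l * E"
      "exp (- (\<theta> * ((real m + 1) * \<delta>) * (real (Suc k))\<^sup>2)) = E ^ l * E * E"
      "exp (- (\<theta> * ((real m - 1) * \<delta>) * (real (Suc k))\<^sup>2)) = E ^ l"
      using p[of m] p[of "Suc m"] p[of l] by (simp_all add: l add_ac del: of_nat_Suc) (simp_all add: add_ac mult_ac)
    then show ?thesis unfolding heat_term_def E_def[symmetric] l
      by (simp add: power2_eq_square field_simps del: of_nat_Suc)
  qed
  with S m \<theta> show ?thesis unfolding heat_diff2_def by simp
qed

lemma heat_diff2_nonneg:
  assumes "0 < \<theta>" "0 < \<delta>" "1 \<le> m"
  shows "0 \<le> heat_diff2 \<theta> x \<delta> m"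
  by (rule sums_le[OF _ sums_zero heat_diff2_sums[OF assms]]) auto

lemma heat_diff2_antimono:
  assumes \<theta>: "0 < \<theta>" "0 < \<delta>" and m: "1 \<le> m" "m \<le> l"
  shows "heat_diff2 \<theta> x \<delta> l \<le> heat_diff2 \<theta> x \<delta> m"
proof (rule sums_le[OF _ heat_diff2_sums heat_diff2_sums])
  fix k
  have "exp (- (\<theta> * (real (Suc k))\<^sup>2 * \<delta>)) ^ (l - 1) \<le> exp (- (\<theta> * (real (Suc k))\<^sup>2 * \<delta>)) ^ (m - 1)"
    using m \<theta> by (intro power_decreasing) auto
  then show "(sin (real (Suc k) * x))\<^sup>2 / (real (Suc k))\<^sup>2 * (exp (- (\<theta> * (real (Suc k))\<^sup>2 * \<delta>)) ^ (l - 1) * (1 - exp (- (\<theta> * (real (Suc k))\<^sup>2 * \<delta>)))\<^sup>2)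
     \<le> (sin (real (Suc k) * x))\<^sup>2 / (real (Suc k))\<^sup>2 * (exp (- (\<theta> * (real (Suc k))\<^sup>2 * \<delta>)) ^ (m - 1) * (1 - exp (- (\<theta> * (real (Suc k))\<^sup>2 * \<delta>)))\<^sup>2)"
    by (intro mult_left_mono mult_right_mono) auto
qed (use assms in auto)

text \<open>The second differences telescope to the first increment of \<open>heat_sum\<close> minus
  a later one, which is nonnegative by monotonicity.\<close>

lemma heat_diff2_sum_le:
  assumes \<theta>: "0 < \<theta>" "0 < \<delta>"
  shows "(\<Sum>m=1..l. heat_diff2 \<theta> x \<delta> m) \<le> heat_sum \<theta> x \<delta>"
proof -
  have "(\<Sum>m=1..l. heat_diff2 \<theta> x \<delta> m) = heat_sum \<theta> x \<delta> - (heat_sum \<theta> x ((real l + 1) * \<delta>) - heat_sum \<theta> x (real l * \<delta>))"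
  proof (induction l)
    case 0
    then show ?case by (simp add: heat_sum_def heat_term_def)
  next
    case (Suc l)
    then show ?case by (simp add: heat_diff2_def algebra_simps)
  qed
  moreover have "heat_sum \<theta> x (real l * \<delta>) \<le> heat_sum \<theta> x ((real l + 1) * \<delta>)"
    by (rule heat_sum_mono[OF \<theta>(1)]) (use \<theta> in \<open>auto intro!: mult_right_mono\<close>)
  ultimately show ?thesis by simp
qed

text \<open>Decay of order 1 / m: in a decreasing sequence m times the m-th term is at most the sum
  of the first m terms.\<close>

lemma heat_diff2_le:
  assumes \<theta>: "0 < \<theta>" "0 < \<delta>" and m: "1 \<le> m"
  shows "real m * heat_diff2 \<theta> x \<delta> m \<le> heat_sum \<theta> x \<delta>"
proof -
  have "real m * heat_diff2 \<theta> x \<delta> m = (\<Sum>l=1..m. heat_diff2 \<theta> x \<delta> m)" by simp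
  also have "\<dots> \<le> (\<Sum>l=1..m. heat_diff2 \<theta> x \<delta> l)"
    by (intro sum_mono heat_diff2_antimono[OF \<theta>]) auto
  also have "\<dots> \<le> heat_sum \<theta> x \<delta>" by (rule heat_diff2_sum_le[OF \<theta>])
  finally show ?thesis .
qed

text \<open>Joint continuity in the form used for estimators: one radius \<eta> for the random
  argument that works for all large n at once.\<close>

lemma product_near:
  fixes a :: "nat \<Rightarrow> real" and \<phi> :: "real \<Rightarrow> real"
  assumes a: "a \<longlonglongrightarrow> a0" and \<phi>: "isCont \<phi> u0" and \<epsilon>: "\<epsilon> > 0"
  shows "\<exists>\<eta>>0. \<forall>\<^sub>F n in sequentially. \<forall>u. \<bar>u - u0\<bar> \<le> \<eta> \<longrightarrow> \<bar>a n * \<phi> u - a0 * \<phi> u0\<bar> \<le> \<epsilon>"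
proof -
  define e1 where "e1 = min 1 (\<epsilon> / (2 * (\<bar>a0\<bar> + 1)))"
  define e2 where "e2 = \<epsilon> / (2 * (\<bar>\<phi> u0\<bar> + 1))"
  have e1: "e1 > 0" and e2: "e2 > 0" using \<epsilon> by (auto simp: e1_def e2_def add_nonneg_pos)
  obtain s where s: "s > 0" "\<And>u. \<bar>u - u0\<bar> < s \<Longrightarrow> \<bar>\<phi> u - \<phi> u0\<bar> < e1"
    using \<phi> e1 unfolding continuous_at_eps_delta by (metis dist_real_def)
  have "\<forall>\<^sub>F n in sequentially. dist (a n) a0 < e2" using a e2 by (rule tendstoD)
  then have "\<forall>\<^sub>F n in sequentially. \<forall>u. \<bar>u - u0\<bar> \<le> s / 2 \<longrightarrow> \<bar>a n * \<phi> u - a0 * \<phi> u0\<bar> \<le> \<epsilon>"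
  proof eventually_elim
    case (elim n)
    show ?case
    proof (intro allI impI)
      fix u assume "\<bar>u - u0\<bar> \<le> s / 2"
      then have \<phi>1: "\<bar>\<phi> u - \<phi> u0\<bar> < e1" using s by auto
      then have "\<bar>\<phi> u\<bar> \<le> \<bar>\<phi> u0\<bar> + 1" unfolding e1_def by linarith
      then have "\<bar>a n - a0\<bar> * \<bar>\<phi> u\<bar> \<le> e2 * (\<bar>\<phi> u0\<bar> + 1)"
        using elim e2 by (intro mult_mono) (auto simp: dist_real_def)
      also have "\<dots> = \<epsilon> / 2" unfolding e2_def by (simp add: field_simps add_nonneg_eq_0_iff)
      finally have 1: "\<bar>(a n - a0) * \<phi> u\<bar> \<le> \<epsilon> / 2" by (simp add: abs_mult)
      have "\<bar>a0\<bar> * \<bar>\<phi> u - \<phi> u0\<bar> \<le> (\<bar>a0\<bar> + 1) * (\<epsilon> / (2 * (\<bar>a0\<bar> + 1)))"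
        using \<phi>1 \<epsilon> unfolding e1_def by (intro mult_mono) auto
      also have "\<dots> = \<epsilon> / 2" by (simp add: field_simps add_nonneg_eq_0_iff)
      finally have 2: "\<bar>a0 * (\<phi> u - \<phi> u0)\<bar> \<le> \<epsilon> / 2" by (simp add: abs_mult)
      have "a n * \<phi> u - a0 * \<phi> u0 = (a n - a0) * \<phi> u + a0 * (\<phi> u - \<phi> u0)" by (simp add: algebra_simps)
      then show "\<bar>a n * \<phi> u - a0 * \<phi> u0\<bar> \<le> \<epsilon>" using 1 2 by linarith
    qed
  qed
  then show ?thesis using s(1) by (intro exI[of _ "s / 2"]) auto
qed

section \<open>Covariances of the observed increments\<close>

text \<open>2 \<kappa> \<open>ou_cov\<close> is exp(-\<kappa> |s - t|) minus exp(-\<kappa> s)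
  exp(-\<kappa> t). The first part depends on the lag only; the second is a product, so its mixed
  difference factors into two increments and forms the nonstationary correction.\<close>

lemma ou_cov_second_diff:
  fixes i j :: nat and c :: real
  assumes \<kappa>: "0 < \<kappa>" and \<delta>: "0 < \<delta>"
  defines "t \<equiv> \<lambda>j::nat. c + \<delta> * real j" and "E \<equiv> exp (- (\<kappa> * \<delta>))" and "m \<equiv> (i - j) + (j - i)"
  shows "2 * \<kappa> * (ou_cov \<kappa> (t (Suc i)) (t (Suc j)) - ou_cov \<kappa> (t (Suc i)) (t j) - ou_cov \<kappa> (t i) (t (Suc j)) + ou_cov \<kappa> (t i) (t j))
    = (if m = 0 then 2 * (1 - E) else - (E ^ (m - 1) * (1 - E)\<^sup>2))
      - (exp (- \<kappa> * t i) - exp (- \<kappa> * t (Suc i))) * (exp (- \<kappa> * t j) - exp (- \<kappa> * t (Suc j)))"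
proof -
  define e where "e u = exp (- \<kappa> * u)" for u
  have add: "e (u + v) = e u * e v" for u v by (simp add: e_def distrib_left flip: exp_add)
  have cov: "2 * \<kappa> * ou_cov \<kappa> u v = e \<bar>u - v\<bar> - e u * e v" for u v
    unfolding add[symmetric] using \<kappa> by (simp add: ou_cov_def e_def)
  have p: "e (\<delta> * real k) = E ^ k" for k
    unfolding e_def E_def exp_of_nat_mult[symmetric] by (simp add: mult_ac)
  have d: "\<bar>t a - t b\<bar> = \<delta> * real ((a - b) + (b - a))" for a b
  proof (cases "a \<le> b")
    case True
    then have "t a - t b = - (\<delta> * real (b - a))" by (simp add: t_def of_nat_diff algebra_simps)
    then show ?thesis using True \<delta> by simp
  next
    case False
    then have "t a - t b = \<delta> * real (a - b)" by (simp add: t_def of_nat_diff algebra_simps)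
    then show ?thesis using False \<delta> by simp
  qed
  have S: "e \<bar>t (Suc i) - t (Suc j)\<bar> - e \<bar>t (Suc i) - t j\<bar> - e \<bar>t i - t (Suc j)\<bar> + e \<bar>t i - t j\<bar>
      = (if m = 0 then 2 * (1 - E) else - (E ^ (m - 1) * (1 - E)\<^sup>2))"
  proof (cases "i = j")
    case True
    then show ?thesis unfolding d p by (simp add: m_def)
  next
    case False
    then obtain l where l: "m = Suc l" by (cases m) (auto simp: m_def)
    \<comment> \<open>The two mixed lags are m + 1 and m - 1, in an order that depends on the sign
      of i - j. Only their sum enters, so knowing the unordered pair is enough.\<close>
    have "{(Suc i - j) + (j - Suc i), (i - Suc j) + (Suc j - i)} = {Suc m, l} \<and> (Suc i - j) + (j - Suc i) \<noteq> (i - Suc j) + (Suc j - i)"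
      using False l by (auto simp: m_def)
    then have "e \<bar>t (Suc i) - t j\<bar> + e \<bar>t i - t (Suc j)\<bar> = E ^ Suc m + E ^ l"
      unfolding d p by (auto simp: doubleton_eq_iff)
    moreover have "e \<bar>t (Suc i) - t (Suc j)\<bar> = E ^ m" "e \<bar>t i - t j\<bar> = E ^ m"
      unfolding d p by (simp_all add: m_def)
    ultimately show ?thesis using l by (simp add: power2_eq_square algebra_simps)
  qed
  have "2 * \<kappa> * (ou_cov \<kappa> (t (Suc i)) (t (Suc j)) - ou_cov \<kappa> (t (Suc i)) (t j) - ou_cov \<kappa> (t i) (t (Suc j)) + ou_cov \<kappa> (t i) (t j))
    = 2 * \<kappa> * ou_cov \<kappa> (t (Suc i)) (t (Suc j)) - 2 * \<kappa> * ou_cov \<kappa> (t (Suc i)) (t j) - 2 * \<kappa> * ou_cov \<kappa> (t i) (t (Suc j)) + 2 * \<kappa> * ou_cov \<kappa> (t i) (t j)"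
    by (simp add: algebra_simps)
  also have "\<dots> = (e \<bar>t (Suc i) - t (Suc j)\<bar> - e \<bar>t (Suc i) - t j\<bar> - e \<bar>t i - t (Suc j)\<bar> + e \<bar>t i - t j\<bar>)
      - (e (t i) - e (t (Suc i))) * (e (t j) - e (t (Suc j)))"
    unfolding cov by (simp add: algebra_simps)
  finally show ?thesis unfolding S unfolding e_def .
qed

text \<open>The point is uniformity in \<kappa>: the increment is at most \<kappa> exp(-\<kappa> c)
  \<delta>, and \<kappa> c \<le> exp(\<kappa> c). Here c > 0 enters, and high modes do not spoil the
  bound.\<close>

lemma exp_increment_le:
  fixes \<kappa> c u \<delta> :: real
  assumes \<kappa>: "0 < \<kappa>" and c: "0 < c" and u: "c \<le> u" "0 \<le> \<delta>"
  shows "0 \<le> exp (- \<kappa> * u) - exp (- \<kappa> * (u + \<delta>))" "exp (- \<kappa> * u) - exp (- \<kappa> * (u + \<delta>)) \<le> \<delta> / c"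
proof -
  show "0 \<le> exp (- \<kappa> * u) - exp (- \<kappa> * (u + \<delta>))" using mult_nonneg_nonneg[of \<kappa> \<delta>] \<kappa> u by (simp add: distrib_left)
  have "exp (- \<kappa> * u) - exp (- \<kappa> * (u + \<delta>)) = exp (- \<kappa> * u) * (1 - exp (- \<kappa> * \<delta>))"
    by (simp add: right_diff_distrib distrib_left flip: exp_add)
  also have "\<dots> \<le> exp (- \<kappa> * c) * (\<kappa> * \<delta>)"
  proof (rule mult_mono)
    show "exp (- \<kappa> * u) \<le> exp (- \<kappa> * c)" using \<kappa> u by simp
    show "1 - exp (- \<kappa> * \<delta>) \<le> \<kappa> * \<delta>" using exp_ge_add_one_self[of "- \<kappa> * \<delta>"] by simp
  qed (use \<kappa> u in auto)
  also have "\<dots> \<le> \<delta> / c"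
  proof -
    have "\<kappa> * c \<le> exp (\<kappa> * c)" using exp_ge_add_one_self[of "\<kappa> * c"] by linarith
    then have "exp (- \<kappa> * c) * (\<kappa> * c) \<le> exp (- \<kappa> * c) * exp (\<kappa> * c)" by (rule mult_left_mono) simp
    then have "exp (- \<kappa> * c) * (\<kappa> * c) \<le> 1" by (simp flip: exp_add)
    then have "exp (- \<kappa> * c) * (\<kappa> * c) * (\<delta> / c) \<le> 1 * (\<delta> / c)"
      using u c by (intro mult_right_mono) auto
    then show ?thesis using c by simp
  qed
  finally show "exp (- \<kappa> * u) - exp (- \<kappa> * (u + \<delta>)) \<le> \<delta> / c" .
qed

lemma sig_n2_eq:
  assumes "0 < n"
  shows "sig_n2 \<theta> x c d n = 2 / sqrt (pi * \<theta>) * heat_sum \<theta> x ((d - c) / real n)"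
proof -
  have "(sin (real (Suc k) * x))\<^sup>2 / (real (Suc k))\<^sup>2 * (1 - exp (- (d - c) * \<theta> * (real (Suc k))\<^sup>2 / real n))
    = (sin (real (Suc k) * x))\<^sup>2 * heat_term (\<theta> * ((d - c) / real n)) (real (Suc k))" for k
  proof -
    have "- (d - c) * \<theta> * (real (Suc k))\<^sup>2 / real n = - (\<theta> * ((d - c) / real n) * (real (Suc k))\<^sup>2)"
      using assms by (simp add: field_simps)
    then show ?thesis unfolding heat_term_def by (simp only: times_divide_eq_left times_divide_eq_right)
  qed
  then show ?thesis unfolding sig_n2_def heat_sum_def by (simp only:)
qed

lemma F_n_eq:
  assumes \<theta>: "0 < \<theta>" and cd: "c < d" and n: "0 < n" and j: "1 \<le> j"
  shows "F_n \<theta> x c d n j = - (heat_diff2 \<theta> x ((d - c) / real n) j / sqrt (pi * \<theta>))"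
proof -
  let ?\<delta> = "(d - c) / real n"
  have \<delta>: "0 < ?\<delta>" using cd n by simp
  obtain l where l: "j = Suc l" using j by (cases j) auto
  have "(sin (real (Suc k) * x))\<^sup>2 / (real (Suc k))\<^sup>2
        * (2 * exp (- real j * (d - c) * \<theta> * (real (Suc k))\<^sup>2 / real n)
           - exp (- (real j + 1) * (d - c) * \<theta> * (real (Suc k))\<^sup>2 / real n)
           - exp (- (real j - 1) * (d - c) * \<theta> * (real (Suc k))\<^sup>2 / real n))
      = - ((sin (real (Suc k) * x))\<^sup>2 / (real (Suc k))\<^sup>2 *
      (exp (- (\<theta> * (real (Suc k))\<^sup>2 * ?\<delta>)) ^ (j - 1) * (1 - exp (- (\<theta> * (real (Suc k))\<^sup>2 * ?\<delta>)))\<^sup>2))" for k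
  proof -
    define E where "E = exp (- (\<theta> * (real (Suc k))\<^sup>2 * ?\<delta>))"
    have p: "exp (real i * - (\<theta> * (real (Suc k))\<^sup>2 * ?\<delta>)) = E ^ i" for i
      unfolding E_def by (rule exp_of_nat_mult)
    have "- real j * (d - c) * \<theta> * (real (Suc k))\<^sup>2 / real n = real j * - (\<theta> * (real (Suc k))\<^sup>2 * ?\<delta>)"
      "- (real j + 1) * (d - c) * \<theta> * (real (Suc k))\<^sup>2 / real n = real (Suc j) * - (\<theta> * (real (Suc k))\<^sup>2 * ?\<delta>)"
      "- (real j - 1) * (d - c) * \<theta> * (real (Suc k))\<^sup>2 / real n = real l * - (\<theta> * (real (Suc k))\<^sup>2 * ?\<delta>)"
      using n by (simp_all add: l field_simps)
    then have e: "exp (- real j * (d - c) * \<theta> * (real (Suc k))\<^sup>2 / real n) = E ^ j"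
      "exp (- (real j + 1) * (d - c) * \<theta> * (real (Suc k))\<^sup>2 / real n) = E ^ Suc j"
      "exp (- (real j - 1) * (d - c) * \<theta> * (real (Suc k))\<^sup>2 / real n) = E ^ l"
      by (simp_all only: p)
    show ?thesis unfolding e E_def[symmetric] by (simp add: l power2_eq_square field_simps del: of_nat_Suc)
  qed
  then have "F_n \<theta> x c d n j = 1 / sqrt (pi * \<theta>) * (\<Sum>k. - ((sin (real (Suc k) * x))\<^sup>2 / (real (Suc k))\<^sup>2 *
      (exp (- (\<theta> * (real (Suc k))\<^sup>2 * ?\<delta>)) ^ (j - 1) * (1 - exp (- (\<theta> * (real (Suc k))\<^sup>2 * ?\<delta>)))\<^sup>2)))"
    unfolding F_n_def by (simp only:)
  also have "\<dots> = 1 / sqrt (pi * \<theta>) * - heat_diff2 \<theta> x ?\<delta> j"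
    using sums_minus[OF heat_diff2_sums[OF \<theta> \<delta> j, of x]] by (simp only: sums_iff)
  finally show ?thesis by simp
qed

locale she_obs = she_point +
  fixes c d :: real
  assumes \<sigma>: "0 < \<sigma>" and x: "0 < x" "x < pi" and cd: "0 < c" "c < d"
begin

definition dt :: "nat \<Rightarrow> real" where "dt n = (d - c) / real n"

definition h :: "nat \<Rightarrow> real" where "h n = heat_sum \<theta> x (dt n)"

text \<open>Variance of an increment of the stationary process, not of the observed one. It is the
  same for all positions in the grid, so a single deterministic factor can be taken out of the
  quartic variation.\<close>

definition sc2 :: "nat \<Rightarrow> real" where "sc2 n = 2 * \<sigma>\<^sup>2 / (pi * \<theta>) * h n"

definition X :: "nat \<Rightarrow> nat \<Rightarrow> 'a \<Rightarrow> real" where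
  "X n j \<omega> = (if j < n then (sol (grid c d n (Suc j)) \<omega> - sol (grid c d n j) \<omega>) / sqrt (sc2 n) else 0)"

definition R :: "nat \<Rightarrow> nat \<Rightarrow> nat \<Rightarrow> real" where "R n i j = expectation (\<lambda>\<omega>. X n i \<omega> * X n j \<omega>)"

definition r :: "nat \<Rightarrow> nat \<Rightarrow> real" where
  "r n m = (if m = 0 then 1 else - (heat_diff2 \<theta> x (dt n) m / (2 * h n)))"

text \<open>Both increments in the nonstationary correction are at most dt n / c, the weights
  sin^2(kx) / k^2 are summable, and the stationary variance is proportional to 2 h n. As h n is of
  order sqrt (dt n), the quotient is O(n^(-3/2)).\<close>

definition err :: "nat \<Rightarrow> real" where
  "err n = (dt n / c)\<^sup>2 * (\<Sum>k. 1 / (real (Suc k))\<^sup>2) / (2 * h n)"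

lemma dt_pos: "0 < n \<Longrightarrow> 0 < dt n"
  using cd by (simp add: dt_def)

lemma h_pos: "0 < n \<Longrightarrow> 0 < h n"
  unfolding h_def by (rule heat_sum_pos[OF x \<theta> dt_pos])

lemma sc2_pos: "0 < n \<Longrightarrow> 0 < sc2 n"
  using h_pos \<sigma> \<theta> by (simp add: sc2_def)

lemma grid_eq: "grid c d n j = c + dt n * real j"
  by (simp add: grid_def dt_def)

lemma dt_nonneg: "0 \<le> dt n"
  using cd by (simp add: dt_def)

lemma grid_ge: "c \<le> grid c d n j"
  using dt_nonneg by (simp add: grid_eq)

lemma grid_nonneg: "0 \<le> grid c d n j"
  using grid_ge[of n j] cd by linarith

lemma X_measurable: "X n j \<in> borel_measurable M"
  unfolding X_def[abs_def] using sol_measurable[OF grid_nonneg] by (cases "j < n") auto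

lemma X_gauss: "gauss M {..<n} (X n)"
proof -
  have "gauss M {..<Suc n} (\<lambda>j \<omega>. if j < Suc n then sol (grid c d n j) \<omega> else 0)"
    by (rule sol_gauss(1)) (rule grid_nonneg)
  from gauss_linear[OF this, of "{..<n}" "\<lambda>i j. if i < n then ((if j = Suc i then 1 else 0) - (if j = i then 1 else 0)) / sqrt (sc2 n) else 0"]
  have "gauss M {..<n} (\<lambda>i \<omega>. \<Sum>j<Suc n. (if i < n then ((if j = Suc i then 1 else 0) - (if j = i then 1 else 0)) / sqrt (sc2 n) else 0)
      * (if j < Suc n then sol (grid c d n j) \<omega> else 0))" by simp
  moreover have "(\<Sum>j<Suc n. (if i < n then ((if j = Suc i then 1 else 0) - (if j = i then 1 else 0)) / sqrt (sc2 n) else 0)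
      * (if j < Suc n then sol (grid c d n j) \<omega> else 0)) = X n i \<omega>" for i \<omega>
  proof (cases "i < n")
    case True
    have "(\<Sum>j<Suc n. (if i < n then ((if j = Suc i then 1 else 0) - (if j = i then 1 else 0)) / sqrt (sc2 n) else 0)
      * (if j < Suc n then sol (grid c d n j) \<omega> else 0))
      = (\<Sum>j<Suc n. (if j = Suc i then sol (grid c d n j) \<omega> / sqrt (sc2 n) else 0) - (if j = i then sol (grid c d n j) \<omega> / sqrt (sc2 n) else 0))"
      using True by (intro sum.cong) auto
    also have "\<dots> = sol (grid c d n (Suc i)) \<omega> / sqrt (sc2 n) - sol (grid c d n i) \<omega> / sqrt (sc2 n)"
      using True unfolding sum_subtractf by (simp del: sum.lessThan_Suc)
    finally show ?thesis using True by (simp add: X_def diff_divide_distrib)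
  qed (simp add: X_def)
  ultimately show ?thesis by (simp only:)
qed

lemma R_sums:
  assumes ij: "i < n" "j < n"
  defines "t \<equiv> grid c d n"
  shows "(\<lambda>k. (g k)\<^sup>2 * (ou_cov (\<kappa> k) (t (Suc i)) (t (Suc j)) - ou_cov (\<kappa> k) (t (Suc i)) (t j)
      - ou_cov (\<kappa> k) (t i) (t (Suc j)) + ou_cov (\<kappa> k) (t i) (t j))) sums (sc2 n * R n i j)"
proof -
  have n: "0 < n" using ij by simp
  have t: "0 \<le> t j" for j unfolding t_def by (rule grid_nonneg)
  note G = sol_gauss[of "Suc n" t, OF t]
  have i: "integrable M (\<lambda>\<omega>. sol (t a) \<omega> * sol (t b) \<omega>)" if "a \<le> n" "b \<le> n" for a b
    using gauss_integrable_prod[OF G(1), of a b] that by simp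
  have s: "(\<lambda>k. (g k)\<^sup>2 * ou_cov (\<kappa> k) (t a) (t b)) sums expectation (\<lambda>\<omega>. sol (t a) \<omega> * sol (t b) \<omega>)" if "a \<le> n" "b \<le> n" for a b
    by (rule G(2)) (use that in auto)
  have "sc2 n * R n i j = expectation (\<lambda>\<omega>. sc2 n * (X n i \<omega> * X n j \<omega>))" by (simp add: R_def)
  also have "\<dots> = expectation (\<lambda>\<omega>. (sol (t (Suc i)) \<omega> * sol (t (Suc j)) \<omega> - sol (t (Suc i)) \<omega> * sol (t j) \<omega>
      - sol (t i) \<omega> * sol (t (Suc j)) \<omega>) + sol (t i) \<omega> * sol (t j) \<omega>)"
  proof (rule Bochner_Integration.integral_cong[OF refl])
    fix \<omega>
    have "s \<noteq> 0 \<Longrightarrow> (s * s) * ((a - b) / s * ((a' - b') / s)) = (a * a' - a * b' - b * a') + b * b'" for s a b a' b' :: real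
      by (simp add: field_simps)
    from this[of "sqrt (sc2 n)"]
    show "sc2 n * (X n i \<omega> * X n j \<omega>) = (sol (t (Suc i)) \<omega> * sol (t (Suc j)) \<omega> - sol (t (Suc i)) \<omega> * sol (t j) \<omega>
      - sol (t i) \<omega> * sol (t (Suc j)) \<omega>) + sol (t i) \<omega> * sol (t j) \<omega>"
      using ij sc2_pos[OF n] by (simp add: X_def t_def)
  qed
  also have "\<dots> = expectation (\<lambda>\<omega>. sol (t (Suc i)) \<omega> * sol (t (Suc j)) \<omega>) - expectation (\<lambda>\<omega>. sol (t (Suc i)) \<omega> * sol (t j) \<omega>)
      - expectation (\<lambda>\<omega>. sol (t i) \<omega> * sol (t (Suc j)) \<omega>) + expectation (\<lambda>\<omega>. sol (t i) \<omega> * sol (t j) \<omega>)"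
    using i[of "Suc i" "Suc j"] i[of "Suc i" j] i[of i "Suc j"] i[of i j] ij by simp
  finally show ?thesis
    using sums_add[OF sums_diff[OF sums_diff[OF s[of "Suc i" "Suc j"] s[of "Suc i" j]] s[of i "Suc j"]] s[of i j]] ij
    by (simp add: distrib_left right_diff_distrib)
qed

text \<open>Mode by mode the covariance is a lag term \<open>P\<close> minus a correction
  \<open>Q\<close>. The lag terms sum to the stationary covariance, and the corrections are
  nonnegative with a summable bound, so r - R lies between 0 and \<open>err n\<close>.\<close>

lemma R_approx:
  assumes ij: "i < n" "j < n"
  shows "\<bar>R n i j - r n ((i - j) + (j - i))\<bar> \<le> err n"
proof -
  have n: "0 < n" using ij by simp
  let ?m = "(i - j) + (j - i)" and ?t = "\<lambda>j::nat. c + dt n * real j"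
  define E where "E k = exp (- (\<theta> * (real (Suc k))\<^sup>2 * dt n))" for k
  define a where "a k = (sin (real (Suc k) * x))\<^sup>2 / (real (Suc k))\<^sup>2" for k
  define P where "P k = (if ?m = 0 then 2 * (1 - E k) else - (E k ^ (?m - 1) * (1 - E k)\<^sup>2))" for k
  define Q where "Q k = (exp (- \<kappa> k * ?t i) - exp (- \<kappa> k * ?t (Suc i))) * (exp (- \<kappa> k * ?t j) - exp (- \<kappa> k * ?t (Suc j)))" for k
  let ?C = "\<sigma>\<^sup>2 / (pi * \<theta>)"
  have C: "0 < ?C" using \<sigma> \<theta> by simp
  have gk: "(g k)\<^sup>2 * u = ?C * (a k * (2 * \<kappa> k * u))" for k u
    using \<theta> unfolding g_square a_def \<kappa>_def by (simp del: of_nat_Suc)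
  have cov_k: "(g k)\<^sup>2 * (ou_cov (\<kappa> k) (?t (Suc i)) (?t (Suc j)) - ou_cov (\<kappa> k) (?t (Suc i)) (?t j)
      - ou_cov (\<kappa> k) (?t i) (?t (Suc j)) + ou_cov (\<kappa> k) (?t i) (?t j)) = ?C * (a k * P k) - ?C * (a k * Q k)" for k
  proof -
    have "2 * \<kappa> k * (ou_cov (\<kappa> k) (?t (Suc i)) (?t (Suc j)) - ou_cov (\<kappa> k) (?t (Suc i)) (?t j)
      - ou_cov (\<kappa> k) (?t i) (?t (Suc j)) + ou_cov (\<kappa> k) (?t i) (?t j)) = P k - Q k"
      unfolding ou_cov_second_diff[OF \<kappa>_pos dt_pos[OF n]] unfolding P_def Q_def E_def \<kappa>_def ..
    then show ?thesis unfolding gk by (simp add: right_diff_distrib)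
  qed
  have s1: "(\<lambda>k. ?C * (a k * P k) - ?C * (a k * Q k)) sums (sc2 n * R n i j)"
    using R_sums[OF ij] unfolding grid_eq cov_k .
  have s2: "(\<lambda>k. a k * P k) sums (2 * h n * r n ?m)"
  proof (cases "?m = 0")
    case True
    have "(\<lambda>k. 2 * ((sin (real (Suc k) * x))\<^sup>2 * heat_term (\<theta> * dt n) (real (Suc k)))) sums (2 * h n)"
      unfolding h_def heat_sum_def by (intro sums_mult summable_sums summable_heat_sum) (use \<theta> dt_nonneg in auto)
    moreover have "2 * ((sin (real (Suc k) * x))\<^sup>2 * heat_term (\<theta> * dt n) (real (Suc k))) = a k * P k" for k
      using True by (simp add: a_def P_def E_def heat_term_def mult_ac del: of_nat_Suc)
    ultimately show ?thesis using True by (simp add: r_def)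
  next
    case False
    have "(\<lambda>k. - (a k * (E k ^ (?m - 1) * (1 - E k)\<^sup>2))) sums (- heat_diff2 \<theta> x (dt n) ?m)"
      unfolding a_def E_def by (rule sums_minus[OF heat_diff2_sums[OF \<theta> dt_pos[OF n]]]) (use False in linarith)
    moreover have "2 * h n * r n ?m = - heat_diff2 \<theta> x (dt n) ?m"
      unfolding r_def if_not_P[OF False] using h_pos[OF n] by simp
    ultimately show ?thesis unfolding P_def if_not_P[OF False] by (simp only: mult_minus_right)
  qed
  have s3: "(\<lambda>k. ?C * (a k * Q k)) sums (?C * (2 * h n * r n ?m) - sc2 n * R n i j)"
    using sums_diff[OF sums_mult[OF s2, of ?C] s1] by simp
  have Q: "0 \<le> Q k" "Q k \<le> (dt n / c)\<^sup>2" for k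
  proof -
    have q: "0 \<le> exp (- \<kappa> k * ?t l) - exp (- \<kappa> k * ?t (Suc l))" "exp (- \<kappa> k * ?t l) - exp (- \<kappa> k * ?t (Suc l)) \<le> dt n / c" for l
    proof -
      have e: "?t (Suc l) = ?t l + dt n" by (simp add: algebra_simps)
      have ge: "c \<le> ?t l" using dt_nonneg by simp
      show "0 \<le> exp (- \<kappa> k * ?t l) - exp (- \<kappa> k * ?t (Suc l))" "exp (- \<kappa> k * ?t l) - exp (- \<kappa> k * ?t (Suc l)) \<le> dt n / c"
        unfolding e by (rule exp_increment_le[OF \<kappa>_pos cd(1) ge dt_nonneg])+
    qed
    show "0 \<le> Q k" unfolding Q_def by (intro mult_nonneg_nonneg q)
    show "Q k \<le> (dt n / c)\<^sup>2" unfolding Q_def power2_eq_square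
      by (intro mult_mono q) (use dt_nonneg cd in auto)
  qed
  have a: "0 \<le> a k" "a k \<le> 1 / (real (Suc k))\<^sup>2" for k
    unfolding a_def by (auto intro!: divide_right_mono simp: abs_square_le_1 simp del: of_nat_Suc)
  have isq: "(\<lambda>k. 1 / (real (Suc k))\<^sup>2) sums (\<Sum>k. 1 / (real (Suc k))\<^sup>2)"
    using inverse_squares_sums by (intro summable_sums) (auto simp: sums_iff)
  have "a k * Q k \<le> (dt n / c)\<^sup>2 * (1 / (real (Suc k))\<^sup>2)" for k
    using mult_mono[OF a(2)[of k] Q(2)[of k] _ Q(1)[of k]] by (simp add: mult.commute del: of_nat_Suc)
  then have "?C * (2 * h n * r n ?m) - sc2 n * R n i j \<le> ?C * ((dt n / c)\<^sup>2 * (\<Sum>k. 1 / (real (Suc k))\<^sup>2))"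
    by (intro sums_le[OF _ s3 sums_mult[OF sums_mult[OF isq]]] mult_left_mono) (use C in auto)
  moreover have "0 \<le> ?C * (2 * h n * r n ?m) - sc2 n * R n i j"
    by (rule sums_le[OF _ sums_zero s3]) (intro mult_nonneg_nonneg less_imp_le[OF C] a Q)
  moreover have "sc2 n = ?C * (2 * h n)" by (simp add: sc2_def)
  ultimately have "?C * (2 * h n) * \<bar>R n i j - r n ?m\<bar> \<le> ?C * ((dt n / c)\<^sup>2 * (\<Sum>k. 1 / (real (Suc k))\<^sup>2))"
  proof -
    assume 1: "?C * (2 * h n * r n ?m) - sc2 n * R n i j \<le> ?C * ((dt n / c)\<^sup>2 * (\<Sum>k. 1 / (real (Suc k))\<^sup>2))"
      and 2: "0 \<le> ?C * (2 * h n * r n ?m) - sc2 n * R n i j" and 3: "sc2 n = ?C * (2 * h n)"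
    have 4: "?C * (2 * h n * r n ?m) - sc2 n * R n i j = ?C * (2 * h n) * (r n ?m - R n i j)"
      unfolding 3 by (simp only: right_diff_distrib mult.assoc)
    have pos: "0 < ?C * (2 * h n)" using C h_pos[OF n] by (intro mult_pos_pos) auto
    have "0 \<le> r n ?m - R n i j" using 2 pos unfolding 4 by (simp only: zero_le_mult_iff) linarith
    then have "\<bar>R n i j - r n ?m\<bar> = r n ?m - R n i j" by linarith
    then show ?thesis using 1 4 by simp
  qed
  then have "2 * h n * \<bar>R n i j - r n ?m\<bar> \<le> (dt n / c)\<^sup>2 * (\<Sum>k. 1 / (real (Suc k))\<^sup>2)"
    using C by (simp only: mult.assoc mult_le_cancel_left_pos)
  then show ?thesis unfolding err_def using h_pos[OF n] by (simp add: le_divide_eq mult_ac)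
qed

lemma h_tendsto: "0 \<le> m \<Longrightarrow> (\<lambda>n. heat_sum \<theta> x (m * dt n) / sqrt (dt n)) \<longlonglongrightarrow> sqrt (pi * \<theta>) / 2 * sqrt m"
  unfolding dt_def by (rule heat_sum_tendsto[OF x \<theta>]) (use cd in auto)

lemma h_tendsto1: "(\<lambda>n. h n / sqrt (dt n)) \<longlonglongrightarrow> sqrt (pi * \<theta>) / 2"
  using h_tendsto[of 1] by (simp add: h_def)

text \<open>The limiting correlations are those of increments of fractional Brownian motion with
  Hurst index 1/4: at fixed lag only the square root asymptotics of \<open>heat_sum\<close>
  survives.\<close>

lemma near_stationary: "near_stationary R r err (\<lambda>m. - ((2 * sqrt (real m) - sqrt (real m + 1) - sqrt (real m - 1)) / 2))"
proof
  show "\<bar>R n i j - r n (i - j + (j - i))\<bar> \<le> err n" if "i < n" "j < n" for n i j by (rule R_approx[OF that])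
  show "(\<lambda>n. real n * err n) \<longlonglongrightarrow> 0"
  proof -
    \<comment> \<open>Cancelling n dt n = d - c turns n err n into this constant times sqrt (dt n)
      divided by h n / sqrt (dt n); the denominator has a positive limit.\<close>
    let ?K = "(d - c) / c\<^sup>2 * (\<Sum>k. 1 / (real (Suc k))\<^sup>2) / 2"
    have "(\<lambda>n. ?K * (sqrt (dt n) / (h n / sqrt (dt n)))) \<longlonglongrightarrow> ?K * (0 / (sqrt (pi * \<theta>) / 2))"
    proof (rule tendsto_mult[OF tendsto_const tendsto_divide[OF _ h_tendsto1]])
      show "(\<lambda>n. sqrt (dt n)) \<longlonglongrightarrow> 0" unfolding dt_def using cd by real_asymp
    qed (use \<theta> in simp)
    moreover have "\<forall>\<^sub>F n in sequentially. ?K * (sqrt (dt n) / (h n / sqrt (dt n))) = real n * err n"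
      using eventually_gt_at_top[of 0]
    proof eventually_elim
      case (elim n)
      have "sqrt (dt n) / (h n / sqrt (dt n)) = dt n / h n"
        using dt_nonneg[of n] by simp
      moreover have "real n * dt n = d - c" using elim by (simp add: dt_def)
      then have "real n * (dt n)\<^sup>2 = (d - c) * dt n" by (simp add: power2_eq_square flip: mult.assoc)
      then have "real n * err n = (d - c) * dt n / c\<^sup>2 * (\<Sum>k. 1 / (real (Suc k))\<^sup>2) / (2 * h n)"
        unfolding err_def power_divide by (simp only: times_divide_eq_right times_divide_eq_left mult.assoc[symmetric])
      ultimately show ?case using dt_nonneg[of n] by (simp add: mult_ac)
    qed
    ultimately show ?thesis by (simp add: tendsto_cong)
  qed
  fix n m :: nat
  show "r n 0 = 1" by (simp add: r_def)
  show "\<bar>r n m\<bar> \<le> 1 / (2 * real m)" if n: "0 < n" and m: "1 \<le> m"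
  proof -
    have "real m * heat_diff2 \<theta> x (dt n) m \<le> h n" unfolding h_def by (rule heat_diff2_le[OF \<theta> dt_pos[OF n] m])
    then have "heat_diff2 \<theta> x (dt n) m / (2 * h n) \<le> 1 / (2 * real m)" using h_pos[OF n] m by (simp add: field_simps)
    then show ?thesis using m heat_diff2_nonneg[OF \<theta> dt_pos[OF n] m, of x] h_pos[OF n] by (simp add: r_def)
  qed
  show "(\<Sum>k=1..m. \<bar>r n k\<bar>) \<le> 1 / 2" if n: "0 < n"
  proof -
    have "(\<Sum>k=1..m. \<bar>r n k\<bar>) = (\<Sum>k=1..m. heat_diff2 \<theta> x (dt n) k / (2 * h n))"
      by (intro sum.cong refl) (use heat_diff2_nonneg[OF \<theta> dt_pos[OF n], of _ x] h_pos[OF n] in \<open>auto simp: r_def\<close>)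
    also have "\<dots> = (\<Sum>k=1..m. heat_diff2 \<theta> x (dt n) k) / (2 * h n)" by (simp only: sum_divide_distrib)
    also have "\<dots> \<le> h n / (2 * h n)"
      unfolding h_def by (intro divide_right_mono heat_diff2_sum_le[OF \<theta> dt_pos[OF n]]) (use h_pos[OF n] in \<open>simp add: h_def\<close>)
    finally show ?thesis using h_pos[OF n] by simp
  qed
  show "(\<lambda>n. r n m) \<longlonglongrightarrow> - ((2 * sqrt (real m) - sqrt (real m + 1) - sqrt (real m - 1)) / 2)" if m: "1 \<le> m"
  proof -
    let ?L = "sqrt (pi * \<theta>) / 2"
    have L: "?L \<noteq> 0" using \<theta> by simp
    have "(\<lambda>n. - ((2 * (heat_sum \<theta> x (real m * dt n) / sqrt (dt n)) - heat_sum \<theta> x ((real m + 1) * dt n) / sqrt (dt n)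
        - heat_sum \<theta> x ((real m - 1) * dt n) / sqrt (dt n)) / (2 * (h n / sqrt (dt n)))))
      \<longlonglongrightarrow> - ((2 * (?L * sqrt (real m)) - ?L * sqrt (real m + 1) - ?L * sqrt (real m - 1)) / (2 * ?L))"
      by (intro tendsto_minus tendsto_divide tendsto_diff tendsto_mult[OF tendsto_const] h_tendsto h_tendsto1) (use m L in auto)
    moreover have "\<forall>\<^sub>F n in sequentially. - ((2 * (heat_sum \<theta> x (real m * dt n) / sqrt (dt n)) - heat_sum \<theta> x ((real m + 1) * dt n) / sqrt (dt n)
        - heat_sum \<theta> x ((real m - 1) * dt n) / sqrt (dt n)) / (2 * (h n / sqrt (dt n)))) = r n m"
      using eventually_gt_at_top[of 0]
    proof eventually_elim
      case (elim n)
      have "s \<noteq> 0 \<Longrightarrow> (2 * (u / s) - v / s - w / s) / (2 * (z / s)) = (2 * u - v - w) / (2 * z)" for u v w z s :: real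
        by (cases "z = 0") (simp_all add: field_simps)
      from this[of "sqrt (dt n)"] show ?case using dt_pos[OF elim] m by (simp add: r_def heat_diff2_def)
    qed
    moreover have "(2 * (?L * sqrt (real m)) - ?L * sqrt (real m + 1) - ?L * sqrt (real m - 1)) / (2 * ?L)
      = (2 * sqrt (real m) - sqrt (real m + 1) - sqrt (real m - 1)) / 2"
    proof -
      have "l \<noteq> 0 \<Longrightarrow> (2 * (l * u) - l * v - l * w) / (2 * l) = (2 * u - v - w) / 2" for l u v w :: real
        by (simp add: field_simps)
      from this[OF L] show ?thesis .
    qed
    ultimately show ?thesis by (simp only: tendsto_cong)
  qed
qed

end

section \<open>Consistency and asymptotic normality\<close>

context she_obs
begin

section \<open>Limit law of the normalised quartic variation\<close>

interpretation NS: near_stationary R r err "\<lambda>m. - ((2 * sqrt (real m) - sqrt (real m + 1) - sqrt (real m - 1)) / 2)"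
  by (rule near_stationary)

definition v :: real where "v = sbar2 \<theta> x c d + sbar4 \<theta> x c d"

lemma sig_n2_pos: "0 < n \<Longrightarrow> 0 < sig_n2 \<theta> x c d n"
  using h_pos[of n] \<theta> unfolding h_def dt_def by (simp add: sig_n2_eq)

lemma r_eq: "0 < n \<Longrightarrow> 1 \<le> j \<Longrightarrow> F_n \<theta> x c d n j / sig_n2 \<theta> x c d n = r n j"
  using \<theta> h_pos[of n] unfolding r_def h_def dt_def F_n_eq[OF \<theta> cd(2)] sig_n2_eq by simp

lemma r_sum_eq: "(\<Sum>j=1..n-1. (1 - real j / real n) * \<bar>F_n \<theta> x c d n j / sig_n2 \<theta> x c d n\<bar> ^ p)
    = (\<Sum>j=1..n-1. (1 - real j / real n) * \<bar>r n j\<bar> ^ p)"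
proof (rule sum.cong[OF refl])
  fix j assume "j \<in> {1..n-1}"
  then have "0 < n" "1 \<le> j" by auto
  then show "(1 - real j / real n) * \<bar>F_n \<theta> x c d n j / sig_n2 \<theta> x c d n\<bar> ^ p = (1 - real j / real n) * \<bar>r n j\<bar> ^ p"
    by (simp only: r_eq)
qed

lemma v_eq: "v = (72 + 144 * lim (\<lambda>n. \<Sum>m=1..n-1. (1 - real m / real n) * \<bar>r n m\<bar> ^ 2))
      + (24 + 48 * lim (\<lambda>n. \<Sum>m=1..n-1. (1 - real m / real n) * \<bar>r n m\<bar> ^ 4))"
  unfolding v_def sbar2_def sbar4_def r_sum_eq ..

lemma v_pos: "0 < v"
  unfolding v_eq using NS.power_sum_lim_nonneg[of 2] NS.power_sum_lim_nonneg[of 4] by simp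

definition S :: "nat \<Rightarrow> 'a \<Rightarrow> real" where "S n \<omega> = (\<Sum>j<n. X n j \<omega> ^ 4)"

definition T :: "nat \<Rightarrow> 'a \<Rightarrow> real" where "T n \<omega> = (S n \<omega> - 3 * real n) / sqrt (real n)"

text \<open>The empirical fourth moment relative to 3, the fourth moment of a standard normal
  variable; hence the limit 1.\<close>

definition U :: "nat \<Rightarrow> 'a \<Rightarrow> real" where "U n \<omega> = S n \<omega> / (3 * real n)"

lemma measurables [measurable]:
  "S n \<in> borel_measurable M" "T n \<in> borel_measurable M" "U n \<in> borel_measurable M"
proof -
  note [measurable] = X_measurable
  show 1 [measurable]: "S n \<in> borel_measurable M" unfolding S_def[abs_def] by measurable
  show "T n \<in> borel_measurable M" "U n \<in> borel_measurable M" unfolding T_def[abs_def] U_def[abs_def] by measurable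
qed

definition mean_err :: "nat \<Rightarrow> real" where
  "mean_err n = ((\<Sum>j<n. 3 * (R n j j)\<^sup>2) - 3 * real n) / sqrt (real n)"

text \<open>Centred at the exact mean, as the theorem on quartic sums requires, whereas the
  estimators lead to \<open>T\<close>, centred at 3 n. The difference is deterministic and tends to
  0.\<close>

definition T0 :: "nat \<Rightarrow> 'a \<Rightarrow> real" where
  "T0 n \<omega> = ((\<Sum>j<n. X n j \<omega> ^ 4) - (\<Sum>j<n. 3 * (R n j j)\<^sup>2)) / sqrt (real n)"

lemma T_eq: "T n \<omega> = T0 n \<omega> + mean_err n"
  by (simp add: T_def T0_def mean_err_def S_def diff_divide_distrib)

lemma ex_B: "\<exists>B\<ge>1. (\<forall>n i. i < n \<longrightarrow> (\<Sum>j<n. \<bar>R n i j\<bar>) \<le> B) \<and> (\<forall>n i j. i < n \<longrightarrow> j < n \<longrightarrow> \<bar>R n i j\<bar> \<le> B)"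
proof -
  obtain B where B: "1 \<le> B" and rowB: "\<And>n i. i < n \<Longrightarrow> (\<Sum>j<n. \<bar>R n i j\<bar>) \<le> B" using NS.row_sum by blast
  have "\<bar>R n i j\<bar> \<le> B" if "i < n" "j < n" for n i j
    by (rule order_trans[OF member_le_sum[of j "{..<n}" "\<lambda>j. \<bar>R n i j\<bar>"] rowB]) (use that in auto)
  with B rowB show ?thesis by blast
qed

lemma T_char: "(\<lambda>n. expectation (\<lambda>\<omega>. cis (t * T n \<omega>))) \<longlonglongrightarrow> of_real (exp (- v * t\<^sup>2 / 2))"
proof -
  obtain B where B: "1 \<le> B" "\<And>n i. i < n \<Longrightarrow> (\<Sum>j<n. \<bar>R n i j\<bar>) \<le> B" "\<And>n i j. i < n \<Longrightarrow> j < n \<Longrightarrow> \<bar>R n i j\<bar> \<le> B"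
    using ex_B by blast
  have "(\<lambda>n. expectation (\<lambda>\<omega>. cis (t * T0 n \<omega>))) \<longlonglongrightarrow> of_real (exp (- v * t\<^sup>2 / 2))"
    unfolding T0_def
  proof (rule gauss_quartic_clt[where X = X and B = B and \<rho> = B, folded R_def])
    show "gauss M {..<n} (X n)" for n by (rule X_gauss)
    show "(\<lambda>n. (\<Sum>j<n. \<Sum>k<n. 72 * R n j j * R n k k * (R n j k)\<^sup>2 + 24 * R n j k ^ 4) / real n) \<longlonglongrightarrow> v"
      unfolding v_eq by (rule NS.q_tendsto)
    show "0 \<le> B" using B(1) by simp
  qed (fact B)+
  then show ?thesis unfolding T_eq
    by (rule char_shift_tendsto) (use NS.mean_tendsto in \<open>simp add: mean_err_def[abs_def]\<close>)
qed

lemma T_second_moment: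
  "\<exists>C. \<forall>n>0. integrable M (\<lambda>\<omega>. (T n \<omega>)\<^sup>2) \<and> expectation (\<lambda>\<omega>. (T n \<omega>)\<^sup>2) \<le> C"
proof -
  obtain B where B: "1 \<le> B" "\<And>n i. i < n \<Longrightarrow> (\<Sum>j<n. \<bar>R n i j\<bar>) \<le> B" "\<And>n i j. i < n \<Longrightarrow> j < n \<Longrightarrow> \<bar>R n i j\<bar> \<le> B"
    using ex_B by blast
  have "Bseq mean_err"
    using NS.mean_tendsto by (intro convergent_imp_Bseq convergentI) (simp add: mean_err_def[abs_def])
  then obtain K where K: "\<And>n. norm (mean_err n) \<le> K" unfolding Bseq_def by blast
  define C where "C = 2 * (16 * (fact 8 * B ^ 8) * B) + 2 * K\<^sup>2"
  have "integrable M (\<lambda>\<omega>. (T n \<omega>)\<^sup>2) \<and> expectation (\<lambda>\<omega>. (T n \<omega>)\<^sup>2) \<le> C" if n: "n > 0" for n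
  proof -
    have i: "integrable M (\<lambda>\<omega>. (T0 n \<omega>)\<^sup>2)" and b: "expectation (\<lambda>\<omega>. (T0 n \<omega>)\<^sup>2) \<le> 16 * (fact 8 * B ^ 8) * B"
      unfolding T0_def using gauss_quartic_second_moment[OF X_gauss n B(1), folded R_def, of B] B(2,3) by blast+
    have le: "(T n \<omega>)\<^sup>2 \<le> 2 * (T0 n \<omega>)\<^sup>2 + 2 * K\<^sup>2" for \<omega>
    proof -
      have "(T n \<omega>)\<^sup>2 \<le> 2 * (T0 n \<omega>)\<^sup>2 + 2 * (mean_err n)\<^sup>2"
        unfolding T_eq using sum_squares_bound[of "T0 n \<omega>" "mean_err n"] by (simp add: power2_sum)
      moreover have "(mean_err n)\<^sup>2 \<le> K\<^sup>2"
        using power_mono[OF K[of n], of 2] by simp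
      ultimately show ?thesis by linarith
    qed
    have i2: "integrable M (\<lambda>\<omega>. 2 * (T0 n \<omega>)\<^sup>2 + 2 * K\<^sup>2)" using i by simp
    have iT: "integrable M (\<lambda>\<omega>. (T n \<omega>)\<^sup>2)"
      by (rule Bochner_Integration.integrable_bound[OF i2]) (auto intro!: AE_I2 order_trans[OF le])
    have "expectation (\<lambda>\<omega>. (T n \<omega>)\<^sup>2) \<le> expectation (\<lambda>\<omega>. 2 * (T0 n \<omega>)\<^sup>2 + 2 * K\<^sup>2)"
      by (rule integral_mono[OF iT i2 le])
    also have "\<dots> = 2 * expectation (\<lambda>\<omega>. (T0 n \<omega>)\<^sup>2) + 2 * K\<^sup>2" using i by (simp add: prob_space)
    also have "\<dots> \<le> C" using b unfolding C_def by linarith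
    finally show ?thesis using iT by blast
  qed
  then show ?thesis by blast
qed

lemma U_eq: "0 < n \<Longrightarrow> U n \<omega> - 1 = 1 / (3 * sqrt (real n)) * T n \<omega>"
proof -
  assume n: "0 < n"
  have "s > 0 \<Longrightarrow> a / (3 * (s * s)) - 1 = 1 / (3 * s) * ((a - 3 * (s * s)) / s)" for a s :: real
    by (simp add: field_simps)
  from this[of "sqrt (real n)" "S n \<omega>"] n show ?thesis by (simp add: U_def T_def)
qed

lemma U_conv: "conv_in_prob M U 1"
proof -
  obtain C where C: "\<And>n. n > 0 \<Longrightarrow> integrable M (\<lambda>\<omega>. (T n \<omega>)\<^sup>2)" "\<And>n. n > 0 \<Longrightarrow> expectation (\<lambda>\<omega>. (T n \<omega>)\<^sup>2) \<le> C"
    using T_second_moment by blast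
  show ?thesis
    by (rule conv_in_prob_of_second_moment[of T C "\<lambda>n. 1 / (3 * sqrt (real n))"])
       (use C U_eq in \<open>auto\<close>, real_asymp)
qed

lemma quartic_var_eq:
  assumes n: "0 < n"
  shows "quartic_var \<theta> \<sigma> w x c d n \<omega> = (sc2 n)\<^sup>2 * S n \<omega>"
proof -
  have "quartic_var \<theta> \<sigma> w x c d n \<omega> = (\<Sum>j<n. (sol (grid c d n (Suc j)) \<omega> - sol (grid c d n j) \<omega>) ^ 4)"
    unfolding quartic_var_def sol_def by (rule sum.reindex_bij_witness[of _ Suc "\<lambda>i. i - 1"]) auto
  also have "\<dots> = (\<Sum>j<n. (sc2 n)\<^sup>2 * X n j \<omega> ^ 4)"
  proof (rule sum.cong[OF refl])
    fix j assume "j \<in> {..<n}"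
    moreover have "(sc2 n)\<^sup>2 = sqrt (sc2 n) ^ 4" using sc2_pos[OF n] by (simp add: power4_eq_xxxx power2_eq_square mult.assoc)
    ultimately show "(sol (grid c d n (Suc j)) \<omega> - sol (grid c d n j) \<omega>) ^ 4 = (sc2 n)\<^sup>2 * X n j \<omega> ^ 4"
      using sc2_pos[OF n] by (simp add: X_def power_divide)
  qed
  finally show ?thesis by (simp add: S_def sum_distrib_left)
qed

lemma sc2_eq: "0 < n \<Longrightarrow> sc2 n = \<sigma>\<^sup>2 * sig_n2 \<theta> x c d n / sqrt (pi * \<theta>)"
proof -
  assume n: "0 < n"
  have "p = s * s \<Longrightarrow> 2 * \<sigma>\<^sup>2 / p * H = \<sigma>\<^sup>2 * (2 / s * H) / s" for p s H :: real by simp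
  from this[of "pi * \<theta>" "sqrt (pi * \<theta>)" "h n"] show ?thesis
    using \<theta> unfolding sc2_def sig_n2_eq[OF n] h_def dt_def by simp
qed

section \<open>The two estimators\<close>

text \<open>The constant for which the estimator of \<theta> equals A n / U n exactly, so that the
  centring of the limit theorem is the value of the estimator at U n = 1.\<close>

definition A :: "nat \<Rightarrow> real" where "A n = (d - c) * \<theta> / (real n * (sig_n2 \<theta> x c d n)\<^sup>2)"

definition B :: "nat \<Rightarrow> real" where "B n = sqrt (real n) * sig_n2 \<theta> x c d n / sqrt (d - c) * \<sigma>\<^sup>2"

lemma theta_hat_eq:
  assumes n: "0 < n"
  shows "theta_hat \<theta> \<sigma> w x c d n \<omega> = A n * (1 / U n \<omega>)"
proof -
  have s: "(sc2 n)\<^sup>2 = \<sigma> ^ 4 * (sig_n2 \<theta> x c d n)\<^sup>2 / (pi * \<theta>)"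
    using \<theta> unfolding sc2_eq[OF n] by (simp add: power_divide power_mult_distrib)
  show ?thesis unfolding theta_hat_def quartic_var_eq[OF n] s A_def U_def
    \<comment> \<open>Where the quartic sum vanishes, both sides are 0 by the convention for
      division by 0.\<close>
    using \<sigma> \<theta> n sig_n2_pos[OF n] by (cases "S n \<omega> = 0") (simp_all add: field_simps)
qed

lemma sigma2_hat_eq:
  assumes n: "0 < n"
  shows "sigma2_hat \<theta> \<sigma> w x c d n \<omega> = B n * sqrt (U n \<omega>)"
proof -
  have s: "(sc2 n)\<^sup>2 = \<sigma> ^ 4 * (sig_n2 \<theta> x c d n)\<^sup>2 / (pi * \<theta>)"
    using \<theta> unfolding sc2_eq[OF n] by (simp add: power_divide power_mult_distrib)
  have "\<theta> * pi / (3 * (d - c)) * ((sc2 n)\<^sup>2 * S n \<omega>) = (B n)\<^sup>2 * U n \<omega>"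
    unfolding s B_def U_def using \<theta> n cd by (simp add: power_divide power_mult_distrib field_simps)
  moreover have "0 \<le> B n" using sig_n2_pos[OF n] cd by (simp add: B_def)
  ultimately show ?thesis unfolding sigma2_hat_def quartic_var_eq[OF n] by (simp add: real_sqrt_mult)
qed

lemma sig_tendsto: "(\<lambda>n. sqrt (real n) * sig_n2 \<theta> x c d n) \<longlonglongrightarrow> sqrt (d - c)"
proof -
  let ?L = "sqrt (pi * \<theta>)"
  have L: "?L \<noteq> 0" using \<theta> by simp
  have "(\<lambda>n. 2 / ?L * sqrt (d - c) * (h n / sqrt (dt n))) \<longlonglongrightarrow> 2 / ?L * sqrt (d - c) * (?L / 2)"
    by (intro tendsto_mult tendsto_const h_tendsto1)
  moreover have "2 / ?L * sqrt (d - c) * (?L / 2) = sqrt (d - c)" using L by simp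
  moreover have "\<forall>\<^sub>F n in sequentially. 2 / ?L * sqrt (d - c) * (h n / sqrt (dt n)) = sqrt (real n) * sig_n2 \<theta> x c d n"
    using eventually_gt_at_top[of 0]
  proof eventually_elim
    case (elim n)
    have "sqrt (dt n) = sqrt (d - c) / sqrt (real n)" by (simp add: dt_def real_sqrt_divide)
    then show ?case using cd elim by (simp add: sig_n2_eq h_def dt_def)
  qed
  ultimately show ?thesis by (simp only: tendsto_cong)
qed

lemma A_tendsto: "A \<longlonglongrightarrow> \<theta>"
proof -
  have "(\<lambda>n. (d - c) * \<theta> / (sqrt (real n) * sig_n2 \<theta> x c d n)\<^sup>2) \<longlonglongrightarrow> (d - c) * \<theta> / (sqrt (d - c))\<^sup>2"
    by (intro tendsto_divide tendsto_const tendsto_power sig_tendsto) (use cd in auto)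
  moreover have "A = (\<lambda>n. (d - c) * \<theta> / (sqrt (real n) * sig_n2 \<theta> x c d n)\<^sup>2)"
    by (simp add: A_def fun_eq_iff power_mult_distrib)
  ultimately show ?thesis using cd by simp
qed

lemma B_tendsto: "B \<longlonglongrightarrow> \<sigma>\<^sup>2"
proof -
  have "B \<longlonglongrightarrow> sqrt (d - c) / sqrt (d - c) * \<sigma>\<^sup>2"
    unfolding B_def by (intro tendsto_mult tendsto_divide tendsto_const sig_tendsto) (use cd in auto)
  then show ?thesis using cd by simp
qed

lemma quartic_var_measurable: "quartic_var \<theta> \<sigma> w x c d n \<in> borel_measurable M"
  using sol_measurable[OF grid_nonneg] unfolding quartic_var_def[abs_def] sol_def[abs_def]
  by (intro borel_measurable_sum borel_measurable_power borel_measurable_diff) auto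

lemma theta_hat_measurable [measurable]: "theta_hat \<theta> \<sigma> w x c d n \<in> borel_measurable M"
  using quartic_var_measurable[of n] unfolding theta_hat_def[abs_def] by measurable

lemma sigma2_hat_measurable [measurable]: "sigma2_hat \<theta> \<sigma> w x c d n \<in> borel_measurable M"
  using quartic_var_measurable[of n] unfolding sigma2_hat_def[abs_def] by measurable

lemma theta_hat_consistent: "conv_in_prob M (theta_hat \<theta> \<sigma> w x c d) \<theta>"
proof (rule conv_in_prob_compose[where U = U and f = "\<lambda>n u. A n * (1 / u)" and ?u0.0 = 1])
  show "\<exists>\<eta>>0. \<forall>\<^sub>F n in sequentially. \<forall>u. \<bar>u - 1\<bar> \<le> \<eta> \<longrightarrow> \<bar>A n * (1 / u) - \<theta>\<bar> \<le> \<epsilon>" if "\<epsilon> > 0" for \<epsilon>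
    using product_near[OF A_tendsto, where \<phi> = "\<lambda>u. 1 / u" and ?u0.0 = 1 and \<epsilon> = \<epsilon>] that by simp
qed (auto simp: U_conv theta_hat_eq)

lemma sigma2_hat_consistent: "conv_in_prob M (sigma2_hat \<theta> \<sigma> w x c d) (\<sigma>\<^sup>2)"
proof (rule conv_in_prob_compose[where U = U and f = "\<lambda>n u. B n * sqrt u" and ?u0.0 = 1])
  show "\<exists>\<eta>>0. \<forall>\<^sub>F n in sequentially. \<forall>u. \<bar>u - 1\<bar> \<le> \<eta> \<longrightarrow> \<bar>B n * sqrt u - \<sigma>\<^sup>2\<bar> \<le> \<epsilon>" if "\<epsilon> > 0" for \<epsilon>
    using product_near[OF B_tendsto, where \<phi> = sqrt and ?u0.0 = 1 and \<epsilon> = \<epsilon>] that by (simp add: isCont_real_sqrt)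
qed (auto simp: U_conv sigma2_hat_eq)

text \<open>A delta method without derivatives: f(U) - f(1) is written as \<phi>(U) (U - 1), where U
  - 1 is T n / (3 sqrt n), so continuity of \<phi> at 1 suffices. The identity is required only
  where U n > 0, an event whose probability tends to 1.\<close>

lemma clt_of_linearisation:
  assumes [measurable]: "\<And>n. Y n \<in> borel_measurable M"
    and a: "a \<longlonglongrightarrow> a0" and \<phi>: "isCont \<phi> 1" and nz: "a0 * \<phi> 1 \<noteq> 0"
    and Y: "\<And>n \<omega>. 0 < n \<Longrightarrow> 0 < U n \<omega> \<Longrightarrow> Y n \<omega> = a n * \<phi> (U n \<omega>) * T n \<omega>"
  shows "conv_in_distr_normal M Y ((a0 * \<phi> 1)\<^sup>2 * v)"
proof (rule conv_in_distr_normalI)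
  show "0 < (a0 * \<phi> 1)\<^sup>2 * v" using nz v_pos by simp
  obtain C where C: "\<And>n. n > 0 \<Longrightarrow> integrable M (\<lambda>\<omega>. (T n \<omega>)\<^sup>2)" "\<And>n. n > 0 \<Longrightarrow> expectation (\<lambda>\<omega>. (T n \<omega>)\<^sup>2) \<le> C"
    using T_second_moment by blast
  fix t
  show "(\<lambda>n. expectation (\<lambda>\<omega>. cis (t * Y n \<omega>))) \<longlonglongrightarrow> of_real (exp (- ((a0 * \<phi> 1)\<^sup>2 * v) * t\<^sup>2 / 2))"
  proof (rule char_slutsky[where U = U and T = T and C = C and c = "a0 * \<phi> 1" and v = v and ?u0.0 = 1])
    fix \<epsilon> :: real assume "\<epsilon> > 0"
    from product_near[OF a \<phi> this] obtain \<eta> where \<eta>: "\<eta> > 0"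
      and ev: "\<forall>\<^sub>F n in sequentially. \<forall>u. \<bar>u - 1\<bar> \<le> \<eta> \<longrightarrow> \<bar>a n * \<phi> u - a0 * \<phi> 1\<bar> \<le> \<epsilon>" by blast
    \<comment> \<open>The radius is cut at 1 / 2 so that U n is positive wherever the identity for Y
      n is invoked.\<close>
    have "\<forall>\<^sub>F n in sequentially. \<forall>\<omega>\<in>space M. \<bar>U n \<omega> - 1\<bar> \<le> min \<eta> (1 / 2) \<longrightarrow> \<bar>Y n \<omega> - a0 * \<phi> 1 * T n \<omega>\<bar> \<le> \<epsilon> * \<bar>T n \<omega>\<bar>"
      using ev eventually_gt_at_top[of 0]
    proof eventually_elim
      case (elim n)
      show ?case
      proof (intro ballI impI)
        fix \<omega> assume u: "\<bar>U n \<omega> - 1\<bar> \<le> min \<eta> (1 / 2)"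
        have "\<bar>U n \<omega> - 1\<bar> \<le> 1 / 2" using u by simp
        then have "0 < U n \<omega>" by linarith
        then have "Y n \<omega> - a0 * \<phi> 1 * T n \<omega> = (a n * \<phi> (U n \<omega>) - a0 * \<phi> 1) * T n \<omega>"
          using Y[OF elim(2)] by (simp add: left_diff_distrib)
        moreover have "\<bar>a n * \<phi> (U n \<omega>) - a0 * \<phi> 1\<bar> \<le> \<epsilon>" using elim(1) u by simp
        ultimately show "\<bar>Y n \<omega> - a0 * \<phi> 1 * T n \<omega>\<bar> \<le> \<epsilon> * \<bar>T n \<omega>\<bar>"
          by (simp only: abs_mult mult_right_mono abs_ge_zero)
      qed
    qed
    then show "\<exists>\<eta>>0. \<forall>\<^sub>F n in sequentially. \<forall>\<omega>\<in>space M. \<bar>U n \<omega> - 1\<bar> \<le> \<eta> \<longrightarrow> \<bar>Y n \<omega> - a0 * \<phi> 1 * T n \<omega>\<bar> \<le> \<epsilon> * \<bar>T n \<omega>\<bar>"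
      using \<eta> by (intro exI[of _ "min \<eta> (1 / 2)"]) simp
  next
    show "(\<lambda>n. expectation (\<lambda>\<omega>. cis (t * T n \<omega>))) \<longlonglongrightarrow> of_real (exp (- v * t\<^sup>2 / 2))" for t
      by (rule T_char)
  qed (use C in \<open>auto intro: U_conv\<close>)
qed fact

lemma theta_hat_clt:
  "conv_in_distr_normal M (\<lambda>n \<omega>. sqrt (real n) * (theta_hat \<theta> \<sigma> w x c d n \<omega> - A n)) (1 / 9 * \<theta>\<^sup>2 * v)"
proof -
  have "conv_in_distr_normal M (\<lambda>n \<omega>. sqrt (real n) * (theta_hat \<theta> \<sigma> w x c d n \<omega> - A n)) ((\<theta> * (\<lambda>u. - 1 / (3 * u)) 1)\<^sup>2 * v)"
  \<comment> \<open>From 1/u - 1 = -(u - 1) / u; the 3 stems from U - 1 = T / (3 sqrt n). The square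
    of \<phi>(1) is 1/9.\<close>
  proof (rule clt_of_linearisation[OF _ A_tendsto, where \<phi> = "\<lambda>u. - 1 / (3 * u)"])
    fix n \<omega> assume n: "0 < n" and U: "0 < U n \<omega>"
    have T: "T n \<omega> = 3 * sqrt (real n) * (U n \<omega> - 1)" using U_eq[OF n, of \<omega>] n by (simp add: field_simps)
    show "sqrt (real n) * (theta_hat \<theta> \<sigma> w x c d n \<omega> - A n) = A n * (- 1 / (3 * U n \<omega>)) * T n \<omega>"
      unfolding theta_hat_eq[OF n] T using U by (simp add: field_simps)
  qed (use \<theta> in auto)
  moreover have "(\<theta> * (\<lambda>u. - 1 / (3 * u)) 1)\<^sup>2 * v = 1 / 9 * \<theta>\<^sup>2 * v" by (simp add: power_divide)
  ultimately show ?thesis by (simp only:)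
qed

lemma sigma2_hat_clt:
  "conv_in_distr_normal M (\<lambda>n \<omega>. sqrt (real n) * (sigma2_hat \<theta> \<sigma> w x c d n \<omega> - B n)) (1 / 36 * \<sigma> ^ 4 * v)"
proof -
  have "conv_in_distr_normal M (\<lambda>n \<omega>. sqrt (real n) * (sigma2_hat \<theta> \<sigma> w x c d n \<omega> - B n)) ((\<sigma>\<^sup>2 * (\<lambda>u. 1 / (3 * (sqrt u + 1))) 1)\<^sup>2 * v)"
  \<comment> \<open>From sqrt u - 1 = (u - 1) / (sqrt u + 1); here \<phi>(1) = 1/6, which accounts
    for 1/36.\<close>
  proof (rule clt_of_linearisation[OF _ B_tendsto, where \<phi> = "\<lambda>u. 1 / (3 * (sqrt u + 1))"])
    fix n \<omega> assume n: "0 < n" and U: "0 < U n \<omega>"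
    have T: "T n \<omega> = 3 * sqrt (real n) * (U n \<omega> - 1)" using U_eq[OF n, of \<omega>] n by (simp add: field_simps)
    have "s > 0 \<Longrightarrow> r * (b * s - b) = b * (1 / (3 * (s + 1))) * (3 * r * (s * s - 1))" for s r b :: real
      by (simp add: divide_simps) (simp add: algebra_simps)
    from this[of "sqrt (U n \<omega>)"] U
    show "sqrt (real n) * (sigma2_hat \<theta> \<sigma> w x c d n \<omega> - B n) = B n * (1 / (3 * (sqrt (U n \<omega>) + 1))) * T n \<omega>"
      unfolding sigma2_hat_eq[OF n] T by simp
  qed (use \<sigma> in \<open>auto intro!: continuous_intros\<close>)
  moreover have "(\<sigma>\<^sup>2 * (\<lambda>u. 1 / (3 * (sqrt u + 1))) 1)\<^sup>2 * v = 1 / 36 * \<sigma> ^ 4 * v"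
    by (simp add: power_divide power_mult_distrib)
  ultimately show ?thesis by (simp only:)
qed

end

theorem theorem3p1:
  fixes M :: "'a measure" and w :: "nat \<Rightarrow> real \<Rightarrow> 'a \<Rightarrow> real"
    and \<theta> \<sigma> x c d :: real
  assumes "prob_space M"
    and "\<theta> > 0" and "\<sigma> > 0"
    and "\<forall>k\<ge>1. std_BM M (w k)"
    and "prob_space.indep_vars M (\<lambda>_. PiM UNIV (\<lambda>_. borel)) (\<lambda>k \<omega> t. w k t \<omega>) {1..}"
    and "0 < x" and "x < pi"
    and "0 < c" and "c < d"
  shows "conv_in_prob M (theta_hat \<theta> \<sigma> w x c d) \<theta>
       \<and> conv_in_prob M (sigma2_hat \<theta> \<sigma> w x c d) (\<sigma>\<^sup>2)
       \<and> conv_in_distr_normal M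
           (\<lambda>n \<omega>. sqrt (real n) * (theta_hat \<theta> \<sigma> w x c d n \<omega>
                 - (d - c) * \<theta> / (real n * (sig_n2 \<theta> x c d n)\<^sup>2)))
           (1 / 9 * \<theta>\<^sup>2 * (sbar2 \<theta> x c d + sbar4 \<theta> x c d))
       \<and> conv_in_distr_normal M
           (\<lambda>n \<omega>. sqrt (real n) * (sigma2_hat \<theta> \<sigma> w x c d n \<omega>
                 - sqrt (real n) * sig_n2 \<theta> x c d n / sqrt (d - c) * \<sigma>\<^sup>2))
           (1 / 36 * \<sigma> ^ 4 * (sbar2 \<theta> x c d + sbar4 \<theta> x c d))"
proof -
  interpret prob_space M by fact
  interpret she_obs M w \<theta> \<sigma> x c d
    by unfold_locales (use assms in auto)
  show ?thesis
    using theta_hat_consistent sigma2_hat_consistent theta_hat_clt sigma2_hat_clt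
    unfolding A_def B_def v_def by blast
qed

end
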